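(* Let $\lambda$ be a partition with $\lambda_i\ge i$ for all $i$, with indecomposable components $\lambda^{(1)},\ldots,\lambda^{(r)}$. Then the ring $R^\lambda$ has a unique tensor decomposition into tensor-indecomposables, up to permuting the factors; specifically, that unique decomposition is $$R^\lambda=R^{\lambda^{(1)}}\otimes\cdots\otimes R^{\lambda^{(r)}}.$$
   Context: Partitions are written in weakly increasing order, $\lambda=(\lambda_1\le\cdots\le\lambda_n)$ with $\lambda_i\ge i$. For $m\ge 0$, $h_m(i)$ is the complete homogeneous symmetric polynomial of degree $m$ in $x_1,\ldots,x_i$; $I_\lambda=\langle h_{\lambda_i-i+1}(i):1\le i\le n\rangle$ and $R^\lambda=\mathbb{Z}[x_1,\ldots,x_n]/I_\lambda$, graded with $\deg x_i=1$. Indecomposable components: if $k_1<\cdots<k_s$ are all the indices $k$ with $\lambda_k=k$, and $k_0=0$, $k_{s+1}=n+1$, the indecomposable components of $\lambda$ are the nonempty partitions among $(\lambda_{k_t+1}-k_t,\ldots,\lambda_{k_{t+1}-1}-k_t)$, $0\le t\le s$. The ring $R^{\lambda^{(j)}}$, for the component $\lambda^{(j)}$ coming from index $t$, is identified with the subalgebra of $R^\lambda$ generated by the images of $x_{k_t+1},\ldots,x_{k_{t+1}-1}$ (in this order corresponding to the variables $x_1,x_2,\ldots$ of $R^{\lambda^{(j)}}$). A standard graded $\mathbb{Z}$-algebra is a commutative ring $R=\bigoplus_{d\ge0}R_d$ with each $R_d$ a free $\mathbb{Z}$-module, $R_dR_e\subset R_{d+e}$, and $R$ generated over $R_0=\mathbb{Z}$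 by $R_1$. A tensor decomposition of $R$ is an isomorphism of graded $\mathbb{Z}$-algebras $R\cong T^{(1)}\otimes_{\mathbb{Z}}\cdots\otimes_{\mathbb{Z}} T^{(s)}$ with each $T^{(i)}$ a standard graded $\mathbb{Z}$-algebra; each $T^{(i)}$ is identified with the subalgebra of $R$ generated by the corresponding direct summand $T^{(i)}_1$ of $R_1=\bigoplus_iT^{(i)}_1$, and two decompositions are regarded as the same if these subalgebras coincide. It is nontrivial if $T^{(i)}\ne\mathbb{Z}$ for all $i$. $R$ is tensor-indecomposable if it is not $\mathbb{Z}$ itself and has no nontrivial tensor decomposition (into at least two factors). An empty tensor product is $\mathbb{Z}$. *)

theory Defs
  imports "HOL-Algebra.IntRing" "HOL-Algebra.Generated_Rings" "HOL-Algebra.Generated_Groups"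
    "HOL-Algebra.Free_Abelian_Groups" "HOL-Library.Poly_Mapping"
begin

section \<open>Standard graded algebras\<close>

text \<open>\<open>homog R d\<close> is the homogeneous component of degree \<open>d\<close>.  The algebras are over the integers,
  so an algebra is just a commutative ring and an algebra homomorphism just a ring homomorphism.\<close>

record 'a graded_ring = "'a ring" +
  homog :: "nat \<Rightarrow> 'a set"

definition make_graded :: "'a ring \<Rightarrow> (nat \<Rightarrow> 'a set) \<Rightarrow> 'a graded_ring" where
  "make_graded R H = ring.extend R (graded_ring.fields H)"

definition direct_sum_of_homog :: "'a graded_ring \<Rightarrow> bool" where
  "direct_sum_of_homog R \<longleftrightarrow>
     (\<forall>d. subgroup (homog R d) (add_monoid R)) \<and>
     (\<forall>x\<in>carrier R. \<exists>!f. (\<forall>d. f d \<in> homog R d) \<and> finite {d. f d \<noteq> \<zero>\<^bsub>R\<^esub>} \<and>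
        x = (\<Oplus>\<^bsub>R\<^esub>d\<in>{d. f d \<noteq> \<zero>\<^bsub>R\<^esub>}. f d))"

definition free_homog :: "'a graded_ring \<Rightarrow> nat \<Rightarrow> bool" where
  "free_homog R d \<longleftrightarrow>
     (\<exists>B :: 'a set. add_monoid (R\<lparr>carrier := homog R d\<rparr>) \<cong> free_Abelian_group B)"

text \<open>The condition that the component of degree 0 is the ring of integers is read as: the unique
  ring homomorphism from the integers is a bijection onto it.\<close>

definition standard_graded :: "'a graded_ring \<Rightarrow> bool" where
  "standard_graded R \<longleftrightarrow>
     cring R \<and> direct_sum_of_homog R \<and>
     (\<forall>d. free_homog R d) \<and>
     (\<forall>d e. \<forall>x\<in>homog R d. \<forall>y\<in>homog R e. x \<otimes>\<^bsub>R\<^esub> y \<in> homog R (d + e)) \<and>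
     bij_betw (\<lambda>k::int. [k] \<cdot>\<^bsub>R\<^esub> \<one>\<^bsub>R\<^esub>) UNIV (homog R 0) \<and>
     carrier R = generate_ring R (homog R 0 \<union> homog R 1)"

definition graded_iso :: "'a graded_ring \<Rightarrow> 'b graded_ring \<Rightarrow> ('a \<Rightarrow> 'b) set" where
  "graded_iso R S = {h \<in> ring_iso R S. \<forall>d. h ` homog R d = homog S d}"


section \<open>Tensor products\<close>

text \<open>The tensor product of a family of rings \<open>T i\<close> (\<open>i \<in> I\<close>) is the integral monoid ring of the
  direct product of the multiplicative monoids, modulo the relations making \<open>f \<mapsto> [f]\<close> additive in
  each coordinate.  The subgroup generated by these relations is already an ideal, so additively
  this is the usual quotient of a free abelian group.  For empty \<open>I\<close> there is a single generator
  and no relation, which yields the ring of integers.\<close>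

definition product_monoid_ring ::
    "'i set \<Rightarrow> ('i \<Rightarrow> 'b graded_ring) \<Rightarrow> (('i \<Rightarrow> 'b) \<Rightarrow>\<^sub>0 int) ring" where
  "product_monoid_ring I T =
     \<lparr>carrier = {p. Poly_Mapping.keys p \<subseteq> (\<Pi>\<^sub>E i\<in>I. carrier (T i))},
      monoid.mult = (\<lambda>p q. \<Sum>f\<in>Poly_Mapping.keys p. \<Sum>g\<in>Poly_Mapping.keys q.
                Poly_Mapping.single (\<lambda>i\<in>I. f i \<otimes>\<^bsub>T i\<^esub> g i)
                  (Poly_Mapping.lookup p f * Poly_Mapping.lookup q g)),
      monoid.one = Poly_Mapping.single (\<lambda>i\<in>I. \<one>\<^bsub>T i\<^esub>) 1,
      ring.zero = 0,
      ring.add = (+)\<rparr>"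

definition multiadditive_relations ::
    "'i set \<Rightarrow> ('i \<Rightarrow> 'b graded_ring) \<Rightarrow> (('i \<Rightarrow> 'b) \<Rightarrow>\<^sub>0 int) set" where
  "multiadditive_relations I T =
     {Poly_Mapping.single (f(i := a \<oplus>\<^bsub>T i\<^esub> b)) 1
        - Poly_Mapping.single (f(i := a)) 1 - Poly_Mapping.single (f(i := b)) 1 | f i a b.
        f \<in> (\<Pi>\<^sub>E i\<in>I. carrier (T i)) \<and> i \<in> I \<and> a \<in> carrier (T i) \<and> b \<in> carrier (T i)}"

definition tensor_ideal :: "'i set \<Rightarrow> ('i \<Rightarrow> 'b graded_ring) \<Rightarrow> (('i \<Rightarrow> 'b) \<Rightarrow>\<^sub>0 int) set" where
  "tensor_ideal I T = Idl\<^bsub>product_monoid_ring I T\<^esub> (multiadditive_relations I T)"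

definition pure_tensor ::
    "'i set \<Rightarrow> ('i \<Rightarrow> 'b graded_ring) \<Rightarrow> ('i \<Rightarrow> 'b) \<Rightarrow> (('i \<Rightarrow> 'b) \<Rightarrow>\<^sub>0 int) set" where
  "pure_tensor I T f =
     tensor_ideal I T +>\<^bsub>product_monoid_ring I T\<^esub> Poly_Mapping.single f 1"

definition tensor_product ::
    "'i set \<Rightarrow> ('i \<Rightarrow> 'b graded_ring) \<Rightarrow> (('i \<Rightarrow> 'b) \<Rightarrow>\<^sub>0 int) set graded_ring" where
  "tensor_product I T =
     (let Q = product_monoid_ring I T Quot tensor_ideal I T
      in make_graded Q
           (\<lambda>d. generate (add_monoid Q)
                  {pure_tensor I T f | f e. f \<in> (\<Pi>\<^sub>E i\<in>I. homog (T i) (e i)) \<and> (\<Sum>i\<in>I. e i) = d}))"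

definition tensor_embed ::
    "'i set \<Rightarrow> ('i \<Rightarrow> 'b graded_ring) \<Rightarrow> 'i \<Rightarrow> 'b \<Rightarrow> (('i \<Rightarrow> 'b) \<Rightarrow>\<^sub>0 int) set" where
  "tensor_embed I T j x = pure_tensor I T (\<lambda>i\<in>I. if i = j then x else \<one>\<^bsub>T i\<^esub>)"


section \<open>Tensor decompositions\<close>

definition tensor_decomposition ::
    "'a graded_ring \<Rightarrow> nat \<Rightarrow> (nat \<Rightarrow> 'b graded_ring)
       \<Rightarrow> ('a \<Rightarrow> ((nat \<Rightarrow> 'b) \<Rightarrow>\<^sub>0 int) set) \<Rightarrow> bool" where
  "tensor_decomposition R s T \<phi> \<longleftrightarrow>
     (\<forall>i<s. standard_graded (T i)) \<and> \<phi> \<in> graded_iso R (tensor_product {..<s} T)"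

text \<open>The subalgebra of \<open>R\<close> with which the factor \<open>T j\<close> is identified: it is generated by the
  summand of \<open>homog R 1\<close> that corresponds to \<open>homog (T j) 1\<close>.\<close>

definition factor_subalgebra ::
    "'a graded_ring \<Rightarrow> nat \<Rightarrow> (nat \<Rightarrow> 'b graded_ring)
       \<Rightarrow> ('a \<Rightarrow> ((nat \<Rightarrow> 'b) \<Rightarrow>\<^sub>0 int) set) \<Rightarrow> nat \<Rightarrow> 'a set" where
  "factor_subalgebra R s T \<phi> j =
     generate_ring R {x \<in> carrier R. \<phi> x \<in> tensor_embed {..<s} T j ` homog (T j) 1}"

definition same_up_to_permutation ::
    "'a graded_ring \<Rightarrow> nat \<Rightarrow> (nat \<Rightarrow> 'b graded_ring)
       \<Rightarrow> ('a \<Rightarrow> ((nat \<Rightarrow> 'b) \<Rightarrow>\<^sub>0 int) set)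
       \<Rightarrow> nat \<Rightarrow> (nat \<Rightarrow> 'c graded_ring)
       \<Rightarrow> ('a \<Rightarrow> ((nat \<Rightarrow> 'c) \<Rightarrow>\<^sub>0 int) set) \<Rightarrow> bool" where
  "same_up_to_permutation R s T \<phi> s' T' \<phi>' \<longleftrightarrow>
     (\<exists>\<sigma>. bij_betw \<sigma> {..<s} {..<s'} \<and>
          (\<forall>i<s. factor_subalgebra R s T \<phi> i = factor_subalgebra R s' T' \<phi>' (\<sigma> i)))"

definition nontrivial_decomposition ::
    "'a graded_ring \<Rightarrow> nat \<Rightarrow> (nat \<Rightarrow> 'b graded_ring)
       \<Rightarrow> ('a \<Rightarrow> ((nat \<Rightarrow> 'b) \<Rightarrow>\<^sub>0 int) set) \<Rightarrow> bool" where
  "nontrivial_decomposition R s T \<phi> \<longleftrightarrow>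
     tensor_decomposition R s T \<phi> \<and> (\<forall>i<s. \<not> \<Z> \<simeq> T i)"

text \<open>The factors of a tensor decomposition embed into \<open>R\<close>, so it is no restriction that here they
  have the same element type as \<open>R\<close>.\<close>

definition tensor_indecomposable :: "'a graded_ring \<Rightarrow> bool" where
  "tensor_indecomposable R \<longleftrightarrow>
     \<not> \<Z> \<simeq> R \<and>
     \<not> (\<exists>s\<ge>2. \<exists>(T :: nat \<Rightarrow> 'a graded_ring) \<phi>. nontrivial_decomposition R s T \<phi>)"


section \<open>The rings of partitions\<close>

text \<open>Integer polynomials in variables indexed by natural numbers are finitely supported maps from
  exponent vectors to coefficients; \<^theory>\<open>HOL-Library.Poly_Mapping\<close> provides their ring
  structure.\<close>

type_synonym int_mpoly = "(nat \<Rightarrow>\<^sub>0 nat) \<Rightarrow>\<^sub>0 int"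

definition monom_degree :: "(nat \<Rightarrow>\<^sub>0 nat) \<Rightarrow> nat" where
  "monom_degree a = (\<Sum>j\<in>Poly_Mapping.keys a. Poly_Mapping.lookup a j)"

definition poly_var :: "nat \<Rightarrow> int_mpoly" where
  "poly_var i = Poly_Mapping.single (Poly_Mapping.single i 1) 1"

definition polys_upto :: "nat \<Rightarrow> int_mpoly ring" where
  "polys_upto n =
     \<lparr>carrier = {p. \<forall>a\<in>Poly_Mapping.keys p. Poly_Mapping.keys a \<subseteq> {1..n}},
      monoid.mult = (*), monoid.one = 1, ring.zero = 0, ring.add = (+)\<rparr>"

definition homogeneous :: "nat \<Rightarrow> int_mpoly \<Rightarrow> bool" where
  "homogeneous d p \<longleftrightarrow> (\<forall>a\<in>Poly_Mapping.keys p. monom_degree a = d)"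

definition complete_sym :: "nat \<Rightarrow> nat \<Rightarrow> int_mpoly" where
  "complete_sym m i =
     (\<Sum>a | Poly_Mapping.keys a \<subseteq> {1..i} \<and> monom_degree a = m. Poly_Mapping.single a 1)"

text \<open>A partition is the list of its parts in weakly increasing order; parts are numbered from 1.\<close>

definition part :: "nat list \<Rightarrow> nat \<Rightarrow> nat" where
  "part lam i = lam ! (i - 1)"

definition part_ideal :: "nat list \<Rightarrow> int_mpoly set" where
  "part_ideal lam =
     Idl\<^bsub>polys_upto (length lam)\<^esub>
       ((\<lambda>i. complete_sym (part lam i - i + 1) i) ` {1..length lam})"

definition part_class :: "nat list \<Rightarrow> int_mpoly \<Rightarrow> int_mpoly set" where
  "part_class lam p = part_ideal lam +>\<^bsub>polys_upto (length lam)\<^esub> p"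

definition part_ring :: "nat list \<Rightarrow> int_mpoly set graded_ring" where
  "part_ring lam =
     make_graded (polys_upto (length lam) Quot part_ideal lam)
       (\<lambda>d. part_class lam ` {p \<in> carrier (polys_upto (length lam)). homogeneous d p})"

text \<open>The list \<open>k\<^sub>0 = 0 < k\<^sub>1 < \<dots> < k\<^sub>s < k\<^sub>s\<^sub>+\<^sub>1 = n + 1\<close>, where \<open>k\<^sub>1, \<dots>, k\<^sub>s\<close> are the indices \<open>k\<close>
  with \<open>part lam k = k\<close>.\<close>

definition cut_indices :: "nat list \<Rightarrow> nat list" where
  "cut_indices lam =
     0 # filter (\<lambda>k. part lam k = k) [1..<length lam + 1] @ [length lam + 1]"

text \<open>The indecomposable components, each paired with the number \<open>k\<^sub>t\<close> by which its variables are
  shifted inside those of the whole partition.\<close>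

definition components :: "nat list \<Rightarrow> (nat \<times> nat list) list" where
  "components lam =
     (let ks = cut_indices lam
      in filter (\<lambda>(k, mu). mu \<noteq> [])
           (map (\<lambda>t. (ks ! t, map (\<lambda>i. part lam i - ks ! t) [ks ! t + 1..<ks ! (t + 1)]))
              [0..<length ks - 1]))"

definition num_components :: "nat list \<Rightarrow> nat" where
  "num_components lam = length (components lam)"

definition offset :: "nat list \<Rightarrow> nat \<Rightarrow> nat" where
  "offset lam j = fst (components lam ! j)"

definition component :: "nat list \<Rightarrow> nat \<Rightarrow> nat list" where
  "component lam j = snd (components lam ! j)"

definition component_ring :: "nat list \<Rightarrow> nat \<Rightarrow> int_mpoly set graded_ring" where
  "component_ring lam j = part_ring (component lam j)"

text \<open>\<open>\<phi>\<close> is compatible with the identification of the variable number \<open>i\<close> of a component with the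
  variable number \<open>offset + i\<close> of the whole partition.\<close>

definition identifies_variables ::
    "nat list \<Rightarrow> (int_mpoly set \<Rightarrow> ((nat \<Rightarrow> int_mpoly set) \<Rightarrow>\<^sub>0 int) set) \<Rightarrow> bool" where
  "identifies_variables lam \<phi> \<longleftrightarrow>
     (\<forall>j<num_components lam. \<forall>i\<in>{1..length (component lam j)}.
        \<phi> (part_class lam (poly_var (offset lam j + i))) =
        tensor_embed {..<num_components lam} (component_ring lam) j
          (part_class (component lam j) (poly_var i)))"

end

theory Submission
  imports Defs
begin

text \<open>Scaling the degree-\<open>d\<close> part of one tensor factor by \<open>d\<close> and extending by the Leibniz rule gives a
  derivation of the whole ring, which on degree 1 is the projection onto the summand of that factor.
  So a tensor decomposition yields derivations \<open>D\<close> of degree 0 that are idempotent in degree 1, and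
  it suffices to know how these act on the variables.  Let \<open>t\<close> be an index of an indecomposable
  component, let \<open>d\<close> be the degree of the relation number \<open>t\<close>, and suppose that \<open>D\<close> multiplies all
  earlier variables of the component by \<open>c\<close>.  Write \<open>D x\<^sub>t = c x\<^sub>t + z\<close>.  Applying \<open>D\<close> to the relation
  shows that \<open>z\<close> is annihilated by the derivative of the relation in \<open>x\<^sub>t\<close>; comparing normal forms,
  the coefficients \<open>e\<^sub>l\<close> of \<open>z\<close> satisfy \<open>d e\<^sub>l = e\<^sub>t\<close> for the earlier \<open>l\<close> of the component and vanish
  outside it.  If \<open>t\<close> is not the first index, \<open>D\<^sup>2 = D\<close> forces \<open>z = 0\<close> or \<open>e\<^sub>t = 1 - 2 c\<close>, and the
  latter contradicts \<open>d\<close> dividing \<open>e\<^sub>t\<close> because \<open>d\<close> is at least 2.  Hence \<open>D\<close> is the scalar 0 or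
  1 on each component, that is, each component lies in a single factor of every tensor
  decomposition.  This makes the components indecomposable, and it makes an arbitrary decomposition
  a coarsening of the one into components: a factor containing several components would decompose.\<close>

section \<open>The tensor product of a family of rings\<close>

subsection \<open>The product monoid ring\<close>

text \<open>Integrality is what makes the result true. For the partition (2, 3), which is a single
  component, the element x_1 + 2 x_2 has square zero, and once 2 is inverted the ring becomes a
  tensor product of two rings with one generator of square zero each. So the argument has to end in
  a divisibility. Its source is the factor d in front of the earlier coefficients, the leading
  coefficient of the derivative of a polynomial that is monic of degree d in x_t. Coefficients can
  be compared because every relation is monic in its last variable: the monomials in which each
  exponent of x_i is below the degree of relation i form a basis, and the ring is torsion-free. The
  components decouple because at an index k whose part is k all complete symmetric polynomials of
  positive degree in x_1, ..., x_k vanish in the ring, so that the later relations can be rewritten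
  in the later variables alone.\<close>

lemmas frag_carrier_induct [consumes 1, case_names zero diff one] = free_Abelian_group_induct

text \<open>The defining double sum over keys is a nested \<open>frag_extend\<close>, hence additive
  in both arguments; the ring laws of the product monoid ring can then be checked on single
  generators.\<close>

lemma bilinear_frag_extend:
  "(\<Sum>f\<in>Poly_Mapping.keys p. \<Sum>g\<in>Poly_Mapping.keys q.
      Poly_Mapping.single (M f g) (Poly_Mapping.lookup p f * Poly_Mapping.lookup q g))
   = frag_extend (\<lambda>f. frag_extend (\<lambda>g. frag_of (M f g)) q) p"
proof -
  have "Poly_Mapping.single (M f g) (a * b) = frag_cmul a (frag_cmul b (frag_of (M f g)))" for f g a b
    by (rule poly_mapping_eqI) (simp add: lookup_single when_def)
  then show ?thesis
    by (simp add: frag_extend_def frag_cmul_sum)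
qed

lemma frag_extend_add_fun: "frag_extend (\<lambda>x. b x + c x) p = frag_extend b p + frag_extend c p"
  by (simp add: frag_extend_def frag_cmul_distrib2 sum.distrib)

lemma frag_extend_diff_fun: "frag_extend (\<lambda>x. b x - c x) p = frag_extend b p - frag_extend c p"
  using frag_extend_add_fun [of "\<lambda>x. b x - c x" c p] by simp

section \<open>Graded records, additive homomorphisms and derivations\<close>

lemma make_graded_simps [simp]:
  "carrier (make_graded R H) = carrier R" "monoid.mult (make_graded R H) = monoid.mult R"
  "ring.add (make_graded R H) = ring.add R" "\<one>\<^bsub>make_graded R H\<^esub> = \<one>\<^bsub>R\<^esub>" "\<zero>\<^bsub>make_graded R H\<^esub> = \<zero>\<^bsub>R\<^esub>"
  "homog (make_graded R H) = H"
  by (simp_all add: make_graded_def ring.extend_def graded_ring.fields_def)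

text \<open>\<open>make_graded\<close> and record updates yield rings of another type or term; being
  a commutative ring depends only on the five fields listed.\<close>

lemma cring_cong:
  assumes "cring R" "carrier S = carrier R" "monoid.mult S = monoid.mult R"
  "ring.add S = ring.add R" "\<one>\<^bsub>S\<^esub> = \<one>\<^bsub>R\<^esub>" "\<zero>\<^bsub>S\<^esub> = \<zero>\<^bsub>R\<^esub>"
  shows "cring S"
proof -
  interpret R: cring R by fact
  have "abelian_group S"
    by (rule abelian_groupI) (use assms(2-) R.a_assoc R.a_comm R.add.l_inv_ex in auto)
  moreover have "Group.comm_monoid S"
    by (rule comm_monoidI) (use assms(2-) R.m_assoc R.m_comm in auto)
  ultimately show ?thesis
    by (rule cringI) (use assms(2-) R.l_distr in auto)
qed

lemma cring_make_graded: "cring R \<Longrightarrow> cring (make_graded R H)"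
  by (erule cring_cong) simp_all


lemma (in abelian_group) minus_eq_zeroD:
  assumes "x \<in> carrier G" "y \<in> carrier G" "x \<ominus> y = \<zero>"
  shows "x = y"
  using assms by (metis a_inv_closed a_minus_def minus_equality minus_minus)

lemma (in abelian_group) additive_zero:
  assumes "a \<in> carrier G" "a = a \<oplus> a" shows "a = \<zero>"
  using assms by (metis add.r_cancel_one')

lemma ring_hom_cringI': "cring R \<Longrightarrow> cring A \<Longrightarrow> h \<in> ring_hom R A \<Longrightarrow> ring_hom_cring R A h"
  by (simp add: ring_hom_cring_def ring_hom_cring_axioms_def)

lemma add_hom_group_hom:
  assumes "abelian_group R" "abelian_group A" "h \<in> hom (add_monoid R) (add_monoid A)"
  shows "group_hom (add_monoid R) (add_monoid A) h"
  using assms by (simp add: group_hom_def group_hom_axioms_def abelian_group.a_group)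

lemma add_hom_simps:
  assumes "abelian_group R" "abelian_group A" "h \<in> hom (add_monoid R) (add_monoid A)"
  shows add_hom_closed: "x \<in> carrier R \<Longrightarrow> h x \<in> carrier A"
    and add_hom_add: "x \<in> carrier R \<Longrightarrow> y \<in> carrier R \<Longrightarrow> h (x \<oplus>\<^bsub>R\<^esub> y) = h x \<oplus>\<^bsub>A\<^esub> h y"
    and add_hom_zero: "h \<zero>\<^bsub>R\<^esub> = \<zero>\<^bsub>A\<^esub>"
    and add_hom_inv: "x \<in> carrier R \<Longrightarrow> h (\<ominus>\<^bsub>R\<^esub> x) = \<ominus>\<^bsub>A\<^esub> h x"
    and add_hom_minus: "x \<in> carrier R \<Longrightarrow> y \<in> carrier R \<Longrightarrow> h (x \<ominus>\<^bsub>R\<^esub> y) = h x \<ominus>\<^bsub>A\<^esub> h y"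
proof -
  interpret h: group_hom "add_monoid R" "add_monoid A" h
    by (rule add_hom_group_hom [OF assms])
  interpret R: abelian_group R by fact
  show c: "x \<in> carrier R \<Longrightarrow> h x \<in> carrier A" for x
    using h.hom_closed by simp
  show a: "x \<in> carrier R \<Longrightarrow> y \<in> carrier R \<Longrightarrow> h (x \<oplus>\<^bsub>R\<^esub> y) = h x \<oplus>\<^bsub>A\<^esub> h y" for x y
    using h.hom_mult by simp
  show "h \<zero>\<^bsub>R\<^esub> = \<zero>\<^bsub>A\<^esub>"
    using h.hom_one by simp
  show i: "x \<in> carrier R \<Longrightarrow> h (\<ominus>\<^bsub>R\<^esub> x) = \<ominus>\<^bsub>A\<^esub> h x" for x
    using h.hom_inv [of x] by (simp add: a_inv_def)
  show "x \<in> carrier R \<Longrightarrow> y \<in> carrier R \<Longrightarrow> h (x \<ominus>\<^bsub>R\<^esub> y) = h x \<ominus>\<^bsub>A\<^esub> h y"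
    using a [of x "\<ominus>\<^bsub>R\<^esub> y"] i [of y] R.a_inv_closed [of y] by (simp add: a_minus_def)
qed

lemma add_hom_finsum:
  assumes "abelian_group R" "abelian_group A" "h \<in> hom (add_monoid R) (add_monoid A)"
    and "f \<in> S \<rightarrow> carrier R"
  shows "h (finsum R f S) = finsum A (\<lambda>i. h (f i)) S"
proof -
  interpret R: abelian_group R by fact
  interpret A: abelian_group A by fact
  note simps = add_hom_simps [OF assms(1-3)]
  show ?thesis using assms(4)
  proof (induction S rule: infinite_finite_induct)
    case (insert x S)
    then have "f x \<in> carrier R" "f \<in> S \<rightarrow> carrier R" "(\<lambda>i. h (f i)) \<in> S \<rightarrow> carrier A"
      by (auto intro!: simps)
    then show ?case using insert
      by (simp add: R.finsum_insert A.finsum_insert simps)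
  qed (simp_all add: simps)
qed

lemma ring_hom_add_hom: "h \<in> ring_hom R A \<Longrightarrow> h \<in> hom (add_monoid R) (add_monoid A)"
  by (auto simp: ring_hom_def hom_def)

lemma cring_abelian: "cring R \<Longrightarrow> abelian_group R"
  by (simp add: cring_def ring_def)

text \<open>Additive maps are linear over the integers, so these are the derivations of the ring as
  an integral algebra.\<close>

definition derivation :: "('a, 'm) ring_scheme \<Rightarrow> ('a \<Rightarrow> 'a) \<Rightarrow> bool" where
  "derivation R D \<longleftrightarrow> D \<in> hom (add_monoid R) (add_monoid R) \<and>
     (\<forall>x\<in>carrier R. \<forall>y\<in>carrier R. D (x \<otimes>\<^bsub>R\<^esub> y) = D x \<otimes>\<^bsub>R\<^esub> y \<oplus>\<^bsub>R\<^esub> x \<otimes>\<^bsub>R\<^esub> D y)"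

lemma derivation_one:
  assumes "cring R" "derivation R D"
  shows "D \<one>\<^bsub>R\<^esub> = \<zero>\<^bsub>R\<^esub>"
proof -
  interpret R: cring R by fact
  have "D \<one>\<^bsub>R\<^esub> \<in> carrier R"
    using assms(2) by (auto simp: derivation_def hom_def)
  moreover from this have "D \<one>\<^bsub>R\<^esub> = D \<one>\<^bsub>R\<^esub> \<oplus>\<^bsub>R\<^esub> D \<one>\<^bsub>R\<^esub>"
    using assms(2) unfolding derivation_def by (metis R.l_one R.one_closed R.r_one)
  ultimately show ?thesis
    by (metis R.add.r_cancel_one')
qed

locale tensor_family =
  fixes I :: "'i set" and T :: "'i \<Rightarrow> 'b graded_ring"
  assumes finI: "finite I" and cringT: "\<And>i. i \<in> I \<Longrightarrow> cring (T i)"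
begin

abbreviation "P \<equiv> product_monoid_ring I T"
definition "E = (\<Pi>\<^sub>E i\<in>I. carrier (T i))"
definition "mul f g = (\<lambda>i\<in>I. f i \<otimes>\<^bsub>T i\<^esub> g i)"
definition "un = (\<lambda>i\<in>I. \<one>\<^bsub>T i\<^esub>)"

lemma P_mult: "p \<otimes>\<^bsub>P\<^esub> q = frag_extend (\<lambda>f. frag_extend (\<lambda>g. frag_of (mul f g)) q) p"
  by (simp add: product_monoid_ring_def bilinear_frag_extend mul_def)

lemma P_simps [simp]:
  "p \<in> carrier P \<longleftrightarrow> Poly_Mapping.keys p \<subseteq> E" "\<one>\<^bsub>P\<^esub> = frag_of un" "\<zero>\<^bsub>P\<^esub> = 0" "p \<oplus>\<^bsub>P\<^esub> q = p + q"
  by (simp_all add: product_monoid_ring_def un_def E_def)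

lemma P_mult_simps [simp]:
  "0 \<otimes>\<^bsub>P\<^esub> q = 0" "p \<otimes>\<^bsub>P\<^esub> 0 = 0"
  "(p + p') \<otimes>\<^bsub>P\<^esub> q = p \<otimes>\<^bsub>P\<^esub> q + p' \<otimes>\<^bsub>P\<^esub> q"
  "(p - p') \<otimes>\<^bsub>P\<^esub> q = p \<otimes>\<^bsub>P\<^esub> q - p' \<otimes>\<^bsub>P\<^esub> q"
  "p \<otimes>\<^bsub>P\<^esub> (q + q') = p \<otimes>\<^bsub>P\<^esub> q + p \<otimes>\<^bsub>P\<^esub> q'"
  "p \<otimes>\<^bsub>P\<^esub> (q - q') = p \<otimes>\<^bsub>P\<^esub> q - p \<otimes>\<^bsub>P\<^esub> q'"
  "frag_of f \<otimes>\<^bsub>P\<^esub> frag_of g = frag_of (mul f g)"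
  unfolding P_mult
  by (simp_all add: frag_extend_add frag_extend_diff frag_extend_add_fun frag_extend_diff_fun
      frag_extend_eq_0)

lemma mul_closed: "f \<in> E \<Longrightarrow> g \<in> E \<Longrightarrow> mul f g \<in> E"
  by (auto simp: mul_def un_def E_def PiE_iff cring.cring_simprules cringT)

lemma mul_assoc: "f \<in> E \<Longrightarrow> g \<in> E \<Longrightarrow> h \<in> E \<Longrightarrow> mul (mul f g) h = mul f (mul g h)"
  by (auto simp: mul_def un_def E_def PiE_iff fun_eq_iff cring.cring_simprules cringT)

lemma mul_comm: "f \<in> E \<Longrightarrow> g \<in> E \<Longrightarrow> mul f g = mul g f"
  by (auto simp: mul_def un_def E_def PiE_iff fun_eq_iff cring.cring_simprules cringT)

lemma un_closed: "un \<in> E"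
  by (auto simp: mul_def un_def E_def PiE_iff cring.cring_simprules cringT)

lemma mul_un: "f \<in> E \<Longrightarrow> mul un f = f"
  by (auto simp: mul_def un_def E_def PiE_iff fun_eq_iff cringT extensional_def
      intro!: monoid.l_one ring.is_monoid cring.axioms(1))

lemma P_mult_closed:
  assumes "Poly_Mapping.keys p \<subseteq> E" "Poly_Mapping.keys q \<subseteq> E"
  shows "Poly_Mapping.keys (p \<otimes>\<^bsub>P\<^esub> q) \<subseteq> E"
proof
  fix x assume "x \<in> Poly_Mapping.keys (p \<otimes>\<^bsub>P\<^esub> q)"
  then obtain f g where "f \<in> Poly_Mapping.keys p" "g \<in> Poly_Mapping.keys q" "x = mul f g"
    unfolding P_mult by (fastforce dest!: subsetD [OF keys_frag_extend])
  moreover from this have "f \<in> E" "g \<in> E"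
    using assms by (meson subsetD)+
  ultimately show "x \<in> E" by (simp only: mul_closed)
qed

lemma P_mult_comm:
  assumes p: "Poly_Mapping.keys p \<subseteq> E" and q: "Poly_Mapping.keys q \<subseteq> E"
  shows "p \<otimes>\<^bsub>P\<^esub> q = q \<otimes>\<^bsub>P\<^esub> p"
  using p
proof (induction rule: frag_induction)
  case (one f)
  then have f: "f \<in> E" .
  show ?case using q
  proof (induction rule: frag_induction)
    case (one g)
    then show ?case using mul_comm [OF f, of g] by simp
  qed simp_all
qed simp_all

lemma P_mult_assoc:
  assumes p: "Poly_Mapping.keys p \<subseteq> E" and q: "Poly_Mapping.keys q \<subseteq> E" and r: "Poly_Mapping.keys r \<subseteq> E"
  shows "(p \<otimes>\<^bsub>P\<^esub> q) \<otimes>\<^bsub>P\<^esub> r = p \<otimes>\<^bsub>P\<^esub> (q \<otimes>\<^bsub>P\<^esub> r)"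
  using p
proof (induction rule: frag_induction)
  case (one f)
  then have f: "f \<in> E" .
  show ?case using q
  proof (induction rule: frag_induction)
    case (one g)
    then have g: "g \<in> E" .
    show ?case using r
    proof (induction rule: frag_induction)
      case (one h)
      then show ?case using mul_assoc [OF f g, of h] by simp
    qed simp_all
  qed simp_all
qed simp_all

lemma P_mult_one: "Poly_Mapping.keys p \<subseteq> E \<Longrightarrow> frag_of un \<otimes>\<^bsub>P\<^esub> p = p"
  by (induction rule: frag_induction) (simp_all add: mul_un)

lemma add_monoid_P: "add_monoid P = free_Abelian_group E"
  by (simp add: product_monoid_ring_def free_Abelian_group_def E_def)

lemma cring_P: "cring P"
proof (rule cringI)
  show "abelian_group P"
    by (rule comm_group_abelian_groupI) (simp only: add_monoid_P abelian_free_Abelian_group)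
  show "Group.comm_monoid P"
    by (rule comm_monoidI)
       (simp_all add: P_mult_closed P_mult_assoc P_mult_one un_closed del: P_mult_simps,
        rule P_mult_comm)
qed simp

sublocale P: cring P by (rule cring_P)

subsection \<open>Pure tensors\<close>

abbreviation "J \<equiv> tensor_ideal I T"
abbreviation "TP \<equiv> tensor_product I T"
abbreviation "pure \<equiv> pure_tensor I T"
abbreviation "emb \<equiv> tensor_embed I T"

lemma E_upd: "f \<in> E \<Longrightarrow> i \<in> I \<Longrightarrow> a \<in> carrier (T i) \<Longrightarrow> f(i := a) \<in> E"
  by (auto simp: E_def PiE_iff extensional_def)

lemma relations_carrier: "multiadditive_relations I T \<subseteq> carrier P"
proof
  fix p assume "p \<in> multiadditive_relations I T"
  then obtain f i a b where *: "p = frag_of (f(i := a \<oplus>\<^bsub>T i\<^esub> b)) - frag_of (f(i := a)) - frag_of (f(i := b))"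
    "f \<in> E" "i \<in> I" "a \<in> carrier (T i)" "b \<in> carrier (T i)"
    unfolding multiadditive_relations_def E_def by blast
  then have "a \<oplus>\<^bsub>T i\<^esub> b \<in> carrier (T i)"
    by (simp add: cring.cring_simprules cringT)
  then have "frag_of (f(i := a \<oplus>\<^bsub>T i\<^esub> b)) \<in> carrier P" "frag_of (f(i := a)) \<in> carrier P" "frag_of (f(i := b)) \<in> carrier P"
    using * E_upd by auto
  then show "p \<in> carrier P"
    unfolding *(1) P_simps by (meson Un_least keys_diff order_trans)
qed

lemma ideal_J: "ideal J P"
  unfolding tensor_ideal_def by (rule P.genideal_ideal[OF relations_carrier])

sublocale J: ideal J P by (rule ideal_J)

lemma ring_TP: "TP = make_graded (P Quot J)
           (\<lambda>d. generate (add_monoid (P Quot J))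
                  {pure f | f e. f \<in> (\<Pi>\<^sub>E i\<in>I. homog (T i) (e i)) \<and> (\<Sum>i\<in>I. e i) = d})"
  by (simp add: tensor_product_def Let_def)


lemma cring_TP: "cring TP"
  unfolding ring_TP by (rule cring_make_graded) (rule J.quotient_is_cring [OF cring_P])

sublocale TP: cring TP by (rule cring_TP)

definition "cls p = J +>\<^bsub>P\<^esub> p"

lemma cls_hom: "cls \<in> ring_hom P TP"
  using J.rcos_ring_hom by (simp add: ring_hom_def ring_TP cls_def [abs_def])

sublocale cls: ring_hom_cring P TP cls
  by (rule ring_hom_cringI' [OF cring_P cring_TP cls_hom])

lemma pure_cls: "pure f = cls (frag_of f)"
  by (simp add: pure_tensor_def cls_def)

lemma carrier_TP: "carrier TP = cls ` carrier P"
  by (auto simp: ring_TP FactRing_def A_RCOSETS_def' cls_def)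

lemma pure_closed [simp]: "f \<in> E \<Longrightarrow> pure f \<in> carrier TP"
  using cls.hom_closed by (simp add: pure_cls)

lemma P_minus:
  assumes "Poly_Mapping.keys p \<subseteq> E" "Poly_Mapping.keys q \<subseteq> E"
  shows "p \<ominus>\<^bsub>P\<^esub> q = p - q"
proof -
  have "\<ominus>\<^bsub>P\<^esub> q = - q"
    by (rule P.minus_equality) (use assms in simp_all)
  then show ?thesis by (simp add: a_minus_def)
qed

lemma TP_induct [consumes 1, case_names zero pure diff]:
  assumes "x \<in> carrier TP"
    and "Q \<zero>\<^bsub>TP\<^esub>" "\<And>f. f \<in> E \<Longrightarrow> Q (pure f)"
    and "\<And>x y. x \<in> carrier TP \<Longrightarrow> y \<in> carrier TP \<Longrightarrow> Q x \<Longrightarrow> Q y \<Longrightarrow> Q (x \<ominus>\<^bsub>TP\<^esub> y)"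
  shows "Q x"
proof -
  obtain p where p: "Poly_Mapping.keys p \<subseteq> E" "x = cls p"
    using assms(1) by (auto simp: carrier_TP)
  have "Q (cls p)" using p(1)
  proof (induction p rule: frag_carrier_induct)
    case zero
    show ?case using cls.hom_zero assms(2) by simp
  next
    case (diff p q)
    have "cls (p - q) = cls p \<ominus>\<^bsub>TP\<^esub> cls q"
      unfolding P_minus [OF diff(1,2), symmetric]
      using diff(1,2)
      by (intro add_hom_minus [OF P.is_abelian_group TP.is_abelian_group ring_hom_add_hom [OF cls_hom]]) simp_all
    then show ?case using diff by (simp add: assms(4))
  next
    case (one f)
    then show ?case using assms(3) by (simp add: pure_cls)
  qed
  then show ?thesis by (simp add: p)
qed

lemma mul_upd:
  assumes "i \<in> I"
  shows "mul (f(i := a)) g = (mul f g)(i := a \<otimes>\<^bsub>T i\<^esub> g i)"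
  using assms by (auto simp: mul_def)

lemma E_app: "f \<in> E \<Longrightarrow> i \<in> I \<Longrightarrow> f i \<in> carrier (T i)"
  by (auto simp: E_def)

text \<open>The free abelian group on the tuples maps to \<open>A\<close> by \<open>m\<close>, and
  multiadditivity makes this map vanish on the relations and all their multiples, so it factors
  through the quotient. The target is only an abelian group, which lets ring homomorphisms and
  derivations both be built from it.\<close>

theorem TP_universal:
  fixes A :: "('c, 'm) ring_scheme"
  assumes A: "abelian_group A" and m: "\<And>f. f \<in> E \<Longrightarrow> m f \<in> carrier A"
    and m_add: "\<And>f i a b. f \<in> E \<Longrightarrow> i \<in> I \<Longrightarrow> a \<in> carrier (T i) \<Longrightarrow> b \<in> carrier (T i) \<Longrightarrow>
        m (f(i := a \<oplus>\<^bsub>T i\<^esub> b)) = m (f(i := a)) \<oplus>\<^bsub>A\<^esub> m (f(i := b))"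
  obtains \<Phi> where "\<Phi> \<in> hom (add_monoid TP) (add_monoid A)" "\<And>f. f \<in> E \<Longrightarrow> \<Phi> (pure f) = m f"
proof -
  interpret A: abelian_group A by fact
  have "m ` E \<subseteq> carrier (add_monoid A)" using m by auto
  from comm_group.free_Abelian_group_universal [OF A.a_comm_group this]
  obtain h where h: "h \<in> hom (add_monoid P) (add_monoid A)" and hm: "\<And>f. f \<in> E \<Longrightarrow> h (frag_of f) = m f"
    unfolding add_monoid_P by blast
  note hs = add_hom_simps [OF P.is_abelian_group A h]
  have hs': "h (p - q) = h p \<ominus>\<^bsub>A\<^esub> h q" if "Poly_Mapping.keys p \<subseteq> E" "Poly_Mapping.keys q \<subseteq> E" for p q
    using hs(5) [of p q] that by (simp add: P_minus)
  have pc: "p \<otimes>\<^bsub>P\<^esub> q \<in> carrier P" if "p \<in> carrier P" "q \<in> carrier P" for p q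
    using that by (rule P.m_closed)
  \<comment> \<open>The kernel of \<open>h\<close> is a priori only a subgroup, since
    \<open>A\<close> has no multiplication. \<open>K\<close> is the largest ideal inside it, so it
    suffices to find the generators of \<open>J\<close> in \<open>K\<close>.\<close>
  define K where "K = {p \<in> carrier P. \<forall>q\<in>carrier P. h (p \<otimes>\<^bsub>P\<^esub> q) = \<zero>\<^bsub>A\<^esub>}"
  have "ideal K P"
  proof (rule idealI)
    show "ring P" by (rule P.ring_axioms)
    show "subgroup K (add_monoid P)"
    proof (rule P.add.subgroupI)
      show "K \<subseteq> carrier P" by (auto simp: K_def)
      show "K \<noteq> {}" using hs(3) by (force simp: K_def)
      fix a assume a: "a \<in> K"
      have "h (\<ominus>\<^bsub>P\<^esub> a \<otimes>\<^bsub>P\<^esub> q) = \<zero>\<^bsub>A\<^esub>" if "q \<in> carrier P" for q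
        using a that hs(4) [OF pc] unfolding K_def by (simp add: P.l_minus del: P_simps)
      then show "\<ominus>\<^bsub>P\<^esub> a \<in> K" using a by (simp add: K_def del: P_simps)
      fix b assume b: "b \<in> K"
      have "h ((a \<oplus>\<^bsub>P\<^esub> b) \<otimes>\<^bsub>P\<^esub> q) = \<zero>\<^bsub>A\<^esub>" if "q \<in> carrier P" for q
        using a b that hs(2) [OF pc pc] unfolding K_def by (simp add: P.l_distr del: P_simps)
      then show "a \<oplus>\<^bsub>P\<^esub> b \<in> K" using a b by (simp add: K_def del: P_simps)
    qed
    fix a x assume ax: "a \<in> K" "x \<in> carrier P"
    then have *: "a \<in> carrier P" "\<And>q. q \<in> carrier P \<Longrightarrow> h (a \<otimes>\<^bsub>P\<^esub> q) = \<zero>\<^bsub>A\<^esub>"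
      unfolding K_def by blast+
    have "h (a \<otimes>\<^bsub>P\<^esub> x \<otimes>\<^bsub>P\<^esub> q) = \<zero>\<^bsub>A\<^esub>" if "q \<in> carrier P" for q
      using *(2) [OF pc [OF ax(2) that]] P.m_assoc [OF *(1) ax(2) that] by simp
    then show "a \<otimes>\<^bsub>P\<^esub> x \<in> K" using pc [OF *(1) ax(2)] by (simp only: K_def mem_Collect_eq) blast
    then show "x \<otimes>\<^bsub>P\<^esub> a \<in> K" using P.m_comm [OF *(1) ax(2)] by simp
  qed
  moreover have "multiadditive_relations I T \<subseteq> K"
  proof
    fix r assume r: "r \<in> multiadditive_relations I T"
    then obtain f i a b where *: "r = frag_of (f(i := a \<oplus>\<^bsub>T i\<^esub> b)) - frag_of (f(i := a)) - frag_of (f(i := b))"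
      "f \<in> E" "i \<in> I" "a \<in> carrier (T i)" "b \<in> carrier (T i)"
      unfolding multiadditive_relations_def E_def by blast
    interpret Ti: cring "T i" using * cringT by simp
    have "h (r \<otimes>\<^bsub>P\<^esub> q) = \<zero>\<^bsub>A\<^esub>" if "q \<in> carrier P" for q
    proof -
      have "Poly_Mapping.keys q \<subseteq> E" using that by simp
      then show ?thesis
      proof (induction q rule: frag_carrier_induct)
        case zero
        then show ?case using hs(3) by simp
      next
        case (diff p q)
        have "r \<otimes>\<^bsub>P\<^esub> p \<in> carrier P" "r \<otimes>\<^bsub>P\<^esub> q \<in> carrier P"
          using diff(1,2) r relations_carrier by (metis P.m_closed P_simps(1) subsetD)+
        then show ?case using diff hs' A.r_neg [OF A.zero_closed] by (simp add: a_minus_def)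
      next
        case (one g)
        have gi: "g i \<in> carrier (T i)" using one * by (simp add: E_app)
        \<comment> \<open>A relation in coordinate \<open>i\<close> times the generator
          \<open>g\<close> is again such a relation, at the tuple \<open>mul f g\<close> and with
          both summands multiplied by \<open>g i\<close>.\<close>
        define u v where "u = a \<otimes>\<^bsub>T i\<^esub> g i" and "v = b \<otimes>\<^bsub>T i\<^esub> g i"
        have uv: "u \<in> carrier (T i)" "v \<in> carrier (T i)" using * gi by (simp_all add: u_def v_def)
        have mE: "mul f g \<in> E" using one * by (simp add: mul_closed)
        have "r \<otimes>\<^bsub>P\<^esub> frag_of g = frag_of ((mul f g)(i := u \<oplus>\<^bsub>T i\<^esub> v)) - frag_of ((mul f g)(i := u))
             - frag_of ((mul f g)(i := v))"
          unfolding *(1) u_def v_def using * gi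
          by (simp add: mul_upd Ti.l_distr)
        moreover have "h \<dots> = m ((mul f g)(i := u \<oplus>\<^bsub>T i\<^esub> v)) \<ominus>\<^bsub>A\<^esub> m ((mul f g)(i := u)) \<ominus>\<^bsub>A\<^esub> m ((mul f g)(i := v))"
          using mE uv * keys_diff [of "frag_of ((mul f g)(i := u \<oplus>\<^bsub>T i\<^esub> v))" "frag_of ((mul f g)(i := u))"]
          by (subst hs', force simp: E_upd, force simp: E_upd, subst hs')
            (simp_all add: E_upd hm)
        moreover have "\<dots> = \<zero>\<^bsub>A\<^esub>"
          using m_add [OF mE *(3) uv] m [OF E_upd [OF mE *(3) uv(1)]] m [OF E_upd [OF mE *(3) uv(2)]]
          by (simp add: a_minus_def A.a_assoc A.a_comm A.r_neg A.a_lcomm)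
            (metis A.a_assoc A.a_inv_closed A.r_neg A.r_zero A.add.m_lcomm)
        ultimately show ?case by simp
      qed
    qed
    then show "r \<in> K" using subsetD [OF relations_carrier r] unfolding K_def by blast
  qed
  ultimately have "J \<subseteq> K"
    unfolding tensor_ideal_def by (rule P.genideal_minimal)
  have h0: "h p = \<zero>\<^bsub>A\<^esub>" if "p \<in> J" for p
  proof -
    have "p \<in> K" using that \<open>J \<subseteq> K\<close> by blast
    then have "p \<in> carrier P" "h (p \<otimes>\<^bsub>P\<^esub> \<one>\<^bsub>P\<^esub>) = \<zero>\<^bsub>A\<^esub>"
      using P.one_closed unfolding K_def by blast+
    then show ?thesis using P.r_one by metis
  qed
  have wd: "h p = h q" if "p \<in> carrier P" "q \<in> carrier P" "cls p = cls q" for p q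
  proof -
    have "p \<ominus>\<^bsub>P\<^esub> q \<in> J"
      using P.quotient_eq_iff_same_a_r_cos [OF ideal_J that(1,2)] that(3) by (simp add: cls_def)
    then have "h p \<ominus>\<^bsub>A\<^esub> h q = \<zero>\<^bsub>A\<^esub>"
      using h0 hs(5) that by metis
    then show ?thesis by (rule A.minus_eq_zeroD [OF hs(1) [OF that(1)] hs(1) [OF that(2)]])
  qed
  \<comment> \<open>A class is evaluated at an arbitrary representative; \<open>wd\<close> makes the
    choice immaterial.\<close>
  define \<Phi> where "\<Phi> X = h (SOME p. p \<in> carrier P \<and> cls p = X)" for X
  have \<Phi>: "\<Phi> (cls p) = h p" if "p \<in> carrier P" for p
  proof -
    have "(SOME q. q \<in> carrier P \<and> cls q = cls p) \<in> carrier P \<and> cls (SOME q. q \<in> carrier P \<and> cls q = cls p) = cls p"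
      by (rule someI [of _ p]) (use that in simp)
    then show ?thesis unfolding \<Phi>_def using wd that by blast
  qed
  show thesis
  proof
    show "\<Phi> \<in> hom (add_monoid TP) (add_monoid A)"
    proof (rule homI)
      fix x assume "x \<in> carrier (add_monoid TP)"
      then show "\<Phi> x \<in> carrier (add_monoid A)" using hs(1) \<Phi> by (auto simp: carrier_TP)
      fix y assume "y \<in> carrier (add_monoid TP)"
      with \<open>x \<in> _\<close> obtain p q where pq: "p \<in> carrier P" "q \<in> carrier P" "x = cls p" "y = cls q"
        by (auto simp: carrier_TP)
      then have "\<Phi> (cls (p \<oplus>\<^bsub>P\<^esub> q)) = \<Phi> x \<oplus>\<^bsub>A\<^esub> \<Phi> y"
        by (simp only: \<Phi> P.a_closed hs(2))
      then show "\<Phi> (x \<otimes>\<^bsub>add_monoid TP\<^esub> y) = \<Phi> x \<otimes>\<^bsub>add_monoid A\<^esub> \<Phi> y"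
        using cls.hom_add [OF pq(1,2)] pq by simp
    qed
    fix f assume "f \<in> E"
    then show "\<Phi> (pure f) = m f" using \<Phi> hm by (simp add: pure_cls)
  qed
qed

end

section \<open>Pure tensors, and homomorphisms and derivations out of the tensor product\<close>

context tensor_family begin

lemma one_TP: "\<one>\<^bsub>TP\<^esub> = pure un"
  using cls.hom_one by (simp add: pure_cls)

lemma pure_mult: "f \<in> E \<Longrightarrow> g \<in> E \<Longrightarrow> pure f \<otimes>\<^bsub>TP\<^esub> pure g = pure (mul f g)"
  using cls.hom_mult [of "frag_of f" "frag_of g"] by (simp add: pure_cls)

lemma pure_add:
  assumes "f \<in> E" "i \<in> I" "a \<in> carrier (T i)" "b \<in> carrier (T i)"
  shows "pure (f(i := a \<oplus>\<^bsub>T i\<^esub> b)) = pure (f(i := a)) \<oplus>\<^bsub>TP\<^esub> pure (f(i := b))"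
proof -
  interpret Ti: cring "T i" using assms cringT by simp
  define A B C where "A = frag_of (f(i := a \<oplus>\<^bsub>T i\<^esub> b))" and "B = frag_of (f(i := a))" and "C = frag_of (f(i := b))"
  have ABC: "A \<in> carrier P" "B \<in> carrier P" "C \<in> carrier P"
    using assms by (simp_all add: A_def B_def C_def E_upd)
  have "A - B - C \<in> multiadditive_relations I T"
    unfolding multiadditive_relations_def A_def B_def C_def using assms(1) unfolding E_def using assms(2-) by blast
  then have "A - B - C \<in> J"
    unfolding tensor_ideal_def using P.genideal_self [OF relations_carrier] by blast
  moreover have "A - B - C = A \<ominus>\<^bsub>P\<^esub> (B \<oplus>\<^bsub>P\<^esub> C)"
    using ABC by (subst P_minus) (simp_all del: P_simps(1) add: P_simps(1) [symmetric] P.a_closed [simplified])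
  ultimately have "cls A = cls (B \<oplus>\<^bsub>P\<^esub> C)"
    using P.quotient_eq_iff_same_a_r_cos [OF ideal_J ABC(1) P.a_closed [OF ABC(2,3)]] by (simp add: cls_def)
  then show ?thesis
    using ABC cls.hom_add [OF ABC(2,3)] by (simp add: pure_cls A_def B_def C_def del: P_simps)
qed

lemma pure_zero:
  assumes "f \<in> E" "i \<in> I" "f i = \<zero>\<^bsub>T i\<^esub>"
  shows "pure f = \<zero>\<^bsub>TP\<^esub>"
proof -
  interpret Ti: cring "T i" using assms cringT by simp
  have "f(i := \<zero>\<^bsub>T i\<^esub>) = f" using assms(3) by auto
  then have "pure f = pure f \<oplus>\<^bsub>TP\<^esub> pure f"
    using pure_add [OF assms(1,2) Ti.zero_closed Ti.zero_closed] by simp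
  then show ?thesis using TP.additive_zero assms(1) by simp
qed

lemma emb_pure: "i \<in> I \<Longrightarrow> emb i x = pure (un(i := x))"
  unfolding tensor_embed_def un_def by (rule arg_cong [of _ _ pure]) auto

lemma emb_hom: 
  assumes i: "i \<in> I" shows "emb i \<in> ring_hom (T i) TP"
proof (rule ring_hom_memI)
  interpret Ti: cring "T i" using assms cringT by simp
  show "emb i \<one>\<^bsub>T i\<^esub> = \<one>\<^bsub>TP\<^esub>"
    unfolding emb_pure [OF i] one_TP using i by (intro arg_cong [of _ _ pure]) (auto simp: un_def)
  fix x assume x: "x \<in> carrier (T i)"
  show "emb i x \<in> carrier TP" using x i by (simp add: emb_pure E_upd un_closed)
  fix y assume y: "y \<in> carrier (T i)"
  show "emb i (x \<oplus>\<^bsub>T i\<^esub> y) = emb i x \<oplus>\<^bsub>TP\<^esub> emb i y"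
    using x y i by (simp add: emb_pure pure_add un_closed)
  have "(mul un (un(i := y)))(i := x \<otimes>\<^bsub>T i\<^esub> y) = un(i := x \<otimes>\<^bsub>T i\<^esub> y)"
    using i y by (simp add: mul_un E_upd un_closed)
  then show "emb i (x \<otimes>\<^bsub>T i\<^esub> y) = emb i x \<otimes>\<^bsub>TP\<^esub> emb i y"
    using x y i by (simp add: emb_pure pure_mult E_upd un_closed mul_upd)
qed

lemma emb_closed [simp]: "i \<in> I \<Longrightarrow> x \<in> carrier (T i) \<Longrightarrow> emb i x \<in> carrier TP"
  using emb_hom ring_hom_closed by metis

text \<open>Coordinates outside \<open>S\<close> are set to one, and multiplying by
  \<open>emb j (f j)\<close> fills in coordinate \<open>j\<close>. Ring homomorphisms out of the
  tensor product are therefore determined on the embedded factors.\<close>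

lemma pure_finprod_emb:
  assumes f: "f \<in> E"
  shows "pure f = finprod TP (\<lambda>i. emb i (f i)) I"
proof -
  have fi: "f i \<in> carrier (T i)" if "i \<in> I" for i using f that by (rule E_app)
  have "finite S \<Longrightarrow> S \<subseteq> I \<Longrightarrow> finprod TP (\<lambda>i. emb i (f i)) S = pure (\<lambda>i\<in>I. if i \<in> S then f i else \<one>\<^bsub>T i\<^esub>)" for S
  proof (induction S rule: finite_induct)
    case empty
    show ?case unfolding TP.finprod_empty one_TP by (rule arg_cong [of _ _ pure]) (auto simp: un_def)
  next
    case (insert j S)
    define g where "g = (\<lambda>i\<in>I. if i \<in> S then f i else \<one>\<^bsub>T i\<^esub>)"
    interpret Tj: cring "T j" using insert cringT by simp
    have j: "j \<in> I" using insert by simp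
    have g: "g \<in> E" 
      unfolding g_def E_def using fi by (auto simp: cring.cring_simprules cringT)
    have "finprod TP (\<lambda>i. emb i (f i)) (insert j S) = emb j (f j) \<otimes>\<^bsub>TP\<^esub> finprod TP (\<lambda>i. emb i (f i)) S"
      using insert fi by (intro TP.finprod_insert) auto
    also have "\<dots> = pure (un(j := f j)) \<otimes>\<^bsub>TP\<^esub> pure g"
    proof -
      have "finprod TP (\<lambda>i. emb i (f i)) S = pure g"
        unfolding g_def using insert by blast
      then show ?thesis by (simp only: emb_pure [OF j])
    qed
    also have "\<dots> = pure ((mul un g)(j := f j \<otimes>\<^bsub>T j\<^esub> g j))"
      using j fi g by (simp add: pure_mult E_upd un_closed mul_upd)
    also have "(mul un g)(j := f j \<otimes>\<^bsub>T j\<^esub> g j) = g(j := f j)"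
      using g insert j fi [OF j] by (simp add: mul_un) (simp add: g_def)
    also have "\<dots> = (\<lambda>i\<in>I. if i \<in> insert j S then f i else \<one>\<^bsub>T i\<^esub>)"
      using j by (auto simp: g_def)
    finally show ?case .
  qed
  from this [OF finI] have "finprod TP (\<lambda>i. emb i (f i)) I = pure (\<lambda>i\<in>I. if i \<in> I then f i else \<one>\<^bsub>T i\<^esub>)" by simp
  also have "(\<lambda>i\<in>I. if i \<in> I then f i else \<one>\<^bsub>T i\<^esub>) = f"
    using f by (auto simp: E_def fun_eq_iff PiE_iff extensional_def)
  finally show ?thesis by simp
qed

text \<open>The tensor product is the coproduct of commutative rings: the product of the
  \<open>q i (f i)\<close> is multiadditive in \<open>f\<close>, because each coordinate enters
  through a single factor, and multiplicative in \<open>f\<close>, because \<open>A\<close> is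
  commutative.\<close>

theorem TP_ring_hom:
  fixes A :: "('c, 'm) ring_scheme"
  assumes A: "cring A" and q: "\<And>i. i \<in> I \<Longrightarrow> q i \<in> ring_hom (T i) A"
  obtains \<Phi> where "\<Phi> \<in> ring_hom TP A" "\<And>i x. i \<in> I \<Longrightarrow> x \<in> carrier (T i) \<Longrightarrow> \<Phi> (emb i x) = q i x"
proof -
  interpret A: cring A by fact
  define m where "m f = finprod A (\<lambda>i. q i (f i)) I" for f
  have qc: "q i x \<in> carrier A" if "i \<in> I" "x \<in> carrier (T i)" for i x
    using q that ring_hom_closed by metis
  have m_closed: "m f \<in> carrier A" if "f \<in> E" for f
    unfolding m_def using that by (auto intro!: A.finprod_closed qc E_app)
  have m_split: "m f = q i (f i) \<otimes>\<^bsub>A\<^esub> finprod A (\<lambda>i. q i (f i)) (I - {i})" if "f \<in> E" "i \<in> I" for f i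
  proof -
    have "m f = finprod A (\<lambda>i. q i (f i)) (insert i (I - {i}))"
      using that by (simp add: m_def insert_absorb)
    also have "\<dots> = q i (f i) \<otimes>\<^bsub>A\<^esub> finprod A (\<lambda>i. q i (f i)) (I - {i})"
      using that finI by (intro A.finprod_insert) (auto intro!: qc E_app)
    finally show ?thesis .
  qed
  have m_upd: "m (f(i := a)) = q i a \<otimes>\<^bsub>A\<^esub> finprod A (\<lambda>i. q i (f i)) (I - {i})"
    if "f \<in> E" "i \<in> I" "a \<in> carrier (T i)" for f i a
  proof -
    have "finprod A (\<lambda>k. q k ((f(i := a)) k)) (I - {i}) = finprod A (\<lambda>i. q i (f i)) (I - {i})"
      using that by (intro A.finprod_cong) (auto intro!: qc E_app [OF that(1)] simp: simp_implies_def)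
    then show ?thesis using m_split [OF E_upd [OF that] that(2)] by simp
  qed
  have m_add: "m (f(i := a \<oplus>\<^bsub>T i\<^esub> b)) = m (f(i := a)) \<oplus>\<^bsub>A\<^esub> m (f(i := b))"
    if *: "f \<in> E" "i \<in> I" "a \<in> carrier (T i)" "b \<in> carrier (T i)" for f i a b
  proof -
    interpret Ti: cring "T i" using * cringT by simp
    have "finprod A (\<lambda>i. q i (f i)) (I - {i}) \<in> carrier A"
      using * by (auto intro!: A.finprod_closed qc E_app)
    then show ?thesis using * qc
      by (simp add: m_upd ring_hom_add [OF q] A.l_distr)
  qed
  from TP_universal [OF A.is_abelian_group m_closed m_add]
  obtain \<Phi> where \<Phi>: "\<Phi> \<in> hom (add_monoid TP) (add_monoid A)" "\<And>f. f \<in> E \<Longrightarrow> \<Phi> (pure f) = m f"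
    by blast
  note \<Phi>s = add_hom_simps [OF TP.is_abelian_group A.is_abelian_group \<Phi>(1)]
  have m_mult: "m (mul f g) = m f \<otimes>\<^bsub>A\<^esub> m g" if "f \<in> E" "g \<in> E" for f g
  proof -
    have "m (mul f g) = finprod A (\<lambda>i. q i (f i) \<otimes>\<^bsub>A\<^esub> q i (g i)) I"
      unfolding m_def using that
      by (intro A.finprod_cong) (auto simp: mul_def simp_implies_def qc E_app ring_hom_mult [OF q])
    also have "\<dots> = m f \<otimes>\<^bsub>A\<^esub> m g"
      unfolding m_def using that by (intro A.finprod_multf) (auto intro!: qc E_app)
    finally show ?thesis .
  qed
  have m_un: "m un = \<one>\<^bsub>A\<^esub>"
    unfolding m_def by (rule A.finprod_one_eqI) (simp add: un_def ring_hom_one [OF q])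
  show thesis
  proof
    show "\<Phi> \<in> ring_hom TP A"
    proof (rule ring_hom_memI)
      show "\<Phi> \<one>\<^bsub>TP\<^esub> = \<one>\<^bsub>A\<^esub>" by (simp add: one_TP \<Phi> un_closed m_un)
      fix x assume x: "x \<in> carrier TP"
      show "\<Phi> x \<in> carrier A" using x by (rule \<Phi>s)
      fix y assume y: "y \<in> carrier TP"
      show "\<Phi> (x \<oplus>\<^bsub>TP\<^esub> y) = \<Phi> x \<oplus>\<^bsub>A\<^esub> \<Phi> y" using x y by (rule \<Phi>s)
      show "\<Phi> (x \<otimes>\<^bsub>TP\<^esub> y) = \<Phi> x \<otimes>\<^bsub>A\<^esub> \<Phi> y" using x
      proof (induction x rule: TP_induct)
        case (pure f)
        show ?case using y
        proof (induction y rule: TP_induct)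
          case (pure g)
          then show ?case using \<open>f \<in> E\<close> by (simp add: pure_mult \<Phi> mul_closed m_mult)
        next
          case (diff x y)
          then show ?case using \<open>f \<in> E\<close> 
            by (simp add: TP.minus_eq A.minus_eq TP.r_distr TP.r_minus A.r_distr A.r_minus \<Phi>s)
        qed (use \<open>f \<in> E\<close> in \<open>simp add: \<Phi>s\<close>)
      next
        case (diff x x')
        then show ?case using y
          by (simp add: TP.minus_eq A.minus_eq TP.l_distr TP.l_minus A.l_distr A.l_minus \<Phi>s)
      qed (use y in \<open>simp add: \<Phi>s\<close>)
    qed
    fix i x assume ix: "i \<in> I" "x \<in> carrier (T i)"
    have "\<Phi> (emb i x) = q i x \<otimes>\<^bsub>A\<^esub> finprod A (\<lambda>i. q i (un i)) (I - {i})"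
      using ix by (simp add: emb_pure \<Phi> E_upd un_closed m_upd)
    also have "finprod A (\<lambda>i. q i (un i)) (I - {i}) = \<one>\<^bsub>A\<^esub>"
      by (rule A.finprod_one_eqI) (simp add: un_def ring_hom_one [OF q])
    finally show "\<Phi> (emb i x) = q i x" using ix qc by simp
  qed
qed

lemma TP_hom_eq:
  assumes A: "cring A" and h: "\<Phi> \<in> ring_hom TP A" "\<Psi> \<in> ring_hom TP A"
    and eq: "\<And>i x. i \<in> I \<Longrightarrow> x \<in> carrier (T i) \<Longrightarrow> \<Phi> (emb i x) = \<Psi> (emb i x)"
    and x: "x \<in> carrier TP"
  shows "\<Phi> x = \<Psi> x"
proof -
  interpret A: cring A by fact
  interpret \<Phi>: ring_hom_cring TP A \<Phi> by (rule ring_hom_cringI' [OF cring_TP A h(1)])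
  interpret \<Psi>: ring_hom_cring TP A \<Psi> by (rule ring_hom_cringI' [OF cring_TP A h(2)])
  show ?thesis using x
  proof (induction x rule: TP_induct)
    case (pure f)
    have *: "(\<lambda>i. emb i (f i)) \<in> I \<rightarrow> carrier TP" using pure by (auto simp: E_app)
    show ?case unfolding pure_finprod_emb [OF pure] \<Phi>.hom_finprod [OF *] \<Psi>.hom_finprod [OF *]
      using pure by (intro A.finprod_cong) (auto simp: simp_implies_def eq E_app)
  next
    case (diff x y)
    then show ?case by (simp add: TP.minus_eq)
  qed simp
qed

text \<open>Applying \<open>D\<close> to coordinate \<open>j\<close> of a tuple is multiadditive,
  and tuples multiply coordinatewise, so the Leibniz rule of \<open>D\<close> passes to pure tensors
  and then to sums. The other embedded factors have coordinate one at \<open>j\<close> and are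
  killed because \<open>D\<close> kills one.\<close>

theorem TP_derivation:
  assumes j: "j \<in> I" and D: "derivation (T j) D"
  obtains \<Theta> where "derivation TP \<Theta>" "\<And>x. x \<in> carrier (T j) \<Longrightarrow> \<Theta> (emb j x) = emb j (D x)"
    "\<And>i x. i \<in> I \<Longrightarrow> i \<noteq> j \<Longrightarrow> x \<in> carrier (T i) \<Longrightarrow> \<Theta> (emb i x) = \<zero>\<^bsub>TP\<^esub>"
proof -
  interpret Tj: cring "T j" using j cringT by simp
  have Dh: "D \<in> hom (add_monoid (T j)) (add_monoid (T j))"
    and DL: "\<And>x y. x \<in> carrier (T j) \<Longrightarrow> y \<in> carrier (T j) \<Longrightarrow> D (x \<otimes>\<^bsub>T j\<^esub> y) = D x \<otimes>\<^bsub>T j\<^esub> y \<oplus>\<^bsub>T j\<^esub> x \<otimes>\<^bsub>T j\<^esub> D y"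
    using D by (auto simp: derivation_def)
  note Ds = add_hom_simps [OF Tj.is_abelian_group Tj.is_abelian_group Dh]
  define m where "m f = pure (f(j := D (f j)))" for f
  have DE: "f(j := D (f j)) \<in> E" if "f \<in> E" for f
    using that j by (simp add: E_upd E_app Ds)
  have m_add: "m (f(i := a \<oplus>\<^bsub>T i\<^esub> b)) = m (f(i := a)) \<oplus>\<^bsub>TP\<^esub> m (f(i := b))"
    if *: "f \<in> E" "i \<in> I" "a \<in> carrier (T i)" "b \<in> carrier (T i)" for f i a b
  proof (cases "i = j")
    case True
    then show ?thesis using * by (simp add: m_def Ds pure_add)
  next
    case False
    then have "m (f(i := c)) = pure ((f(j := D (f j)))(i := c))" for c
      by (simp add: m_def fun_upd_twist)
    then show ?thesis using pure_add [OF DE *(2-)] * by simp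
  qed
  have "m f \<in> carrier TP" if "f \<in> E" for f using that by (simp add: m_def DE)
  from TP_universal [OF TP.is_abelian_group this m_add]
  obtain \<Theta> where \<Theta>: "\<Theta> \<in> hom (add_monoid TP) (add_monoid TP)" "\<And>f. f \<in> E \<Longrightarrow> \<Theta> (pure f) = m f"
    by blast
  note \<Theta>s = add_hom_simps [OF TP.is_abelian_group TP.is_abelian_group \<Theta>(1)]
  have L: "\<Theta> (x \<otimes>\<^bsub>TP\<^esub> y) = \<Theta> x \<otimes>\<^bsub>TP\<^esub> y \<oplus>\<^bsub>TP\<^esub> x \<otimes>\<^bsub>TP\<^esub> \<Theta> y" if x: "x \<in> carrier TP" and y: "y \<in> carrier TP" for x y
    using x
  proof (induction x rule: TP_induct)
    case (pure f)
    then have f: "f \<in> E" .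
    show ?case using y
    proof (induction y rule: TP_induct)
      case (pure g)
      then have g: "g \<in> E" .
      have c: "f j \<in> carrier (T j)" "g j \<in> carrier (T j)" using f g j by (simp_all add: E_app)
      have mulj: "mul f g j = f j \<otimes>\<^bsub>T j\<^esub> g j" using j by (simp add: mul_def)
      have "\<Theta> (pure f \<otimes>\<^bsub>TP\<^esub> pure g) = pure ((mul f g)(j := D (f j \<otimes>\<^bsub>T j\<^esub> g j)))"
        using f g by (simp add: pure_mult \<Theta> mul_closed m_def mulj)
      also have "\<dots> = pure ((mul f g)(j := D (f j) \<otimes>\<^bsub>T j\<^esub> g j)) \<oplus>\<^bsub>TP\<^esub> pure ((mul f g)(j := f j \<otimes>\<^bsub>T j\<^esub> D (g j)))"
        using f g c j by (simp add: DL pure_add mul_closed Ds)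
      also have "(mul f g)(j := D (f j) \<otimes>\<^bsub>T j\<^esub> g j) = mul (f(j := D (f j))) g"
        using j by (simp only: mul_upd)
      also have "(mul f g)(j := f j \<otimes>\<^bsub>T j\<^esub> D (g j)) = mul f (g(j := D (g j)))"
        using j by (auto simp: mul_def)
      finally show ?case using f g by (simp only: \<Theta> m_def pure_mult DE)
    next
      case (diff x y)
      then show ?case using f
        by (simp add: TP.minus_eq TP.r_distr TP.r_minus \<Theta>s TP.minus_add TP.a_ac)
    qed (use f in \<open>simp add: \<Theta>s\<close>)
  next
    case (diff x x')
    then show ?case using y
      by (simp add: TP.minus_eq TP.l_distr TP.l_minus \<Theta>s TP.minus_add TP.a_ac)
  qed (use y in \<open>simp add: \<Theta>s\<close>)
  have D1: "D \<one>\<^bsub>T j\<^esub> = \<zero>\<^bsub>T j\<^esub>" using derivation_one D Tj.is_cring by blast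
  show thesis
  proof
    show "derivation TP \<Theta>" using \<Theta>(1) L by (simp add: derivation_def)
    show "\<Theta> (emb j x) = emb j (D x)" if "x \<in> carrier (T j)" for x
      using that j by (simp add: emb_pure \<Theta> E_upd un_closed m_def)
    fix i x assume *: "i \<in> I" "i \<noteq> j" "x \<in> carrier (T i)"
    have "\<Theta> (emb i x) = pure ((un(i := x))(j := D (un j)))"
      using * by (simp add: emb_pure \<Theta> E_upd un_closed m_def)
    also have "\<dots> = \<zero>\<^bsub>TP\<^esub>"
      using * j by (intro pure_zero [of _ j]) (simp_all add: E_upd un_closed E_app Ds, simp add: un_def D1)
    finally show "\<Theta> (emb i x) = \<zero>\<^bsub>TP\<^esub>" .
  qed
qed

end

section \<open>Graded rings\<close>

lemma add_hom_int_scalar: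
  assumes "abelian_group R" "abelian_group A" "h \<in> hom (add_monoid R) (add_monoid A)" "x \<in> carrier R"
  shows "h ([(k::int)] \<cdot>\<^bsub>R\<^esub> x) = [k] \<cdot>\<^bsub>A\<^esub> h x"
proof -
  interpret h: group_hom "add_monoid R" "add_monoid A" h
    by (rule add_hom_group_hom [OF assms(1-3)])
  show ?thesis using h.hom_int_pow [of x k] assms(4) by (simp add: add_pow_def)
qed

lemma (in ring) int_scalar_mult:
  "x \<in> carrier R \<Longrightarrow> ([(k::int)] \<cdot> \<one>) \<otimes> x = [k] \<cdot> x"
  by (simp add: add_pow_ldistr_int)

lemma (in ring) int_scalar_closed [simp]: "x \<in> carrier R \<Longrightarrow> [(k::int)] \<cdot> x \<in> carrier R"
  using add.int_pow_closed by (simp add: add_pow_def)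

lemma (in ring) int_scalar_scalar:
  "x \<in> carrier R \<Longrightarrow> [(k::int)] \<cdot> ([(l::int)] \<cdot> x) = [(k * l)] \<cdot> x"
  using add.int_pow_pow [of x k l] by (simp add: add_pow_def mult.commute)

lemma (in ring) int_scalar_add:
  "x \<in> carrier R \<Longrightarrow> [((k::int) + l)] \<cdot> x = [k] \<cdot> x \<oplus> [l] \<cdot> x"
  using add.int_pow_mult [of x k l] by (simp add: add_pow_def)

lemma (in ring) int_scalar_one [simp]: "x \<in> carrier R \<Longrightarrow> [(1::int)] \<cdot> x = x"
  using add.int_pow_1 [of x] by (simp add: add_pow_def)

lemma (in abelian_group) int_scalar_0 [simp]: "[(0::int)] \<cdot> x = \<zero>"
  by (simp add: add_pow_def int_pow_def)

lemma (in ring) nat_scalar_add: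
  "x \<in> carrier R \<Longrightarrow> [((k::nat) + l)] \<cdot> x = [k] \<cdot> x \<oplus> [l] \<cdot> x"
  using add.nat_pow_mult [of x k l] by (simp add: add_pow_def)

lemma (in abelian_group) nat_scalar_distr:
  "x \<in> carrier G \<Longrightarrow> y \<in> carrier G \<Longrightarrow> [(k::nat)] \<cdot> (x \<oplus> y) = [k] \<cdot> x \<oplus> [k] \<cdot> y"
  using add.nat_pow_distrib [of x y k] by (simp add: add_pow_def)

lemma (in abelian_group) nat_scalar_closed:
  "x \<in> carrier G \<Longrightarrow> [(k::nat)] \<cdot> x \<in> carrier G"
  using add.nat_pow_closed by (simp add: add_pow_def)

lemma ring_hom_int:
  assumes "cring R" "cring A" "h \<in> ring_hom R A"
  shows "h ([(k::int)] \<cdot>\<^bsub>R\<^esub> \<one>\<^bsub>R\<^esub>) = [k] \<cdot>\<^bsub>A\<^esub> \<one>\<^bsub>A\<^esub>"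
proof -
  interpret R: cring R by fact
  show ?thesis
    using add_hom_int_scalar [OF cring_abelian cring_abelian ring_hom_add_hom] assms R.one_closed
    by (metis ring_hom_one)
qed

lemma (in abelian_group) finsum_supp:
  assumes "finite S" "{d. f d \<noteq> \<zero>} \<subseteq> S" "\<And>d. f d \<in> carrier G"
  shows "(\<Oplus>d\<in>{d. f d \<noteq> \<zero>}. f d) = (\<Oplus>d\<in>S. f d)"
  using assms by (intro add.finprod_mono_neutral_cong_left) auto

text \<open>Additive projections give one decomposition of each element; it is unique because
  applying \<open>pr e\<close> to any other decomposition isolates its term of degree
  \<open>e\<close>.\<close>

lemma direct_sumI:
  fixes R :: "'a graded_ring"
  assumes R: "abelian_group R" and sub: "\<And>d. subgroup (homog R d) (add_monoid R)"
    and pr: "\<And>d. pr d \<in> hom (add_monoid R) (add_monoid R)"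
    and pr_homog: "\<And>d x. x \<in> carrier R \<Longrightarrow> pr d x \<in> homog R d"
    and fin: "\<And>x. x \<in> carrier R \<Longrightarrow> finite {d. pr d x \<noteq> \<zero>\<^bsub>R\<^esub>}"
    and sum: "\<And>x. x \<in> carrier R \<Longrightarrow> x = (\<Oplus>\<^bsub>R\<^esub>d\<in>{d. pr d x \<noteq> \<zero>\<^bsub>R\<^esub>}. pr d x)"
    and pr_id: "\<And>d e x. x \<in> homog R d \<Longrightarrow> pr e x = (if e = d then x else \<zero>\<^bsub>R\<^esub>)"
  shows "direct_sum_of_homog R"
proof -
  interpret R: abelian_group R by fact
  have hc: "x \<in> carrier R" if "x \<in> homog R d" for x d
    using subgroup.subset [OF sub] that by auto
  have uniq: "f = (\<lambda>d. pr d x)" 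
    if f: "\<forall>d. f d \<in> homog R d" "finite {d. f d \<noteq> \<zero>\<^bsub>R\<^esub>}" "x = (\<Oplus>\<^bsub>R\<^esub>d\<in>{d. f d \<noteq> \<zero>\<^bsub>R\<^esub>}. f d)" for x f
  proof
    fix e
    have fc: "f d \<in> carrier R" for d using f hc by blast
    have pref: "pr e (f d) = (if e = d then f d else \<zero>\<^bsub>R\<^esub>)" for d
      by (rule pr_id) (use f in blast)
    have "pr e x = (\<Oplus>\<^bsub>R\<^esub>d\<in>{d. f d \<noteq> \<zero>\<^bsub>R\<^esub>}. pr e (f d))"
      unfolding f(3) using fc by (intro add_hom_finsum [OF R R pr]) auto
    also have "\<dots> = (\<Oplus>\<^bsub>R\<^esub>d\<in>insert e {d. f d \<noteq> \<zero>\<^bsub>R\<^esub>}. if d = e then f e else \<zero>\<^bsub>R\<^esub>)"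
      using f fc by (intro R.add.finprod_mono_neutral_cong_left) (auto simp: pref)
    also have "\<dots> = f e"
      using R.add.finprod_singleton_swap [of e "insert e {d. f d \<noteq> \<zero>\<^bsub>R\<^esub>}" "\<lambda>_. f e"] f(2) fc by simp
    finally show "f e = pr e x" by simp
  qed
  show ?thesis
    unfolding direct_sum_of_homog_def
  proof (intro conjI allI ballI sub)
    fix x assume x: "x \<in> carrier R"
    show "\<exists>!f. (\<forall>d. f d \<in> homog R d) \<and> finite {d. f d \<noteq> \<zero>\<^bsub>R\<^esub>} \<and> x = (\<Oplus>\<^bsub>R\<^esub>d\<in>{d. f d \<noteq> \<zero>\<^bsub>R\<^esub>}. f d)"
    proof (rule ex1I [of _ "\<lambda>d. pr d x"])
      show "(\<forall>d. pr d x \<in> homog R d) \<and> finite {d. pr d x \<noteq> \<zero>\<^bsub>R\<^esub>} \<and> x = (\<Oplus>\<^bsub>R\<^esub>d\<in>{d. pr d x \<noteq> \<zero>\<^bsub>R\<^esub>}. pr d x)"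
        using pr_homog fin sum x by blast
    qed (use uniq in blast)
  qed
qed

text \<open>A multiplicative grading whose components need not form a direct sum. Only this is
  established directly for tensor products, and \<open>graded_hom\<close> allows such
  targets.\<close>

locale pregraded_cring = cring R for R :: "'a graded_ring" (structure) +
  assumes homog_subgroup: "\<And>d. subgroup (homog R d) (add_monoid R)"
    and homog_mult: "\<And>x y d e. x \<in> homog R d \<Longrightarrow> y \<in> homog R e \<Longrightarrow> x \<otimes> y \<in> homog R (d + e)"
begin

lemma homog_carrier: "x \<in> homog R d \<Longrightarrow> x \<in> carrier R"
  using subgroup.subset [OF homog_subgroup] by auto

lemma homog_zero [simp]: "\<zero> \<in> homog R d"
  using subgroup.one_closed [OF homog_subgroup] by auto

lemma homog_add: "x \<in> homog R d \<Longrightarrow> y \<in> homog R d \<Longrightarrow> x \<oplus> y \<in> homog R d"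
  using subgroup.m_closed [OF homog_subgroup] by auto

lemma homog_inv: "x \<in> homog R d \<Longrightarrow> \<ominus> x \<in> homog R d"
  using subgroup.m_inv_closed [OF homog_subgroup] by (auto simp: a_inv_def)

lemma homog_finsum: "(\<And>i. i \<in> S \<Longrightarrow> f i \<in> homog R d) \<Longrightarrow> finsum R f S \<in> homog R d"
proof (induction S rule: infinite_finite_induct)
  case (insert x S)
  then have "f \<in> S \<rightarrow> carrier R" "f x \<in> carrier R" using homog_carrier by auto
  then show ?case using insert by (simp add: finsum_insert homog_add)
qed simp_all

end

locale graded_cring = pregraded_cring +
  assumes dir: "direct_sum_of_homog R"
begin

definition decomp :: "'a \<Rightarrow> nat \<Rightarrow> 'a" where
  "decomp x = (THE f. (\<forall>d. f d \<in> homog R d) \<and> finite {d. f d \<noteq> \<zero>} \<and> x = (\<Oplus>d\<in>{d. f d \<noteq> \<zero>}. f d))"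

lemma decomp:
  assumes "x \<in> carrier R"
  shows "decomp x d \<in> homog R d" "finite {d. decomp x d \<noteq> \<zero>}" "(\<Oplus>d\<in>{d. decomp x d \<noteq> \<zero>}. decomp x d) = x"
proof -
  have "\<exists>!f. (\<forall>d. f d \<in> homog R d) \<and> finite {d. f d \<noteq> \<zero>} \<and> x = (\<Oplus>d\<in>{d. f d \<noteq> \<zero>}. f d)"
    using dir assms by (simp add: direct_sum_of_homog_def)
  from theI' [OF this] show "decomp x d \<in> homog R d" "finite {d. decomp x d \<noteq> \<zero>}" "(\<Oplus>d\<in>{d. decomp x d \<noteq> \<zero>}. decomp x d) = x"
    unfolding decomp_def by simp_all
qed

lemma decomp_eqI:
  assumes "\<And>d. f d \<in> homog R d" "finite S" "\<And>d. d \<notin> S \<Longrightarrow> f d = \<zero>" "x = (\<Oplus>d\<in>S. f d)"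
  shows "decomp x = f"
proof -
  have fc: "f d \<in> carrier R" for d using assms homog_carrier by blast
  then have xc: "x \<in> carrier R" unfolding assms(4) by (intro finsum_closed) auto
  have sup: "{d. f d \<noteq> \<zero>} \<subseteq> S" using assms(3) by auto
  have "x = (\<Oplus>d\<in>{d. f d \<noteq> \<zero>}. f d)"
    using finsum_supp [OF assms(2) sup fc] assms(4) by simp
  moreover have "\<exists>!f. (\<forall>d. f d \<in> homog R d) \<and> finite {d. f d \<noteq> \<zero>} \<and> x = (\<Oplus>d\<in>{d. f d \<noteq> \<zero>}. f d)"
    using dir xc by (simp add: direct_sum_of_homog_def)
  ultimately show ?thesis
    unfolding decomp_def using assms(1) finite_subset [OF sup assms(2)] by (intro the1_equality) simp_all
qed

lemma decomp_add:
  assumes "x \<in> carrier R" "y \<in> carrier R"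
  shows "decomp (x \<oplus> y) = (\<lambda>d. decomp x d \<oplus> decomp y d)"
proof -
  define S where "S = {d. decomp x d \<noteq> \<zero>} \<union> {d. decomp y d \<noteq> \<zero>}"
  have S: "finite S" "{d. decomp x d \<noteq> \<zero>} \<subseteq> S" "{d. decomp y d \<noteq> \<zero>} \<subseteq> S"
    using decomp assms by (auto simp: S_def)
  have c: "decomp x d \<in> carrier R" "decomp y d \<in> carrier R" for d
    using decomp(1) assms homog_carrier by blast+
  have "x = (\<Oplus>d\<in>S. decomp x d)" "y = (\<Oplus>d\<in>S. decomp y d)"
    using finsum_supp [OF S(1,2) c(1)] finsum_supp [OF S(1,3) c(2)] decomp(3) assms by simp_all
  then have "x \<oplus> y = (\<Oplus>d\<in>S. decomp x d \<oplus> decomp y d)"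
    using c by (subst finsum_addf) auto
  then show ?thesis
    using S decomp(1) assms by (intro decomp_eqI [of _ S]) (auto simp: homog_add S_def)
qed

lemma decomp_homog:
  assumes "x \<in> homog R d"
  shows "decomp x = (\<lambda>e. if e = d then x else \<zero>)"
  using assms homog_carrier [OF assms] by (intro decomp_eqI [of _ "{d}"]) auto

text \<open>Additive maps given degree by degree glue to one additive map by directness of the sum.
  The Euler derivation and the augmentation both arise this way.\<close>

lemma graded_extend:
  assumes A: "abelian_group A"
    and \<theta>: "\<And>d x. x \<in> homog R d \<Longrightarrow> \<theta> d x \<in> carrier A"
    and \<theta>_add: "\<And>d x y. x \<in> homog R d \<Longrightarrow> y \<in> homog R d \<Longrightarrow> \<theta> d (x \<oplus> y) = \<theta> d x \<oplus>\<^bsub>A\<^esub> \<theta> d y"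
  obtains \<Theta> where "\<Theta> \<in> hom (add_monoid R) (add_monoid A)" "\<And>d x. x \<in> homog R d \<Longrightarrow> \<Theta> x = \<theta> d x"
proof -
  interpret A: abelian_group A by fact
  have \<theta>0: "\<theta> d \<zero> = \<zero>\<^bsub>A\<^esub>" for d
  proof (rule A.additive_zero)
    show "\<theta> d \<zero> = \<theta> d \<zero> \<oplus>\<^bsub>A\<^esub> \<theta> d \<zero>" using \<theta>_add [of \<zero> d \<zero>] by simp
  qed (simp add: \<theta>)
  define \<Theta> where "\<Theta> x = (\<Oplus>\<^bsub>A\<^esub>d\<in>{d. decomp x d \<noteq> \<zero>}. \<theta> d (decomp x d))" for x
  have c: "\<theta> d (decomp x d) \<in> carrier A" if "x \<in> carrier R" for x d
    using that decomp(1) \<theta> by blast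
  have \<Theta>_eq: "\<Theta> x = (\<Oplus>\<^bsub>A\<^esub>d\<in>S. \<theta> d (decomp x d))" if "x \<in> carrier R" "finite S" "{d. decomp x d \<noteq> \<zero>} \<subseteq> S" for x S
    unfolding \<Theta>_def using that c by (intro A.add.finprod_mono_neutral_cong_left) (auto simp: \<theta>0)
  show thesis
  proof
    show "\<Theta> \<in> hom (add_monoid R) (add_monoid A)"
    proof (rule homI)
      fix x assume "x \<in> carrier (add_monoid R)"
      then have x: "x \<in> carrier R" by simp
      then show "\<Theta> x \<in> carrier (add_monoid A)"
        unfolding \<Theta>_def using c by (simp add: A.finsum_closed)
      fix y assume "y \<in> carrier (add_monoid R)"
      then have y: "y \<in> carrier R" by simp
      define S where "S = {d. decomp x d \<noteq> \<zero>} \<union> {d. decomp y d \<noteq> \<zero>}"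
      have S: "finite S" "{d. decomp x d \<noteq> \<zero>} \<subseteq> S" "{d. decomp y d \<noteq> \<zero>} \<subseteq> S"
        using decomp x y by (auto simp: S_def)
      have "{d. decomp (x \<oplus> y) d \<noteq> \<zero>} \<subseteq> S"
        using x y by (auto simp: decomp_add S_def)
      then have "\<Theta> (x \<oplus> y) = (\<Oplus>\<^bsub>A\<^esub>d\<in>S. \<theta> d (decomp x d) \<oplus>\<^bsub>A\<^esub> \<theta> d (decomp y d))"
        using x y S c decomp(1)
        by (subst \<Theta>_eq) (auto simp: decomp_add \<theta>_add simp_implies_def intro!: A.finsum_cong)
      also have "\<dots> = \<Theta> x \<oplus>\<^bsub>A\<^esub> \<Theta> y"
        using x y S c by (simp add: \<Theta>_eq A.finsum_addf)
      finally show "\<Theta> (x \<otimes>\<^bsub>add_monoid R\<^esub> y) = \<Theta> x \<otimes>\<^bsub>add_monoid A\<^esub> \<Theta> y" by simp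
    qed
    fix d x assume x: "x \<in> homog R d"
    then have "\<Theta> x = (\<Oplus>\<^bsub>A\<^esub>e\<in>{d}. \<theta> e (decomp x e))"
      using homog_carrier by (intro \<Theta>_eq) (auto simp: decomp_homog)
    then show "\<Theta> x = \<theta> d x" using x \<theta> by (simp add: decomp_homog)
  qed
qed

lemma homog_induct [consumes 1, case_names homog add]:
  assumes "x \<in> carrier R" and "\<And>x d. x \<in> homog R d \<Longrightarrow> Q x"
    and add: "\<And>x y. x \<in> carrier R \<Longrightarrow> y \<in> carrier R \<Longrightarrow> Q x \<Longrightarrow> Q y \<Longrightarrow> Q (x \<oplus> y)"
  shows "Q x"
proof -
  have "finite S \<Longrightarrow> Q (\<Oplus>d\<in>S. decomp x d)" for S
  proof (induction S rule: finite_induct)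
    case empty
    show ?case using assms(2) [OF homog_zero] by simp
  next
    case (insert d S)
    have c: "decomp x e \<in> carrier R" for e using assms(1) decomp homog_carrier by blast
    then show ?case using insert assms(2) [OF decomp(1) [OF assms(1)]]
      by (simp add: finsum_insert add)
  qed
  then show ?thesis using decomp [OF assms(1)] by metis
qed

text \<open>The coordinate maps in the form that \<open>direct_sumI\<close> takes as input, so that
  directness of a grading can be carried along an isomorphism.\<close>

lemma projections:
  obtains pr where "\<And>d. pr d \<in> hom (add_monoid R) (add_monoid R)"
    "\<And>d e x. x \<in> homog R d \<Longrightarrow> pr e x = (if e = d then x else \<zero>)"
    "\<And>x d. x \<in> carrier R \<Longrightarrow> pr d x \<in> homog R d"
    "\<And>x. x \<in> carrier R \<Longrightarrow> finite {d. pr d x \<noteq> \<zero>}"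
    "\<And>x. x \<in> carrier R \<Longrightarrow> x = (\<Oplus>d\<in>{d. pr d x \<noteq> \<zero>}. pr d x)"
proof
  show "(\<lambda>x. decomp x d) \<in> hom (add_monoid R) (add_monoid R)" for d
    using homog_carrier [OF decomp(1)] by (auto intro!: homI simp: decomp_add)
  show "x \<in> carrier R \<Longrightarrow> x = (\<Oplus>d\<in>{d. decomp x d \<noteq> \<zero>}. decomp x d)" for x
    by (rule decomp(3) [symmetric])
qed (simp add: decomp_homog, (erule decomp)+)

text \<open>Multiplying degree \<open>d\<close> by \<open>d\<close> obeys the Leibniz rule because
  degrees add under multiplication.\<close>

lemma euler_derivation:
  obtains D where "derivation R D" "\<And>x. x \<in> homog R 1 \<Longrightarrow> D x = x"
proof -
  obtain D where D: "D \<in> hom (add_monoid R) (add_monoid R)" "\<And>d x. x \<in> homog R d \<Longrightarrow> D x = [d] \<cdot> x"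
    using graded_extend [OF is_abelian_group, of "\<lambda>d x. [d] \<cdot> x"] homog_carrier
    by (auto simp: nat_scalar_distr nat_scalar_closed)
  note Ds = add_hom_simps [OF is_abelian_group is_abelian_group D(1)]
  have "D (x \<otimes> y) = D x \<otimes> y \<oplus> x \<otimes> D y" if x: "x \<in> carrier R" and y: "y \<in> carrier R" for x y
    using x
  proof (induction x rule: homog_induct)
    case (homog x d)
    note x = this
    then have xc: "x \<in> carrier R" by (rule homog_carrier)
    show ?case using y
    proof (induction y rule: homog_induct)
      case (homog y e)
      note y = this
      then have yc: "y \<in> carrier R" by (rule homog_carrier)
      show ?case using D(2) [OF homog_mult [OF x y]] D(2) [OF x] D(2) [OF y] xc yc
        by (simp add: add_pow_ldistr add_pow_rdistr nat_scalar_add)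
    qed (use xc in \<open>simp add: r_distr Ds a_ac\<close>)
  qed (use y in \<open>simp add: l_distr Ds a_ac\<close>)
  then have "derivation R D" using D(1) by (simp add: derivation_def)
  moreover have "D x = x" if "x \<in> homog R 1" for x
    using D(2) [OF that] homog_carrier [OF that] nat_scalar_add [of x 1 0] by (simp add: add_pow_def)
  ultimately show thesis by (rule that)
qed

end

section \<open>Standard graded rings\<close>

locale std_graded = graded_cring +
  assumes free: "\<And>d. free_homog R d"
    and homog0: "bij_betw (\<lambda>k::int. [k] \<cdot> \<one>) UNIV (homog R 0)"
    and gen: "carrier R = generate_ring R (homog R 0 \<union> homog R 1)"

lemma std_graded_iff: "std_graded R \<longleftrightarrow> standard_graded R"
  unfolding std_graded_def std_graded_axioms_def graded_cring_def graded_cring_axioms_def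
    pregraded_cring_def pregraded_cring_axioms_def standard_graded_def direct_sum_of_homog_def
  by blast

context std_graded begin

lemma one_homog: "\<one> \<in> homog R 0"
proof -
  have "[(1::int)] \<cdot> \<one> \<in> homog R 0" using homog0 bij_betw_apply by fastforce
  then show ?thesis by simp
qed

lemma homog0E: assumes "x \<in> homog R 0" obtains k :: int where "x = [k] \<cdot> \<one>"
  using homog0 assms unfolding bij_betw_def by auto

lemma std_induct [consumes 1, case_names int homog1 add mult]:
  assumes "x \<in> carrier R" "\<And>k::int. Q ([k] \<cdot> \<one>)" "\<And>x. x \<in> homog R 1 \<Longrightarrow> Q x"
    and add: "\<And>x y. x \<in> carrier R \<Longrightarrow> y \<in> carrier R \<Longrightarrow> Q x \<Longrightarrow> Q y \<Longrightarrow> Q (x \<oplus> y)"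
    and mult: "\<And>x y. x \<in> carrier R \<Longrightarrow> y \<in> carrier R \<Longrightarrow> Q x \<Longrightarrow> Q y \<Longrightarrow> Q (x \<otimes> y)"
  shows "Q x"
proof -
  have sub: "homog R 0 \<union> homog R 1 \<subseteq> carrier R" using homog_carrier by blast
  have "x \<in> generate_ring R (homog R 0 \<union> homog R 1)" using assms(1) gen by simp
  then have "x \<in> carrier R \<and> Q x"
  proof induction
    case one
    show ?case using assms(2) [of 1] by simp
  next
    case (incl h)
    then show ?case using sub assms(2,3) by (auto elim: homog0E)
  next
    case (a_inv h)
    \<comment> \<open>Negation is multiplication by the integer -1, so the cases for integers and
      products cover it.\<close>
    then have "\<ominus> h = ([(-1::int)] \<cdot> \<one>) \<otimes> h"
      using int_scalar_mult [of h "-1"] add.int_pow_neg [of h 1] add.int_pow_1 [of h]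
      by (simp add: add_pow_def a_inv_def)
    then show ?case using a_inv mult [of "[(-1::int)] \<cdot> \<one>" h] assms(2) by simp
  qed (use add mult in auto)
  then show ?thesis ..
qed

lemma hom_eq:
  assumes "cring A" "h \<in> ring_hom R A" "g \<in> ring_hom R A" "\<And>x. x \<in> homog R 1 \<Longrightarrow> h x = g x" "x \<in> carrier R"
  shows "h x = g x"
  using assms(5)
proof (induction x rule: std_induct)
  case (int k)
  show ?case using ring_hom_int [OF is_cring assms(1)] assms(2,3) by metis
next
  case (add x y)
  then show ?case using ring_hom_add [OF assms(2)] ring_hom_add [OF assms(3)] by simp
next
  case (mult x y)
  then show ?case using ring_hom_mult [OF assms(2)] ring_hom_mult [OF assms(3)] by simp
qed (use assms in auto)

text \<open>Positive degrees go to zero, and degree 0, a copy of the integers, goes to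
  \<open>A\<close> in the only possible way; this respects products because degrees add. It serves
  to collapse all factors of a tensor product but one.\<close>

lemma augmentation:
  fixes A :: "('c, 'm) ring_scheme"
  assumes A: "cring A"
  obtains a where "a \<in> ring_hom R A" "\<And>x. x \<in> homog R 1 \<Longrightarrow> a x = \<zero>\<^bsub>A\<^esub>"
proof -
  interpret A: cring A by fact
  define \<theta> where "\<theta> d x = (if d = 0 then [the_inv_into UNIV (\<lambda>k::int. [k] \<cdot> \<one>) x] \<cdot>\<^bsub>A\<^esub> \<one>\<^bsub>A\<^esub> else \<zero>\<^bsub>A\<^esub>)" for d :: nat and x
  have \<theta>0: "\<theta> 0 ([k] \<cdot> \<one>) = [k] \<cdot>\<^bsub>A\<^esub> \<one>\<^bsub>A\<^esub>" for k :: int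
    using homog0 the_inv_f_f [of "\<lambda>k::int. [k] \<cdot> \<one>" k] unfolding \<theta>_def bij_betw_def by simp
  have \<theta>d: "d \<noteq> 0 \<Longrightarrow> \<theta> d x = \<zero>\<^bsub>A\<^esub>" for d x by (simp add: \<theta>_def)
  have "\<theta> d x \<in> carrier A" for d x by (simp add: \<theta>_def)
  moreover have "\<theta> d (x \<oplus> y) = \<theta> d x \<oplus>\<^bsub>A\<^esub> \<theta> d y" if "x \<in> homog R d" "y \<in> homog R d" for d x y
  proof (cases "d = 0")
    case True
    with that obtain k l :: int where "x = [k] \<cdot> \<one>" "y = [l] \<cdot> \<one>" using homog0E by metis
    then show ?thesis using True \<theta>0 [of "k + l"] by (simp add: int_scalar_add A.int_scalar_add \<theta>0)
  qed (simp add: \<theta>d)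
  ultimately obtain a where a: "a \<in> hom (add_monoid R) (add_monoid A)" "\<And>d x. x \<in> homog R d \<Longrightarrow> a x = \<theta> d x"
    using graded_extend [OF A.is_abelian_group, of \<theta>] by blast
  note as = add_hom_simps [OF is_abelian_group A.is_abelian_group a(1)]
  have a0: "a ([k] \<cdot> \<one>) = [k] \<cdot>\<^bsub>A\<^esub> \<one>\<^bsub>A\<^esub>" for k :: int
    using a(2) homog0 \<theta>0 by (metis UNIV_I bij_betw_apply)
  have ad: "a x = \<zero>\<^bsub>A\<^esub>" if "x \<in> homog R d" "d \<noteq> 0" for x d
    using a(2) that \<theta>d by simp
  have m: "a (x \<otimes> y) = a x \<otimes>\<^bsub>A\<^esub> a y" if x: "x \<in> carrier R" and y: "y \<in> carrier R" for x y
    using x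
  proof (induction x rule: homog_induct)
    case (homog x d)
    note x = this
    then have xc: "x \<in> carrier R" by (rule homog_carrier)
    show ?case using y
    proof (induction y rule: homog_induct)
      case (homog y e)
      note y = this
      then have yc: "y \<in> carrier R" by (rule homog_carrier)
      show ?case
      proof (cases "d = 0 \<and> e = 0")
        case True
        then obtain k l :: int where kl: "x = [k] \<cdot> \<one>" "y = [l] \<cdot> \<one>"
          using x y homog0E by metis
        then have "x \<otimes> y = [(k * l)] \<cdot> \<one>" by (simp add: int_scalar_mult int_scalar_scalar)
        then show ?thesis using kl by (simp add: a0 A.int_scalar_mult A.int_scalar_scalar)
      next
        case False
        then have "a x = \<zero>\<^bsub>A\<^esub> \<or> a y = \<zero>\<^bsub>A\<^esub>" using ad x y by blast
        moreover have "a (x \<otimes> y) = \<zero>\<^bsub>A\<^esub>" using ad [OF homog_mult [OF x y]] False by simp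
        ultimately show ?thesis using as(1) xc yc by auto
      qed
    qed (use xc in \<open>simp add: r_distr A.r_distr as\<close>)
  qed (use y in \<open>simp add: l_distr A.l_distr as\<close>)
  have "a \<in> ring_hom R A"
    using a0 [of 1] by (intro ring_hom_memI) (simp_all add: as m)
  then show thesis by (rule that) (use ad in auto)
qed

text \<open>A ring generated by degrees 0 and 1 with nothing in degree 1 coincides with its degree
  0.\<close>

lemma trivial_if_homog1_trivial:
  assumes "homog R 1 \<subseteq> {\<zero>}"
  shows "\<Z> \<simeq> R"
proof -
  have "x \<in> homog R 0" if "x \<in> carrier R" for x
    using that
  proof (induction x rule: std_induct)
    case (int k)
    then show ?case using homog0 by (auto dest: bij_betw_apply)
  next
    case (homog1 x)
    then have "x = \<zero>" using assms by auto
    then show ?case by simp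
  next
    case (mult x y)
    then show ?case using homog_mult [of x 0 y 0] by simp
  qed (simp_all add: homog_add)
  then have c: "carrier R = homog R 0" using homog_carrier by blast
  have "(\<lambda>k::int. [k] \<cdot> \<one>) \<in> ring_iso \<Z> R"
    using homog0 [folded c] by (intro ring_iso_memI) (simp_all add: int_scalar_mult int_scalar_scalar int_scalar_add)
  then show ?thesis unfolding is_ring_iso_def by auto
qed

text \<open>A homomorphism from the integers has its image in degree 0, so it misses every nonzero
  element of degree 1.\<close>

lemma not_int_if_homog1:
  assumes x: "x \<in> homog R 1" "x \<noteq> \<zero>"
  shows "\<not> \<Z> \<simeq> R"
proof
  assume "\<Z> \<simeq> R"
  then obtain h where h: "h \<in> ring_hom \<Z> R" "bij_betw h UNIV (carrier R)"
    unfolding is_ring_iso_def ring_iso_def by auto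
  have hk: "h k = [k] \<cdot> \<one>" for k
  proof -
    have k: "[k] \<cdot>\<^bsub>\<Z>\<^esub> \<one>\<^bsub>\<Z>\<^esub> = k"
    proof (induction k rule: int_induct [where k = 0])
      case base
      show ?case by (simp add: add_pow_def int_pow_def)
    next
      case (step1 i)
      show ?case using ring.int_scalar_add [OF cring.axioms(1) [OF int_is_cring], of 1 i 1] ring.int_scalar_one [OF cring.axioms(1) [OF int_is_cring], of 1] step1 by simp
    next
      case (step2 i)
      show ?case using ring.int_scalar_add [OF cring.axioms(1) [OF int_is_cring], of 1 "i - 1" 1] ring.int_scalar_one [OF cring.axioms(1) [OF int_is_cring], of 1] step2 by simp
    qed
    show ?thesis using ring_hom_int [OF int_is_cring is_cring h(1), of k] unfolding k .
  qed
  have "x \<in> carrier R" using x homog_carrier by blast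
  then obtain k where "x = h k" using h(2) unfolding bij_betw_def by blast
  then have "x = [k] \<cdot> \<one>" using hk by simp
  then have "x \<in> homog R 0" using homog0 by (auto dest: bij_betw_apply)
  then have "decomp x 1 = \<zero>" by (simp add: decomp_homog)
  then show False using x by (simp add: decomp_homog)
qed

text \<open>The elements of degree \<open>d\<close> that \<open>\<alpha>\<close> maps to degree \<open>d\<close> span a subring.\<close>

lemma graded_hom:
  fixes A :: "'c graded_ring"
  assumes A: "pregraded_cring A" "\<one>\<^bsub>A\<^esub> \<in> homog A 0" and \<alpha>: "\<alpha> \<in> ring_hom R A" "\<And>x. x \<in> homog R 1 \<Longrightarrow> \<alpha> x \<in> homog A 1"
    and x: "x \<in> homog R d"
  shows "\<alpha> x \<in> homog A d"
proof -
  interpret A: pregraded_cring A by fact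
  interpret \<alpha>: ring_hom_cring R A \<alpha> by (rule ring_hom_cringI' [OF is_cring A.is_cring \<alpha>(1)])
  \<comment> \<open>\<open>V\<close> is closed under products, so its additive span \<open>W\<close>
    is closed under products as well; \<open>W\<close> contains the generators of degrees 0 and 1,
    hence everything.\<close>
  define V where "V = (\<Union>d. {x \<in> homog R d. \<alpha> x \<in> homog A d})"
  have Vc: "V \<subseteq> carrier R" unfolding V_def using homog_carrier by auto
  have Vm: "v \<otimes> w \<in> V" if vw: "v \<in> V" "w \<in> V" for v w
  proof -
    obtain d e where "v \<in> homog R d" "\<alpha> v \<in> homog A d" "w \<in> homog R e" "\<alpha> w \<in> homog A e"
      using vw unfolding V_def by blast
    then have "v \<otimes> w \<in> homog R (d + e)" "\<alpha> (v \<otimes> w) \<in> homog A (d + e)"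
      using homog_mult A.homog_mult homog_carrier by simp_all
    then show ?thesis unfolding V_def by blast
  qed
  define W where "W = generate (add_monoid R) V"
  have Wadd: "v \<oplus> w \<in> W" if "v \<in> W" "w \<in> W" for v w
    using that generate.eng [of v "add_monoid R" V w] unfolding W_def by simp
  have Winv: "\<ominus> v \<in> W" if "v \<in> W" for v
    using add.generate_m_inv_closed [of V v] that Vc unfolding W_def by (simp add: a_inv_def)
  have V_W: "v \<in> W" if "v \<in> V" for v
    unfolding W_def using generate.incl that by fastforce
  have W0: "\<zero> \<in> W"
    unfolding W_def using generate.one [of "add_monoid R" V] by simp
  have Wc: "v \<in> carrier R" if "v \<in> W" for v
    using add.generate_in_carrier [of V v] Vc that unfolding W_def by simp
  have Wind: "Q v" if "v \<in> W" "Q \<zero>" "\<And>v. v \<in> V \<Longrightarrow> Q v" "\<And>v. v \<in> V \<Longrightarrow> Q (\<ominus> v)"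
    "\<And>v w. v \<in> W \<Longrightarrow> w \<in> W \<Longrightarrow> Q v \<Longrightarrow> Q w \<Longrightarrow> Q (v \<oplus> w)" for v Q
    using that(1) unfolding W_def
  proof induction
    case (eng h1 h2)
    then show ?case using that(5) unfolding W_def by simp
  qed (use that(2-4) in \<open>auto simp: a_inv_def\<close>)
  have VW: "v \<otimes> w \<in> W" if "v \<in> V" "w \<in> W" for v w
  proof (rule Wind [OF that(2)])
    have vc: "v \<in> carrier R" using that Vc by auto
    then show "v \<otimes> \<zero> \<in> W" by (simp add: W0)
    show "v \<otimes> w \<in> W" if "w \<in> V" for w using Vm V_W \<open>v \<in> V\<close> that by blast
    show "v \<otimes> \<ominus> w \<in> W" if "w \<in> V" for w
      using Vm [OF \<open>v \<in> V\<close> that] V_W Winv vc Vc that by (simp add: r_minus subsetD)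
    show "v \<otimes> (w \<oplus> w') \<in> W" if "w \<in> W" "w' \<in> W" "v \<otimes> w \<in> W" "v \<otimes> w' \<in> W" for w w'
      using that Wc vc by (simp add: r_distr Wadd)
  qed
  have WW: "v \<otimes> w \<in> W" if "v \<in> W" "w \<in> W" for v w
  proof (rule Wind [OF that(1)])
    have wc: "w \<in> carrier R" using that Wc by auto
    then show "\<zero> \<otimes> w \<in> W" by (simp add: W0)
    show "v \<otimes> w \<in> W" if "v \<in> V" for v using VW \<open>w \<in> W\<close> that by blast
    show "\<ominus> v \<otimes> w \<in> W" if "v \<in> V" for v
      using VW [OF that \<open>w \<in> W\<close>] Winv wc Vc that by (simp add: l_minus subsetD)
    show "(v \<oplus> v') \<otimes> w \<in> W" if "v \<in> W" "v' \<in> W" "v \<otimes> w \<in> W" "v' \<otimes> w \<in> W" for v v'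
      using that Wc wc by (simp add: l_distr Wadd)
  qed
  have "x \<in> W" if "x \<in> carrier R" for x
    using that
  proof (induction x rule: std_induct)
    case (int k)
    have "[k] \<cdot> \<one> \<in> homog R 0" using homog0 by (auto dest: bij_betw_apply)
    moreover have "[k] \<cdot>\<^bsub>A\<^esub> \<one>\<^bsub>A\<^esub> \<in> homog A 0"
      using group.int_pow_closed [OF subgroup.subgroup_is_group [OF A.homog_subgroup A.add.is_group]] A(2)
        A.add.int_pow_consistent [OF A.homog_subgroup] by (simp add: add_pow_def)
    ultimately show ?case using ring_hom_int [OF is_cring A.is_cring \<alpha>(1), of k]
      by (intro V_W) (auto simp: V_def)
  next
    case (homog1 x)
    then show ?case using \<alpha>(2) by (intro V_W) (auto simp: V_def)
  qed (use Wadd WW in auto)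
  then have "x \<in> W" using x homog_carrier by blast
  \<comment> \<open>The condition \<open>\<alpha> (decomp v d) \<in> homog A d\<close> is additive
    in \<open>v\<close> and holds on \<open>V\<close>, so it holds on \<open>W\<close>; for an
    \<open>x\<close> of degree \<open>d\<close> it is the goal.\<close>
  then have "\<alpha> (decomp x d) \<in> homog A d"
  proof (rule Wind)
    show "\<alpha> (decomp \<zero> d) \<in> homog A d" using decomp_homog [OF homog_zero [of d]] by simp
    show "\<alpha> (decomp v d) \<in> homog A d" if "v \<in> V" for v
      using that unfolding V_def by (auto simp: decomp_homog)
    show "\<alpha> (decomp (\<ominus> v) d) \<in> homog A d" if v: "v \<in> V" for v
    proof -
      obtain e where e: "v \<in> homog R e" "\<alpha> v \<in> homog A e" using v unfolding V_def by blast
      then show ?thesis using homog_inv [OF e(1)] homog_carrier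
        by (simp add: decomp_homog A.homog_inv)
    qed
    show "\<alpha> (decomp (v \<oplus> w) d) \<in> homog A d" if "v \<in> W" "w \<in> W" "\<alpha> (decomp v d) \<in> homog A d" "\<alpha> (decomp w d) \<in> homog A d" for v w
    proof -
      have "decomp v d \<in> carrier R" "decomp w d \<in> carrier R" using that Wc decomp(1) homog_carrier by blast+
      then show ?thesis using that Wc by (simp add: decomp_add A.homog_add)
    qed
  qed
  then show ?thesis using x by (simp add: decomp_homog)
qed

end

section \<open>Tensor decompositions\<close>

text \<open>Every condition is pulled back along the inverse \<open>k\<close>. This will show that
  copies of standard graded rings, realised inside another ring, are standard graded.\<close>

lemma std_graded_transport:
  fixes C :: "'a graded_ring" and U :: "'b graded_ring"
  assumes C: "std_graded C" and U: "cring U" and h: "h \<in> ring_iso C U"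
    and hom: "\<And>d. h ` homog C d = homog U d"
  shows "std_graded U"
proof -
  interpret C: std_graded C by fact
  interpret U: cring U by fact
  define k where "k = inv_into (carrier C) h"
  have hh: "h \<in> ring_hom C U" and hb: "bij_betw h (carrier C) (carrier U)"
    using h by (auto simp: ring_iso_def)
  have k: "k \<in> ring_hom U C" and kb: "bij_betw k (carrier U) (carrier C)"
    using ring_iso_set_sym [OF C.ring_axioms h] by (auto simp: ring_iso_def k_def)
  interpret h: ring_hom_cring C U h by (rule ring_hom_cringI' [OF C.is_cring U hh])
  interpret k: ring_hom_cring U C k by (rule ring_hom_cringI' [OF U C.is_cring k])
  have kh: "k (h x) = x" if "x \<in> carrier C" for x
    using that hb by (simp add: k_def bij_betw_def)
  have hk: "h (k x) = x" if "x \<in> carrier U" for x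
    using that hb by (simp add: k_def bij_betw_def f_inv_into_f)
  have hU: "h x \<in> homog U d" if "x \<in> homog C d" for x d
    unfolding hom [symmetric] using that by (rule imageI)
  have kU: "k x \<in> homog C d" and Uc: "x \<in> carrier U" if x: "x \<in> homog U d" for x d
  proof -
    obtain y where "y \<in> homog C d" "x = h y" using x unfolding hom [symmetric] by blast
    then show "k x \<in> homog C d" "x \<in> carrier U" using kh C.homog_carrier by auto
  qed
  have sub: "subgroup (homog U d) (add_monoid U)" for d
  proof -
    interpret g: group_hom "add_monoid C" "add_monoid U" h
      by (rule add_hom_group_hom [OF C.is_abelian_group U.is_abelian_group ring_hom_add_hom [OF hh]])
    show ?thesis using g.subgroup_img_is_subgroup [OF C.homog_subgroup [of d]] hom by simp
  qed
  obtain pr where pr: "\<And>d. pr d \<in> hom (add_monoid C) (add_monoid C)"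
    "\<And>d e x. x \<in> homog C d \<Longrightarrow> pr e x = (if e = d then x else \<zero>\<^bsub>C\<^esub>)"
    "\<And>x d. x \<in> carrier C \<Longrightarrow> pr d x \<in> homog C d"
    "\<And>x. x \<in> carrier C \<Longrightarrow> finite {d. pr d x \<noteq> \<zero>\<^bsub>C\<^esub>}"
    "\<And>x. x \<in> carrier C \<Longrightarrow> x = (\<Oplus>\<^bsub>C\<^esub>d\<in>{d. pr d x \<noteq> \<zero>\<^bsub>C\<^esub>}. pr d x)"
    using C.projections by blast
  have h0: "h x = \<zero>\<^bsub>U\<^esub> \<longleftrightarrow> x = \<zero>\<^bsub>C\<^esub>" if "x \<in> carrier C" for x
    using kh [OF that] by auto
  have dir: "direct_sum_of_homog U"
  proof (rule direct_sumI [where pr = "\<lambda>d x. h (pr d (k x))"])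
    show "abelian_group U" by (rule U.is_abelian_group)
    show "subgroup (homog U d) (add_monoid U)" for d by (rule sub)
    show "(\<lambda>x. h (pr d (k x))) \<in> hom (add_monoid U) (add_monoid U)" for d
      using add_hom_simps [OF C.is_abelian_group C.is_abelian_group pr(1)]
      by (auto intro!: homI)
    show "h (pr d (k x)) \<in> homog U d" if "x \<in> carrier U" for d x
      using that pr(3) hU by simp
    fix x assume x: "x \<in> carrier U"
    have eq: "{d. h (pr d (k x)) \<noteq> \<zero>\<^bsub>U\<^esub>} = {d. pr d (k x) \<noteq> \<zero>\<^bsub>C\<^esub>}"
      using h0 C.homog_carrier [OF pr(3) [OF k.hom_closed [OF x]]] by simp
    show "finite {d. h (pr d (k x)) \<noteq> \<zero>\<^bsub>U\<^esub>}"
      unfolding eq using x by (intro pr(4)) simp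
    have "h (k x) = h (\<Oplus>\<^bsub>C\<^esub>d\<in>{d. pr d (k x) \<noteq> \<zero>\<^bsub>C\<^esub>}. pr d (k x))"
      using pr(5) [OF k.hom_closed [OF x]] by simp
    also have "\<dots> = (\<Oplus>\<^bsub>U\<^esub>d\<in>{d. pr d (k x) \<noteq> \<zero>\<^bsub>C\<^esub>}. h (pr d (k x)))"
      using C.homog_carrier [OF pr(3) [OF k.hom_closed [OF x]]]
      by (intro add_hom_finsum [OF C.is_abelian_group U.is_abelian_group ring_hom_add_hom [OF hh]]) auto
    finally show "x = (\<Oplus>\<^bsub>U\<^esub>d\<in>{d. h (pr d (k x)) \<noteq> \<zero>\<^bsub>U\<^esub>}. h (pr d (k x)))"
      unfolding eq using hk x by simp
  next
    fix d e x assume "x \<in> homog U d"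
    then show "h (pr e (k x)) = (if e = d then x else \<zero>\<^bsub>U\<^esub>)"
      using pr(2) [OF kU] hk Uc by auto
  qed
  have "free_homog U d" for d
  proof -
    let ?GC = "add_monoid (C\<lparr>carrier := homog C d\<rparr>)" and ?GU = "add_monoid (U\<lparr>carrier := homog U d\<rparr>)"
    obtain B :: "'a set" where B: "?GC \<cong> free_Abelian_group B"
      using C.free [of d] unfolding free_homog_def by blast
    have "group ((add_monoid C)\<lparr>carrier := homog C d\<rparr>)"
      by (rule subgroup.subgroup_is_group [OF C.homog_subgroup C.add.is_group])
    then have GC: "group ?GC" by simp
    have "h \<in> iso ?GC ?GU"
    proof (rule isoI)
      show "h \<in> hom ?GC ?GU" using hU C.homog_carrier by (auto intro!: homI)
      show "bij_betw h (carrier ?GC) (carrier ?GU)"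
        by (rule bij_betw_byWitness [of _ k]) (use kh hk C.homog_carrier Uc hU kU in auto)
    qed
    then have "?GC \<cong> ?GU" by (auto simp: is_iso_def)
    then have 1: "?GU \<cong> ?GC" by (rule group.iso_sym [OF GC])
    have "free_Abelian_group B \<cong> ?GC" using group.iso_sym [OF GC B] .
    then obtain \<psi> where \<psi>: "\<psi> \<in> iso (free_Abelian_group B) ?GC" by (auto simp: is_iso_def)
    \<comment> \<open>\<open>free_homog\<close> requires a basis indexed by elements of the type of
      the ring itself; the images of the basis vectors form such an index set.\<close>
    define b where "b = (\<lambda>x. h (\<psi> (frag_of x)))"
    have "inj_on b B"
    proof (rule inj_onI)
      fix x y assume xy: "x \<in> B" "y \<in> B" "b x = b y"
      have "\<psi> (frag_of x) \<in> homog C d" "\<psi> (frag_of y) \<in> homog C d"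
        using xy \<psi> by (auto simp: iso_def hom_def Pi_iff)
      then have "\<psi> (frag_of x) = \<psi> (frag_of y)"
        using xy(3) kh C.homog_carrier unfolding b_def by metis
      then have "frag_of x = frag_of y"
        using xy \<psi> by (auto simp: iso_def bij_betw_def inj_on_def)
      then show "x = y" by (simp add: frag_of_eq)
    qed
    then have "B \<approx> b ` B" by (meson eqpoll_sym inj_on_image_eqpoll_self)
    then have 2: "free_Abelian_group B \<cong> free_Abelian_group (b ` B)"
      by (simp add: isomorphic_free_Abelian_groups)
    have "?GU \<cong> free_Abelian_group (b ` B)"
      by (rule iso_trans [OF iso_trans [OF 1 B] 2])
    then show ?thesis unfolding free_homog_def by blast
  qed
  moreover have "bij_betw (\<lambda>n::int. [n] \<cdot>\<^bsub>U\<^esub> \<one>\<^bsub>U\<^esub>) UNIV (homog U 0)"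
  proof -
    have "bij_betw h (homog C 0) (homog U 0)"
      using hb hom [of 0] C.homog_carrier by (auto simp: bij_betw_def intro: inj_on_subset)
    from bij_betw_trans [OF C.homog0 this]
    show ?thesis by (simp add: comp_def ring_hom_int [OF C.is_cring U hh])
  qed
  moreover have "carrier U = generate_ring U (homog U 0 \<union> homog U 1)"
  proof
    show "generate_ring U (homog U 0 \<union> homog U 1) \<subseteq> carrier U"
      using Uc by (intro U.generate_ring_incl) blast
    show "carrier U \<subseteq> generate_ring U (homog U 0 \<union> homog U 1)"
    proof
      have *: "h x \<in> generate_ring U (homog U 0 \<union> homog U 1)" if "x \<in> carrier C" for x
        using that
      proof (induction x rule: C.std_induct)
        case (int m)
        have "[m] \<cdot>\<^bsub>C\<^esub> \<one>\<^bsub>C\<^esub> \<in> homog C 0" using C.homog0 by (auto dest: bij_betw_apply)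
        then show ?case using hU by (intro generate_ring.incl) blast
      next
        case (homog1 x)
        then show ?case using hU by (intro generate_ring.incl) blast
      qed (simp_all add: generate_ring.intros)
      fix x assume x: "x \<in> carrier U"
      show "x \<in> generate_ring U (homog U 0 \<union> homog U 1)"
        using * [OF k.hom_closed [OF x]] hk [OF x] by simp
    qed
  qed
  moreover have "x \<otimes>\<^bsub>U\<^esub> y \<in> homog U (d + e)" if "x \<in> homog U d" "y \<in> homog U e" for x y d e
    using hU [OF C.homog_mult [OF kU [OF that(1)] kU [OF that(2)]]] that Uc C.homog_carrier kU hk
    by simp
  ultimately show ?thesis
    by (intro std_graded.intro std_graded_axioms.intro graded_cring.intro graded_cring_axioms.intro
        pregraded_cring.intro pregraded_cring_axioms.intro U sub dir)
qed

lemma m_inv_cong: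
  assumes "carrier G = carrier H" "monoid.mult G = monoid.mult H" "\<one>\<^bsub>G\<^esub> = \<one>\<^bsub>H\<^esub>"
  shows "m_inv G = m_inv H"
  by (rule ext) (simp add: m_inv_def assms)

text \<open>The homogeneous components of the tensor product are generated in the ungraded quotient
  ring, a record of another type than \<open>TP\<close>.\<close>

lemma generate_cong:
  assumes "carrier G = carrier H" "monoid.mult G = monoid.mult H" "\<one>\<^bsub>G\<^esub> = \<one>\<^bsub>H\<^esub>"
  shows "generate G S = generate H S"
proof -
  have "generate G S \<subseteq> generate H S"
    if "carrier G = carrier H" "monoid.mult G = monoid.mult H" "\<one>\<^bsub>G\<^esub> = \<one>\<^bsub>H\<^esub>"
    for G :: "('x, 'y) monoid_scheme" and H :: "('x, 'z) monoid_scheme" and S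
  proof
    fix x assume "x \<in> generate G S"
    then show "x \<in> generate H S"
    proof induction
      case one
      show ?case unfolding that(3) by (rule generate.one)
    next
      case (incl h)
      then show ?case by (rule generate.incl)
    next
      case (inv h)
      then show ?case unfolding m_inv_cong [OF that] by (rule generate.inv)
    next
      case (eng h1 h2)
      then show ?case unfolding that(2) by (intro generate.eng)
    qed
  qed
  from this [OF assms] this [OF assms [symmetric]] show ?thesis by blast
qed

locale graded_tensor_family = tensor_family +
  assumes T_graded: "\<And>i. i \<in> I \<Longrightarrow> std_graded (T i)"
begin

lemma T_pregraded: "i \<in> I \<Longrightarrow> pregraded_cring (T i)"
  by (intro graded_cring.axioms std_graded.axioms T_graded)

lemmas T_homog_zero = pregraded_cring.homog_zero [OF T_pregraded]
  and T_homog_inv = pregraded_cring.homog_inv [OF T_pregraded]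
  and T_homog_add = pregraded_cring.homog_add [OF T_pregraded]
  and T_homog_mult = pregraded_cring.homog_mult [OF T_pregraded]
  and T_homog_carrier = pregraded_cring.homog_carrier [OF T_pregraded]

lemma emb_zero: "i \<in> I \<Longrightarrow> emb i \<zero>\<^bsub>T i\<^esub> = \<zero>\<^bsub>TP\<^esub>"
  by (rule add_hom_zero [OF cring_abelian [OF cringT] TP.is_abelian_group ring_hom_add_hom [OF emb_hom]])

lemma T_minus_closed: "i \<in> I \<Longrightarrow> x \<in> carrier (T i) \<Longrightarrow> \<ominus>\<^bsub>T i\<^esub> x \<in> carrier (T i)"
  by (rule abelian_group.a_inv_closed [OF cring_abelian [OF cringT]])

lemma T_plus_closed:
  "i \<in> I \<Longrightarrow> x \<in> carrier (T i) \<Longrightarrow> y \<in> carrier (T i) \<Longrightarrow> x \<oplus>\<^bsub>T i\<^esub> y \<in> carrier (T i)"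
  by (rule ring.ring_simprules(1) [OF cring.axioms(1) [OF cringT]])

definition "HP d = {pure f | f e. f \<in> (\<Pi>\<^sub>E i\<in>I. homog (T i) (e i)) \<and> (\<Sum>i\<in>I. e i) = d}"

lemma homog_TP: "homog TP d = generate (add_monoid TP) (HP d)"
  by (simp add: ring_TP HP_def, rule generate_cong) simp_all

lemma PiE_homog_E: "f \<in> (\<Pi>\<^sub>E i\<in>I. homog (T i) (e i)) \<Longrightarrow> f \<in> E"
  using T_homog_carrier
  by (fastforce simp: E_def PiE_iff)

lemma HP_carrier: "HP d \<subseteq> carrier TP"
  using PiE_homog_E by (auto simp: HP_def)

lemma homog_TP_induct [consumes 1, case_names zero pure inv add]:
  assumes "x \<in> homog TP d" "Q \<zero>\<^bsub>TP\<^esub>"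
    "\<And>f e. f \<in> (\<Pi>\<^sub>E i\<in>I. homog (T i) (e i)) \<Longrightarrow> (\<Sum>i\<in>I. e i) = d \<Longrightarrow> Q (pure f)"
    "\<And>x. x \<in> carrier TP \<Longrightarrow> Q x \<Longrightarrow> Q (\<ominus>\<^bsub>TP\<^esub> x)"
    "\<And>x y. x \<in> carrier TP \<Longrightarrow> y \<in> carrier TP \<Longrightarrow> Q x \<Longrightarrow> Q y \<Longrightarrow> Q (x \<oplus>\<^bsub>TP\<^esub> y)"
  shows "Q x"
proof -
  have HP: "Q x" if "x \<in> HP d" for x using that assms(3) unfolding HP_def by blast
  have "x \<in> carrier TP \<and> Q x" using assms(1) unfolding homog_TP
  proof induction
    case one
    show ?case using assms(2) by simp
  next
    case (incl h)
    then show ?case using HP HP_carrier by blast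
  next
    case (inv h)
    then show ?case using HP HP_carrier assms(4) TP.a_inv_closed unfolding a_inv_def by blast
  next
    case (eng h1 h2)
    then show ?case using assms(5) by simp
  qed
  then show ?thesis ..
qed

lemma homog_TP_subgroup: "subgroup (homog TP d) (add_monoid TP)"
  unfolding homog_TP using HP_carrier by (intro TP.add.generate_is_subgroup) simp

lemma pure_homog:
  assumes "f \<in> (\<Pi>\<^sub>E i\<in>I. homog (T i) (e i))"
  shows "pure f \<in> homog TP (\<Sum>i\<in>I. e i)"
  unfolding homog_TP by (rule generate.incl) (use assms in \<open>auto simp: HP_def\<close>)

text \<open>Degrees add coordinatewise under multiplication of pure homogeneous tensors, and by
  additivity both factors of a product may be taken to be pure.\<close>

lemma pregraded_TP: "pregraded_cring TP"
proof (intro pregraded_cring.intro pregraded_cring_axioms.intro cring_TP homog_TP_subgroup)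
  fix x y d e assume x: "x \<in> homog TP d" and y: "y \<in> homog TP e"
  note sub = subgroup.one_closed [OF homog_TP_subgroup, simplified]
     subgroup.m_closed [OF homog_TP_subgroup, simplified]
     subgroup.m_inv_closed [OF homog_TP_subgroup, folded a_inv_def]
  have hc: "z \<in> carrier TP" if "z \<in> homog TP n" for z n
    using subgroup.subset [OF homog_TP_subgroup] that by auto
  show "x \<otimes>\<^bsub>TP\<^esub> y \<in> homog TP (d + e)" using x
  proof (induction x rule: homog_TP_induct)
    case zero
    show ?case using y hc sub(1) by simp
  next
    case (pure f e1)
    note f = this
    have fE: "f \<in> E" using PiE_homog_E f(1) .
    show ?case using y
    proof (induction y rule: homog_TP_induct)
      case zero
      show ?case using fE sub(1) by simp
    next
      case (pure g e2)
      have "mul f g \<in> (\<Pi>\<^sub>E i\<in>I. homog (T i) (e1 i + e2 i))"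
        using f(1) pure(1)
          T_homog_mult
        by (auto simp: mul_def PiE_iff)
      from pure_homog [OF this] show ?case
        using f(2) pure(2) PiE_homog_E [OF pure(1)] fE by (simp add: pure_mult sum.distrib)
    next
      case (inv z)
      then show ?case using fE sub(3) by (simp add: TP.r_minus)
    next
      case (add z w)
      then show ?case using fE sub(2) by (simp add: TP.r_distr)
    qed
  next
    case (inv z)
    then show ?case using sub(3) hc [OF y] by (simp add: TP.l_minus)
  next
    case (add z w)
    then show ?case using sub(2) hc [OF y] by (simp add: TP.l_distr)
  qed
qed

sublocale PG: pregraded_cring TP by (rule pregraded_TP)

lemma emb_homog:
  assumes "i \<in> I" "x \<in> homog (T i) d"
  shows "emb i x \<in> homog TP d"
proof -
  have "un(i := x) \<in> (\<Pi>\<^sub>E k\<in>I. homog (T k) (if k = i then d else 0))"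
    using assms std_graded.one_homog [OF T_graded] by (auto simp: un_def)
  from pure_homog [OF this] show ?thesis
    using assms finI by (simp add: emb_pure sum.delta)
qed

lemma one_homog_TP: "\<one>\<^bsub>TP\<^esub> \<in> homog TP 0"
proof -
  have "un \<in> (\<Pi>\<^sub>E k\<in>I. homog (T k) 0)"
    using std_graded.one_homog [OF T_graded] by (auto simp: un_def)
  from pure_homog [OF this] show ?thesis by (simp add: one_TP)
qed

lemma finprod_int:
  "finite S \<Longrightarrow> \<exists>K::int. finprod TP (\<lambda>i. [(k i :: int)] \<cdot>\<^bsub>TP\<^esub> \<one>\<^bsub>TP\<^esub>) S = [K] \<cdot>\<^bsub>TP\<^esub> \<one>\<^bsub>TP\<^esub>"
proof (induction S rule: finite_induct)
  case empty
  show ?case by (rule exI [of _ 1]) simp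
next
  case (insert x S)
  then obtain K :: int where "finprod TP (\<lambda>i. [(k i)] \<cdot>\<^bsub>TP\<^esub> \<one>\<^bsub>TP\<^esub>) S = [K] \<cdot>\<^bsub>TP\<^esub> \<one>\<^bsub>TP\<^esub>" by blast
  then show ?case using insert
    by (intro exI [of _ "k x * K"]) (simp add: TP.int_scalar_mult TP.int_scalar_scalar)
qed

text \<open>A pure tensor of total degree 1 has degree 1 in one coordinate and degree 0 in the
  others. The latter are integers and can be moved into the former, so degree 1 of the tensor
  product is spanned by degree 1 of the embedded factors.\<close>

lemma homog1_TP:
  assumes "x \<in> homog TP 1"
  shows "\<exists>t. (\<forall>i\<in>I. t i \<in> homog (T i) 1) \<and> x = finsum TP (\<lambda>i. emb i (t i)) I"
  using assms
proof (induction x rule: homog_TP_induct)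
  case zero
  show ?case
  proof (rule exI [of _ "\<lambda>i. \<zero>\<^bsub>T i\<^esub>"], rule conjI, rule ballI)
    show "\<zero>\<^bsub>TP\<^esub> = finsum TP (\<lambda>i. emb i \<zero>\<^bsub>T i\<^esub>) I"
      by (rule TP.add.finprod_one_eqI [symmetric]) (rule emb_zero)
  qed (rule T_homog_zero)
next
  case (pure f e)
  have "\<exists>j\<in>I. e j = 1 \<and> (\<forall>i\<in>I. j \<noteq> i \<longrightarrow> e i = 0)"
    using pure(2) by (simp only: sum_eq_1_iff [OF finI])
  then obtain j where j: "j \<in> I" "e j = 1" and j': "\<forall>i\<in>I. j \<noteq> i \<longrightarrow> e i = 0"
    by (elim bexE conjE)
  have e0: "e i = 0" if "i \<in> I" "i \<noteq> j" for i
    using j' that by simp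
  interpret Tj: std_graded "T j" using T_graded j by simp
  have fE: "f \<in> E" using PiE_homog_E pure(1) .
  have "\<exists>k::int. f i = [k] \<cdot>\<^bsub>T i\<^esub> \<one>\<^bsub>T i\<^esub>" if "i \<in> I - {j}" for i
  proof -
    have "i \<in> I" "f i \<in> homog (T i) 0" using that pure(1) e0 [of i] by (auto simp: PiE_iff)
    from std_graded.homog0E [OF T_graded [OF this(1)] this(2)] show ?thesis by metis
  qed
  then obtain k :: "'a \<Rightarrow> int" where k: "\<And>i. i \<in> I - {j} \<Longrightarrow> f i = [(k i)] \<cdot>\<^bsub>T i\<^esub> \<one>\<^bsub>T i\<^esub>" by metis
  have fj: "f j \<in> homog (T j) 1" using pure(1) j by (auto simp: PiE_iff)
  have "pure f = finprod TP (\<lambda>i. emb i (f i)) (insert j (I - {j}))"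
    using pure_finprod_emb [OF fE] j by (simp add: insert_absorb)
  also have "\<dots> = emb j (f j) \<otimes>\<^bsub>TP\<^esub> finprod TP (\<lambda>i. emb i (f i)) (I - {j})"
    using finI j fE by (intro TP.finprod_insert) (auto simp: E_app)
  also have "finprod TP (\<lambda>i. emb i (f i)) (I - {j}) = finprod TP (\<lambda>i. [(k i)] \<cdot>\<^bsub>TP\<^esub> \<one>\<^bsub>TP\<^esub>) (I - {j})"
    using k ring_hom_int [OF cringT cring_TP emb_hom] by (intro TP.finprod_cong' [OF refl]) simp_all
  \<comment> \<open>\<open>K\<close> is the product of the integers in the coordinates of degree
    0.\<close>
  also obtain K :: int where K: "finprod TP (\<lambda>i. [(k i)] \<cdot>\<^bsub>TP\<^esub> \<one>\<^bsub>TP\<^esub>) (I - {j}) = [K] \<cdot>\<^bsub>TP\<^esub> \<one>\<^bsub>TP\<^esub>"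
    using finprod_int [of "I - {j}" k] finI by auto
  note K
  also have "emb j (f j) \<otimes>\<^bsub>TP\<^esub> [K] \<cdot>\<^bsub>TP\<^esub> \<one>\<^bsub>TP\<^esub> = [K] \<cdot>\<^bsub>TP\<^esub> emb j (f j)"
    using j fE by (simp add: E_app TP.add_pow_rdistr_int)
  also have "\<dots> = emb j ([K] \<cdot>\<^bsub>T j\<^esub> f j)"
    using add_hom_int_scalar [OF Tj.is_abelian_group TP.is_abelian_group ring_hom_add_hom [OF emb_hom [OF j(1)]]] j fE
    by (simp add: E_app)
  finally have pf: "pure f = emb j ([K] \<cdot>\<^bsub>T j\<^esub> f j)" .
  have Kf: "[K] \<cdot>\<^bsub>T j\<^esub> f j \<in> homog (T j) 1"
    using Tj.homog_mult [of "[K] \<cdot>\<^bsub>T j\<^esub> \<one>\<^bsub>T j\<^esub>" 0 "f j" 1] fj Tj.homog0 Tj.homog_carrier [OF fj]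
    by (auto simp: Tj.int_scalar_mult dest: bij_betw_apply)
  define t where "t i = (if i = j then [K] \<cdot>\<^bsub>T j\<^esub> f j else \<zero>\<^bsub>T i\<^esub>)" for i
  have "emb i (t i) = (if i = j then pure f else \<zero>\<^bsub>TP\<^esub>)" if "i \<in> I" for i
    using that pf emb_zero unfolding t_def by simp
  then have "finsum TP (\<lambda>i. emb i (t i)) I = finsum TP (\<lambda>i. if i = j then pure f else \<zero>\<^bsub>TP\<^esub>) I"
    using fE by (intro TP.finsum_cong' [OF refl]) simp_all
  also have "\<dots> = pure f"
    using TP.add.finprod_singleton_swap [of j I "\<lambda>_. pure f"] j finI fE by simp
  finally have e1: "pure f = finsum TP (\<lambda>i. emb i (t i)) I" ..
  have e2: "t i \<in> homog (T i) 1" if "i \<in> I" for i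
    using Kf T_homog_zero that unfolding t_def by simp
  show ?case by (intro exI [of _ t] conjI ballI e1 e2)
next
  case (inv x)
  then obtain t where t: "\<forall>i\<in>I. t i \<in> homog (T i) 1" "x = finsum TP (\<lambda>i. emb i (t i)) I" by blast
  have tc: "t i \<in> carrier (T i)" if "i \<in> I" for i
    using t(1) that T_homog_carrier by blast
  have eq: "emb i (\<ominus>\<^bsub>T i\<^esub> t i) = \<ominus>\<^bsub>TP\<^esub> emb i (t i)" if "i \<in> I" for i
    using add_hom_inv [OF cring_abelian [OF cringT] TP.is_abelian_group ring_hom_add_hom [OF emb_hom]] that tc by blast
  have "\<ominus>\<^bsub>TP\<^esub> x = finsum TP (\<lambda>i. \<ominus>\<^bsub>TP\<^esub> emb i (t i)) I"
  proof -
    have "(\<lambda>x. \<ominus>\<^bsub>TP\<^esub> x) \<in> hom (add_monoid TP) (add_monoid TP)"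
      by (auto intro!: homI simp: TP.minus_add)
    from add_hom_finsum [OF TP.is_abelian_group TP.is_abelian_group this, of "\<lambda>i. emb i (t i)" I]
    show ?thesis using t tc by auto
  qed
  also have "\<dots> = finsum TP (\<lambda>i. emb i (\<ominus>\<^bsub>T i\<^esub> t i)) I"
    using eq [symmetric] tc cringT
    by (intro TP.finsum_cong' [OF refl]) (simp_all add: T_minus_closed)
  finally have e1: "\<ominus>\<^bsub>TP\<^esub> x = finsum TP (\<lambda>i. emb i (\<ominus>\<^bsub>T i\<^esub> t i)) I" .
  have e2: "\<ominus>\<^bsub>T i\<^esub> t i \<in> homog (T i) 1" if "i \<in> I" for i
    using t(1) that T_homog_inv by blast
  show ?case by (intro exI [of _ "\<lambda>i. \<ominus>\<^bsub>T i\<^esub> t i"] conjI ballI e1 e2)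
next
  case (add x y)
  then obtain t u where t: "\<forall>i\<in>I. t i \<in> homog (T i) 1" "x = finsum TP (\<lambda>i. emb i (t i)) I"
    and u: "\<forall>i\<in>I. u i \<in> homog (T i) 1" "y = finsum TP (\<lambda>i. emb i (u i)) I" by blast
  have tc: "t i \<in> carrier (T i)" "u i \<in> carrier (T i)" if "i \<in> I" for i
    using t(1) u(1) that T_homog_carrier by blast+
  have eq: "emb i (t i \<oplus>\<^bsub>T i\<^esub> u i) = emb i (t i) \<oplus>\<^bsub>TP\<^esub> emb i (u i)" if "i \<in> I" for i
    using ring_hom_add [OF emb_hom] that tc by blast
  have "x \<oplus>\<^bsub>TP\<^esub> y = finsum TP (\<lambda>i. emb i (t i) \<oplus>\<^bsub>TP\<^esub> emb i (u i)) I"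
    unfolding t u using tc by (subst TP.finsum_addf) auto
  also have "\<dots> = finsum TP (\<lambda>i. emb i (t i \<oplus>\<^bsub>T i\<^esub> u i)) I"
    using eq [symmetric] tc cringT
    by (intro TP.finsum_cong' [OF refl]) (simp_all add: T_plus_closed)
  finally have e1: "x \<oplus>\<^bsub>TP\<^esub> y = finsum TP (\<lambda>i. emb i (t i \<oplus>\<^bsub>T i\<^esub> u i)) I" .
  have e2: "t i \<oplus>\<^bsub>T i\<^esub> u i \<in> homog (T i) 1" if "i \<in> I" for i
    using t(1) u(1) that T_homog_add by blast
  show ?case by (intro exI [of _ "\<lambda>i. t i \<oplus>\<^bsub>T i\<^esub> u i"] conjI ballI e1 e2)
qed

text \<open>The maps \<open>e i\<close> induce a homomorphism \<open>\<beta>\<close> in the opposite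
  direction, and \<open>\<gamma>\<close> and \<open>\<beta>\<close> are mutually inverse as soon as
  they are so on elements of degree 1, which generate. A candidate for a decomposition thus has to
  be checked in degree 1 only.\<close>

lemma graded_isoI:
  fixes A :: "'c graded_ring"
  assumes A: "std_graded A" and e: "\<And>i. i \<in> I \<Longrightarrow> e i \<in> ring_hom (T i) A"
    and e1: "\<And>i x. i \<in> I \<Longrightarrow> x \<in> homog (T i) 1 \<Longrightarrow> e i x \<in> homog A 1"
    and \<gamma>: "\<gamma> \<in> ring_hom A TP" and \<gamma>e: "\<And>i x. i \<in> I \<Longrightarrow> x \<in> homog (T i) 1 \<Longrightarrow> \<gamma> (e i x) = emb i x"
    and span: "\<And>x. x \<in> homog A 1 \<Longrightarrow> \<exists>t. (\<forall>i\<in>I. t i \<in> homog (T i) 1) \<and> x = finsum A (\<lambda>i. e i (t i)) I"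
  shows "\<gamma> \<in> graded_iso A TP"
proof -
  interpret A: std_graded A by fact
  have Tc: "x \<in> carrier (T i)" if "i \<in> I" "x \<in> homog (T i) d" for i x d
    using that T_homog_carrier by blast
  obtain \<beta> where \<beta>: "\<beta> \<in> ring_hom TP A" and \<beta>e: "\<And>i x. i \<in> I \<Longrightarrow> x \<in> carrier (T i) \<Longrightarrow> \<beta> (emb i x) = e i x"
    using TP_ring_hom [of A e] A.is_cring e by blast
  interpret \<gamma>: ring_hom_cring A TP \<gamma> by (rule ring_hom_cringI' [OF A.is_cring cring_TP \<gamma>])
  interpret \<beta>: ring_hom_cring TP A \<beta> by (rule ring_hom_cringI' [OF cring_TP A.is_cring \<beta>])
  have \<gamma>e': "\<gamma> (e i x) = emb i x" if "i \<in> I" "x \<in> carrier (T i)" for i x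
    using std_graded.hom_eq [OF T_graded [OF that(1)] cring_TP ring_hom_trans [OF e [OF that(1)] \<gamma>] emb_hom [OF that(1)] _ that(2)]
      \<gamma>e that(1) by simp
  have \<gamma>\<beta>: "\<gamma> (\<beta> y) = y" if "y \<in> carrier TP" for y
    using TP_hom_eq [OF cring_TP ring_hom_trans [OF \<beta> \<gamma>] id_ring_hom _ that] \<beta>e \<gamma>e' by simp
  have ec: "e i (t i) \<in> carrier A" if "\<forall>i\<in>I. t i \<in> homog (T i) 1" "i \<in> I" for t i
    using that e1 A.homog_carrier by blast
  have embc: "emb i (t i) \<in> carrier TP" if "\<forall>i\<in>I. t i \<in> homog (T i) 1" "i \<in> I" for t i
    using that Tc by (intro emb_closed) blast+
  have \<gamma>sum: "\<gamma> (finsum A (\<lambda>i. e i (t i)) I) = finsum TP (\<lambda>i. emb i (t i)) I"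
    if t: "\<forall>i\<in>I. t i \<in> homog (T i) 1" for t
  proof -
    have "\<gamma> (finsum A (\<lambda>i. e i (t i)) I) = finsum TP (\<lambda>i. \<gamma> (e i (t i))) I"
      using ec [OF t]
      by (intro add_hom_finsum [OF A.is_abelian_group TP.is_abelian_group ring_hom_add_hom [OF \<gamma>]]) blast
    also have "\<dots> = finsum TP (\<lambda>i. emb i (t i)) I"
      using t embc [OF t] by (intro TP.finsum_cong' [OF refl] funcsetI \<gamma>e) blast+
    finally show ?thesis .
  qed
  have \<beta>sum: "\<beta> (finsum TP (\<lambda>i. emb i (t i)) I) = finsum A (\<lambda>i. e i (t i)) I"
    if t: "\<forall>i\<in>I. t i \<in> homog (T i) 1" for t
  proof -
    have "\<beta> (finsum TP (\<lambda>i. emb i (t i)) I) = finsum A (\<lambda>i. \<beta> (emb i (t i))) I"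
      using embc [OF t]
      by (intro add_hom_finsum [OF TP.is_abelian_group A.is_abelian_group ring_hom_add_hom [OF \<beta>]]) blast
    also have "\<dots> = finsum A (\<lambda>i. e i (t i)) I"
      using t ec [OF t] Tc by (intro A.finsum_cong' [OF refl] funcsetI \<beta>e) blast+
    finally show ?thesis .
  qed
  have \<beta>\<gamma>: "\<beta> (\<gamma> x) = x" if "x \<in> carrier A" for x
  proof -
    have "(\<beta> \<circ> \<gamma>) x = id x" if "x \<in> homog A 1" for x
    proof -
      from span [OF that] obtain t where t: "\<forall>i\<in>I. t i \<in> homog (T i) 1" "x = finsum A (\<lambda>i. e i (t i)) I" by blast
      show ?thesis unfolding t(2) by (simp only: comp_def id_def \<gamma>sum [OF t(1)] \<beta>sum [OF t(1)])
    qed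
    from A.hom_eq [OF A.is_cring ring_hom_trans [OF \<gamma> \<beta>] id_ring_hom this that] show ?thesis by simp
  qed
  have "bij_betw \<gamma> (carrier A) (carrier TP)"
    by (rule bij_betw_byWitness [of _ \<beta>]) (auto simp: \<gamma>\<beta> \<beta>\<gamma>)
  then have iso: "\<gamma> \<in> ring_iso A TP" using \<gamma> by (simp add: ring_iso_def)
  have \<gamma>1: "\<gamma> x \<in> homog TP 1" if "x \<in> homog A 1" for x
  proof -
    from span [OF that] obtain t where t: "\<forall>i\<in>I. t i \<in> homog (T i) 1" "x = finsum A (\<lambda>i. e i (t i)) I" by blast
    have "\<gamma> x = finsum TP (\<lambda>i. emb i (t i)) I"
      unfolding t(2) by (rule \<gamma>sum [OF t(1)])
    then show ?thesis using t(1) emb_homog by (simp add: PG.homog_finsum)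
  qed
  have \<gamma>d: "\<gamma> x \<in> homog TP d" if "x \<in> homog A d" for x d
    using A.graded_hom [OF pregraded_TP one_homog_TP \<gamma> \<gamma>1 that] .
  have ed: "e i x \<in> homog A d" if "i \<in> I" "x \<in> homog (T i) d" for i x d
    using std_graded.graded_hom [OF T_graded A.pregraded_cring_axioms A.one_homog e e1 that(2)] that(1) by blast
  have \<beta>d: "\<beta> y \<in> homog A d" if "y \<in> homog TP d" for y d
    using that
  proof (induction y rule: homog_TP_induct)
    case (pure f dg)
    have fE: "f \<in> E" using PiE_homog_E pure(1) .
    have ec': "e i (f i) \<in> carrier A" if "i \<in> I" for i
      by (rule ring_hom_closed [OF e [OF that] E_app [OF fE that]])
    have "\<beta> (pure f) = finprod A (\<lambda>i. \<beta> (emb i (f i))) I"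
    proof -
      have "(\<lambda>i. emb i (f i)) \<in> I \<rightarrow> carrier TP"
        by (intro funcsetI emb_closed E_app [OF fE])
      from \<beta>.hom_finprod [OF this] show ?thesis
        unfolding pure_finprod_emb [OF fE] by (simp only: comp_def)
    qed
    also have "\<dots> = finprod A (\<lambda>i. e i (f i)) I"
      by (intro A.finprod_cong' [OF refl] funcsetI ec' \<beta>e E_app [OF fE])
    finally have "\<beta> (pure f) = finprod A (\<lambda>i. e i (f i)) I" .
    moreover have "finite S \<Longrightarrow> S \<subseteq> I \<Longrightarrow> finprod A (\<lambda>i. e i (f i)) S \<in> homog A (\<Sum>i\<in>S. dg i)" for S
    proof (induction S rule: finite_induct)
      case empty
      show ?case by (simp add: A.one_homog)
    next
      case (insert i S)
      have *: "e k (f k) \<in> homog A (dg k)" if "k \<in> I" for k using ed pure(1) that by (auto simp: PiE_iff)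
      then have "finprod A (\<lambda>i. e i (f i)) (insert i S) = e i (f i) \<otimes>\<^bsub>A\<^esub> finprod A (\<lambda>i. e i (f i)) S"
        using insert A.homog_carrier by (intro A.finprod_insert) blast+
      then show ?case using A.homog_mult * insert by simp
    qed
    ultimately show ?case using pure(2) finI by auto
  qed (simp_all add: A.homog_inv A.homog_add)
  have "\<gamma> ` homog A d = homog TP d" for d
  proof
    show "\<gamma> ` homog A d \<subseteq> homog TP d" using \<gamma>d by blast
    show "homog TP d \<subseteq> \<gamma> ` homog A d"
    proof
      fix y assume y: "y \<in> homog TP d"
      then have "y = \<gamma> (\<beta> y)" using \<gamma>\<beta> PG.homog_carrier by simp
      then show "y \<in> \<gamma> ` homog A d" using \<beta>d [OF y] by blast
    qed
  qed
  then show ?thesis using iso by (simp add: graded_iso_def)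
qed

end

lemma std_graded_cring: "std_graded R \<Longrightarrow> cring R"
  by (intro std_graded.axioms graded_cring.axioms pregraded_cring.axioms)

lemma graded_tensor_familyI:
  assumes "finite I" "\<And>i. i \<in> I \<Longrightarrow> std_graded (T i)"
  shows "graded_tensor_family I T"
  by (intro graded_tensor_family.intro tensor_family.intro graded_tensor_family_axioms.intro
      std_graded_cring assms)

lemma tensor_decompositionI:
  fixes A :: "'c graded_ring"
  assumes A: "std_graded A" and T: "\<And>i. i < s \<Longrightarrow> std_graded (T i)"
    and e: "\<And>i. i < s \<Longrightarrow> e i \<in> ring_hom (T i) A"
    and e1: "\<And>i x. i < s \<Longrightarrow> x \<in> homog (T i) 1 \<Longrightarrow> e i x \<in> homog A 1"
    and \<gamma>: "\<gamma> \<in> ring_hom A (tensor_product {..<s} T)"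
    and \<gamma>e: "\<And>i x. i < s \<Longrightarrow> x \<in> homog (T i) 1 \<Longrightarrow> \<gamma> (e i x) = tensor_embed {..<s} T i x"
    and span: "\<And>x. x \<in> homog A 1 \<Longrightarrow> \<exists>t. (\<forall>i<s. t i \<in> homog (T i) 1) \<and> x = finsum A (\<lambda>i. e i (t i)) {..<s}"
  shows "tensor_decomposition A s T \<gamma>"
proof -
  interpret graded_tensor_family "{..<s}" T
    by (intro graded_tensor_familyI finite_lessThan T) simp
  have "\<gamma> \<in> graded_iso A TP"
  proof (rule graded_isoI [where e = e])
    show "\<exists>t. (\<forall>i\<in>{..<s}. t i \<in> homog (T i) 1) \<and> x = finsum A (\<lambda>i. e i (t i)) {..<s}" if "x \<in> homog A 1" for x
      using span [OF that] by (simp only: Ball_def lessThan_iff)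
  qed (use A e e1 \<gamma> \<gamma>e in simp_all)
  then show ?thesis using T by (simp add: tensor_decomposition_def std_graded_iff)
qed

section \<open>A tensor decomposition seen from inside the decomposed ring\<close>

locale decomposition = R: std_graded R
  for R :: "'a graded_ring" and s :: nat and T :: "nat \<Rightarrow> 'b graded_ring"
    and \<phi> :: "'a \<Rightarrow> ((nat \<Rightarrow> 'b) \<Rightarrow>\<^sub>0 int) set" +
  assumes dec: "tensor_decomposition R s T \<phi>"
begin

lemma T_std: "i < s \<Longrightarrow> std_graded (T i)"
  using dec by (simp add: tensor_decomposition_def std_graded_iff)

sublocale TF: graded_tensor_family "{..<s}" T
  by (intro graded_tensor_familyI finite_lessThan T_std) simp

lemma \<phi>: "\<phi> \<in> ring_hom R TF.TP" "bij_betw \<phi> (carrier R) (carrier TF.TP)" "\<phi> ` homog R d = homog TF.TP d"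
  using dec by (auto simp: tensor_decomposition_def graded_iso_def ring_iso_def)

definition "\<phi>inv = inv_into (carrier R) \<phi>"

lemma \<phi>inv: "\<phi>inv \<in> ring_hom TF.TP R" "x \<in> carrier R \<Longrightarrow> \<phi>inv (\<phi> x) = x"
   "y \<in> carrier TF.TP \<Longrightarrow> \<phi> (\<phi>inv y) = y"
proof -
  have "\<phi> \<in> ring_iso R TF.TP" using \<phi> by (simp add: ring_iso_def)
  from ring_iso_set_sym [OF R.ring_axioms this]
  show "\<phi>inv \<in> ring_hom TF.TP R" by (simp add: \<phi>inv_def ring_iso_def)
  show "x \<in> carrier R \<Longrightarrow> \<phi>inv (\<phi> x) = x"
    using \<phi>(2) by (simp add: \<phi>inv_def bij_betw_def)
  show "y \<in> carrier TF.TP \<Longrightarrow> \<phi> (\<phi>inv y) = y"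
    using \<phi>(2) by (simp add: \<phi>inv_def bij_betw_def f_inv_into_f)
qed

lemma \<phi>inv_homog: "y \<in> homog TF.TP d \<Longrightarrow> \<phi>inv y \<in> homog R d"
  using \<phi>(3) [of d] \<phi>inv(2) R.homog_carrier by (metis image_iff)

text \<open>The inclusion by which the factor \<open>T i\<close> is regarded as a subring of
  \<open>R\<close>.\<close>

definition "eps i x = \<phi>inv (TF.emb i x)"

lemma eps_hom: assumes "i < s" shows "eps i \<in> ring_hom (T i) R"
proof -
  have "eps i = \<phi>inv \<circ> TF.emb i" by (simp add: fun_eq_iff eps_def)
  then show ?thesis using ring_hom_trans [OF TF.emb_hom \<phi>inv(1)] assms by simp
qed

lemma \<phi>_eps: "i < s \<Longrightarrow> x \<in> carrier (T i) \<Longrightarrow> \<phi> (eps i x) = TF.emb i x"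
  unfolding eps_def by (rule \<phi>inv(3)) (rule TF.emb_closed, simp_all)

lemma eps_homog: "i < s \<Longrightarrow> x \<in> homog (T i) d \<Longrightarrow> eps i x \<in> homog R d"
  unfolding eps_def by (intro \<phi>inv_homog TF.emb_homog) simp_all

lemma eps_closed: "i < s \<Longrightarrow> x \<in> carrier (T i) \<Longrightarrow> eps i x \<in> carrier R"
  using ring_hom_closed [OF eps_hom] .

lemma T_carrier: "i < s \<Longrightarrow> x \<in> homog (T i) d \<Longrightarrow> x \<in> carrier (T i)"
  by (rule TF.T_homog_carrier) simp_all

lemma T_cring: "i < s \<Longrightarrow> cring (T i)"
  by (rule TF.cringT) simp

text \<open>The direct summand of degree 1 that belongs to factor \<open>i\<close>. Decompositions
  are compared through these summands, since they generate the subalgebras of the factors.\<close>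

definition "summand i = {x \<in> carrier R. \<phi> x \<in> TF.emb i ` homog (T i) 1}"

lemma factor_subalgebra_summand: "factor_subalgebra R s T \<phi> i = generate_ring R (summand i)"
  by (simp only: factor_subalgebra_def summand_def)

lemma summand_eps:
  assumes "i < s" shows "summand i = eps i ` homog (T i) 1"
proof
  show "summand i \<subseteq> eps i ` homog (T i) 1"
  proof
    fix x assume "x \<in> summand i"
    then obtain y where y: "x \<in> carrier R" "y \<in> homog (T i) 1" "\<phi> x = TF.emb i y"
      unfolding summand_def by blast
    then have "x = eps i y" using \<phi>inv(2) [OF y(1)] by (simp only: eps_def)
    then show "x \<in> eps i ` homog (T i) 1" using y(2) by (rule image_eqI)
  qed
  show "eps i ` homog (T i) 1 \<subseteq> summand i"
  proof
    fix x assume "x \<in> eps i ` homog (T i) 1"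
    then obtain y where y: "y \<in> homog (T i) 1" "x = eps i y" by blast
    have yc: "y \<in> carrier (T i)" by (rule T_carrier [OF assms y(1)])
    have "\<phi> x \<in> TF.emb i ` homog (T i) 1"
      unfolding y(2) \<phi>_eps [OF assms yc] using y(1) by (rule imageI)
    moreover have "x \<in> carrier R" unfolding y(2) by (rule eps_closed [OF assms yc])
    ultimately show "x \<in> summand i" unfolding summand_def by (intro CollectI conjI)
  qed
qed

lemma summand_homog: "i < s \<Longrightarrow> x \<in> summand i \<Longrightarrow> x \<in> homog R 1"
  unfolding summand_eps by (elim imageE) (simp only: eps_homog)

lemma eps_summand: "i < s \<Longrightarrow> x \<in> homog (T i) 1 \<Longrightarrow> eps i x \<in> summand i"
  unfolding summand_eps by (rule imageI)

lemma homog1_eps: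
  assumes "x \<in> homog R 1"
  shows "\<exists>t. (\<forall>i<s. t i \<in> homog (T i) 1) \<and> x = finsum R (\<lambda>i. eps i (t i)) {..<s}"
proof -
  have "\<phi> x \<in> homog TF.TP 1" unfolding \<phi>(3) [of 1, symmetric] using assms by (rule imageI)
  from TF.homog1_TP [OF this] obtain t where t: "\<forall>i\<in>{..<s}. t i \<in> homog (T i) 1"
    "\<phi> x = finsum TF.TP (\<lambda>i. TF.emb i (t i)) {..<s}" by blast
  have ec: "TF.emb i (t i) \<in> carrier TF.TP" if "i \<in> {..<s}" for i
    by (rule TF.emb_closed [OF that]) (rule T_carrier, use that t in auto)
  have "x = \<phi>inv (\<phi> x)" using \<phi>inv(2) R.homog_carrier [OF assms] by simp
  also have "\<dots> = finsum R (\<lambda>i. \<phi>inv (TF.emb i (t i))) {..<s}"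
    unfolding t(2)
    by (rule add_hom_finsum [OF TF.TP.is_abelian_group R.is_abelian_group ring_hom_add_hom [OF \<phi>inv(1)]])
      (intro funcsetI ec)
  finally show ?thesis using t(1) unfolding eps_def by (intro exI [of _ t]) simp
qed

lemma lift_homs:
  fixes A :: "('c, 'm) ring_scheme"
  assumes A: "cring A" and q: "\<And>i. i < s \<Longrightarrow> q i \<in> ring_hom (T i) A"
  obtains \<Phi> where "\<Phi> \<in> ring_hom R A" "\<And>i x. i < s \<Longrightarrow> x \<in> carrier (T i) \<Longrightarrow> \<Phi> (eps i x) = q i x"
proof -
  have "\<And>i. i \<in> {..<s} \<Longrightarrow> q i \<in> ring_hom (T i) A" using q by simp
  from TF.TP_ring_hom [OF A this] obtain \<Psi> where \<Psi>: "\<Psi> \<in> ring_hom TF.TP A"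
    "\<And>i x. i \<in> {..<s} \<Longrightarrow> x \<in> carrier (T i) \<Longrightarrow> \<Psi> (TF.emb i x) = q i x" by blast
  show thesis
  proof
    show "\<Psi> \<circ> \<phi> \<in> ring_hom R A" by (rule ring_hom_trans [OF \<phi>(1) \<Psi>(1)])
    show "(\<Psi> \<circ> \<phi>) (eps i x) = q i x" if "i < s" "x \<in> carrier (T i)" for i x
      using that \<phi>_eps \<Psi>(2) by simp
  qed
qed

text \<open>The identity on \<open>T i\<close> and the augmentations on the other factors together
  define a homomorphism on the tensor product; it retracts \<open>eps i\<close>, which is therefore
  injective.\<close>

lemma projection:
  assumes i: "i < s"
  obtains p where "p \<in> ring_hom R (T i)" "\<And>x. x \<in> carrier (T i) \<Longrightarrow> p (eps i x) = x"
proof -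
  have "\<exists>q. q \<in> ring_hom (T k) (T i) \<and> (k = i \<longrightarrow> q = id)" if k: "k < s" for k
  proof (cases "k = i")
    case False
    obtain a where "a \<in> ring_hom (T k) (T i)"
      using std_graded.augmentation [OF T_std [OF k] T_cring [OF i]] by blast
    then show ?thesis using False by blast
  qed (use id_ring_hom in blast)
  then obtain q where q: "\<And>k. k < s \<Longrightarrow> q k \<in> ring_hom (T k) (T i)" "q i = id"
    using i by metis
  from lift_homs [OF T_cring [OF i] q(1)] obtain \<Phi> where "\<Phi> \<in> ring_hom R (T i)"
    "\<And>k x. k < s \<Longrightarrow> x \<in> carrier (T k) \<Longrightarrow> \<Phi> (eps k x) = q k x" by blast
  then show thesis using q(2) i by (intro that [of \<Phi>]) simp_all
qed

lemma factor_derivation: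
  assumes j: "j < s"
  obtains D where "derivation R D" "\<And>x. x \<in> summand j \<Longrightarrow> D x = x"
    "\<And>i x. i < s \<Longrightarrow> i \<noteq> j \<Longrightarrow> x \<in> summand i \<Longrightarrow> D x = \<zero>\<^bsub>R\<^esub>"
proof -
  obtain E where E: "derivation (T j) E" "\<And>x. x \<in> homog (T j) 1 \<Longrightarrow> E x = x"
    using graded_cring.euler_derivation [OF std_graded.axioms(1) [OF T_std [OF j]]] by blast
  have "j \<in> {..<s}" using j by simp
  from TF.TP_derivation [OF this E(1)]
  obtain \<Theta> where \<Theta>: "derivation TF.TP \<Theta>" "\<And>x. x \<in> carrier (T j) \<Longrightarrow> \<Theta> (TF.emb j x) = TF.emb j (E x)"
    "\<And>i x. i \<in> {..<s} \<Longrightarrow> i \<noteq> j \<Longrightarrow> x \<in> carrier (T i) \<Longrightarrow> \<Theta> (TF.emb i x) = \<zero>\<^bsub>TF.TP\<^esub>" by blast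
  have \<Theta>h: "\<Theta> \<in> hom (add_monoid TF.TP) (add_monoid TF.TP)" using \<Theta>(1) by (simp add: derivation_def)
  have \<Theta>L: "\<Theta> (x \<otimes>\<^bsub>TF.TP\<^esub> y) = \<Theta> x \<otimes>\<^bsub>TF.TP\<^esub> y \<oplus>\<^bsub>TF.TP\<^esub> x \<otimes>\<^bsub>TF.TP\<^esub> \<Theta> y" if "x \<in> carrier TF.TP" "y \<in> carrier TF.TP" for x y
    using \<Theta>(1) that unfolding derivation_def by blast
  have \<Theta>c: "\<Theta> x \<in> carrier TF.TP" if "x \<in> carrier TF.TP" for x
    by (rule add_hom_closed [OF TF.TP.is_abelian_group TF.TP.is_abelian_group \<Theta>h that])
  note \<phi>c = ring_hom_closed [OF \<phi>(1)] and \<phi>ic = ring_hom_closed [OF \<phi>inv(1)]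
  define D where "D x = \<phi>inv (\<Theta> (\<phi> x))" for x
  show thesis
  proof
    show "derivation R D"
      unfolding derivation_def
    proof (intro conjI ballI homI)
      fix x assume "x \<in> carrier (add_monoid R)"
      then show "D x \<in> carrier (add_monoid R)" by (simp add: D_def \<phi>c \<phi>ic \<Theta>c)
      fix y assume "y \<in> carrier (add_monoid R)"
      then show "D (x \<otimes>\<^bsub>add_monoid R\<^esub> y) = D x \<otimes>\<^bsub>add_monoid R\<^esub> D y"
        using \<open>x \<in> _\<close>
        by (simp add: D_def ring_hom_add [OF \<phi>(1)] \<phi>c \<Theta>c ring_hom_add [OF \<phi>inv(1)]
          add_hom_add [OF TF.TP.is_abelian_group TF.TP.is_abelian_group \<Theta>h])
    next
      fix x y assume xy: "x \<in> carrier R" "y \<in> carrier R"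
      have "D (x \<otimes>\<^bsub>R\<^esub> y) = \<phi>inv (\<Theta> (\<phi> x) \<otimes>\<^bsub>TF.TP\<^esub> \<phi> y \<oplus>\<^bsub>TF.TP\<^esub> \<phi> x \<otimes>\<^bsub>TF.TP\<^esub> \<Theta> (\<phi> y))"
        unfolding D_def ring_hom_mult [OF \<phi>(1) xy] \<Theta>L [OF \<phi>c [OF xy(1)] \<phi>c [OF xy(2)]] ..
      also have "\<dots> = D x \<otimes>\<^bsub>R\<^esub> \<phi>inv (\<phi> y) \<oplus>\<^bsub>R\<^esub> \<phi>inv (\<phi> x) \<otimes>\<^bsub>R\<^esub> D y"
        unfolding D_def using xy
        by (simp only: \<phi>c \<Theta>c ring_hom_add [OF \<phi>inv(1)] ring_hom_mult [OF \<phi>inv(1)] TF.TP.m_closed)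
      finally show "D (x \<otimes>\<^bsub>R\<^esub> y) = D x \<otimes>\<^bsub>R\<^esub> y \<oplus>\<^bsub>R\<^esub> x \<otimes>\<^bsub>R\<^esub> D y"
        using xy by (simp add: \<phi>inv(2))
    qed
    show "D x = x" if x: "x \<in> summand j" for x
    proof -
      obtain y where y: "x \<in> carrier R" "y \<in> homog (T j) 1" "\<phi> x = TF.emb j y"
        using x unfolding summand_def by blast
      have "\<Theta> (\<phi> x) = \<phi> x"
        unfolding y(3) \<Theta>(2) [OF T_carrier [OF j y(2)]] E(2) [OF y(2)] ..
      then show ?thesis using \<phi>inv(2) [OF y(1)] by (simp add: D_def)
    qed
    show "D x = \<zero>\<^bsub>R\<^esub>" if i: "i < s" "i \<noteq> j" and x: "x \<in> summand i" for i x
    proof -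
      obtain y where y: "x \<in> carrier R" "y \<in> homog (T i) 1" "\<phi> x = TF.emb i y"
        using x unfolding summand_def by blast
      have "\<Theta> (\<phi> x) = \<zero>\<^bsub>TF.TP\<^esub>"
        unfolding y(3) by (rule \<Theta>(3)) (use i T_carrier y in auto)
      then show ?thesis
        using add_hom_zero [OF TF.TP.is_abelian_group R.is_abelian_group ring_hom_add_hom [OF \<phi>inv(1)]]
        by (simp add: D_def)
    qed
  qed
qed

text \<open>In degree 1 these are orthogonal idempotents with sum the identity: every element is a
  sum of terms \<open>eps i (t i)\<close>, and \<open>D i\<close> keeps term \<open>i\<close> and
  kills the others.\<close>

theorem factor_derivations:
  obtains D where "\<And>i. i < s \<Longrightarrow> derivation R (D i)"
    "\<And>i x. i < s \<Longrightarrow> x \<in> homog R 1 \<Longrightarrow> D i x \<in> summand i"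
    "\<And>i x. i < s \<Longrightarrow> x \<in> summand i \<Longrightarrow> D i x = x"
    "\<And>i j x. i < s \<Longrightarrow> j < s \<Longrightarrow> i \<noteq> j \<Longrightarrow> x \<in> summand i \<Longrightarrow> D j x = \<zero>\<^bsub>R\<^esub>"
    "\<And>x. x \<in> homog R 1 \<Longrightarrow> x = finsum R (\<lambda>i. D i x) {..<s}"
proof -
  have "\<exists>D. derivation R D \<and> (\<forall>x\<in>summand j. D x = x) \<and>
     (\<forall>i x. i < s \<longrightarrow> i \<noteq> j \<longrightarrow> x \<in> summand i \<longrightarrow> D x = \<zero>\<^bsub>R\<^esub>)" if "j < s" for j
    using factor_derivation [OF that] by metis
  then obtain D where D: "\<And>j. j < s \<Longrightarrow> derivation R (D j)" "\<And>j x. j < s \<Longrightarrow> x \<in> summand j \<Longrightarrow> D j x = x"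
    "\<And>i j x. j < s \<Longrightarrow> i < s \<Longrightarrow> i \<noteq> j \<Longrightarrow> x \<in> summand i \<Longrightarrow> D j x = \<zero>\<^bsub>R\<^esub>" by metis
  have Dx: "D i (finsum R (\<lambda>i. eps i (t i)) {..<s}) = eps i (t i)"
    if t: "\<forall>i<s. t i \<in> homog (T i) 1" and i: "i < s" for i t
  proof -
    have ets: "eps k (t k) \<in> summand k" if "k < s" for k
      by (rule eps_summand [OF that]) (use t that in simp)
    have etc: "eps k (t k) \<in> carrier R" if "k < s" for k
      by (rule R.homog_carrier [OF summand_homog [OF that ets [OF that]]])
    have "D i (finsum R (\<lambda>i. eps i (t i)) {..<s}) = finsum R (\<lambda>k. D i (eps k (t k))) {..<s}"
      by (rule add_hom_finsum [OF R.is_abelian_group R.is_abelian_group])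
        (use D(1) [OF i] etc in \<open>auto simp: derivation_def\<close>)
    also have "\<dots> = finsum R (\<lambda>k. if k = i then eps i (t i) else \<zero>\<^bsub>R\<^esub>) {..<s}"
      using etc i D(2) [OF i ets [OF i]] D(3) [OF i _ _ ets]
      by (intro R.finsum_cong' [OF refl]) auto
    also have "\<dots> = eps i (t i)"
      using R.add.finprod_singleton_swap [of i "{..<s}" "\<lambda>_. eps i (t i)"] etc i by simp
    finally show ?thesis .
  qed
  show thesis
  proof (rule that [of D])
    fix i x assume i: "i < s" and x: "x \<in> homog R 1"
    from homog1_eps [OF x] obtain t where t: "\<forall>i<s. t i \<in> homog (T i) 1" "x = finsum R (\<lambda>i. eps i (t i)) {..<s}" by blast
    show "D i x \<in> summand i" unfolding t(2) Dx [OF t(1) i]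
      by (rule eps_summand [OF i]) (use t(1) i in simp)
  next
    fix x assume x: "x \<in> homog R 1"
    from homog1_eps [OF x] obtain t where t: "\<forall>i<s. t i \<in> homog (T i) 1" "x = finsum R (\<lambda>i. eps i (t i)) {..<s}" by blast
    show "x = finsum R (\<lambda>i. D i x) {..<s}"
      using Dx [OF t(1)] t eps_closed T_carrier
      by (subst (1) t(2)) (intro R.finsum_cong' [OF refl], auto)
  qed (use D in auto)
qed

text \<open>The projection onto \<open>T i\<close> makes \<open>eps i\<close> injective, so a zero
  summand forces degree 1 of \<open>T i\<close> to vanish.\<close>

lemma summand_trivial:
  assumes i: "i < s" and triv: "summand i \<subseteq> {\<zero>\<^bsub>R\<^esub>}"
  shows "\<Z> \<simeq> T i"
proof (rule std_graded.trivial_if_homog1_trivial [OF T_std [OF i]])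
  obtain p where p: "p \<in> ring_hom R (T i)" "\<And>x. x \<in> carrier (T i) \<Longrightarrow> p (eps i x) = x"
    using projection [OF i] by blast
  show "homog (T i) 1 \<subseteq> {\<zero>\<^bsub>T i\<^esub>}"
  proof
    fix x assume x: "x \<in> homog (T i) 1"
    have "eps i x = \<zero>\<^bsub>R\<^esub>" using subsetD [OF triv eps_summand [OF i x]] by simp
    then have "x = p \<zero>\<^bsub>R\<^esub>" using p(2) [OF T_carrier [OF i x]] by simp
    also have "\<dots> = \<zero>\<^bsub>T i\<^esub>"
      by (rule add_hom_zero [OF R.is_abelian_group cring_abelian [OF T_cring [OF i]] ring_hom_add_hom [OF p(1)]])
    finally show "x \<in> {\<zero>\<^bsub>T i\<^esub>}" by simp
  qed
qed

end

section \<open>Integer polynomials\<close>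

subsection \<open>Monomials, degrees and variables\<close>

lemma frag_of_mult: "frag_of a * frag_of b = frag_of (a + b :: nat \<Rightarrow>\<^sub>0 nat)"
  by (simp add: mult_single)

lemma frag_of_zero: "frag_of (0 :: nat \<Rightarrow>\<^sub>0 nat) = 1"
  by (rule single_one)

lemma keys_add_nat: "Poly_Mapping.keys (a + b :: nat \<Rightarrow>\<^sub>0 nat) = Poly_Mapping.keys a \<union> Poly_Mapping.keys b"
  by (auto simp: in_keys_iff lookup_add)

lemma poly_var_power: "poly_var i ^ e = frag_of (Poly_Mapping.single i e)"
  by (induction e) (simp_all add: poly_var_def frag_of_zero mult_single single_add [symmetric])

lemma keys_multE:
  fixes p q :: int_mpoly
  assumes "x \<in> Poly_Mapping.keys (p * q)"
  obtains a b where "a \<in> Poly_Mapping.keys p" "b \<in> Poly_Mapping.keys q" "x = a + b"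
  using subsetD [OF keys_mult assms] by blast

lemma keys_addE:
  fixes p q :: "'a \<Rightarrow>\<^sub>0 int"
  assumes "x \<in> Poly_Mapping.keys (p + q)"
  obtains "x \<in> Poly_Mapping.keys p" | "x \<in> Poly_Mapping.keys q"
  using subsetD [OF keys_add assms] by blast

lemma keys_diffE:
  fixes p q :: "'a \<Rightarrow>\<^sub>0 int"
  assumes "x \<in> Poly_Mapping.keys (p - q)"
  obtains "x \<in> Poly_Mapping.keys p" | "x \<in> Poly_Mapping.keys q"
  using subsetD [OF keys_diff assms] by blast

lemma monom_induct [consumes 1, case_names zero add]:
  assumes "Poly_Mapping.keys (a :: nat \<Rightarrow>\<^sub>0 nat) \<subseteq> V" "Q 0"
    "\<And>b i. Poly_Mapping.keys b \<subseteq> V \<Longrightarrow> i \<in> V \<Longrightarrow> Q b \<Longrightarrow> Q (b + Poly_Mapping.single i 1)"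
  shows "Q a"
  using assms(1)
proof (induction "monom_degree a" arbitrary: a)
  case 0
  have "Poly_Mapping.lookup a i = 0" for i
    using 0(1) by (cases "i \<in> Poly_Mapping.keys a") (auto simp: monom_degree_def in_keys_iff)
  then have "a = 0" by (intro poly_mapping_eqI) simp
  then show ?case using assms(2) by simp
next
  case (Suc n)
  then have "Poly_Mapping.keys a \<noteq> {}" by (auto simp: monom_degree_def)
  then obtain i where i: "i \<in> Poly_Mapping.keys a" by blast
  define b where "b = a - Poly_Mapping.single i 1"
  have a: "a = b + Poly_Mapping.single i 1"
    using i by (intro poly_mapping_eqI) (auto simp: b_def lookup_add lookup_minus lookup_single when_def in_keys_iff)
  have kb: "Poly_Mapping.keys b \<subseteq> Poly_Mapping.keys a" unfolding a keys_add_nat by blast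
  have "monom_degree a = (\<Sum>j\<in>Poly_Mapping.keys a. Poly_Mapping.lookup b j + (if j = i then 1 else 0))"
    unfolding monom_degree_def by (intro sum.cong) (auto simp: a lookup_add lookup_single when_def)
  also have "\<dots> = (\<Sum>j\<in>Poly_Mapping.keys a. Poly_Mapping.lookup b j) + 1"
    using i by (simp add: sum.distrib)
  also have "(\<Sum>j\<in>Poly_Mapping.keys a. Poly_Mapping.lookup b j) = monom_degree b"
    unfolding monom_degree_def using kb by (intro sum.mono_neutral_right) (auto simp: in_keys_iff)
  finally have "Q b" using Suc kb by (intro Suc(1)) auto
  then show ?case unfolding a using assms(3) i kb Suc.prems by blast
qed

lemma monom_degree_alt:
  assumes "finite S" "Poly_Mapping.keys a \<subseteq> S"
  shows "monom_degree a = (\<Sum>j\<in>S. Poly_Mapping.lookup a j)"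
  unfolding monom_degree_def using assms by (intro sum.mono_neutral_left) (auto simp: in_keys_iff)

lemma monom_degree_add [simp]: "monom_degree (a + b) = monom_degree a + monom_degree b"
  using monom_degree_alt [of "Poly_Mapping.keys a \<union> Poly_Mapping.keys b"]
  by (simp add: keys_add_nat lookup_add sum.distrib)

lemma monom_degree_single [simp]: "monom_degree (Poly_Mapping.single i e) = e"
  using monom_degree_alt [of "{i}" "Poly_Mapping.single i e"] by simp

lemma monom_degree_zero [simp]: "monom_degree 0 = 0"
  by (simp add: monom_degree_def)

definition vars_in :: "nat set \<Rightarrow> int_mpoly \<Rightarrow> bool" where
  "vars_in V p \<longleftrightarrow> (\<forall>a\<in>Poly_Mapping.keys p. Poly_Mapping.keys a \<subseteq> V)"

text \<open>A strict bound on the degree in variable \<open>i\<close>: bound 1 says that the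
  variable does not occur, and the zero polynomial satisfies every bound.\<close>

definition deg_lt :: "nat \<Rightarrow> nat \<Rightarrow> int_mpoly \<Rightarrow> bool" where
  "deg_lt i e p \<longleftrightarrow> (\<forall>a\<in>Poly_Mapping.keys p. Poly_Mapping.lookup a i < e)"

lemma vars_in_simps [simp]:
  "vars_in V 0" "vars_in V 1" "vars_in V (frag_of a) \<longleftrightarrow> Poly_Mapping.keys a \<subseteq> V"
  "vars_in V (poly_var i) \<longleftrightarrow> i \<in> V"
  by (auto simp: vars_in_def poly_var_def)

lemma vars_in_arith [intro]:
  "vars_in V p \<Longrightarrow> vars_in V q \<Longrightarrow> vars_in V (p + q)"
  "vars_in V p \<Longrightarrow> vars_in V q \<Longrightarrow> vars_in V (p - q)"
  "vars_in V p \<Longrightarrow> vars_in V q \<Longrightarrow> vars_in V (p * q)"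
  "vars_in V p \<Longrightarrow> vars_in V (- p)"
  unfolding vars_in_def
  by (blast elim: keys_addE, blast elim: keys_diffE, fastforce elim!: keys_multE simp: keys_add_nat, simp)

lemma vars_in_power [intro]: "vars_in V p \<Longrightarrow> vars_in V (p ^ n)"
  by (induction n) auto

lemma vars_in_sum [intro]: "(\<And>i. i \<in> S \<Longrightarrow> vars_in V (f i)) \<Longrightarrow> vars_in V (sum f S)"
  by (induction S rule: infinite_finite_induct) auto

lemma vars_in_mono: "vars_in V p \<Longrightarrow> V \<subseteq> W \<Longrightarrow> vars_in W p"
  unfolding vars_in_def by blast

lemma deg_lt_simps [simp]:
  "deg_lt i e 0" "deg_lt i e (frag_of a) \<longleftrightarrow> Poly_Mapping.lookup a i < e"
  by (auto simp: deg_lt_def)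

lemma deg_lt_arith [intro]:
  "deg_lt i e p \<Longrightarrow> deg_lt i e q \<Longrightarrow> deg_lt i e (p + q)"
  "deg_lt i e p \<Longrightarrow> deg_lt i e q \<Longrightarrow> deg_lt i e (p - q)"
  "deg_lt i e p \<Longrightarrow> deg_lt i e (- p)"
  unfolding deg_lt_def by (blast elim: keys_addE, blast elim: keys_diffE, simp)

lemma deg_lt_sum [intro]: "(\<And>i. i \<in> S \<Longrightarrow> deg_lt l e (f i)) \<Longrightarrow> deg_lt l e (sum f S)"
  by (induction S rule: infinite_finite_induct) auto

text \<open>One exponent is at most \<open>d\<close>, the other below \<open>e\<close>; only one of
  the two bounds may be strict for the sum to stay below \<open>d + e\<close>, hence the
  successor.\<close>

lemma deg_lt_mult: "deg_lt i (Suc d) p \<Longrightarrow> deg_lt i e q \<Longrightarrow> deg_lt i (d + e) (p * q)"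
  unfolding deg_lt_def by (fastforce elim!: keys_multE simp: lookup_add)

lemma deg_lt_mult_free: "deg_lt i 1 p \<Longrightarrow> deg_lt i e q \<Longrightarrow> deg_lt i e (p * q)"
  using deg_lt_mult [of i 0 p e q] by simp

lemma deg_lt_mono: "deg_lt i e p \<Longrightarrow> e \<le> e' \<Longrightarrow> deg_lt i e' p"
  unfolding deg_lt_def by fastforce

lemma deg_lt_vars_in: "vars_in V p \<Longrightarrow> i \<notin> V \<Longrightarrow> deg_lt i 1 p"
  unfolding vars_in_def deg_lt_def by (auto simp: in_keys_iff) (metis in_keys_iff subsetD)

lemma deg_lt_var_power: "deg_lt i e (poly_var l ^ n) \<longleftrightarrow> (if l = i then n < e else 0 < e)"
  by (simp add: poly_var_power lookup_single when_def)

lemma deg_lt_var: "deg_lt i e (poly_var l) \<longleftrightarrow> (if l = i then 1 < e else 0 < e)"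
  using deg_lt_var_power [of i e l 1] by simp

lemma homogeneous_simps [simp]:
  "homogeneous d 0" "homogeneous d (frag_of a) \<longleftrightarrow> monom_degree a = d"
  "homogeneous 0 1" "homogeneous 1 (poly_var i)" "homogeneous (Suc 0) (poly_var i)"
  by (auto simp: homogeneous_def poly_var_def)

lemma homogeneous_arith [intro]:
  "homogeneous d p \<Longrightarrow> homogeneous d q \<Longrightarrow> homogeneous d (p + q)"
  "homogeneous d p \<Longrightarrow> homogeneous d q \<Longrightarrow> homogeneous d (p - q)"
  "homogeneous d p \<Longrightarrow> homogeneous d (- p)"
  unfolding homogeneous_def by (blast elim: keys_addE, blast elim: keys_diffE, simp)

lemma homogeneous_mult: "homogeneous d p \<Longrightarrow> homogeneous e q \<Longrightarrow> homogeneous (d + e) (p * q)"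
  unfolding homogeneous_def by (fastforce elim!: keys_multE)

lemma homogeneous_sum [intro]: "(\<And>i. i \<in> S \<Longrightarrow> homogeneous d (f i)) \<Longrightarrow> homogeneous d (sum f S)"
  by (induction S rule: infinite_finite_induct) auto

lemma vars_in_induct [consumes 1, case_names zero monom diff]:
  assumes "vars_in V p" "Q 0" "\<And>a. Poly_Mapping.keys a \<subseteq> V \<Longrightarrow> Q (frag_of a)"
    "\<And>p q. vars_in V p \<Longrightarrow> vars_in V q \<Longrightarrow> Q p \<Longrightarrow> Q q \<Longrightarrow> Q (p - q)"
  shows "Q p"
proof -
  have "Poly_Mapping.keys p \<subseteq> {a. Poly_Mapping.keys a \<subseteq> V}" using assms(1) by (auto simp: vars_in_def)
  then show ?thesis
  proof (induction rule: frag_carrier_induct)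
    case (diff p q)
    then have "vars_in V p" "vars_in V q" by (auto simp: vars_in_def)
    then show ?case using assms(4) diff by blast
  qed (use assms(2,3) in auto)
qed

subsection \<open>The ring of polynomials in finitely many variables\<close>

lemma polys_upto_simps [simp]:
  "p \<in> carrier (polys_upto n) \<longleftrightarrow> vars_in {1..n} p" "\<one>\<^bsub>polys_upto n\<^esub> = 1" "\<zero>\<^bsub>polys_upto n\<^esub> = 0"
  "p \<oplus>\<^bsub>polys_upto n\<^esub> q = p + q" "p \<otimes>\<^bsub>polys_upto n\<^esub> q = p * q"
  by (simp_all add: polys_upto_def vars_in_def)

lemma add_monoid_polys_upto:
  "add_monoid (polys_upto n) = free_Abelian_group {a. Poly_Mapping.keys a \<subseteq> {1..n}}"
  by (auto simp: polys_upto_def free_Abelian_group_def)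

lemma cring_polys_upto: "cring (polys_upto n)"
proof (rule cringI)
  show "abelian_group (polys_upto n)"
    by (rule comm_group_abelian_groupI) (simp only: add_monoid_polys_upto abelian_free_Abelian_group)
  show "Group.comm_monoid (polys_upto n)"
    by (rule comm_monoidI) (auto simp: mult.assoc mult.commute)
qed (simp add: distrib_right)

interpretation PU: cring "polys_upto n" for n by (rule cring_polys_upto)

lemma polys_upto_uminus: "vars_in {1..n} p \<Longrightarrow> \<ominus>\<^bsub>polys_upto n\<^esub> p = - p"
  by (rule PU.minus_equality) auto

lemma polys_upto_minus: "vars_in {1..n} p \<Longrightarrow> vars_in {1..n} q \<Longrightarrow> p \<ominus>\<^bsub>polys_upto n\<^esub> q = p - q"
  by (simp add: a_minus_def polys_upto_uminus)

lemma polys_upto_hom_simps: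
  assumes A: "cring A" and h: "h \<in> ring_hom (polys_upto n) A"
  shows "vars_in {1..n} p \<Longrightarrow> vars_in {1..n} q \<Longrightarrow> h (p + q) = h p \<oplus>\<^bsub>A\<^esub> h q"
    "vars_in {1..n} p \<Longrightarrow> vars_in {1..n} q \<Longrightarrow> h (p - q) = h p \<ominus>\<^bsub>A\<^esub> h q"
    "vars_in {1..n} p \<Longrightarrow> vars_in {1..n} q \<Longrightarrow> h (p * q) = h p \<otimes>\<^bsub>A\<^esub> h q"
    "vars_in {1..n} p \<Longrightarrow> h (- p) = \<ominus>\<^bsub>A\<^esub> h p"
    "vars_in {1..n} p \<Longrightarrow> h p \<in> carrier A"
    "h 0 = \<zero>\<^bsub>A\<^esub>" "h 1 = \<one>\<^bsub>A\<^esub>"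
proof -
  note ah = ring_hom_add_hom [OF h]
  note simps = add_hom_simps [OF PU.is_abelian_group cring_abelian [OF A] ah]
  show "vars_in {1..n} p \<Longrightarrow> vars_in {1..n} q \<Longrightarrow> h (p + q) = h p \<oplus>\<^bsub>A\<^esub> h q"
    using simps(2) [of p q] by simp
  show "vars_in {1..n} p \<Longrightarrow> vars_in {1..n} q \<Longrightarrow> h (p - q) = h p \<ominus>\<^bsub>A\<^esub> h q"
    using simps(5) [of p q] by (simp add: polys_upto_minus)
  show "vars_in {1..n} p \<Longrightarrow> vars_in {1..n} q \<Longrightarrow> h (p * q) = h p \<otimes>\<^bsub>A\<^esub> h q"
    using ring_hom_mult [OF h, of p q] by simp
  show "vars_in {1..n} p \<Longrightarrow> h (- p) = \<ominus>\<^bsub>A\<^esub> h p"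
    using simps(4) [of p] by (simp add: polys_upto_uminus)
  show "vars_in {1..n} p \<Longrightarrow> h p \<in> carrier A"
    using simps(1) [of p] by simp
  show "h 0 = \<zero>\<^bsub>A\<^esub>" "h 1 = \<one>\<^bsub>A\<^esub>"
    using simps(3) ring_hom_one [OF h] by simp_all
qed

lemma polys_upto_hom_eq:
  assumes A: "cring A" and h: "h \<in> ring_hom (polys_upto n) A" and g: "g \<in> ring_hom (polys_upto n) A"
    and eq: "\<And>i. i \<in> {1..n} \<Longrightarrow> h (poly_var i) = g (poly_var i)" and p: "vars_in {1..n} p"
  shows "h p = g p"
proof -
  note hs = polys_upto_hom_simps [OF A h] and gs = polys_upto_hom_simps [OF A g]
  have mono: "h (frag_of a) = g (frag_of a)" if "Poly_Mapping.keys a \<subseteq> {1..n}" for a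
    using that
  proof (induction a rule: monom_induct)
    case zero
    show ?case by (simp add: frag_of_zero hs gs)
  next
    case (add b i)
    have "frag_of (b + Poly_Mapping.single i 1) = frag_of b * poly_var i"
      by (simp add: poly_var_def mult_single)
    then show ?case using add eq [OF add(2)] by (simp add: hs gs)
  qed
  show ?thesis using p
    by (induction rule: vars_in_induct) (simp_all add: mono hs gs)
qed

text \<open>The polynomial ring is additively free on the monomials, so sending a monomial to the
  product of powers of the \<open>y i\<close> extends additively; multiplicativity reduces to
  monomials, where exponents add.\<close>

theorem polys_upto_universal:
  fixes A :: "('c, 'm) ring_scheme"
  assumes A: "cring A" and y: "\<And>i. i \<in> {1..n} \<Longrightarrow> y i \<in> carrier A"
  obtains h where "h \<in> ring_hom (polys_upto n) A" "\<And>i. i \<in> {1..n} \<Longrightarrow> h (poly_var i) = y i"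
proof -
  interpret A: cring A by fact
  let ?S = "{a :: nat \<Rightarrow>\<^sub>0 nat. Poly_Mapping.keys a \<subseteq> {1..n}}"
  define m where "m a = finprod A (\<lambda>i. y i [^]\<^bsub>A\<^esub> (Poly_Mapping.lookup a i)) {1..n}" for a :: "nat \<Rightarrow>\<^sub>0 nat"
  have pc: "y i [^]\<^bsub>A\<^esub> (e :: nat) \<in> carrier A" if "i \<in> {1..n}" for i e
    using y [OF that] by simp
  have mc: "m a \<in> carrier A" for a
    unfolding m_def by (intro A.finprod_closed funcsetI pc)
  then have "m ` ?S \<subseteq> carrier (add_monoid A)" by auto
  from comm_group.free_Abelian_group_universal [OF A.a_comm_group this]
  obtain h where h: "h \<in> hom (add_monoid (polys_upto n)) (add_monoid A)"
    and hm: "\<And>a. a \<in> ?S \<Longrightarrow> h (frag_of a) = m a"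
    unfolding add_monoid_polys_upto by blast
  note hs = add_hom_simps [OF PU.is_abelian_group A.is_abelian_group h]
  have hd: "h (p - q) = h p \<ominus>\<^bsub>A\<^esub> h q" if "vars_in {1..n} p" "vars_in {1..n} q" for p q
    using hs(5) [of p q] that by (simp add: polys_upto_minus)
  have m_add: "m (a + b) = m a \<otimes>\<^bsub>A\<^esub> m b" for a b
  proof -
    have "m (a + b) = finprod A (\<lambda>i. y i [^]\<^bsub>A\<^esub> (Poly_Mapping.lookup a i) \<otimes>\<^bsub>A\<^esub> y i [^]\<^bsub>A\<^esub> (Poly_Mapping.lookup b i)) {1..n}"
      unfolding m_def using y pc
      by (intro A.finprod_cong' [OF refl]) (auto simp: lookup_add A.nat_pow_mult)
    also have "\<dots> = m a \<otimes>\<^bsub>A\<^esub> m b"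
      unfolding m_def by (intro A.finprod_multf funcsetI pc)
    finally show ?thesis .
  qed
  have h0: "h 0 = \<zero>\<^bsub>A\<^esub>" using hs(3) by simp
  have hc: "h p \<in> carrier A" if "vars_in {1..n} p" for p using hs(1) [of p] that by simp
  have h_mult: "h (p * q) = h p \<otimes>\<^bsub>A\<^esub> h q" if p: "vars_in {1..n} p" and q: "vars_in {1..n} q" for p q
    using p
  proof (induction rule: vars_in_induct)
    case zero
    show ?case using hc [OF q] by (simp add: h0)
  next
    case (monom a)
    show ?case using q
    proof (induction rule: vars_in_induct)
      case zero
      show ?case using mc monom by (simp add: h0 hm)
    next
      case (monom b)
      have "a + b \<in> ?S" using monom \<open>Poly_Mapping.keys a \<subseteq> _\<close> by (simp add: keys_add_nat)
      then show ?case using monom \<open>Poly_Mapping.keys a \<subseteq> _\<close> by (simp only: frag_of_mult hm m_add mem_Collect_eq)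
    next
      case (diff p q)
      then have "vars_in {1..n} (frag_of a * p)" "vars_in {1..n} (frag_of a * q)"
        using monom by auto
      then show ?case using diff hc mc monom
        by (simp add: right_diff_distrib hd hm A.minus_eq A.r_distr A.r_minus)
    qed
  next
    case (diff p p')
    then have "vars_in {1..n} (p * q)" "vars_in {1..n} (p' * q)" using q by auto
    then show ?case using diff hc [OF diff(1)] hc [OF diff(2)] hc [OF q]
      by (simp add: left_diff_distrib hd A.minus_eq A.l_distr A.l_minus)
  qed
  have "m 0 = \<one>\<^bsub>A\<^esub>" unfolding m_def by (intro A.finprod_one_eqI) simp
  then have h1: "h 1 = \<one>\<^bsub>A\<^esub>" using hm [of 0] by (simp add: frag_of_zero)
  show thesis
  proof
    show "h \<in> ring_hom (polys_upto n) A"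
    proof (rule ring_hom_memI)
      show "h (p \<oplus>\<^bsub>polys_upto n\<^esub> q) = h p \<oplus>\<^bsub>A\<^esub> h q" if "p \<in> carrier (polys_upto n)" "q \<in> carrier (polys_upto n)" for p q
        using that by (rule hs(2))
    qed (simp_all add: hc h_mult h1)
    fix i assume i: "i \<in> {1..n}"
    have "h (poly_var i) = m (Poly_Mapping.single i 1)"
      unfolding poly_var_def using i by (intro hm) auto
    also have "\<dots> = finprod A (\<lambda>j. if i = j then y j else \<one>\<^bsub>A\<^esub>) {1..n}"
      unfolding m_def using y by (intro A.finprod_cong' [OF refl]) (auto simp: lookup_single when_def)
    also have "\<dots> = y i"
      using i y by (intro A.finprod_singleton) auto
    finally show "h (poly_var i) = y i" .
  qed
qed

subsection \<open>Complete homogeneous symmetric polynomials\<close>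

text \<open>\<open>hpoly k m i\<close> is the complete homogeneous symmetric polynomial of degree \<open>m\<close> in the variables
  with the numbers \<open>k + 1, \<dots>, k + i\<close>.\<close>

fun hpoly :: "nat \<Rightarrow> nat \<Rightarrow> nat \<Rightarrow> int_mpoly" where
  "hpoly k 0 i = 1"
| "hpoly k (Suc m) 0 = 0"
| "hpoly k (Suc m) (Suc i) = hpoly k (Suc m) i + poly_var (k + Suc i) * hpoly k m (Suc i)"

text \<open>The values of complete homogeneous symmetric polynomials at elements of a ring, by the
  same recursion as \<open>hpoly\<close> with offset 0. The relations of a partition can thus be
  stated in any ring.\<close>

fun csym :: "('a, 'm) ring_scheme \<Rightarrow> (nat \<Rightarrow> 'a) \<Rightarrow> nat \<Rightarrow> nat \<Rightarrow> 'a" where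
  "csym A y 0 i = \<one>\<^bsub>A\<^esub>"
| "csym A y (Suc m) 0 = \<zero>\<^bsub>A\<^esub>"
| "csym A y (Suc m) (Suc i) = csym A y (Suc m) i \<oplus>\<^bsub>A\<^esub> y (Suc i) \<otimes>\<^bsub>A\<^esub> csym A y m (Suc i)"

definition monoms :: "nat \<Rightarrow> nat \<Rightarrow> (nat \<Rightarrow>\<^sub>0 nat) set" where
  "monoms m i = {a. Poly_Mapping.keys a \<subseteq> {1..i} \<and> monom_degree a = m}"

lemma complete_sym_monoms: "complete_sym m i = (\<Sum>a\<in>monoms m i. frag_of a)"
  by (simp only: complete_sym_def monoms_def)

lemma monoms_0: "monoms 0 i = {0}"
proof -
  have "a = 0" if "monom_degree a = 0" for a
  proof (rule poly_mapping_eqI)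
    show "Poly_Mapping.lookup a j = Poly_Mapping.lookup 0 j" for j
      using that by (cases "j \<in> Poly_Mapping.keys a") (auto simp: monom_degree_def in_keys_iff)
  qed
  then show ?thesis by (auto simp: monoms_def)
qed

lemma monoms_Suc_0: "monoms (Suc m) 0 = {}"
  by (auto simp: monoms_def monom_degree_def)

text \<open>Monomials are split according to whether the last variable occurs; this is the recursion
  of \<open>hpoly\<close>.\<close>

lemma monoms_Suc_Suc:
  "monoms (Suc m) (Suc i) = monoms (Suc m) i \<union> (\<lambda>b. Poly_Mapping.single (Suc i) 1 + b) ` monoms m (Suc i)"
proof (intro equalityI subsetI)
  fix a assume a: "a \<in> monoms (Suc m) (Suc i)"
  show "a \<in> monoms (Suc m) i \<union> (\<lambda>b. Poly_Mapping.single (Suc i) 1 + b) ` monoms m (Suc i)"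
  proof (cases "Suc i \<in> Poly_Mapping.keys a")
    case True
    define b where "b = a - Poly_Mapping.single (Suc i) 1"
    have ab: "a = Poly_Mapping.single (Suc i) 1 + b"
      using True by (intro poly_mapping_eqI) (auto simp: b_def lookup_add lookup_minus lookup_single when_def in_keys_iff)
    have "b \<in> monoms m (Suc i)"
      using a unfolding ab monoms_def by (auto simp: keys_add_nat)
    then show ?thesis using ab by blast
  next
    case False
    then have "Poly_Mapping.keys a \<subseteq> {1..i}"
      using a by (fastforce simp: monoms_def le_Suc_eq)
    then show ?thesis using a by (simp add: monoms_def)
  qed
qed (auto simp: monoms_def keys_add_nat)

text \<open>Finiteness is proved along, because splitting the sum over the two classes of monomials
  requires finite index sets.\<close>

lemma complete_sym_hpoly: "finite (monoms m i) \<and> complete_sym m i = hpoly 0 m i"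
proof (induction "0::nat" m i rule: hpoly.induct)
  case (1 i)
  show ?case by (simp add: complete_sym_monoms monoms_0 frag_of_zero)
next
  case (2 m)
  show ?case by (simp add: complete_sym_monoms monoms_Suc_0)
next
  case (3 m i)
  have disj: "monoms (Suc m) i \<inter> (\<lambda>b. Poly_Mapping.single (Suc i) 1 + b) ` monoms m (Suc i) = {}"
    by (auto simp: monoms_def keys_add_nat)
  have inj: "inj_on (\<lambda>b. Poly_Mapping.single (Suc i) (1::nat) + b) (monoms m (Suc i))"
    by (intro inj_onI) simp
  have "complete_sym (Suc m) (Suc i) = (\<Sum>a\<in>monoms (Suc m) i. frag_of a)
     + (\<Sum>a\<in>(\<lambda>b. Poly_Mapping.single (Suc i) 1 + b) ` monoms m (Suc i). frag_of a)"
    unfolding complete_sym_monoms monoms_Suc_Suc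
    using 3 disj by (intro sum.union_disjoint) auto
  also have "(\<Sum>a\<in>(\<lambda>b. Poly_Mapping.single (Suc i) 1 + b) ` monoms m (Suc i). frag_of a)
     = (\<Sum>b\<in>monoms m (Suc i). poly_var (Suc i) * frag_of b)"
    using inj by (subst sum.reindex) (simp_all add: poly_var_def mult_single)
  also have "\<dots> = poly_var (Suc i) * complete_sym m (Suc i)"
    by (simp add: complete_sym_monoms sum_distrib_left)
  also have "(\<Sum>a\<in>monoms (Suc m) i. frag_of a) = complete_sym (Suc m) i"
    by (simp only: complete_sym_monoms)
  finally show ?case using 3 by (simp add: monoms_Suc_Suc)
qed

lemma hpoly_vars_in: "vars_in {k + 1..k + i} (hpoly k m i)"
proof (induction k m i rule: hpoly.induct)
  case (3 k m i)
  have "vars_in {k + 1..k + Suc i} (hpoly k (Suc m) i)"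
    by (rule vars_in_mono [OF 3(1)]) auto
  then show ?case using 3(2) by (auto intro!: vars_in_arith)
qed simp_all

lemma hpoly_vars: "k + i \<le> n \<Longrightarrow> vars_in {1..n} (hpoly k m i)"
  by (rule vars_in_mono [OF hpoly_vars_in]) auto

lemma hpoly_homogeneous: "homogeneous m (hpoly k m i)"
proof (induction k m i rule: hpoly.induct)
  case (3 k m i)
  then show ?case using homogeneous_mult [of 1 "poly_var (k + Suc i)" m] by auto
qed simp_all

text \<open>Sorting by powers of the last variable shows that the polynomial is monic of degree
  \<open>m\<close> in it, which permits division over the integers.\<close>

lemma hpoly_expand:
  "hpoly k m (Suc i) = (\<Sum>j\<le>m. hpoly k j i * poly_var (k + Suc i) ^ (m - j))"
proof (induction m)
  case (Suc m)
  have "poly_var (k + Suc i) * (\<Sum>j\<le>m. hpoly k j i * poly_var (k + Suc i) ^ (m - j))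
    = (\<Sum>j\<le>m. hpoly k j i * poly_var (k + Suc i) ^ (Suc m - j))"
    by (simp add: sum_distrib_left Suc_diff_le mult_ac)
  then show ?case using Suc by (simp add: add.commute)
qed simp

lemma hom_hpoly:
  assumes A: "cring A" and h: "h \<in> ring_hom (polys_upto n) A"
    and y: "\<And>l. l \<in> {1..n} \<Longrightarrow> h (poly_var l) = y l" and n: "k + i \<le> n"
  shows "h (hpoly k m i) = csym A (\<lambda>l. y (k + l)) m i"
  using n
proof (induction k m i rule: hpoly.induct)
  case (3 k m i)
  have "k + Suc i \<in> {1..n}" using 3(3) by simp
  have v: "vars_in {1..n} (hpoly k (Suc m) i)" "vars_in {1..n} (poly_var (k + Suc i))"
    "vars_in {1..n} (hpoly k m (Suc i))"
    using 3(3) by (simp_all add: hpoly_vars [simplified])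
  then show ?case
    using 3 y [of "k + Suc i"] polys_upto_hom_simps(1) [OF A h v(1) vars_in_arith(3) [OF v(2,3)]]
      polys_upto_hom_simps(3) [OF A h v(2,3)] by simp
qed (simp_all add: polys_upto_hom_simps [OF A h])

subsection \<open>Division by a complete homogeneous symmetric polynomial\<close>

text \<open>\<open>rem d i e\<close> is the remainder of the \<open>e\<close>-th power of the variable \<open>i\<close> modulo \<open>hpoly 0 d i\<close>, which is
  monic of degree \<open>d\<close> in that variable: the relation
  \<open>\<Sum>j\<le>d. h\<^sub>j(i - 1) * x\<^sub>i ^ (d - j)\<close> turns into a linear recurrence.\<close>

function rem :: "nat \<Rightarrow> nat \<Rightarrow> nat \<Rightarrow> int_mpoly" where
  "rem d i e = (if e < d then poly_var i ^ e else - (\<Sum>j\<in>{1..d}. hpoly 0 j (i - 1) * rem d i (e - j)))"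
  by auto
termination by (relation "Wellfounded.measure (\<lambda>(d, i, e). e)") auto

declare rem.simps [simp del]

lemma rem_small: "e < d \<Longrightarrow> rem d i e = poly_var i ^ e"
  by (simp add: rem.simps)

lemma rem_large: "d \<le> e \<Longrightarrow> rem d i e = - (\<Sum>j\<in>{1..d}. hpoly 0 j (i - 1) * rem d i (e - j))"
  by (simp add: rem.simps [of d i e])

lemma rem_recurrence: "(\<Sum>j\<le>d. hpoly 0 j (i - 1) * rem d i (e + d - j)) = 0"
proof -
  have "{..d} = insert 0 {1..d}" by auto
  then show ?thesis using rem_large [of d "e + d" i] by simp
qed

text \<open>The remainder on division by \<open>hpoly 0 d i\<close>, a monic polynomial in the
  variable \<open>i\<close> with coefficients in the other variables. Given on monomials and
  extended additively, it is additive by construction.\<close>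

definition rho :: "nat \<Rightarrow> nat \<Rightarrow> int_mpoly \<Rightarrow> int_mpoly" where
  "rho d i = frag_extend (\<lambda>a. frag_of (Poly_Mapping.update i 0 a) * rem d i (Poly_Mapping.lookup a i))"

lemma rho_add: "rho d i (p + q) = rho d i p + rho d i q"
  and rho_diff: "rho d i (p - q) = rho d i p - rho d i q"
  and rho_zero [simp]: "rho d i 0 = 0"
  and rho_frag: "rho d i (frag_of a) = frag_of (Poly_Mapping.update i 0 a) * rem d i (Poly_Mapping.lookup a i)"
  by (simp_all add: rho_def frag_extend_add frag_extend_diff)

lemma rho_sum: "rho d i (sum f S) = (\<Sum>s\<in>S. rho d i (f s))"
  by (induction S rule: infinite_finite_induct) (simp_all add: rho_add)

lemma deg_lt_induct [consumes 1, case_names zero monom diff]: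
  assumes "deg_lt i e p" "Q 0" "\<And>a. Poly_Mapping.lookup a i < e \<Longrightarrow> Q (frag_of a)"
    "\<And>p q. deg_lt i e p \<Longrightarrow> deg_lt i e q \<Longrightarrow> Q p \<Longrightarrow> Q q \<Longrightarrow> Q (p - q)"
  shows "Q p"
proof -
  have "Poly_Mapping.keys p \<subseteq> {a. Poly_Mapping.lookup a i < e}" using assms(1) by (auto simp: deg_lt_def)
  then show ?thesis
  proof (induction rule: frag_carrier_induct)
    case (diff p q)
    then have "deg_lt i e p" "deg_lt i e q" by (auto simp: deg_lt_def)
    then show ?case using assms(4) diff by blast
  qed (use assms(2,3) in auto)
qed

lemma poly_induct [case_names zero monom diff]:
  assumes "Q 0" "\<And>a. Q (frag_of a)" "\<And>p q. Q p \<Longrightarrow> Q q \<Longrightarrow> Q (p - q)"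
  shows "Q (p :: int_mpoly)"
proof -
  have "Poly_Mapping.keys p \<subseteq> UNIV" by simp
  then show ?thesis by (induction rule: frag_carrier_induct) (use assms in auto)
qed

lemma update_add:
  "Poly_Mapping.lookup a i = 0 \<Longrightarrow> Poly_Mapping.update i 0 (a + b) = a + Poly_Mapping.update i 0 (b :: nat \<Rightarrow>\<^sub>0 nat)"
  by (intro poly_mapping_eqI) (auto simp: lookup_update lookup_add)

lemma split_var: "frag_of (Poly_Mapping.update i 0 a) * poly_var i ^ Poly_Mapping.lookup a i = frag_of (a :: nat \<Rightarrow>\<^sub>0 nat)"
proof -
  have "Poly_Mapping.update i 0 a + Poly_Mapping.single i (Poly_Mapping.lookup a i) = a"
    by (intro poly_mapping_eqI) (auto simp: lookup_update lookup_add lookup_single when_def)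
  then show ?thesis by (simp add: poly_var_power frag_of_mult del: mult_single)
qed

text \<open>The factor \<open>q\<close> lies in the coefficient ring, over which the remainder is
  linear.\<close>

lemma rho_mult_free:
  assumes "deg_lt i 1 q"
  shows "rho d i (q * p) = q * rho d i p"
  using assms
proof (induction rule: deg_lt_induct)
  case (monom a)
  then have a: "Poly_Mapping.lookup a i = 0" by simp
  show ?case
  proof (induction p rule: poly_induct)
    case (monom b)
    have e: "Poly_Mapping.lookup (a + b) i = Poly_Mapping.lookup b i" by (simp add: lookup_add a)
    have "rho d i (frag_of a * frag_of b)
        = frag_of (a + Poly_Mapping.update i 0 b) * rem d i (Poly_Mapping.lookup b i)"
      by (simp only: frag_of_mult rho_frag e update_add [OF a])
    also have "\<dots> = frag_of a * frag_of (Poly_Mapping.update i 0 b) * rem d i (Poly_Mapping.lookup b i)"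
      by (simp only: frag_of_mult)
    finally show ?case by (simp only: rho_frag mult.assoc)
  qed (simp_all add: right_diff_distrib rho_diff)
qed (simp_all add: left_diff_distrib rho_diff)

lemma rho_var_power: "rho d i (poly_var i ^ e) = rem d i e"
proof -
  have "Poly_Mapping.update i 0 (Poly_Mapping.single i e) = (0 :: nat \<Rightarrow>\<^sub>0 nat)"
    by (intro poly_mapping_eqI) (auto simp: lookup_update lookup_single when_def)
  then show ?thesis by (simp add: poly_var_power rho_frag frag_of_zero)
qed

text \<open>Once the other variables are split off, a multiple of the divisor is a power of the
  variable \<open>i\<close> times the sum in \<open>hpoly_expand\<close>; termwise remainders turn
  this into the vanishing sum of \<open>rem_recurrence\<close>.\<close>

lemma rho_kills:
  assumes "0 < i"
  shows "rho d i (p * hpoly 0 d i) = 0"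
proof (induction p rule: poly_induct)
  case (monom a)
  define b where "b = frag_of (Poly_Mapping.update i 0 a)"
  have b: "deg_lt i 1 b" by (simp add: b_def lookup_update)
  obtain i' where i': "i = Suc i'" using assms by (cases i) auto
  have h: "deg_lt i 1 (hpoly 0 j i')" for j
    using deg_lt_vars_in [OF hpoly_vars_in [of 0 i' j], of i] i' by simp
  have "frag_of a * hpoly 0 d i = b * poly_var i ^ Poly_Mapping.lookup a i * (\<Sum>j\<le>d. hpoly 0 j i' * poly_var i ^ (d - j))"
    unfolding b_def split_var i' hpoly_expand by simp
  also have "\<dots> = (\<Sum>j\<le>d. b * (hpoly 0 j i' * poly_var i ^ (Poly_Mapping.lookup a i + d - j)))"
    unfolding sum_distrib_left
  proof (rule sum.cong [OF refl])
    fix j assume "j \<in> {..d}"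
    then have "poly_var i ^ (Poly_Mapping.lookup a i + d - j) = poly_var i ^ Poly_Mapping.lookup a i * poly_var i ^ (d - j)"
      by (simp add: power_add [symmetric])
    then show "b * poly_var i ^ Poly_Mapping.lookup a i * (hpoly 0 j i' * poly_var i ^ (d - j))
      = b * (hpoly 0 j i' * poly_var i ^ (Poly_Mapping.lookup a i + d - j))" by (simp add: mult_ac)
  qed
  also have "rho d i \<dots> = (\<Sum>j\<le>d. b * (hpoly 0 j i' * rem d i (Poly_Mapping.lookup a i + d - j)))"
    by (simp add: rho_sum rho_mult_free [OF b] rho_mult_free [OF h] rho_var_power)
  also have "\<dots> = b * (\<Sum>j\<le>d. hpoly 0 j (i - 1) * rem d i (Poly_Mapping.lookup a i + d - j))"
    by (simp add: i' sum_distrib_left)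
  also have "\<dots> = 0" unfolding rem_recurrence by simp
  finally show ?case .
qed (simp_all add: left_diff_distrib rho_diff)

lemma rho_id:
  assumes "deg_lt i d p" shows "rho d i p = p"
  using assms
  by (induction rule: deg_lt_induct) (simp_all add: rho_frag rem_small split_var rho_diff)

lemma rem_vars: "0 < i \<Longrightarrow> vars_in {1..i} (rem d i e)"
proof (induction d i e rule: rem.induct)
  case (1 d i e)
  have "vars_in {1..i} (hpoly 0 j (i - 1))" for j using hpoly_vars [of 0 "i - 1" i] by simp
  then show ?case using 1
    by (subst rem.simps) (auto intro!: vars_in_arith vars_in_sum vars_in_power)
qed

lemma rem_deg: "0 < i \<Longrightarrow> deg_lt i d (rem d i e)"
proof (induction d i e rule: rem.induct)
  case (1 d i e)
  have "deg_lt i 1 (hpoly 0 j (i - 1))" for j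
    using deg_lt_vars_in [OF hpoly_vars_in [of 0 "i - 1" j], of i] 1(2) by simp
  then show ?case using 1
    by (subst rem.simps) (auto intro!: deg_lt_arith deg_lt_sum deg_lt_mult_free simp: deg_lt_var_power)
qed

lemma rem_homogeneous: "homogeneous e (rem d i e)"
proof (induction d i e rule: rem.induct)
  case (1 d i e)
  have "homogeneous e (hpoly 0 j (i - 1) * rem d i (e - j))" if "j \<in> {1..d}" "\<not> e < d" for j
    using homogeneous_mult [OF hpoly_homogeneous 1 [OF that(2,1)], of j 0 "i - 1"] that by simp
  then show ?case
    by (subst rem.simps) (auto intro!: homogeneous_arith homogeneous_sum simp: poly_var_power)
qed

text \<open>Every value is an integral combination of the replaced monomials of \<open>p\<close>, so
  a property closed under differences can be checked on these.\<close>

lemma rho_closed: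
  assumes "Q 0" "\<And>p q. Q p \<Longrightarrow> Q q \<Longrightarrow> Q (p - q)"
    and "\<And>a. a \<in> Poly_Mapping.keys p \<Longrightarrow> Q (frag_of (Poly_Mapping.update i 0 a) * rem d i (Poly_Mapping.lookup a i))"
  shows "Q (rho d i p)"
proof -
  have "Poly_Mapping.keys p \<subseteq> Poly_Mapping.keys p" ..
  then show ?thesis
    by (induction rule: frag_carrier_induct) (use assms in \<open>simp_all add: rho_frag rho_diff\<close>)
qed

lemma rho_deg: "0 < i \<Longrightarrow> deg_lt i d (rho d i p)"
  by (rule rho_closed [of "deg_lt i d"])
    (auto intro!: deg_lt_mult_free rem_deg simp: lookup_update)

text \<open>The remainders involve only variables up to \<open>i\<close>, so a division in the
  variable \<open>i\<close> does not disturb degree bounds in later variables.\<close>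

lemma rho_deg_other:
  assumes "0 < i" "i < l" "deg_lt l e p"
  shows "deg_lt l e (rho d i p)"
proof (rule rho_closed [of "deg_lt l e"])
  fix a assume "a \<in> Poly_Mapping.keys p"
  then have "Poly_Mapping.lookup a l < e" using assms(3) by (simp add: deg_lt_def)
  then have "deg_lt l e (rem d i (Poly_Mapping.lookup a i) * frag_of (Poly_Mapping.update i 0 a))"
    using assms deg_lt_vars_in [OF rem_vars [OF assms(1)], of l]
    by (intro deg_lt_mult_free) (auto simp: lookup_update)
  then show "deg_lt l e (frag_of (Poly_Mapping.update i 0 a) * rem d i (Poly_Mapping.lookup a i))"
    by (simp add: mult.commute)
qed auto

lemma rho_homogeneous:
  assumes "homogeneous n p"
  shows "homogeneous n (rho d i p)"
proof (rule rho_closed [of "homogeneous n"])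
  fix a assume "a \<in> Poly_Mapping.keys p"
  then have n: "monom_degree a = n" using assms by (simp add: homogeneous_def)
  have "a = Poly_Mapping.update i 0 a + Poly_Mapping.single i (Poly_Mapping.lookup a i)"
    by (intro poly_mapping_eqI) (auto simp: lookup_update lookup_add lookup_single when_def)
  then have "monom_degree (Poly_Mapping.update i 0 a) + Poly_Mapping.lookup a i = n"
    using n by (metis monom_degree_add monom_degree_single)
  then show "homogeneous n (frag_of (Poly_Mapping.update i 0 a) * rem d i (Poly_Mapping.lookup a i))"
    using homogeneous_mult [of "monom_degree (Poly_Mapping.update i 0 a)" "frag_of (Poly_Mapping.update i 0 a)",
        OF _ rem_homogeneous [of "Poly_Mapping.lookup a i" d i]] by simp
qed auto

lemma keys_update_subset: "Poly_Mapping.keys (Poly_Mapping.update i 0 a) \<subseteq> Poly_Mapping.keys a"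
  by (auto simp: in_keys_iff lookup_update split: if_splits)

lemma rho_vars:
  assumes "0 < i" "i \<le> n" "vars_in {1..n} p"
  shows "vars_in {1..n} (rho d i p)"
proof (rule rho_closed [of "vars_in {1..n}"])
  fix a assume "a \<in> Poly_Mapping.keys p"
  then have "Poly_Mapping.keys (Poly_Mapping.update i 0 a) \<subseteq> {1..n}"
    using keys_update_subset [of i a] assms(3) by (auto simp: vars_in_def)
  moreover have "vars_in {1..n} (rem d i (Poly_Mapping.lookup a i))"
    by (rule vars_in_mono [OF rem_vars]) (use assms in auto)
  ultimately show "vars_in {1..n} (frag_of (Poly_Mapping.update i 0 a) * rem d i (Poly_Mapping.lookup a i))"
    by (intro vars_in_arith) auto
qed auto

text \<open>Powers and remainders satisfy the same recurrence up to the multiple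
  \<open>hpoly 0 d i * poly_var i ^ (e - d)\<close> of the divisor, so their difference is a
  multiple of it by induction.\<close>

lemma power_minus_rem:
  assumes "0 < i" "i \<le> n"
  shows "\<exists>q. vars_in {1..n} q \<and> poly_var i ^ e - rem d i e = hpoly 0 d i * q"
  using assms
proof (induction d i e rule: rem.induct)
  case (1 d i e)
  show ?case
  proof (cases "e < d")
    case True
    then show ?thesis by (intro exI [of _ 0]) (simp add: rem_small)
  next
    case False
    obtain i' where i': "i = Suc i'" using 1 by (cases i) auto
    have "\<forall>j\<in>{1..d}. \<exists>q. vars_in {1..n} q \<and> poly_var i ^ (e - j) - rem d i (e - j) = hpoly 0 d i * q"
      using 1 False by blast
    then obtain q where q: "\<And>j. j \<in> {1..d} \<Longrightarrow> vars_in {1..n} (q j)"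
      "\<And>j. j \<in> {1..d} \<Longrightarrow> poly_var i ^ (e - j) - rem d i (e - j) = hpoly 0 d i * q j" by metis
    have "hpoly 0 d i * poly_var i ^ (e - d) = (\<Sum>j\<le>d. hpoly 0 j i' * poly_var i ^ (e - j))"
      unfolding i' hpoly_expand sum_distrib_right
    proof (rule sum.cong [OF refl])
      fix j assume "j \<in> {..d}"
      then have "poly_var (Suc i') ^ (e - j) = poly_var (Suc i') ^ (d - j) * poly_var (Suc i') ^ (e - d)"
        using False by (simp add: power_add [symmetric])
      then show "hpoly 0 j i' * poly_var (0 + Suc i') ^ (d - j) * poly_var (Suc i') ^ (e - d) =
        hpoly 0 j i' * poly_var (Suc i') ^ (e - j)" by (simp add: mult_ac)
    qed
    also have "{..d} = insert 0 {1..d}" by auto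
    finally have "poly_var i ^ e = hpoly 0 d i * poly_var i ^ (e - d) - (\<Sum>j\<in>{1..d}. hpoly 0 j i' * poly_var i ^ (e - j))"
      by simp
    moreover have "rem d i e = - (\<Sum>j\<in>{1..d}. hpoly 0 j i' * rem d i (e - j))"
      using rem_large [of d e i] False i' by simp
    ultimately have "poly_var i ^ e - rem d i e = hpoly 0 d i * poly_var i ^ (e - d)
       - (\<Sum>j\<in>{1..d}. hpoly 0 j i' * (poly_var i ^ (e - j) - rem d i (e - j)))"
      by (simp add: right_diff_distrib sum_subtractf)
    also have "(\<Sum>j\<in>{1..d}. hpoly 0 j i' * (poly_var i ^ (e - j) - rem d i (e - j)))
       = hpoly 0 d i * (\<Sum>j\<in>{1..d}. hpoly 0 j i' * q j)"
      using q(2) by (simp add: sum_distrib_left mult_ac)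
    finally have "poly_var i ^ e - rem d i e
       = hpoly 0 d i * (poly_var i ^ (e - d) - (\<Sum>j\<in>{1..d}. hpoly 0 j i' * q j))"
      by (simp add: right_diff_distrib)
    moreover have "vars_in {1..n} (poly_var i ^ (e - d) - (\<Sum>j\<in>{1..d}. hpoly 0 j i' * q j))"
      using q(1) 1 i' hpoly_vars [of 0 i' n]
      by (intro vars_in_arith vars_in_power vars_in_sum) auto
    ultimately show ?thesis by blast
  qed
qed

lemma minus_rho:
  assumes i: "0 < i" "i \<le> n" and p: "vars_in {1..n} p"
  shows "\<exists>q. vars_in {1..n} q \<and> p - rho d i p = hpoly 0 d i * q"
  using p
proof (induction rule: vars_in_induct)
  case zero
  show ?case by (intro exI [of _ 0]) simp
next
  case (monom a)
  obtain q where q: "vars_in {1..n} q" "poly_var i ^ Poly_Mapping.lookup a i - rem d i (Poly_Mapping.lookup a i) = hpoly 0 d i * q"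
    using power_minus_rem [OF i] by blast
  let ?b = "frag_of (Poly_Mapping.update i 0 a)"
  have "frag_of a - rho d i (frag_of a) = ?b * (poly_var i ^ Poly_Mapping.lookup a i - rem d i (Poly_Mapping.lookup a i))"
    by (simp add: rho_frag right_diff_distrib split_var)
  also have "\<dots> = hpoly 0 d i * (?b * q)" unfolding q(2) by (simp add: mult_ac)
  finally have "frag_of a - rho d i (frag_of a) = hpoly 0 d i * (?b * q)" .
  moreover have "vars_in {1..n} (?b * q)"
    using q(1) monom keys_update_subset [of i a] by (intro vars_in_arith) auto
  ultimately show ?case by blast
next
  case (diff p q)
  then obtain u v where "vars_in {1..n} u" "p - rho d i p = hpoly 0 d i * u"
    "vars_in {1..n} v" "q - rho d i q = hpoly 0 d i * v" by blast
  then have "vars_in {1..n} (u - v)" "(p - q) - rho d i (p - q) = hpoly 0 d i * (u - v)"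
    by (auto simp: rho_diff algebra_simps)
  then show ?case by blast
qed

section \<open>Normal forms modulo all the relations\<close>

primrec nf :: "(nat \<Rightarrow> nat) \<Rightarrow> nat \<Rightarrow> int_mpoly \<Rightarrow> int_mpoly" where
  "nf dd 0 p = p"
| "nf dd (Suc i) p = nf dd i (rho (dd (Suc i)) (Suc i) p)"

lemma nf_zero [simp]: "nf dd n 0 = 0"
  by (induction n) simp_all

lemma nf_add: "nf dd n (p + q) = nf dd n p + nf dd n q"
  by (induction n arbitrary: p q) (simp_all add: rho_add)

lemma nf_diff: "nf dd n (p - q) = nf dd n p - nf dd n q"
  by (induction n arbitrary: p q) (simp_all add: rho_diff)

text \<open>Divisions in later variables commute with the factor \<open>hpoly 0 (dd i) i\<close>,
  which does not contain them; the division in the variable \<open>i\<close> then gives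
  zero.\<close>

lemma nf_kills: "i \<in> {1..n} \<Longrightarrow> nf dd n (p * hpoly 0 (dd i) i) = 0"
proof (induction n arbitrary: p)
  case (Suc n)
  show ?case
  proof (cases "i = Suc n")
    case True
    then show ?thesis by (simp add: rho_kills)
  next
    case False
    then have "deg_lt (Suc n) 1 (hpoly 0 (dd i) i)"
      using Suc.prems deg_lt_vars_in [OF hpoly_vars_in [of 0 i "dd i"], of "Suc n"] by simp
    then have "rho (dd (Suc n)) (Suc n) (p * hpoly 0 (dd i) i) = rho (dd (Suc n)) (Suc n) p * hpoly 0 (dd i) i"
      using rho_mult_free [of "Suc n" "hpoly 0 (dd i) i" "dd (Suc n)" p] by (simp add: mult.commute)
    then show ?thesis using Suc False by simp
  qed
qed simp

definition reduced :: "(nat \<Rightarrow> nat) \<Rightarrow> nat \<Rightarrow> int_mpoly \<Rightarrow> bool" where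
  "reduced dd n p \<longleftrightarrow> (\<forall>i\<in>{1..n}. deg_lt i (dd i) p)"

lemma nf_id: "reduced dd n p \<Longrightarrow> nf dd n p = p"
proof (induction n)
  case (Suc n)
  then have "rho (dd (Suc n)) (Suc n) p = p" by (intro rho_id) (simp add: reduced_def)
  then show ?case using Suc by (simp add: reduced_def)
qed simp

lemma nf_deg_other: "n < l \<Longrightarrow> deg_lt l e p \<Longrightarrow> deg_lt l e (nf dd n p)"
  by (induction n arbitrary: p) (simp_all add: rho_deg_other)

text \<open>The order of the divisions matters: a division in the variable \<open>i\<close> may
  raise degrees in earlier variables but not in later ones, so working from \<open>n\<close> down to
  1 preserves the bounds already reached.\<close>

lemma nf_reduced: "reduced dd n (nf dd n p)"
proof (induction n arbitrary: p)
  case (Suc n)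
  have "deg_lt (Suc n) (dd (Suc n)) (nf dd (Suc n) p)"
    by (simp add: nf_deg_other rho_deg)
  then show ?case using Suc by (auto simp: reduced_def le_Suc_eq)
qed (simp add: reduced_def)

lemma nf_homogeneous: "homogeneous m p \<Longrightarrow> homogeneous m (nf dd n p)"
  by (induction n arbitrary: p) (simp_all add: rho_homogeneous)

lemma nf_vars: "n \<le> N \<Longrightarrow> vars_in {1..N} p \<Longrightarrow> vars_in {1..N} (nf dd n p)"
  by (induction n arbitrary: p) (simp_all add: rho_vars [simplified])

lemma nf_mult_free: "(\<And>i. i \<in> {1..n} \<Longrightarrow> deg_lt i 1 q) \<Longrightarrow> nf dd n (q * p) = q * nf dd n p"
  by (induction n arbitrary: p) (simp_all add: rho_mult_free)

text \<open>Each division subtracts a multiple of its divisor, so the total change is a sum of such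
  multiples. \<open>Q\<close> stands for membership in an ideal that contains the divisors.\<close>

lemma minus_nf:
  assumes "n \<le> N" "vars_in {1..N} p" "Q 0" "\<And>p q. Q p \<Longrightarrow> Q q \<Longrightarrow> Q (p + q)"
    "\<And>i q. i \<in> {1..n} \<Longrightarrow> vars_in {1..N} q \<Longrightarrow> Q (hpoly 0 (dd i) i * q)"
  shows "Q (p - nf dd n p)"
  using assms
proof (induction n arbitrary: p)
  case (Suc n)
  let ?r = "rho (dd (Suc n)) (Suc n) p"
  have "vars_in {1..N} ?r" using Suc.prems by (simp add: rho_vars [simplified])
  then have "Q (?r - nf dd n ?r)" using Suc by simp
  moreover obtain q where "vars_in {1..N} q" "p - ?r = hpoly 0 (dd (Suc n)) (Suc n) * q"
    using minus_rho [of "Suc n" N p "dd (Suc n)"] Suc.prems by auto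
  then have "Q (p - ?r)" using Suc.prems(5) [of "Suc n" q] by simp
  ultimately have "Q ((p - ?r) + (?r - nf dd n ?r))" using Suc.prems(4) by blast
  then show ?case by simp
qed simp

section \<open>The ring of a partition\<close>

declare One_nat_def [simp del]

lemma hom_sum:
  assumes A: "cring A" and h: "h \<in> ring_hom (polys_upto n) A" and f: "\<And>i. i \<in> S \<Longrightarrow> vars_in {1..n} (f i)"
  shows "h (sum f S) = finsum A (\<lambda>i. h (f i)) S"
proof -
  interpret A: cring A by fact
  show ?thesis using f
  proof (induction S rule: infinite_finite_induct)
    case (insert x S)
    then have "vars_in {1..n} (f x)" "vars_in {1..n} (sum f S)" by auto
    then show ?case using insert
      by (simp add: polys_upto_hom_simps [OF A h] A.finsum_insert Pi_def)
  qed (simp_all add: polys_upto_hom_simps [OF A h])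
qed

definition hpart :: "nat \<Rightarrow> int_mpoly \<Rightarrow> int_mpoly" where
  "hpart e = frag_extend (\<lambda>a. if monom_degree a = e then frag_of a else 0)"

lemma hpart_simps: "hpart e 0 = 0" "hpart e (p + q) = hpart e p + hpart e q"
  "hpart e (p - q) = hpart e p - hpart e q"
  "hpart e (frag_of a) = (if monom_degree a = e then frag_of a else 0)"
  by (simp_all add: hpart_def frag_extend_add frag_extend_diff)

lemma hpart_homogeneous: "homogeneous e (hpart e p)"
  by (induction p rule: poly_induct) (auto simp: hpart_simps)

lemma hpart_vars: "vars_in V p \<Longrightarrow> vars_in V (hpart e p)"
  by (induction rule: vars_in_induct) (auto simp: hpart_simps)

lemma homogeneous_induct [consumes 1, case_names zero monom diff]:
  assumes "homogeneous e p" "Q 0" "\<And>a. monom_degree a = e \<Longrightarrow> Q (frag_of a)"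
    "\<And>p q. Q p \<Longrightarrow> Q q \<Longrightarrow> Q (p - q)"
  shows "Q p"
proof -
  have "Poly_Mapping.keys p \<subseteq> {a. monom_degree a = e}" using assms(1) by (auto simp: homogeneous_def)
  then show ?thesis
    by (induction rule: frag_carrier_induct) (use assms(2-4) in auto)
qed

lemma hpart_id: "homogeneous e p \<Longrightarrow> hpart e' p = (if e' = e then p else 0)"
  by (induction rule: homogeneous_induct) (auto simp: hpart_simps)

lemma hpart_sum:
  assumes "finite S" "monom_degree ` Poly_Mapping.keys p \<subseteq> S"
  shows "(\<Sum>e\<in>S. hpart e p) = p"
proof -
  have "Poly_Mapping.keys p \<subseteq> {a. monom_degree a \<in> S}" using assms(2) by auto
  then show ?thesis
  proof (induction rule: frag_carrier_induct)
    case (one a)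
    then show ?case using assms(1) by (simp add: hpart_simps)
  qed (simp_all add: hpart_simps sum_subtractf)
qed

lemma hpart_eq_zero: "e \<notin> monom_degree ` Poly_Mapping.keys p \<Longrightarrow> hpart e p = 0"
  unfolding hpart_def by (rule frag_extend_eq_0) auto

lemma homogeneous_0:
  assumes "homogeneous 0 p"
  shows "p = of_int (Poly_Mapping.lookup p 0)"
proof (rule poly_mapping_eqI)
  fix a
  have "a = 0" if "a \<in> Poly_Mapping.keys p"
  proof -
    \<comment> \<open>The variables in \<open>monoms\<close> are numbered from 1, so the variable 0
      has to be ruled out, which degree 0 does.\<close>
    have "a \<in> monoms 0 (Max (insert 0 (Poly_Mapping.keys a)))" if "monom_degree a = 0"
    proof -
      have "i = 0 \<Longrightarrow> Poly_Mapping.lookup a i = 0" for i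
        using that by (cases "i \<in> Poly_Mapping.keys a") (auto simp: monom_degree_def in_keys_iff)
      then have "0 \<notin> Poly_Mapping.keys a" by (auto simp: in_keys_iff)
      then have "Poly_Mapping.keys a \<subseteq> {1..Max (insert 0 (Poly_Mapping.keys a))}"
        by (auto simp: Suc_le_eq One_nat_def) (metis gr0I)
      then show ?thesis using that by (simp add: monoms_def)
    qed
    then show ?thesis using assms that monoms_0 by (auto simp: homogeneous_def)
  qed
  then show "Poly_Mapping.lookup p a = Poly_Mapping.lookup (of_int (Poly_Mapping.lookup p 0)) a"
    by (cases "a = 0") (auto simp: lookup_of_int when_def in_keys_iff)
qed

lemma of_int_poly: "vars_in V (of_int k)" "homogeneous 0 (of_int k)" "0 < e \<Longrightarrow> deg_lt i e (of_int k)"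
proof -
  have "(of_int k :: int_mpoly) = Poly_Mapping.single 0 (of_int k)" by (simp only: single_of_int)
  then have "Poly_Mapping.keys (of_int k :: int_mpoly) \<subseteq> {0}" by simp
  then show "vars_in V (of_int k)" "homogeneous 0 (of_int k)" "0 < e \<Longrightarrow> deg_lt i e (of_int k)"
    by (auto simp: vars_in_def homogeneous_def deg_lt_def)
qed

locale partition =
  fixes lam :: "nat list"
  assumes sorted_lam: "sorted lam" and lam_ge: "\<And>i. i \<in> {1..length lam} \<Longrightarrow> i \<le> part lam i"
begin

abbreviation "n \<equiv> length lam"
abbreviation "P \<equiv> polys_upto n"
abbreviation "R \<equiv> part_ring lam"
abbreviation "cl \<equiv> part_class lam"
abbreviation "J \<equiv> part_ideal lam"
text \<open>The degree of relation number \<open>i\<close>. For \<open>i\<close> from 1 to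
  \<open>n\<close> it is 1 exactly if \<open>part lam i = i\<close>; the relation then expresses
  \<open>x\<^sub>i\<close> by earlier variables.\<close>

definition "dg i = part lam i - i + 1"

lemma dg_pos [simp]: "0 < dg i" by (simp add: dg_def)

lemma part_mono: "1 \<le> i \<Longrightarrow> i \<le> j \<Longrightarrow> j \<le> n \<Longrightarrow> part lam i \<le> part lam j"
  unfolding part_def using sorted_lam by (intro sorted_nth_mono) auto

lemma J_eq: "J = Idl\<^bsub>P\<^esub> ((\<lambda>i. hpoly 0 (dg i) i) ` {1..n})"
  using complete_sym_hpoly by (simp add: part_ideal_def dg_def)

lemma gens: "(\<lambda>i. hpoly 0 (dg i) i) ` {1..n} \<subseteq> carrier P"
  using hpoly_vars by fastforce

lemma ideal_J: "ideal J P"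
  unfolding J_eq by (rule PU.genideal_ideal [OF gens])

lemma gen_in_J: "i \<in> {1..n} \<Longrightarrow> hpoly 0 (dg i) i \<in> J"
  unfolding J_eq using PU.genideal_self [OF gens] by blast

lemma J_minimal: "ideal K P \<Longrightarrow> (\<And>i. i \<in> {1..n} \<Longrightarrow> hpoly 0 (dg i) i \<in> K) \<Longrightarrow> J \<subseteq> K"
  unfolding J_eq by (rule PU.genideal_minimal) auto

lemma J_closed:
  "p \<in> J \<Longrightarrow> vars_in {1..n} p" "0 \<in> J" "p \<in> J \<Longrightarrow> q \<in> J \<Longrightarrow> p + q \<in> J"
  "p \<in> J \<Longrightarrow> vars_in {1..n} q \<Longrightarrow> p * q \<in> J"
proof -
  interpret J: ideal J P by (rule ideal_J)
  show "p \<in> J \<Longrightarrow> vars_in {1..n} p" using J.Icarr by simp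
  show "0 \<in> J" using J.zero_closed by simp
  show "p \<in> J \<Longrightarrow> q \<in> J \<Longrightarrow> p + q \<in> J" using J.a_closed [of p q] by simp
  show "p \<in> J \<Longrightarrow> vars_in {1..n} q \<Longrightarrow> p * q \<in> J" using J.I_r_closed [of p q] by simp
qed

lemma cring_R: "cring R"
  unfolding part_ring_def
  by (rule cring_make_graded) (rule ideal.quotient_is_cring [OF ideal_J cring_polys_upto])

sublocale R: cring R by (rule cring_R)

lemma cl_hom: "cl \<in> ring_hom P R"
  using ideal.rcos_ring_hom [OF ideal_J]
  by (simp add: ring_hom_def part_ring_def part_class_def [abs_def])

lemmas cl_simps = polys_upto_hom_simps [OF cring_R cl_hom]

lemma carrier_R: "carrier R = cl ` {p. vars_in {1..n} p}"
  by (auto simp: part_ring_def FactRing_def A_RCOSETS_def' part_class_def)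

lemma cl_eq_iff:
  assumes "vars_in {1..n} p" "vars_in {1..n} q"
  shows "cl p = cl q \<longleftrightarrow> p - q \<in> J"
  using PU.quotient_eq_iff_same_a_r_cos [OF ideal_J, of p q] assms
  by (simp add: part_class_def polys_upto_minus)

lemma cl_eq_zero_iff: "vars_in {1..n} p \<Longrightarrow> cl p = \<zero>\<^bsub>R\<^esub> \<longleftrightarrow> p \<in> J"
  using cl_eq_iff [of p 0] cl_simps(6) by simp

text \<open>Vanishing of the normal form is not visibly stable under multiplication. Asking it of
  all multiples gives an ideal \<open>K\<close>, which contains the generators by
  \<open>nf_kills\<close>.\<close>

lemma nf_J: assumes "p \<in> J" shows "nf dg n p = 0"
proof -
  define K where "K = {p. vars_in {1..n} p \<and> (\<forall>q. vars_in {1..n} q \<longrightarrow> nf dg n (q * p) = 0)}"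
  have "ideal K P"
  proof (rule idealI)
    show "ring P" by (rule PU.ring_axioms)
    show "subgroup K (add_monoid P)"
    proof (rule PU.add.subgroupI)
      show "K \<subseteq> carrier P" by (auto simp: K_def)
      show "K \<noteq> {}" by (auto simp: K_def intro: exI [of _ 0])
      fix a assume a: "a \<in> K"
      have "nf dg n (q * (0 - a)) = 0" if "vars_in {1..n} q" for q
        using a that by (simp only: K_def mem_Collect_eq right_diff_distrib nf_diff mult_zero_right nf_zero diff_zero)
      then show "\<ominus>\<^bsub>P\<^esub> a \<in> K" using a by (auto simp: K_def polys_upto_uminus)
      fix b assume b: "b \<in> K"
      show "a \<oplus>\<^bsub>P\<^esub> b \<in> K" using a b by (auto simp: K_def distrib_left nf_add)
    qed
    fix a x assume a: "a \<in> K" and x: "x \<in> carrier P"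
    have "nf dg n (q * (a * x)) = 0" if "vars_in {1..n} q" for q
    proof -
      have "vars_in {1..n} (q * x)" using that x by auto
      then have "nf dg n ((q * x) * a) = 0" using a by (simp add: K_def)
      then show ?thesis by (simp add: mult_ac)
    qed
    then show "a \<otimes>\<^bsub>P\<^esub> x \<in> K" using a x by (auto simp: K_def)
    then show "x \<otimes>\<^bsub>P\<^esub> a \<in> K" by (simp add: mult.commute)
  qed
  moreover have "hpoly 0 (dg i) i \<in> K" if "i \<in> {1..n}" for i
    using nf_kills [OF that] hpoly_vars [of 0 i n] that by (auto simp: K_def)
  ultimately have "J \<subseteq> K" by (rule J_minimal)
  then have "p \<in> K" using assms by blast
  then have "nf dg n (1 * p) = 0" unfolding K_def by (simp del: mult_1 mult_1_left)
  then show ?thesis by simp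
qed

lemma minus_nf_J: "vars_in {1..n} p \<Longrightarrow> p - nf dg n p \<in> J"
  by (rule minus_nf [of n n]) (auto intro: J_closed(2,3) J_closed(4) [OF gen_in_J])

lemma nf_vars_n: "vars_in {1..n} p \<Longrightarrow> vars_in {1..n} (nf dg n p)"
  by (rule nf_vars) simp_all

lemma cl_nf: "vars_in {1..n} p \<Longrightarrow> cl (nf dg n p) = cl p"
  using cl_eq_iff [of p "nf dg n p"] minus_nf_J nf_vars_n by simp

lemma cl_eq_nf:
  assumes "vars_in {1..n} p" "vars_in {1..n} q"
  shows "cl p = cl q \<longleftrightarrow> nf dg n p = nf dg n q"
proof
  assume "cl p = cl q"
  then have "nf dg n (p - q) = 0" using cl_eq_iff assms nf_J by blast
  then show "nf dg n p = nf dg n q" by (simp add: nf_diff)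
qed (use cl_nf assms in metis)

text \<open>The reduced representative of a class; by \<open>cl_eq_nf\<close> it does not depend on
  the polynomial chosen.\<close>

definition norm :: "int_mpoly set \<Rightarrow> int_mpoly" where
  "norm x = nf dg n (SOME p. vars_in {1..n} p \<and> cl p = x)"

lemma norm_cl: assumes "vars_in {1..n} p" shows "norm (cl p) = nf dg n p"
proof -
  have "vars_in {1..n} (SOME q. vars_in {1..n} q \<and> cl q = cl p) \<and> cl (SOME q. vars_in {1..n} q \<and> cl q = cl p) = cl p"
    by (rule someI [of _ p]) (use assms in simp)
  then show ?thesis unfolding norm_def using cl_eq_nf assms by blast
qed

lemma R_E: assumes "x \<in> carrier R" obtains p where "vars_in {1..n} p" "x = cl p"
  using assms carrier_R by auto

lemma norm_vars: "x \<in> carrier R \<Longrightarrow> vars_in {1..n} (norm x)"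
  by (elim R_E) (simp add: norm_cl nf_vars_n)

lemma cl_norm: "x \<in> carrier R \<Longrightarrow> cl (norm x) = x"
  by (elim R_E) (simp add: norm_cl cl_nf)

lemma norm_reduced: "x \<in> carrier R \<Longrightarrow> reduced dg n (norm x)"
  by (elim R_E) (simp add: norm_cl nf_reduced)

lemma norm_add: "x \<in> carrier R \<Longrightarrow> y \<in> carrier R \<Longrightarrow> norm (x \<oplus>\<^bsub>R\<^esub> y) = norm x + norm y"
  by (elim R_E) (simp add: norm_cl cl_simps(1) [symmetric] nf_add vars_in_arith)

lemma homog_R: "homog R e = cl ` {p. vars_in {1..n} p \<and> homogeneous e p}"
  by (simp add: part_ring_def)

lemma homog_R_E: assumes "x \<in> homog R e" obtains p where "vars_in {1..n} p" "homogeneous e p" "x = cl p"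
  using assms homog_R by auto

lemma cl_homog: "vars_in {1..n} p \<Longrightarrow> homogeneous e p \<Longrightarrow> cl p \<in> homog R e"
  by (auto simp: homog_R)

lemma homog_R_carrier: "x \<in> homog R e \<Longrightarrow> x \<in> carrier R"
  by (auto simp: homog_R carrier_R)

lemma norm_homogeneous: "x \<in> homog R e \<Longrightarrow> homogeneous e (norm x)"
  by (elim homog_R_E) (simp add: norm_cl nf_homogeneous)

lemma norm_of_reduced: "vars_in {1..n} p \<Longrightarrow> reduced dg n p \<Longrightarrow> norm (cl p) = p"
  by (simp add: norm_cl nf_id)

lemma R_homog_subgroup: "subgroup (homog R e) (add_monoid R)"
proof (rule R.add.subgroupI)
  show "homog R e \<subseteq> carrier R" using homog_R_carrier by blast
  show "homog R e \<noteq> {}" using cl_homog [of 0 e] by auto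
  fix a assume "a \<in> homog R e"
  then obtain p where p: "vars_in {1..n} p" "homogeneous e p" "a = cl p" by (rule homog_R_E)
  then show "\<ominus>\<^bsub>R\<^esub> a \<in> homog R e" using cl_homog [of "- p" e] by (auto simp: cl_simps)
  fix b assume "b \<in> homog R e"
  then obtain q where q: "vars_in {1..n} q" "homogeneous e q" "b = cl q" by (rule homog_R_E)
  then show "a \<oplus>\<^bsub>R\<^esub> b \<in> homog R e" using p cl_homog [of "p + q" e] by (auto simp: cl_simps)
qed

text \<open>Homogeneous parts are taken of the normal form, which makes them well defined on classes
  and compatible with addition.\<close>

lemma R_direct_sum: "direct_sum_of_homog R"
proof (rule direct_sumI [where pr = "\<lambda>e x. cl (hpart e (norm x))"])
  show "abelian_group R" by (rule R.is_abelian_group)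
  show "subgroup (homog R d) (add_monoid R)" for d by (rule R_homog_subgroup)
  show "(\<lambda>x. cl (hpart d (norm x))) \<in> hom (add_monoid R) (add_monoid R)" for d
    by (auto intro!: homI simp: norm_add hpart_simps cl_simps hpart_vars norm_vars)
  show "cl (hpart d (norm x)) \<in> homog R d" if "x \<in> carrier R" for d x
    using that by (intro cl_homog hpart_vars norm_vars hpart_homogeneous)
  fix x assume x: "x \<in> carrier R"
  define S where "S = monom_degree ` Poly_Mapping.keys (norm x)"
  have sub: "{d. cl (hpart d (norm x)) \<noteq> \<zero>\<^bsub>R\<^esub>} \<subseteq> S"
    using hpart_eq_zero [of _ "norm x"] cl_simps(6) unfolding S_def by fastforce
  have S: "finite S" by (simp add: S_def)
  show "finite {d. cl (hpart d (norm x)) \<noteq> \<zero>\<^bsub>R\<^esub>}" using finite_subset [OF sub S] .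
  have hv: "vars_in {1..n} (hpart d (norm x))" for d using x by (intro hpart_vars norm_vars)
  have "x = cl (\<Sum>d\<in>S. hpart d (norm x))"
    using hpart_sum [OF S, of "norm x"] cl_norm [OF x] by (simp add: S_def)
  also have "\<dots> = (\<Oplus>\<^bsub>R\<^esub>d\<in>S. cl (hpart d (norm x)))"
    by (rule hom_sum [OF cring_R cl_hom hv])
  also have "\<dots> = (\<Oplus>\<^bsub>R\<^esub>d\<in>{d. cl (hpart d (norm x)) \<noteq> \<zero>\<^bsub>R\<^esub>}. cl (hpart d (norm x)))"
    by (rule R.finsum_supp [OF S sub, symmetric]) (simp add: cl_simps hv)
  finally show "x = (\<Oplus>\<^bsub>R\<^esub>d\<in>{d. cl (hpart d (norm x)) \<noteq> \<zero>\<^bsub>R\<^esub>}. cl (hpart d (norm x)))" .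
next
  fix d e x assume x: "x \<in> homog R d"
  show "cl (hpart e (norm x)) = (if e = d then x else \<zero>\<^bsub>R\<^esub>)"
    using hpart_id [OF norm_homogeneous [OF x], of e] cl_norm [OF homog_R_carrier [OF x]] cl_simps(6) by simp
qed

text \<open>Normal forms identify a homogeneous component with the free group on the monomials of
  that degree in which every exponent of a variable \<open>i\<close> is below
  \<open>dg i\<close>.\<close>

lemma R_free: "free_homog R e"
proof -
  define S where "S = {a. Poly_Mapping.keys a \<subseteq> {1..n} \<and> monom_degree a = e \<and> (\<forall>i\<in>{1..n}. Poly_Mapping.lookup a i < dg i)}"
  have S: "Poly_Mapping.keys p \<subseteq> S \<longleftrightarrow> vars_in {1..n} p \<and> homogeneous e p \<and> reduced dg n p" for p
    unfolding S_def vars_in_def homogeneous_def reduced_def deg_lt_def by blast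
  let ?G = "add_monoid (R\<lparr>carrier := homog R e\<rparr>)"
  have "norm \<in> iso ?G (free_Abelian_group S)"
  proof (rule isoI)
    show "norm \<in> hom ?G (free_Abelian_group S)"
      by (auto intro!: homI simp: S norm_vars norm_homogeneous norm_reduced norm_add homog_R_carrier)
    show "bij_betw norm (carrier ?G) (carrier (free_Abelian_group S))"
      by (rule bij_betw_byWitness [of _ cl])
        (auto simp: S cl_norm norm_of_reduced norm_vars norm_homogeneous norm_reduced homog_R_carrier cl_homog)
  qed
  then have 1: "?G \<cong> free_Abelian_group S" by (auto simp: is_iso_def)
  \<comment> \<open>The basis must be indexed by elements of the type of \<open>R\<close>, whose
    elements are sets of polynomials; singletons serve as labels.\<close>
  have "inj_on (\<lambda>a. {frag_of a}) S" by (auto simp: inj_on_def frag_of_eq)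
  then have "S \<approx> (\<lambda>a. {frag_of a}) ` S" by (meson eqpoll_sym inj_on_image_eqpoll_self)
  then have 2: "free_Abelian_group S \<cong> free_Abelian_group ((\<lambda>a. {frag_of a :: int_mpoly}) ` S)"
    by (simp add: isomorphic_free_Abelian_groups)
  show ?thesis unfolding free_homog_def using iso_trans [OF 1 2] by blast
qed

lemma cl_of_int: "cl (of_int k) = [k] \<cdot>\<^bsub>R\<^esub> \<one>\<^bsub>R\<^esub>"
proof (induction k rule: int_induct [where k = 0])
  case base
  show ?case by (simp add: cl_simps)
next
  case (step1 i)
  have "cl (of_int (i + 1)) = cl (of_int i) \<oplus>\<^bsub>R\<^esub> \<one>\<^bsub>R\<^esub>"
    by (simp add: cl_simps of_int_poly)
  then show ?case using step1 by (simp add: R.int_scalar_add)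
next
  case (step2 i)
  have "cl (of_int (i - 1)) = cl (of_int i) \<ominus>\<^bsub>R\<^esub> \<one>\<^bsub>R\<^esub>"
    using cl_simps(2) [of "of_int i" 1] by (simp add: cl_simps(7) of_int_poly)
  also have "cl (of_int i) = [(i - 1)] \<cdot>\<^bsub>R\<^esub> \<one>\<^bsub>R\<^esub> \<oplus>\<^bsub>R\<^esub> \<one>\<^bsub>R\<^esub>"
    using R.int_scalar_add [of "\<one>\<^bsub>R\<^esub>" "i - 1" 1] step2 by simp
  finally show ?case
    by (simp add: R.minus_eq R.a_assoc R.r_neg)
qed

lemma std_graded_R: "std_graded R"
  unfolding std_graded_iff standard_graded_def
proof (intro conjI allI ballI cring_R R_direct_sum R_free)
  show "x \<otimes>\<^bsub>R\<^esub> y \<in> homog R (d + e)" if x: "x \<in> homog R d" and y: "y \<in> homog R e" for x y d e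
  proof -
    obtain p where "vars_in {1..n} p" "homogeneous d p" "x = cl p" using x by (rule homog_R_E)
    moreover obtain q where "vars_in {1..n} q" "homogeneous e q" "y = cl q" using y by (rule homog_R_E)
    ultimately show ?thesis using cl_homog [of "p * q" "d + e"] homogeneous_mult by (auto simp: cl_simps)
  qed
  show "bij_betw (\<lambda>k::int. [k] \<cdot>\<^bsub>R\<^esub> \<one>\<^bsub>R\<^esub>) UNIV (homog R 0)"
    unfolding bij_betw_def
  proof
    show "inj (\<lambda>k::int. [k] \<cdot>\<^bsub>R\<^esub> \<one>\<^bsub>R\<^esub>)"
    proof (rule injI)
      fix k l :: int assume "[k] \<cdot>\<^bsub>R\<^esub> \<one>\<^bsub>R\<^esub> = [l] \<cdot>\<^bsub>R\<^esub> \<one>\<^bsub>R\<^esub>"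
      then have "norm (cl (of_int k)) = norm (cl (of_int l))" by (simp add: cl_of_int)
      moreover have "norm (cl (of_int m)) = of_int m" for m
        by (rule norm_of_reduced) (simp_all add: of_int_poly reduced_def)
      ultimately show "k = l" by simp
    qed
    show "range (\<lambda>k::int. [k] \<cdot>\<^bsub>R\<^esub> \<one>\<^bsub>R\<^esub>) = homog R 0"
    proof
      show "range (\<lambda>k::int. [k] \<cdot>\<^bsub>R\<^esub> \<one>\<^bsub>R\<^esub>) \<subseteq> homog R 0"
        by (auto simp: cl_of_int [symmetric] intro!: cl_homog of_int_poly)
      show "homog R 0 \<subseteq> range (\<lambda>k::int. [k] \<cdot>\<^bsub>R\<^esub> \<one>\<^bsub>R\<^esub>)"
      proof
        fix x assume "x \<in> homog R 0"
        then obtain p where "homogeneous 0 p" "x = cl p" by (rule homog_R_E)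
        then have "x = cl (of_int (Poly_Mapping.lookup p 0))" using homogeneous_0 by metis
        then show "x \<in> range (\<lambda>k::int. [k] \<cdot>\<^bsub>R\<^esub> \<one>\<^bsub>R\<^esub>)" by (simp add: cl_of_int)
      qed
    qed
  qed
  show "carrier R = generate_ring R (homog R 0 \<union> homog R 1)"
  proof
    show "generate_ring R (homog R 0 \<union> homog R 1) \<subseteq> carrier R"
      using homog_R_carrier by (intro R.generate_ring_incl) blast
    show "carrier R \<subseteq> generate_ring R (homog R 0 \<union> homog R 1)" (is "_ \<subseteq> ?G")
    proof
      have mono: "cl (frag_of a) \<in> ?G" if "Poly_Mapping.keys a \<subseteq> {1..n}" for a
        using that
      proof (induction a rule: monom_induct)
        case zero
        show ?case by (simp add: frag_of_zero cl_simps generate_ring.one)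
      next
        case (add b i)
        have "frag_of (b + Poly_Mapping.single i 1) = frag_of b * poly_var i"
          by (simp add: poly_var_def mult_single)
        moreover have "cl (poly_var i) \<in> ?G"
          using add(2) cl_homog [of "poly_var i" 1] by (intro generate_ring.incl) simp
        ultimately show ?case using add by (simp add: cl_simps generate_ring.eng_mult)
      qed
      have "cl p \<in> ?G" if "vars_in {1..n} p" for p
        using that
      proof (induction rule: vars_in_induct)
        case zero
        show ?case by (simp add: cl_simps R.zero_in_generate)
      next
        case (diff p q)
        then show ?case by (simp add: cl_simps a_minus_def generate_ring.eng_add generate_ring.a_inv)
      qed (rule mono)
      then show "x \<in> ?G" if "x \<in> carrier R" for x using that by (elim R_E) simp
    qed
  qed
qed

sublocale G: std_graded R by (rule std_graded_R)

text \<open>The relations vanish at the \<open>y i\<close>, so evaluation is constant on classes,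
  and the induced map can be computed on normal forms.\<close>

theorem part_ring_lift:
  fixes A :: "('c, 'm) ring_scheme"
  assumes A: "cring A" and y: "\<And>i. i \<in> {1..n} \<Longrightarrow> y i \<in> carrier A"
    and rel: "\<And>i. i \<in> {1..n} \<Longrightarrow> csym A y (dg i) i = \<zero>\<^bsub>A\<^esub>"
  obtains H where "H \<in> ring_hom R A" "\<And>i. i \<in> {1..n} \<Longrightarrow> H (cl (poly_var i)) = y i"
proof -
  interpret A: cring A by fact
  obtain h where h: "h \<in> ring_hom P A" "\<And>i. i \<in> {1..n} \<Longrightarrow> h (poly_var i) = y i"
    using polys_upto_universal [OF A, of n y] y by blast
  note hs = polys_upto_hom_simps [OF A h(1)]
  have "ring_hom_ring P A h"
    using h(1) by (simp add: ring_hom_ring_def ring_hom_ring_axioms_def PU.ring_axioms A.ring_axioms)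
  then have ker: "ideal (a_kernel P A h) P" by (rule ring_hom_ring.kernel_is_ideal)
  have "J \<subseteq> a_kernel P A h"
  proof (rule J_minimal [OF ker])
    fix i assume i: "i \<in> {1..n}"
    have "h (hpoly 0 (dg i) i) = csym A (\<lambda>l. y (0 + l)) (dg i) i"
    proof (rule hom_hpoly [OF A h(1), where y = y])
      show "h (poly_var l) = y l" if "l \<in> {1..n}" for l using that by (rule h(2))
      show "0 + i \<le> n" using i by simp
    qed
    then have "h (hpoly 0 (dg i) i) = \<zero>\<^bsub>A\<^esub>"
      using rel [OF i] by simp
    then show "hpoly 0 (dg i) i \<in> a_kernel P A h"
      using hpoly_vars [of 0 i n] i by (simp add: a_kernel_def')
  qed
  then have hJ: "h p = \<zero>\<^bsub>A\<^esub>" if "p \<in> J" for p using that by (auto simp: a_kernel_def')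
  have h_nf: "h (nf dg n p) = h p" if "vars_in {1..n} p" for p
  proof -
    have "h p \<ominus>\<^bsub>A\<^esub> h (nf dg n p) = \<zero>\<^bsub>A\<^esub>"
      using hJ [OF minus_nf_J [OF that]] hs(2) [OF that nf_vars_n [OF that]] by simp
    then have "h p = h (nf dg n p)"
      by (rule A.minus_eq_zeroD [OF hs(5) [OF that] hs(5) [OF nf_vars_n [OF that]]])
    then show ?thesis ..
  qed
  define H where "H x = h (norm x)" for x
  have H: "H (cl p) = h p" if "vars_in {1..n} p" for p
    using that by (simp add: H_def norm_cl h_nf)
  show thesis
  proof
    show "H \<in> ring_hom R A"
    proof (rule ring_hom_memI)
      show "H \<one>\<^bsub>R\<^esub> = \<one>\<^bsub>A\<^esub>" using H [of 1] by (simp add: cl_simps hs)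
      fix x assume "x \<in> carrier R"
      then obtain p where p: "vars_in {1..n} p" "x = cl p" by (rule R_E)
      then show "H x \<in> carrier A" by (simp add: H hs)
      fix y assume "y \<in> carrier R"
      then obtain q where q: "vars_in {1..n} q" "y = cl q" by (rule R_E)
      show "H (x \<oplus>\<^bsub>R\<^esub> y) = H x \<oplus>\<^bsub>A\<^esub> H y"
        using p q H [of "p + q"] by (auto simp: H hs cl_simps)
      show "H (x \<otimes>\<^bsub>R\<^esub> y) = H x \<otimes>\<^bsub>A\<^esub> H y"
        using p q H [of "p * q"] by (auto simp: H hs cl_simps)
    qed
    show "H (cl (poly_var i)) = y i" if "i \<in> {1..n}" for i
      using that H [of "poly_var i"] h(2) by simp
  qed
qed

end

subsection \<open>Vanishing of complete homogeneous symmetric functions\<close>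


lemma csym_closed:
  assumes "cring A" and "\<And>l. l \<in> {1..i} \<Longrightarrow> y l \<in> carrier A"
  shows "csym A y m i \<in> carrier A"
proof -
  interpret A: cring A by fact
  show ?thesis using assms(2)
  proof (induction m arbitrary: i)
    case (Suc m)
    note IH = Suc.IH
    show ?case using Suc.prems
    proof (induction i)
      case (Suc i)
      have "y (Suc i) \<in> carrier A" "csym A y m (Suc i) \<in> carrier A" "csym A y (Suc m) i \<in> carrier A"
        using Suc IH [OF Suc.prems] by auto
      then show ?case by simp
    qed simp
  qed simp
qed

lemma csym_cong:
  assumes "\<And>l. l \<in> {1..i} \<Longrightarrow> y l = z l" shows "csym A y m i = csym A z m i"
  using assms
proof (induction m arbitrary: i)
  case (Suc m)
  note IH = Suc.IH
  show ?case using Suc.prems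
  proof (induction i)
    case (Suc i)
    then show ?case using IH [OF Suc.prems] by auto
  qed simp
qed simp

lemma csym_hom:
  assumes "cring A" "cring B" "h \<in> ring_hom A B" "\<And>l. l \<in> {1..i} \<Longrightarrow> y l \<in> carrier A"
  shows "h (csym A y m i) = csym B (\<lambda>l. h (y l)) m i"
proof -
  interpret h: ring_hom_cring A B h by (rule ring_hom_cringI' [OF assms(1-3)])
  show ?thesis using assms(4)
  proof (induction m arbitrary: i)
    case (Suc m)
    note IH = Suc.IH
    show ?case using Suc.prems
    proof (induction i)
      case (Suc i)
      have "y (Suc i) \<in> carrier A" "csym A y m (Suc i) \<in> carrier A" "csym A y (Suc m) i \<in> carrier A"
        using Suc by (auto intro!: csym_closed [OF assms(1)])
      then show ?case using Suc IH [OF Suc.prems] by simp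
    qed simp
  qed simp
qed

text \<open>The recursion expresses a value through one with fewer elements in the same degree and
  one of lower degree, so vanishing spreads from the degree of each relation to all higher
  degrees.\<close>

lemma csym_vanish:
  fixes L :: "nat \<Rightarrow> nat"
  assumes A: "cring A" and y: "\<And>l. l \<in> {1..N} \<Longrightarrow> y l \<in> carrier A"
    and mono: "\<And>i. 1 \<le> i \<Longrightarrow> Suc i \<le> N \<Longrightarrow> L i \<le> L (Suc i)" and ge: "\<And>i. i \<in> {1..N} \<Longrightarrow> i \<le> L i"
    and rel: "\<And>i. i \<in> {1..N} \<Longrightarrow> csym A y (L i - i + 1) i = \<zero>\<^bsub>A\<^esub>"
    and im: "i \<in> {1..N}" "L i - i + 1 \<le> m"
  shows "csym A y m i = \<zero>\<^bsub>A\<^esub>"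
proof -
  interpret A: cring A by fact
  show ?thesis using im
  proof (induction i arbitrary: m)
    case (Suc i)
    note outer = Suc.IH and i = Suc.prems(1)
    show ?case using Suc.prems(2)
    proof (induction m rule: dec_induct)
      case base
      show ?case using rel [OF i] .
    next
      case (step m)
      have "csym A y (Suc m) i = \<zero>\<^bsub>A\<^esub>"
      proof (cases "i = 0")
        case False
        \<comment> \<open>Since \<open>L\<close> is weakly increasing, the bound
          \<open>L i - i + 1\<close> drops by at most one from \<open>i\<close> to
          \<open>Suc i\<close>, so the first \<open>i\<close> elements already give zero in degree
          \<open>Suc m\<close>.\<close>
        then have "L i - i + 1 \<le> Suc m" using mono [of i] ge [OF i] step(1) i by auto
        then show ?thesis using outer False i by simp
      qed simp
      then show ?case using step y [OF i] by simp
    qed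
  qed simp
qed

lemma csym_1:
  assumes "cring A" "\<And>l. l \<in> {1..i} \<Longrightarrow> y l \<in> carrier A"
  shows "csym A y 1 i = finsum A y {1..i}"
proof -
  interpret A: cring A by fact
  show ?thesis using assms(2)
  proof (induction i)
    case 0
    then show ?case by (simp add: One_nat_def)
  next
    case (Suc i)
    have "{1..Suc i} = insert (Suc i) {1..i}" by auto
    moreover have "y (Suc i) \<in> carrier A" "finsum A y {1..i} \<in> carrier A"
      using Suc by (auto intro!: A.finsum_closed)
    ultimately show ?case using Suc
      by (simp add: One_nat_def A.finsum_insert Pi_def A.a_comm)
  qed
qed

text \<open>If all positive degrees vanish on the first \<open>k\<close> elements, these behave like
  no elements at all: both recursions start from the same values.\<close>

lemma csym_split:
  assumes A: "cring A" and y: "\<And>l. l \<in> {1..k + i} \<Longrightarrow> y l \<in> carrier A"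
    and zero: "\<And>m. 1 \<le> m \<Longrightarrow> csym A y m k = \<zero>\<^bsub>A\<^esub>"
  shows "csym A y m (k + i) = csym A (\<lambda>l. y (k + l)) m i"
  using y
proof (induction m arbitrary: i)
  case (Suc m)
  note IH = Suc.IH
  show ?case using Suc.prems
  proof (induction i)
    case 0
    show ?case using zero [of "Suc m"] by simp
  next
    case (Suc i)
    have "csym A y m (k + Suc i) = csym A (\<lambda>l. y (k + l)) m (Suc i)"
      by (rule IH) (rule Suc.prems)
    then show ?case using Suc by simp
  qed
qed simp

subsection \<open>Derivations of the ring of a partition\<close>

text \<open>\<open>hder k m i\<close> is the partial derivative of \<open>hpoly k m i\<close> with respect to its last variable.\<close>

fun hder :: "nat \<Rightarrow> nat \<Rightarrow> nat \<Rightarrow> int_mpoly" where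
  "hder k 0 i = 0"
| "hder k (Suc m) i = hpoly k m i + poly_var (k + i) * hder k m i"

lemma hder_vars_in: "1 \<le> i \<Longrightarrow> vars_in {k + 1..k + i} (hder k m i)"
  by (induction m) (auto intro!: vars_in_arith hpoly_vars_in)

lemma lookup_frag_mult:
  "Poly_Mapping.lookup (frag_of a * u) (a + b) = Poly_Mapping.lookup (u :: int_mpoly) b"
  by (induction u rule: poly_induct)
    (simp_all add: frag_of_mult right_diff_distrib lookup_minus del: mult_single)

lemma lookup_of_int_mult: "Poly_Mapping.lookup (of_int c * p) a = c * Poly_Mapping.lookup (p :: int_mpoly) a"
  by (induction c rule: int_induct [where k = 0])
    (simp_all add: distrib_right left_diff_distrib lookup_add lookup_minus)

lemma single_1_eq_iff: "Poly_Mapping.single l (1::nat) = Poly_Mapping.single l' 1 \<longleftrightarrow> l = l'"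
proof
  assume "Poly_Mapping.single l (1::nat) = Poly_Mapping.single l' 1"
  then have "Poly_Mapping.keys (Poly_Mapping.single l (1::nat)) = Poly_Mapping.keys (Poly_Mapping.single l' (1::nat))" by simp
  then show "l = l'" by simp
qed simp

definition linear_form :: "nat set \<Rightarrow> (nat \<Rightarrow> int) \<Rightarrow> int_mpoly" where
  "linear_form S c = (\<Sum>l\<in>S. of_int (c l) * poly_var l)"

lemma lookup_linear_form:
  "finite S \<Longrightarrow> Poly_Mapping.lookup (linear_form S c) (Poly_Mapping.single l 1) = (if l \<in> S then c l else 0)"
  by (simp add: linear_form_def lookup_sum lookup_of_int_mult poly_var_def single_1_eq_iff if_distrib cong: if_cong)

lemma linear_form_vars: "S \<subseteq> V \<Longrightarrow> vars_in V (linear_form S c)"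
  unfolding linear_form_def by (intro vars_in_sum vars_in_arith(3) of_int_poly(1)) auto

lemma linear_form_homogeneous: "homogeneous 1 (linear_form S c)"
  unfolding linear_form_def
  using homogeneous_mult [OF of_int_poly(2) homogeneous_simps(4)] by (intro homogeneous_sum) simp

lemma linear_form_deg: "deg_lt l 2 (linear_form S c)"
  unfolding linear_form_def
  by (intro deg_lt_sum deg_lt_mult_free) (simp_all add: of_int_poly deg_lt_var)

lemma linear_form_deg_free: "l \<notin> S \<Longrightarrow> deg_lt l 1 (linear_form S c)"
  unfolding linear_form_def
  by (intro deg_lt_sum deg_lt_mult_free) (auto simp: of_int_poly deg_lt_var)

lemma homogeneous_1_linear_form:
  assumes "homogeneous 1 p" "finite S" "vars_in S p"
  shows "p = linear_form S (\<lambda>l. Poly_Mapping.lookup p (Poly_Mapping.single l 1))"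
proof -
  have "Poly_Mapping.keys p \<subseteq> {Poly_Mapping.single l 1 | l. l \<in> S}"
  proof
    fix a assume a: "a \<in> Poly_Mapping.keys p"
    then have "monom_degree a = 1" "Poly_Mapping.keys a \<subseteq> S"
      using assms by (auto simp: homogeneous_def vars_in_def)
    then have "(\<Sum>j\<in>S. Poly_Mapping.lookup a j) = 1" using monom_degree_alt assms(2) by metis
    then obtain l where l: "l \<in> S" "Poly_Mapping.lookup a l = 1" "\<forall>j\<in>S. l \<noteq> j \<longrightarrow> Poly_Mapping.lookup a j = 0"
      using sum_eq_1_iff [OF assms(2)] by metis
    have "a = Poly_Mapping.single l 1"
      using l \<open>Poly_Mapping.keys a \<subseteq> S\<close> by (intro poly_mapping_eqI) (auto simp: lookup_single when_def in_keys_iff)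
    then show "a \<in> {Poly_Mapping.single l 1 | l. l \<in> S}" using l by blast
  qed
  then show ?thesis
  proof (induction p rule: frag_carrier_induct)
    case zero
    show ?case by (simp add: linear_form_def)
  next
    case (diff p q)
    have "linear_form S (\<lambda>l. c l - d l) = linear_form S c - linear_form S d" for c d
      by (simp add: linear_form_def left_diff_distrib sum_subtractf)
    then show ?case using diff(3,4) by (simp add: lookup_minus)
  next
    case (one a)
    then obtain l where "l \<in> S" "a = Poly_Mapping.single l 1" by blast
    then show ?case using assms(2)
      by (simp add: linear_form_def single_1_eq_iff if_distrib [of of_int] if_distrib [of "\<lambda>x. x * _"] poly_var_def cong: if_cong)
  qed
qed

text \<open>The two leading terms in the last variable; the comparison of coefficients in
  \<open>annihilator_of_hder\<close> sees only these.\<close>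

lemma hpoly_shape:
  "\<exists>w. hpoly k (Suc m) (Suc i) = poly_var (k + Suc i) ^ Suc m + poly_var (k + Suc i) ^ m * hpoly k 1 i + w
     \<and> deg_lt (k + Suc i) m w"
proof -
  let ?X = "poly_var (k + Suc i)"
  have free: "deg_lt (k + Suc i) 1 (hpoly k j i)" for j
    by (rule deg_lt_vars_in [OF hpoly_vars_in]) simp
  define w where "w = (\<Sum>j\<in>{2..Suc m}. hpoly k j i * ?X ^ (Suc m - j))"
  have "{..Suc m} = insert 0 (insert 1 {2..Suc m})" by auto
  then have "hpoly k (Suc m) (Suc i) = ?X ^ Suc m + (hpoly k 1 i * ?X ^ m + w)"
    unfolding hpoly_expand w_def by simp
  moreover have "deg_lt (k + Suc i) m w"
    unfolding w_def by (intro deg_lt_sum deg_lt_mult_free free) (auto simp: deg_lt_var_power)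
  ultimately show ?thesis by (intro exI [of _ w]) (simp add: mult.commute add.assoc)
qed

text \<open>The derivative of the two leading terms in the last variable. Its leading coefficient is
  the degree of the polynomial, and this is the integer that later has to divide a
  coefficient.\<close>

lemma hder_shape:
  "\<exists>w. hder k (Suc (Suc m)) (Suc i) = of_nat (Suc (Suc m)) * poly_var (k + Suc i) ^ Suc m
     + of_nat (Suc m) * poly_var (k + Suc i) ^ m * hpoly k 1 i + w \<and> deg_lt (k + Suc i) m w"
proof (induction m)
  case 0
  show ?case by (intro exI [of _ 0]) (simp add: One_nat_def algebra_simps)
next
  case (Suc m)
  let ?X = "poly_var (k + Suc i)"
  obtain w where w: "hder k (Suc (Suc m)) (Suc i) = of_nat (Suc (Suc m)) * ?X ^ Suc m
     + of_nat (Suc m) * ?X ^ m * hpoly k 1 i + w" "deg_lt (k + Suc i) m w" using Suc by blast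
  obtain v where v: "hpoly k (Suc (Suc m)) (Suc i) = ?X ^ Suc (Suc m) + ?X ^ Suc m * hpoly k 1 i + v"
    "deg_lt (k + Suc i) (Suc m) v" using hpoly_shape by blast
  have "hder k (Suc (Suc (Suc m))) (Suc i) = hpoly k (Suc (Suc m)) (Suc i) + ?X * hder k (Suc (Suc m)) (Suc i)"
    by (rule hder.simps)
  also have "\<dots> = of_nat (Suc (Suc (Suc m))) * ?X ^ Suc (Suc m)
     + of_nat (Suc (Suc m)) * ?X ^ Suc m * hpoly k 1 i + (v + ?X * w)"
    unfolding v(1) w(1) by (simp add: algebra_simps)
  finally have "hder k (Suc (Suc (Suc m))) (Suc i) = of_nat (Suc (Suc (Suc m))) * ?X ^ Suc (Suc m)
     + of_nat (Suc (Suc m)) * ?X ^ Suc m * hpoly k 1 i + (v + ?X * w)" .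
  moreover have "deg_lt (k + Suc i) (Suc m) (v + ?X * w)"
    using v(2) deg_lt_mult [of "k + Suc i" 1 ?X m w] w(2) by (auto simp: deg_lt_var One_nat_def)
  ultimately show ?case by blast
qed

lemma hpoly_1: "hpoly k 1 i = linear_form {k + 1..k + i} (\<lambda>_. 1)"
proof (induction i)
  case (Suc i)
  have "{k + 1..k + Suc i} = insert (k + Suc i) {k + 1..k + i}" by auto
  then show ?case using Suc by (simp add: linear_form_def One_nat_def add.commute)
qed (simp add: linear_form_def One_nat_def)

lemma nf_skip:
  "t \<le> N \<Longrightarrow> (\<And>l. t < l \<Longrightarrow> l \<le> N \<Longrightarrow> deg_lt l (dd l) q) \<Longrightarrow> nf dd N q = nf dd t q"
proof (induction N)
  case (Suc N)
  show ?case
  proof (cases "t = Suc N")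
    case False
    then have "rho (dd (Suc N)) (Suc N) q = q" using Suc.prems by (intro rho_id) simp
    then show ?thesis using Suc False by simp
  qed simp
qed simp

lemma (in abelian_group) add_left_imp_eq:
  assumes "x \<in> carrier G" "y \<in> carrier G" "z \<in> carrier G" "x \<oplus> y = x \<oplus> z"
  shows "y = z"
  using assms by (metis r_neg1)

lemma (in abelian_group) add_eq_right_imp_zero:
  assumes "x \<in> carrier G" "y \<in> carrier G" "x \<oplus> y = y"
  shows "x = \<zero>"
  using add_left_imp_eq [of y x \<zero>] assms by (simp add: a_comm)

context partition begin

text \<open>The numbers of the variables in normal form, which form a basis of degree 1. The
  remaining variables are eliminated by relations of degree 1.\<close>

definition "L = {l \<in> {1..n}. 2 \<le> dg l}"

lemma finite_L [simp]: "finite L" by (simp add: L_def)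

lemma L_sub: "L \<subseteq> {1..n}" by (auto simp: L_def)

text \<open>The coefficients of \<open>x\<^sub>t ^ (d - 1) * x\<^sub>l\<close> in the normal form of
  \<open>hder k d i * z - c\<^sub>t * d * hpoly k d i\<close>, where \<open>t = k + i\<close> and \<open>d = dg t\<close>.\<close>

lemma annihilator_of_hder:
  assumes i: "1 \<le> i" "k + i \<le> n" and dg: "\<And>l. l \<in> {k + 1..k + i} \<Longrightarrow> 2 \<le> dg l"
    and rel: "cl (hpoly k (dg (k + i)) i) = \<zero>\<^bsub>R\<^esub>"
    and ann: "cl (hder k (dg (k + i)) i * linear_form L c) = \<zero>\<^bsub>R\<^esub>"
    and l: "l \<in> L" "l \<noteq> k + i"
  shows "int (dg (k + i)) * c l = (if l \<in> {k + 1..<k + i} then c (k + i) else 0)"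
proof -
  define t where "t = k + i"
  obtain i' where i': "i = Suc i'" using i by (cases i) auto
  have e: "k + Suc i' = t" by (simp add: t_def i')
  have "2 \<le> dg t" using dg [of t] i by (simp add: t_def)
  then obtain m where m: "dg t = Suc (Suc m)" by (metis add_2_eq_Suc le_Suc_ex)
  let ?X = "poly_var t" and ?S = "hpoly k 1 i'" and ?d = "of_nat (Suc (Suc m)) :: int_mpoly" and ?ct = "of_int (c t) :: int_mpoly"
  have tL: "t \<in> L" using i dg [of t] by (auto simp: L_def t_def)
  define Z where "Z = linear_form (L - {t}) c"
  have Z: "linear_form L c = ?ct * ?X + Z"
    unfolding Z_def linear_form_def using tL by (simp add: sum.remove)
  obtain w where w: "hder k (dg t) i = ?d * ?X ^ Suc m + of_nat (Suc m) * ?X ^ m * ?S + w" "deg_lt t m w"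
    unfolding m i' using hder_shape [of k m i', unfolded e] by blast
  obtain v where v: "hpoly k (dg t) i = ?X ^ Suc (Suc m) + ?X ^ Suc m * ?S + v" "deg_lt t (Suc m) v"
    unfolding m i' using hpoly_shape [of k "Suc m" i', unfolded e] by blast
  \<comment> \<open>This multiple of the relation cancels the leading term in \<open>?X\<close>: the
    derivative begins with \<open>?d * ?X ^ Suc m\<close>, and the linear form has coefficient
    \<open>c t\<close> at \<open>?X\<close>.\<close>
  define q where "q = hder k (dg t) i * linear_form L c - ?ct * ?d * hpoly k (dg t) i"
  \<comment> \<open>The coefficient of \<open>?X ^ Suc m\<close> in \<open>q\<close>: the term
    \<open>?ct * ?S\<close> arises \<open>Suc m\<close> times from the derivative and is subtracted
    \<open>Suc (Suc m)\<close> times.\<close>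
  define u where "u = ?d * Z - ?ct * ?S"
  define W where "W = of_nat (Suc m) * ?X ^ m * ?S * Z + w * linear_form L c - ?ct * ?d * v"
  have q: "q = ?X ^ Suc m * u + W"
    unfolding q_def u_def W_def w(1) v(1) Z by (simp add: algebra_simps)
  have const: "deg_lt j 1 ?ct" "deg_lt j 1 ?d" "deg_lt j 1 (of_nat (Suc m))" for j
    using of_int_poly(3) [of 1 j "c t"] of_int_poly(3) [of 1 j "int (Suc (Suc m))"] of_int_poly(3) [of 1 j "int (Suc m)"]
    by (simp_all only: of_int_of_nat_eq zero_less_one)
  have S: "deg_lt t 1 ?S" by (rule deg_lt_vars_in [OF hpoly_vars_in]) (simp add: t_def i')
  have Zt: "deg_lt t 1 Z" unfolding Z_def by (rule linear_form_deg_free) simp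
  have "deg_lt t (Suc m) (of_nat (Suc m) * (?S * (Z * ?X ^ m)))"
    by (intro deg_lt_mult_free const S Zt) (simp add: deg_lt_var_power)
  moreover have "deg_lt t (Suc m) (w * linear_form L c)"
    using deg_lt_mult [of t 1 "linear_form L c" m w] w(2) linear_form_deg [of t L c]
    by (simp add: mult.commute One_nat_def numeral_2_eq_2)
  moreover have "deg_lt t (Suc m) (?ct * (?d * v))"
    by (intro deg_lt_mult_free const v(2))
  ultimately have W: "deg_lt t (Suc m) W"
    unfolding W_def by (auto simp: mult_ac intro!: deg_lt_arith)
  have ut: "deg_lt t 1 u" unfolding u_def by (intro deg_lt_arith deg_lt_mult_free const S Zt)
  have block: "vars_in {k + 1..t} (hder k (dg t) i)" "vars_in {k + 1..t} (hpoly k (dg t) i)"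
    using hder_vars_in [OF i(1)] hpoly_vars_in by (simp_all add: t_def)
  have "deg_lt j (dg j) q" if j: "t \<le> j" "j \<le> n" for j
  proof (cases "j = t")
    case True
    have "deg_lt t (dg t) (u * ?X ^ Suc m)"
      by (intro deg_lt_mult_free ut) (simp add: deg_lt_var_power m del: power_Suc)
    moreover have "deg_lt t (dg t) W" by (rule deg_lt_mono [OF W]) (simp add: m)
    ultimately show ?thesis unfolding q True by (auto simp: mult.commute)
  next
    case False
    have "deg_lt j (dg j) (linear_form L c)"
    proof (cases "j \<in> L")
      case True
      then show ?thesis using deg_lt_mono [OF linear_form_deg [of j L c]] by (simp add: L_def)
    next
      case False
      then show ?thesis using deg_lt_mono [OF linear_form_deg_free [OF False]] by (simp add: dg_def)
    qed
    moreover have "deg_lt j 1 (hder k (dg t) i)" "deg_lt j 1 (hpoly k (dg t) i)"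
      using False j by (auto intro!: deg_lt_vars_in block)
    moreover from this(2) have "deg_lt j (dg j) (?ct * (?d * hpoly k (dg t) i))"
      using deg_lt_mono [of j 1 _ "dg j"] by (intro deg_lt_mult_free const) (simp add: dg_def)
    ultimately show ?thesis unfolding q_def by (auto simp: mult.assoc intro!: deg_lt_arith deg_lt_mult_free)
  qed
  \<comment> \<open>The degree bounds hold in \<open>t\<close> and in all later variables, so only
    divisions in earlier variables act on \<open>q\<close>; these commute with powers of
    \<open>?X\<close>.\<close>
  then have skip: "nf dg n q = nf dg (t - 1) q"
    using i by (intro nf_skip) (auto simp: t_def)
  \<comment> \<open>\<open>u\<close> is linear and contains only variables with \<open>dg\<close> at
    least 2, so it is already reduced.\<close>
  have "nf dg (t - 1) u = u"
  proof (rule nf_id, unfold reduced_def, rule ballI)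
    fix j assume j: "j \<in> {1..t - 1}"
    have "deg_lt j (dg j) Z"
    proof (cases "j \<in> L")
      case True
      then show ?thesis using deg_lt_mono [OF linear_form_deg] by (simp add: L_def Z_def)
    next
      case False
      then show ?thesis using deg_lt_mono [OF linear_form_deg_free] by (simp add: dg_def Z_def)
    qed
    moreover have "deg_lt j (dg j) ?S"
    proof (cases "j \<in> {k + 1..k + i'}")
      case True
      then have "2 \<le> dg j" using dg i' by auto
      then show ?thesis unfolding hpoly_1 using deg_lt_mono [OF linear_form_deg] by blast
    next
      case False
      then show ?thesis unfolding hpoly_1 using deg_lt_mono [OF linear_form_deg_free] by (simp add: dg_def)
    qed
    ultimately show "deg_lt j (dg j) u" unfolding u_def by (intro deg_lt_arith deg_lt_mult_free const)
  qed
  moreover have "nf dg (t - 1) (?X ^ Suc m * u) = ?X ^ Suc m * nf dg (t - 1) u"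
    by (rule nf_mult_free) (auto simp: deg_lt_var_power simp del: power_Suc)
  ultimately have nfq: "nf dg n q = ?X ^ Suc m * u + nf dg (t - 1) W"
    unfolding skip by (simp add: q nf_add)
  have lf: "vars_in {1..n} (linear_form L c)" by (rule linear_form_vars [OF L_sub])
  have v1: "vars_in {1..n} (hder k (dg t) i)" "vars_in {1..n} (hpoly k (dg t) i)"
  proof -
    have sub: "{k + 1..t} \<subseteq> {1..n}" using i by (auto simp: t_def)
    show "vars_in {1..n} (hder k (dg t) i)" by (rule vars_in_mono [OF block(1) sub])
    show "vars_in {1..n} (hpoly k (dg t) i)" by (rule vars_in_mono [OF block(2) sub])
  qed
  have v2: "vars_in {1..n} (?ct * ?d)" using of_int_poly(1) [of "{1..n}" "c t * int (Suc (Suc m))"] by (simp del: of_nat_Suc)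
  have "cl q = cl (hder k (dg t) i * linear_form L c) \<ominus>\<^bsub>R\<^esub> cl (?ct * ?d) \<otimes>\<^bsub>R\<^esub> cl (hpoly k (dg t) i)"
    unfolding q_def using v1 v2 lf cl_simps(2) [OF vars_in_arith(3) [OF v1(1) lf] vars_in_arith(3) [OF v2 v1(2)]]
      cl_simps(3) [OF v2 v1(2)] by simp
  also have "\<dots> = \<zero>\<^bsub>R\<^esub>" using ann rel cl_simps(5) [OF v2] by (simp add: t_def R.minus_eq)
  finally have "q \<in> J" using cl_eq_zero_iff [of q] v1 v2 lf unfolding q_def by auto
  then have "?X ^ Suc m * u + nf dg (t - 1) W = 0" using nf_J nfq by metis
  moreover have "deg_lt t (Suc m) (nf dg (t - 1) W)"
    using W i by (intro nf_deg_other) (simp_all add: t_def)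
  \<comment> \<open>The remaining terms have degree at most \<open>m\<close> in \<open>?X\<close>
    and so cannot contribute to the monomial under comparison.\<close>
  then have "Poly_Mapping.lookup (nf dg (t - 1) W) (Poly_Mapping.single t (Suc m) + Poly_Mapping.single l 1) = 0"
    by (auto simp: deg_lt_def lookup_add in_keys_iff) (metis lookup_add lookup_single_eq nat_less_le not_add_less1 in_keys_iff)
  ultimately have "Poly_Mapping.lookup u (Poly_Mapping.single l 1) = 0"
    using lookup_frag_mult [of "Poly_Mapping.single t (Suc m)" u "Poly_Mapping.single l 1"]
    by (metis add.right_neutral lookup_add lookup_zero poly_var_power)
  moreover have "Poly_Mapping.lookup u (Poly_Mapping.single l 1)
      = int (Suc (Suc m)) * c l - c t * (if l \<in> {k + 1..k + i'} then 1 else 0)"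
  proof -
    define K where "K = int (Suc (Suc m))"
    have u: "u = of_int K * Z - ?ct * ?S" by (simp only: u_def K_def of_int_of_nat_eq)
    have "Poly_Mapping.lookup u (Poly_Mapping.single l 1) = K * c l - c t * (if l \<in> {k + 1..k + i'} then 1 else 0)"
      using l unfolding u hpoly_1 Z_def by (simp add: lookup_minus lookup_of_int_mult lookup_linear_form t_def)
    then show ?thesis by (simp only: K_def)
  qed
  moreover have "l \<in> {k + 1..<k + i} \<longleftrightarrow> l \<in> {k + 1..k + i'}" using i' by auto
  ultimately show ?thesis by (simp add: t_def [symmetric] m split: if_splits)
qed

abbreviation "yv l \<equiv> cl (poly_var l)"

lemma yv_closed: "l \<in> {1..n} \<Longrightarrow> yv l \<in> carrier R"
  by (rule cl_simps(5)) simp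

lemma yv_homog: "l \<in> {1..n} \<Longrightarrow> yv l \<in> homog R 1"
  by (rule cl_homog) simp_all

definition is_cut :: "nat \<Rightarrow> bool" where
  "is_cut k \<longleftrightarrow> k = 0 \<or> (k \<in> {1..n} \<and> part lam k = k)"

lemma cl_hpoly: "k + i \<le> n \<Longrightarrow> cl (hpoly k m i) = csym R (\<lambda>l. yv (k + l)) m i"
  by (rule hom_hpoly [OF cring_R cl_hom refl])

lemma csym_rel: "i \<in> {1..n} \<Longrightarrow> csym R yv (dg i) i = \<zero>\<^bsub>R\<^esub>"
  using cl_hpoly [of 0 i "dg i"] gen_in_J [of i] cl_eq_zero_iff [of "hpoly 0 (dg i) i"] hpoly_vars [of 0 i n] by simp

text \<open>At a positive cut the relation has degree 1, so \<open>csym_vanish\<close> covers all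
  positive degrees. Relations are assumed only up to \<open>N\<close>, so that the lemma applies
  inside an induction on the number of the relation.\<close>

lemma csym_cut:
  assumes A: "cring A" and y: "\<And>l. l \<in> {1..n} \<Longrightarrow> y l \<in> carrier A"
    and rel: "\<And>i. i \<in> {1..n} \<Longrightarrow> i \<le> N \<Longrightarrow> csym A y (dg i) i = \<zero>\<^bsub>A\<^esub>"
    and k: "is_cut k" "k \<le> N" "1 \<le> m"
  shows "csym A y m k = \<zero>\<^bsub>A\<^esub>"
proof (cases "k = 0")
  case True
  then show ?thesis using k by (cases m) auto
next
  case False
  then have k': "k \<in> {1..n}" "part lam k = k" using k by (auto simp: is_cut_def)
  show ?thesis
  proof (rule csym_vanish [OF A, where N = k and L = "part lam"])
    show "csym A y (part lam i - i + 1) i = \<zero>\<^bsub>A\<^esub>" if "i \<in> {1..k}" for i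
      using rel [of i] that k' k(2) by (simp add: dg_def)
  qed (use y k' k part_mono lam_ge in auto)
qed

text \<open>At a cut \<open>k\<close> the first \<open>k\<close> variables drop out by
  \<open>csym_split\<close>, which turns relation number \<open>k + i\<close> into one in the
  variables after \<open>k\<close> alone.\<close>

lemma block_rel:
  assumes "is_cut k" "1 \<le> i" "k + i \<le> n"
  shows "cl (hpoly k (dg (k + i)) i) = \<zero>\<^bsub>R\<^esub>"
proof -
  have cz: "csym R yv m k = \<zero>\<^bsub>R\<^esub>" if "1 \<le> m" for m
    by (rule csym_cut [OF cring_R yv_closed csym_rel assms(1) _ that, of n]) (use assms in auto)
  have "csym R yv (dg (k + i)) (k + i) = csym R (\<lambda>l. yv (k + l)) (dg (k + i)) i"
    by (rule csym_split [OF cring_R _ cz]) (use yv_closed assms(3) in auto)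
  then show ?thesis using csym_rel [of "k + i"] assms cl_hpoly [OF assms(3)] by simp
qed

lemma cl_of_int_mult: "vars_in {1..n} p \<Longrightarrow> cl (of_int k * p) = [k] \<cdot>\<^bsub>R\<^esub> cl p"
  using cl_simps(3) [of "of_int k" p] by (simp add: of_int_poly cl_of_int R.int_scalar_mult cl_simps(5))

lemma norm_scalar: "x \<in> carrier R \<Longrightarrow> norm ([(k::int)] \<cdot>\<^bsub>R\<^esub> x) = of_int k * norm x"
proof -
  assume "x \<in> carrier R"
  then obtain p where p: "vars_in {1..n} p" "x = cl p" by (rule R_E)
  have "vars_in {1..n} (of_int k * p)" using p of_int_poly by auto
  then show ?thesis using p nf_mult_free [of n "of_int k" dg p]
    by (simp add: cl_of_int_mult [symmetric] norm_cl of_int_poly)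
qed

text \<open>The ring is torsion-free because normal forms are integral polynomials and
  \<open>norm\<close> is compatible with integer multiples.\<close>

lemma scalar_zero:
  assumes "x \<in> carrier R" "[(k::int)] \<cdot>\<^bsub>R\<^esub> x = \<zero>\<^bsub>R\<^esub>" "k \<noteq> 0"
  shows "x = \<zero>\<^bsub>R\<^esub>"
proof -
  have "of_int k * norm x = 0"
    using norm_scalar [OF assms(1), of k] assms(2) norm_cl [of 0] cl_simps(6) by simp
  then have "norm x = 0" using assms(3) by simp
  then show ?thesis using cl_norm [OF assms(1)] cl_simps(6) by simp
qed

lemma scalar_yv_eq:
  assumes "l \<in> L" "[(a::int)] \<cdot>\<^bsub>R\<^esub> yv l = [b] \<cdot>\<^bsub>R\<^esub> yv l"
  shows "a = b"
proof -
  have l: "l \<in> {1..n}" "2 \<le> dg l" using assms(1) by (auto simp: L_def)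
  have "reduced dg n (poly_var l)"
    using l dg_pos by (auto simp: reduced_def deg_lt_var)
  then have nl: "norm (yv l) = poly_var l" using l by (intro norm_of_reduced) simp_all
  have "of_int a * poly_var l = of_int b * poly_var l"
    using norm_scalar [OF yv_closed [OF l(1)]] assms(2) nl by metis
  then have "a * Poly_Mapping.lookup (poly_var l) (Poly_Mapping.single l 1) = b * Poly_Mapping.lookup (poly_var l) (Poly_Mapping.single l 1)"
    by (metis lookup_of_int_mult)
  then show ?thesis by (simp add: poly_var_def)
qed

lemma yv_nonzero: "l \<in> L \<Longrightarrow> yv l \<noteq> \<zero>\<^bsub>R\<^esub>"
  using scalar_yv_eq [of l 1 0] L_sub yv_closed by auto

text \<open>A reduced polynomial cannot contain a variable with \<open>dg\<close> equal to
  1.\<close>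

lemma homog1_linear:
  assumes "x \<in> homog R 1"
  obtains c where "x = cl (linear_form L c)"
proof -
  have xc: "x \<in> carrier R" using assms homog_R_carrier by blast
  have "vars_in L (norm x)"
    unfolding vars_in_def
  proof (intro ballI subsetI)
    fix a l assume a: "a \<in> Poly_Mapping.keys (norm x)" and l: "l \<in> Poly_Mapping.keys a"
    have ln: "l \<in> {1..n}" using norm_vars [OF xc] a l unfolding vars_in_def by blast
    then have "Poly_Mapping.lookup a l < dg l"
      using norm_reduced [OF xc] a by (auto simp: reduced_def deg_lt_def)
    then show "l \<in> L" using l ln by (auto simp: L_def in_keys_iff)
  qed
  from homogeneous_1_linear_form [OF norm_homogeneous [OF assms] finite_L this]
  have "cl (norm x) = cl (linear_form L (\<lambda>l. Poly_Mapping.lookup (norm x) (Poly_Mapping.single l 1)))"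
    by (rule arg_cong)
  then show thesis using cl_norm [OF xc] that by simp
qed

lemma cl_linear_form:
  assumes "S \<subseteq> {1..n}"
  shows "cl (linear_form S c) = finsum R (\<lambda>l. [(c l)] \<cdot>\<^bsub>R\<^esub> yv l) S"
proof -
  have v: "vars_in {1..n} (of_int (c l) * poly_var l)" if "l \<in> S" for l
    using that assms by (intro vars_in_arith(3) of_int_poly) auto
  have "cl (linear_form S c) = finsum R (\<lambda>l. cl (of_int (c l) * poly_var l)) S"
    unfolding linear_form_def by (rule hom_sum [OF cring_R cl_hom v])
  also have "\<dots> = finsum R (\<lambda>l. [(c l)] \<cdot>\<^bsub>R\<^esub> yv l) S"
    using assms yv_closed by (intro R.finsum_cong' [OF refl]) (auto simp: cl_of_int_mult subset_iff)
  finally show ?thesis .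
qed

lemma int_scalar_distr:
  "x \<in> carrier R \<Longrightarrow> y \<in> carrier R \<Longrightarrow> [(k::int)] \<cdot>\<^bsub>R\<^esub> (x \<oplus>\<^bsub>R\<^esub> y) = [k] \<cdot>\<^bsub>R\<^esub> x \<oplus>\<^bsub>R\<^esub> [k] \<cdot>\<^bsub>R\<^esub> y"
  using comm_group.int_pow_distrib [OF R.a_comm_group, of x y k] by (simp add: add_pow_def)

lemma add_hom_linear_form:
  assumes h: "h \<in> hom (add_monoid R) (add_monoid R)" and S: "S \<subseteq> {1..n}"
    and hy: "\<And>l. l \<in> S \<Longrightarrow> h (yv l) = [(c::int)] \<cdot>\<^bsub>R\<^esub> yv l"
  shows "h (cl (linear_form S a)) = [c] \<cdot>\<^bsub>R\<^esub> cl (linear_form S a)"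
proof -
  have yc: "yv l \<in> carrier R" if "l \<in> S" for l using that S yv_closed by auto
  have "finite S" using S finite_subset by blast
  then have "h (finsum R (\<lambda>l. [(a l)] \<cdot>\<^bsub>R\<^esub> yv l) S) = [c] \<cdot>\<^bsub>R\<^esub> finsum R (\<lambda>l. [(a l)] \<cdot>\<^bsub>R\<^esub> yv l) S"
    using hy yc
  proof (induction S rule: finite_induct)
    case empty
    have "[c] \<cdot>\<^bsub>R\<^esub> \<zero>\<^bsub>R\<^esub> = \<zero>\<^bsub>R\<^esub>"
      using add_hom_int_scalar [OF R.is_abelian_group R.is_abelian_group, of "\<lambda>_. \<zero>\<^bsub>R\<^esub>" "\<zero>\<^bsub>R\<^esub>" c]
      by (metis R.int_scalar_scalar R.int_scalar_0 R.zero_closed mult_zero_right)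
    then show ?case using add_hom_zero [OF R.is_abelian_group R.is_abelian_group h] by simp
  next
    case (insert l S)
    have c: "yv l \<in> carrier R" "finsum R (\<lambda>l. [(a l)] \<cdot>\<^bsub>R\<^esub> yv l) S \<in> carrier R"
      using insert(5) by (auto intro!: R.finsum_closed)
    have "finsum R (\<lambda>l. [(a l)] \<cdot>\<^bsub>R\<^esub> yv l) (insert l S) = [(a l)] \<cdot>\<^bsub>R\<^esub> yv l \<oplus>\<^bsub>R\<^esub> finsum R (\<lambda>l. [(a l)] \<cdot>\<^bsub>R\<^esub> yv l) S"
      using insert(1,2,5) by (intro R.finsum_insert) auto
    moreover have "h ([(a l)] \<cdot>\<^bsub>R\<^esub> yv l) = [c] \<cdot>\<^bsub>R\<^esub> ([(a l)] \<cdot>\<^bsub>R\<^esub> yv l)"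
      using add_hom_int_scalar [OF R.is_abelian_group R.is_abelian_group h c(1)] insert(4) [of l] c(1)
      by (simp add: R.int_scalar_scalar mult.commute)
    ultimately show ?case
      using insert c add_hom_add [OF R.is_abelian_group R.is_abelian_group h, of "[(a l)] \<cdot>\<^bsub>R\<^esub> yv l"]
      by (simp add: int_scalar_distr)
  qed
  then show ?thesis by (simp add: cl_linear_form [OF S])
qed

text \<open>Euler's identity: a derivation that acts as the scalar \<open>c\<close> on the variables
  acts as \<open>m * c\<close> on forms of degree \<open>m\<close>.\<close>

lemma derivation_hpoly:
  assumes D: "derivation R D" and y: "\<And>l. l \<in> {k + 1..k + i} \<Longrightarrow> D (yv l) = [(c::int)] \<cdot>\<^bsub>R\<^esub> yv l"
    and n: "k + i \<le> n"
  shows "D (cl (hpoly k m i)) = [(int m * c)] \<cdot>\<^bsub>R\<^esub> cl (hpoly k m i)"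
proof -
  have Dh: "D \<in> hom (add_monoid R) (add_monoid R)"
    and DL: "\<And>x y. x \<in> carrier R \<Longrightarrow> y \<in> carrier R \<Longrightarrow> D (x \<otimes>\<^bsub>R\<^esub> y) = D x \<otimes>\<^bsub>R\<^esub> y \<oplus>\<^bsub>R\<^esub> x \<otimes>\<^bsub>R\<^esub> D y"
    using D by (auto simp: derivation_def)
  note Ds = add_hom_simps [OF R.is_abelian_group R.is_abelian_group Dh]
  show ?thesis using y n
  proof (induction k m i rule: hpoly.induct)
    case (1 k i)
    show ?case using derivation_one [OF cring_R D] by (simp add: cl_simps)
  next
    case (2 k m)
    have "[(int (Suc m) * c)] \<cdot>\<^bsub>R\<^esub> \<zero>\<^bsub>R\<^esub> = \<zero>\<^bsub>R\<^esub>"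
      by (metis R.int_scalar_scalar R.int_scalar_0 R.zero_closed mult_zero_right)
    then show ?case using Ds(3) by (simp add: cl_simps)
  next
    case (3 k m i)
    have v: "vars_in {1..n} (hpoly k (Suc m) i)" "vars_in {1..n} (poly_var (k + Suc i))"
      "vars_in {1..n} (hpoly k m (Suc i))"
      using 3(4) by (simp_all add: hpoly_vars)
    define A B y where "A = cl (hpoly k (Suc m) i)" and "B = cl (hpoly k m (Suc i))" and "y = yv (k + Suc i)"
    have c: "A \<in> carrier R" "B \<in> carrier R" "y \<in> carrier R"
      using v by (simp_all add: A_def B_def y_def cl_simps(5))
    have e: "cl (hpoly k (Suc m) (Suc i)) = A \<oplus>\<^bsub>R\<^esub> y \<otimes>\<^bsub>R\<^esub> B"
      unfolding A_def B_def y_def hpoly.simps using v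
      by (simp only: cl_simps(1) [OF v(1) vars_in_arith(3) [OF v(2,3)]] cl_simps(3) [OF v(2,3)])
    have "D A = [(int (Suc m) * c)] \<cdot>\<^bsub>R\<^esub> A" unfolding A_def by (rule 3(1)) (use 3(3,4) in auto)
    moreover have "D B = [(int m * c)] \<cdot>\<^bsub>R\<^esub> B" unfolding B_def by (rule 3(2)) (use 3(3,4) in auto)
    moreover have "D y = [c] \<cdot>\<^bsub>R\<^esub> y" unfolding y_def by (rule 3(3)) simp
    moreover have "int (Suc m) * c = c + int m * c" by (simp add: algebra_simps)
    ultimately show ?case unfolding e using c
      by (simp add: Ds DL R.add_pow_ldistr_int R.add_pow_rdistr_int int_scalar_distr R.int_scalar_add)
  qed
qed

text \<open>The chain rule: the deviation \<open>z\<close> of \<open>D\<close> from the scalar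
  \<open>c\<close> at the last variable contributes \<open>z\<close> times the partial derivative in
  that variable.\<close>

lemma derivation_hder:
  assumes D: "derivation R D" and y: "\<And>l. l \<in> {k + 1..<k + i} \<Longrightarrow> D (yv l) = [(c::int)] \<cdot>\<^bsub>R\<^esub> yv l"
    and yi: "D (yv (k + i)) = [c] \<cdot>\<^bsub>R\<^esub> yv (k + i) \<oplus>\<^bsub>R\<^esub> z" and z: "z \<in> carrier R"
    and n: "k + i \<le> n" "1 \<le> i"
  shows "D (cl (hpoly k m i)) = [(int m * c)] \<cdot>\<^bsub>R\<^esub> cl (hpoly k m i) \<oplus>\<^bsub>R\<^esub> cl (hder k m i) \<otimes>\<^bsub>R\<^esub> z"
proof -
  have Dh: "D \<in> hom (add_monoid R) (add_monoid R)"
    and DL: "\<And>x y. x \<in> carrier R \<Longrightarrow> y \<in> carrier R \<Longrightarrow> D (x \<otimes>\<^bsub>R\<^esub> y) = D x \<otimes>\<^bsub>R\<^esub> y \<oplus>\<^bsub>R\<^esub> x \<otimes>\<^bsub>R\<^esub> D y"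
    using D by (auto simp: derivation_def)
  note Ds = add_hom_simps [OF R.is_abelian_group R.is_abelian_group Dh]
  obtain i' where i': "i = Suc i'" using n by (cases i) auto
  show ?thesis
  proof (induction m)
    case 0
    show ?case using derivation_one [OF cring_R D] z by (simp add: cl_simps)
  next
    case (Suc m)
    have v: "vars_in {1..n} (hpoly k (Suc m) i')" "vars_in {1..n} (poly_var (k + i))"
      "vars_in {1..n} (hpoly k m i)" "vars_in {1..n} (hder k m i)"
      using n i' hpoly_vars vars_in_mono [OF hder_vars_in [OF n(2), of k m], of "{1..n}"] by auto
    define A B y H where "A = cl (hpoly k (Suc m) i')" and "B = cl (hpoly k m i)" and "y = yv (k + i)"
      and "H = cl (hder k m i)"
    have c: "A \<in> carrier R" "B \<in> carrier R" "y \<in> carrier R" "H \<in> carrier R"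
      using v by (simp_all add: A_def B_def y_def H_def cl_simps(5))
    have e: "cl (hpoly k (Suc m) i) = A \<oplus>\<^bsub>R\<^esub> y \<otimes>\<^bsub>R\<^esub> B"
      unfolding A_def B_def y_def i' hpoly.simps using v unfolding i'
      by (simp only: cl_simps(1) [OF v(1) vars_in_arith(3) [OF v(2,3)], unfolded i'] cl_simps(3) [OF v(2,3), unfolded i'])
    have e': "cl (hder k (Suc m) i) = B \<oplus>\<^bsub>R\<^esub> y \<otimes>\<^bsub>R\<^esub> H"
      unfolding B_def y_def H_def hder.simps
      by (simp only: cl_simps(1) [OF v(3) vars_in_arith(3) [OF v(2,4)]] cl_simps(3) [OF v(2,4)])
    have "D A = [(int (Suc m) * c)] \<cdot>\<^bsub>R\<^esub> A"
      unfolding A_def by (rule derivation_hpoly [OF D]) (use y n i' in auto)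
    moreover have "D B = [(int m * c)] \<cdot>\<^bsub>R\<^esub> B \<oplus>\<^bsub>R\<^esub> H \<otimes>\<^bsub>R\<^esub> z" using Suc by (simp add: B_def H_def)
    moreover have "D y = [c] \<cdot>\<^bsub>R\<^esub> y \<oplus>\<^bsub>R\<^esub> z" using yi by (simp add: y_def)
    moreover have "int (Suc m) * c = c + int m * c" by (simp add: algebra_simps)
    ultimately show ?case unfolding e e' using c z
      by (simp add: Ds DL R.add_pow_ldistr_int R.add_pow_rdistr_int int_scalar_distr R.int_scalar_add
        R.l_distr R.r_distr R.a_ac R.m_ac)
  qed
qed

lemma annihilator_step:
  assumes D: "derivation R D" and D1: "\<And>x. x \<in> homog R 1 \<Longrightarrow> D x \<in> homog R 1"
    and k: "is_cut k" "k + i \<le> n" "1 \<le> i" and dg: "\<And>l. l \<in> {k + 1..k + i} \<Longrightarrow> 2 \<le> dg l"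
    and y: "\<And>l. l \<in> {k + 1..<k + i} \<Longrightarrow> D (yv l) = [(c::int)] \<cdot>\<^bsub>R\<^esub> yv l"
  obtains e where "D (yv (k + i)) = [c] \<cdot>\<^bsub>R\<^esub> yv (k + i) \<oplus>\<^bsub>R\<^esub> cl (linear_form {k + 1..k + i} e)"
    "\<And>l. l \<in> {k + 1..<k + i} \<Longrightarrow> int (dg (k + i)) * e l = e (k + i)"
proof -
  let ?t = "k + i" and ?d = "dg (k + i)"
  have t: "?t \<in> {1..n}" "?t \<in> L" using k dg [of ?t] by (auto simp: L_def)
  have yt: "yv ?t \<in> homog R 1" "yv ?t \<in> carrier R" using yv_homog yv_closed t by blast+
  define z where "z = D (yv ?t) \<ominus>\<^bsub>R\<^esub> [c] \<cdot>\<^bsub>R\<^esub> yv ?t"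
  have Dyc: "D (yv ?t) \<in> carrier R" using D1 [OF yt(1)] homog_R_carrier by blast
  have zc: "z \<in> carrier R" unfolding z_def using Dyc yt by simp
  have Dy: "D (yv ?t) = [c] \<cdot>\<^bsub>R\<^esub> yv ?t \<oplus>\<^bsub>R\<^esub> z"
    unfolding z_def R.minus_eq using Dyc yt(2) by (simp add: R.a_lcomm R.r_neg)
  have "[c] \<cdot>\<^bsub>R\<^esub> yv ?t \<in> homog R 1"
    using cl_homog [of "of_int c * poly_var ?t" 1] t(1) homogeneous_mult [OF of_int_poly(2) homogeneous_simps(4), of c ?t]
    by (simp add: cl_of_int_mult vars_in_arith of_int_poly)
  then have "z \<in> homog R 1"
    unfolding z_def R.minus_eq by (intro G.homog_add G.homog_inv D1 yt)
  then obtain e where e: "z = cl (linear_form L e)" by (rule homog1_linear)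
  have "cl (hder k ?d i) \<otimes>\<^bsub>R\<^esub> z = \<zero>\<^bsub>R\<^esub>"
  proof -
    have h0: "cl (hpoly k ?d i) = \<zero>\<^bsub>R\<^esub>" by (rule block_rel [OF k(1,3,2)])
    have s0: "[(int ?d * c)] \<cdot>\<^bsub>R\<^esub> \<zero>\<^bsub>R\<^esub> = \<zero>\<^bsub>R\<^esub>"
      by (metis R.int_scalar_scalar R.int_scalar_0 R.zero_closed mult_zero_right)
    have hc: "cl (hder k ?d i) \<in> carrier R"
      by (intro cl_simps(5) vars_in_mono [OF hder_vars_in [OF k(3)]]) (use k in auto)
    have "D \<zero>\<^bsub>R\<^esub> = \<zero>\<^bsub>R\<^esub>"
      using D add_hom_zero [OF R.is_abelian_group R.is_abelian_group] by (simp add: derivation_def)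
    then show ?thesis using derivation_hder [OF D y Dy zc k(2,3), of ?d] hc zc unfolding h0 s0 by simp
  qed
  moreover have "cl (hder k ?d i * linear_form L e) = cl (hder k ?d i) \<otimes>\<^bsub>R\<^esub> z"
    unfolding e by (intro cl_simps(3) vars_in_mono [OF hder_vars_in [OF k(3)]] linear_form_vars L_sub) (use k in auto)
  ultimately have ann: "cl (hder k ?d i * linear_form L e) = \<zero>\<^bsub>R\<^esub>" by simp
  have co: "int ?d * e l = (if l \<in> {k + 1..<?t} then e ?t else 0)" if "l \<in> L" "l \<noteq> ?t" for l
    by (rule annihilator_of_hder [OF k(3,2) dg block_rel [OF k(1,3,2)] ann that])
  have sub: "{k + 1..?t} \<subseteq> L" using dg k by (auto simp: L_def)
  have "linear_form L e = linear_form {k + 1..?t} e"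
    unfolding linear_form_def
  proof (rule sum.mono_neutral_right [OF finite_L sub], rule ballI)
    fix l assume l: "l \<in> L - {k + 1..?t}"
    then have "l \<in> L" "l \<noteq> ?t" "l \<notin> {k + 1..<?t}" using k by auto
    then have "int ?d * e l = 0" using co [of l] by (simp only: if_not_P not_False_eq_True)
    then have "e l = 0" using dg_pos [of ?t] by simp
    then show "of_int (e l) * poly_var l = 0" by simp
  qed
  then have z: "z = cl (linear_form {k + 1..?t} e)" using e by simp
  show thesis
  proof (rule that [of e])
    show "D (yv ?t) = [c] \<cdot>\<^bsub>R\<^esub> yv ?t \<oplus>\<^bsub>R\<^esub> cl (linear_form {k + 1..?t} e)"
      using Dy z by simp
    fix l assume l: "l \<in> {k + 1..<?t}"
    then have "l \<in> L" "l \<noteq> ?t" using sub by auto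
    then show "int ?d * e l = e ?t" using co [OF \<open>l \<in> L\<close> \<open>l \<noteq> ?t\<close>] l by (simp only: if_True)
  qed
qed

theorem derivation_on_block:
  assumes D: "derivation R D" and D1: "\<And>x. x \<in> homog R 1 \<Longrightarrow> D x \<in> homog R 1"
    and D2: "\<And>x. x \<in> homog R 1 \<Longrightarrow> D (D x) = D x"
    and k: "is_cut k" "k + N \<le> n" and dg: "\<And>l. l \<in> {k + 1..k + N} \<Longrightarrow> 2 \<le> dg l"
  shows "\<exists>c\<in>{0, 1 :: int}. \<forall>l\<in>{k + 1..k + N}. D (yv l) = [c] \<cdot>\<^bsub>R\<^esub> yv l"
proof (cases "N = 0")
  case False
  have Dh: "D \<in> hom (add_monoid R) (add_monoid R)" using D by (simp add: derivation_def)
  note Ds = add_hom_simps [OF R.is_abelian_group R.is_abelian_group Dh]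
  note Dsc = add_hom_int_scalar [OF R.is_abelian_group R.is_abelian_group Dh]
  have yc: "yv l \<in> carrier R" "yv l \<in> homog R 1" if "l \<in> {k + 1..k + N}" for l
    using that k by (auto intro!: yv_closed yv_homog)
  have inL: "l \<in> L" if "l \<in> {k + 1..k + N}" for l using that dg k by (auto simp: L_def)
  \<comment> \<open>With no earlier variable in the block, any scalar may be taken for
    \<open>c\<close>; with 0 the linear form is the whole of \<open>D (yv (k + 1))\<close>.\<close>
  obtain e where e: "D (yv (k + 1)) = [(0::int)] \<cdot>\<^bsub>R\<^esub> yv (k + 1) \<oplus>\<^bsub>R\<^esub> cl (linear_form {k + 1..k + 1} e)"
  proof (rule annihilator_step [OF D D1 k(1), of 1 0])
    show "k + 1 \<le> n" using k False by simp
    show "2 \<le> dg l" if "l \<in> {k + 1..k + 1}" for l using dg [of l] that False by simp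
  qed (use that in auto)
  define c where "c = e (k + 1)"
  have y1: "yv (k + 1) \<in> carrier R" "yv (k + 1) \<in> homog R 1" using yc [of "k + 1"] False by simp_all
  have "cl (linear_form {k + 1..k + 1} e) = [c] \<cdot>\<^bsub>R\<^esub> yv (k + 1)"
    using cl_of_int_mult [of "poly_var (k + 1)"] k False by (simp add: linear_form_def c_def)
  then have Dc: "D (yv (k + 1)) = [c] \<cdot>\<^bsub>R\<^esub> yv (k + 1)" using e y1 by simp
  \<comment> \<open>Idempotence of \<open>D\<close> in degree 1 passes to the scalar
    \<open>c\<close>, because integer multiples of a basis variable determine the integer.\<close>
  have "[(c * c)] \<cdot>\<^bsub>R\<^esub> yv (k + 1) = [c] \<cdot>\<^bsub>R\<^esub> yv (k + 1)"
    using D2 [OF y1(2)] y1 by (simp add: Dc Dsc R.int_scalar_scalar)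
  then have cc: "c * c = c" using scalar_yv_eq [OF inL [of "k + 1"], of "c * c" c] False by simp
  then have c01: "c \<in> {0, 1}" by auto
  have "\<forall>l\<in>{k + 1..k + i}. D (yv l) = [c] \<cdot>\<^bsub>R\<^esub> yv l" if "i \<le> N" for i
    using that
  proof (induction i)
    case (Suc i)
    show ?case
    proof (cases "i = 0")
      case True
      then have e: "{k + 1..k + Suc i} = {k + 1}" by auto
      show ?thesis unfolding e using Dc by simp
    next
      case False
      define t where "t = k + Suc i"
      have tn: "t \<in> {1..n}" using k Suc by (simp add: t_def)
      have IH: "D (yv l) = [c] \<cdot>\<^bsub>R\<^esub> yv l" if "l \<in> {k + 1..<k + Suc i}" for l
        using Suc that by simp
      obtain e where e0: "D (yv (k + Suc i)) = [c] \<cdot>\<^bsub>R\<^esub> yv (k + Suc i) \<oplus>\<^bsub>R\<^esub> cl (linear_form {k + 1..k + Suc i} e)"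
        "\<And>l. l \<in> {k + 1..<k + Suc i} \<Longrightarrow> int (dg (k + Suc i)) * e l = e (k + Suc i)"
      proof (rule annihilator_step [OF D D1 k(1), of "Suc i" c])
        show "k + Suc i \<le> n" using k Suc by simp
        show "2 \<le> dg l" if "l \<in> {k + 1..k + Suc i}" for l using dg [of l] that Suc by simp
        show "D (yv l) = [c] \<cdot>\<^bsub>R\<^esub> yv l" if "l \<in> {k + 1..<k + Suc i}" for l using IH that .
      qed (use that in auto)
      note e = e0 [folded t_def] and IH = IH [folded t_def]
      define z where "z = cl (linear_form {k + 1..t} e)"
      have sub: "{k + 1..<t} \<subseteq> {1..n}" "{k + 1..t} \<subseteq> {1..n}" using k Suc by (auto simp: t_def)
      have yt: "yv t \<in> carrier R" "yv t \<in> homog R 1" using yc [of t] Suc by (simp_all add: t_def)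
      define z' where "z' = cl (linear_form {k + 1..<t} e)"
      have z'c: "z' \<in> carrier R" unfolding z'_def by (intro cl_simps(5) linear_form_vars sub)
      have zc: "z \<in> carrier R" unfolding z_def by (intro cl_simps(5) linear_form_vars sub)
      have "{k + 1..t} = insert t {k + 1..<t}" by (auto simp: t_def)
      then have "linear_form {k + 1..t} e = of_int (e t) * poly_var t + linear_form {k + 1..<t} e"
        by (simp add: linear_form_def)
      then have z: "z = [(e t)] \<cdot>\<^bsub>R\<^esub> yv t \<oplus>\<^bsub>R\<^esub> z'"
        unfolding z_def z'_def
        using cl_simps(1) [of "of_int (e t) * poly_var t" "linear_form {k + 1..<t} e"]
          linear_form_vars [OF sub(1)] tn cl_of_int_mult [of "poly_var t"]
        by (simp add: vars_in_arith of_int_poly)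
      have Dz': "D z' = [c] \<cdot>\<^bsub>R\<^esub> z'"
        unfolding z'_def by (rule add_hom_linear_form [OF Dh sub(1) IH])
      have Dt: "D (yv t) = [c] \<cdot>\<^bsub>R\<^esub> yv t \<oplus>\<^bsub>R\<^esub> z" using e(1) by (simp add: z_def)
      \<comment> \<open>\<open>D\<close> acts as \<open>c\<close> on the part \<open>z'\<close> in
        earlier variables and adds \<open>z\<close> to the scalar action on \<open>yv t\<close>;
        collecting terms, \<open>z\<close> is an eigenvector with eigenvalue
        \<open>c + e t\<close>.\<close>
      have "D z = [(e t)] \<cdot>\<^bsub>R\<^esub> ([c] \<cdot>\<^bsub>R\<^esub> yv t \<oplus>\<^bsub>R\<^esub> z) \<oplus>\<^bsub>R\<^esub> [c] \<cdot>\<^bsub>R\<^esub> z'"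
      proof -
        have "D z = [(e t)] \<cdot>\<^bsub>R\<^esub> D (yv t) \<oplus>\<^bsub>R\<^esub> [c] \<cdot>\<^bsub>R\<^esub> z'"
          unfolding z using yt z'c by (simp add: Ds Dsc Dz')
        then show ?thesis by (simp only: Dt)
      qed
      also have "\<dots> = [c] \<cdot>\<^bsub>R\<^esub> ([(e t)] \<cdot>\<^bsub>R\<^esub> yv t \<oplus>\<^bsub>R\<^esub> z') \<oplus>\<^bsub>R\<^esub> [(e t)] \<cdot>\<^bsub>R\<^esub> z"
        using yt z'c zc by (simp add: int_scalar_distr R.int_scalar_scalar mult.commute R.a_ac)
      also have "\<dots> = [(c + e t)] \<cdot>\<^bsub>R\<^esub> z"
        unfolding z [symmetric] using zc by (simp add: R.int_scalar_add)
      finally have Dz: "D z = [(c + e t)] \<cdot>\<^bsub>R\<^esub> z" .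
      \<comment> \<open>As \<open>c * c = c\<close>, comparing \<open>D (D (yv t))\<close> with
        \<open>D (yv t)\<close> leaves a single integer multiple of \<open>z\<close> that
        vanishes.\<close>
      have "D (D (yv t)) = [c] \<cdot>\<^bsub>R\<^esub> yv t \<oplus>\<^bsub>R\<^esub> ([c] \<cdot>\<^bsub>R\<^esub> z \<oplus>\<^bsub>R\<^esub> [(c + e t)] \<cdot>\<^bsub>R\<^esub> z)"
        unfolding Dt using yt zc by (simp add: Ds Dsc Dt Dz int_scalar_distr R.int_scalar_scalar cc R.a_assoc)
      then have "[c] \<cdot>\<^bsub>R\<^esub> yv t \<oplus>\<^bsub>R\<^esub> [(c + (c + e t))] \<cdot>\<^bsub>R\<^esub> z = [c] \<cdot>\<^bsub>R\<^esub> yv t \<oplus>\<^bsub>R\<^esub> z"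
        using D2 [OF yt(2)] Dt zc R.int_scalar_add [OF zc, of c "c + e t"] by simp
      then have "[(c + (c + e t))] \<cdot>\<^bsub>R\<^esub> z = z"
        using R.add_left_imp_eq [of "[c] \<cdot>\<^bsub>R\<^esub> yv t" _ z] yt zc by simp
      moreover have "[(c + (c + e t))] \<cdot>\<^bsub>R\<^esub> z = [(c + c + e t - 1)] \<cdot>\<^bsub>R\<^esub> z \<oplus>\<^bsub>R\<^esub> z"
        using R.int_scalar_add [OF zc, of "c + c + e t - 1" 1] zc by (simp add: add.assoc)
      ultimately have "[(c + c + e t - 1)] \<cdot>\<^bsub>R\<^esub> z = \<zero>\<^bsub>R\<^esub>"
        using R.add_eq_right_imp_zero [of "[(c + c + e t - 1)] \<cdot>\<^bsub>R\<^esub> z" z] zc by simp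
      moreover have "c + c + e t - 1 \<noteq> 0"
      proof
        assume "c + c + e t - 1 = 0"
        then have "e t = 1 \<or> e t = - 1" using c01 by auto
        \<comment> \<open>The first index of the block is an earlier index, so its coefficient
          witnesses that \<open>dg t\<close> divides \<open>e t\<close>.\<close>
        moreover have "k + 1 \<in> {k + 1..<t}" using False by (simp add: t_def)
        from e(2) [OF this, symmetric] have "int (dg t) dvd e t" by simp
        ultimately have "int (dg t) dvd 1" by auto
        then show False using dg [of t] Suc by (simp add: t_def)
      qed
      ultimately have "z = \<zero>\<^bsub>R\<^esub>" using scalar_zero zc by blast
      then have "D (yv t) = [c] \<cdot>\<^bsub>R\<^esub> yv t" using Dt yt by simp
      moreover have "{k + 1..k + Suc i} = insert t {k + 1..k + i}" by (auto simp: t_def)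
      moreover have "\<forall>l\<in>{k + 1..k + i}. D (yv l) = [c] \<cdot>\<^bsub>R\<^esub> yv l" using Suc by simp
      ultimately show ?thesis by (simp only: ball_simps)
    qed
  qed simp
  then show ?thesis using c01 by blast
qed auto

lemma derivation_on_homog1:
  assumes "derivation R D" "\<And>l. l \<in> L \<Longrightarrow> D (yv l) = [(c::int)] \<cdot>\<^bsub>R\<^esub> yv l" "x \<in> homog R 1"
  shows "D x = [c] \<cdot>\<^bsub>R\<^esub> x"
  using assms(3)
proof (rule homog1_linear)
  fix a assume "x = cl (linear_form L a)"
  then show ?thesis
    using add_hom_linear_form [OF _ L_sub assms(2)] assms(1) by (simp add: derivation_def)
qed

text \<open>With a single block every \<open>D i\<close> is a scalar 0 or 1 on degree 1. The scalar
  0 would make its factor trivial, and the scalar 1 for two factors contradicts their orthogonality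
  at the first variable.\<close>

theorem indecomposable:
  assumes n: "1 \<le> n" and lt: "\<And>i. i \<in> {1..n} \<Longrightarrow> i < part lam i"
  shows "tensor_indecomposable R"
proof -
  have dg2: "2 \<le> dg i" if "i \<in> {1..n}" for i using lt [OF that] by (simp add: dg_def)
  have L: "L = {1..n}" using dg2 by (auto simp: L_def)
  have y1: "yv 1 \<in> homog R 1" "yv 1 \<in> carrier R" "yv 1 \<noteq> \<zero>\<^bsub>R\<^esub>"
  proof -
    have 1: "1 \<in> {1..n}" using n by simp
    show "yv 1 \<in> homog R 1" "yv 1 \<in> carrier R" by (rule yv_homog [OF 1], rule yv_closed [OF 1])
    show "yv 1 \<noteq> \<zero>\<^bsub>R\<^esub>" by (rule yv_nonzero) (simp only: L 1)
  qed
  have False if s: "2 \<le> s" and dec: "nontrivial_decomposition R s (T :: nat \<Rightarrow> int_mpoly set graded_ring) \<phi>" for s T \<phi>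
  proof -
    interpret D: decomposition R s T \<phi>
      using dec by (intro decomposition.intro std_graded_R decomposition_axioms.intro)
        (simp add: nontrivial_decomposition_def)
    obtain D where D: "\<And>i. i < s \<Longrightarrow> derivation R (D i)"
      "\<And>i x. i < s \<Longrightarrow> x \<in> homog R 1 \<Longrightarrow> D i x \<in> D.summand i"
      "\<And>i x. i < s \<Longrightarrow> x \<in> D.summand i \<Longrightarrow> D i x = x"
      "\<And>i j x. i < s \<Longrightarrow> j < s \<Longrightarrow> i \<noteq> j \<Longrightarrow> x \<in> D.summand i \<Longrightarrow> D j x = \<zero>\<^bsub>R\<^esub>"
      "\<And>x. x \<in> homog R 1 \<Longrightarrow> x = finsum R (\<lambda>i. D i x) {..<s}"
    proof (rule D.factor_derivations, goal_cases)
      case (1 D)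
      show ?case by (rule 1(1)) (fact 1)+
    qed
    have one: "D i (yv 1) = yv 1" if i: "i < s" for i
    proof -
      have "\<exists>c\<in>{0, 1 :: int}. \<forall>l\<in>{0 + 1..0 + n}. D i (yv l) = [c] \<cdot>\<^bsub>R\<^esub> yv l"
      proof (rule derivation_on_block [OF D(1) [OF i]])
        show "D i x \<in> homog R 1" if "x \<in> homog R 1" for x
          using D.summand_homog [OF i D(2) [OF i that]] .
        show "D i (D i x) = D i x" if "x \<in> homog R 1" for x
          using D(3) [OF i D(2) [OF i that]] .
        show "is_cut 0" by (simp add: is_cut_def)
        show "2 \<le> dg l" if "l \<in> {0 + 1..0 + n}" for l using that dg2 by simp
      qed simp
      then obtain c :: int where c01: "c \<in> {0, 1}" and "\<forall>l\<in>{0 + 1..0 + n}. D i (yv l) = [c] \<cdot>\<^bsub>R\<^esub> yv l"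
        by (elim bexE)
      then have c: "c \<in> {0, 1}" "\<And>l. l \<in> L \<Longrightarrow> D i (yv l) = [c] \<cdot>\<^bsub>R\<^esub> yv l"
        unfolding L by simp_all
      have "c \<noteq> 0"
      proof
        assume "c = 0"
        have "D.summand i \<subseteq> {\<zero>\<^bsub>R\<^esub>}"
        proof
          fix x assume x: "x \<in> D.summand i"
          have "D i x = [c] \<cdot>\<^bsub>R\<^esub> x"
            by (rule derivation_on_homog1 [OF D(1) [OF i] c(2) D.summand_homog [OF i x]])
          then show "x \<in> {\<zero>\<^bsub>R\<^esub>}" using D(3) [OF i x] \<open>c = 0\<close> by simp
        qed
        then have "\<Z> \<simeq> T i" by (rule D.summand_trivial [OF i])
        then show False using dec i by (simp add: nontrivial_decomposition_def)
      qed
      then show ?thesis using c(1) c(2) [of 1] y1(2) n L by auto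
    qed
    have "0 < s" "1 < s" "(0::nat) \<noteq> 1" using s by auto
    moreover have "yv 1 \<in> D.summand 0" using D(2) [OF \<open>0 < s\<close> y1(1)] one [OF \<open>0 < s\<close>] by simp
    ultimately have "D 1 (yv 1) = \<zero>\<^bsub>R\<^esub>" using D(4) by blast
    then show False using one [OF \<open>1 < s\<close>] y1(3) by simp
  qed
  moreover have "\<not> \<Z> \<simeq> R" using G.not_int_if_homog1 y1 by blast
  ultimately show ?thesis unfolding tensor_indecomposable_def by blast
qed

end

subsection \<open>Indecomposable components\<close>

lemma hom_linear_form:
  assumes A: "cring A" and h: "h \<in> ring_hom (polys_upto m) A" and S: "S \<subseteq> {1..m}"
  shows "h (linear_form S c) = finsum A (\<lambda>l. [(c l)] \<cdot>\<^bsub>A\<^esub> h (poly_var l)) S"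
proof -
  interpret A: cring A by fact
  note hs = polys_upto_hom_simps [OF A h]
  have hk: "h (of_int k) = [k] \<cdot>\<^bsub>A\<^esub> \<one>\<^bsub>A\<^esub>" for k
  proof -
    have "[k] \<cdot>\<^bsub>polys_upto m\<^esub> \<one>\<^bsub>polys_upto m\<^esub> = of_int k"
    proof (induction k rule: int_induct [where k = 0])
      case (step1 i)
      then show ?case using PU.int_scalar_add [of 1 m i 1] PU.int_scalar_one [of 1 m] by simp
    next
      case (step2 i)
      then show ?case using PU.int_scalar_add [of 1 m "i - 1" 1] PU.int_scalar_one [of 1 m] by simp
    qed simp
    then show ?thesis using ring_hom_int [OF cring_polys_upto A h, of k] by simp
  qed
  have v: "vars_in {1..m} (of_int (c l) * poly_var l)" if "l \<in> S" for l
    using that S by (intro vars_in_arith(3) of_int_poly) auto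
  have "h (linear_form S c) = finsum A (\<lambda>l. h (of_int (c l) * poly_var l)) S"
    unfolding linear_form_def by (rule hom_sum [OF A h v])
  also have "\<dots> = finsum A (\<lambda>l. [(c l)] \<cdot>\<^bsub>A\<^esub> h (poly_var l)) S"
  proof (rule A.finsum_cong' [OF refl])
    have c: "h (poly_var l) \<in> carrier A" if "l \<in> S" for l using that S by (intro hs(5)) auto
    then show "(\<lambda>l. [(c l)] \<cdot>\<^bsub>A\<^esub> h (poly_var l)) \<in> S \<rightarrow> carrier A" by simp
    fix l assume l: "l \<in> S"
    have "h (of_int (c l) * poly_var l) = h (of_int (c l)) \<otimes>\<^bsub>A\<^esub> h (poly_var l)"
      using l S by (intro hs(3) of_int_poly) auto
    then show "h (of_int (c l) * poly_var l) = [(c l)] \<cdot>\<^bsub>A\<^esub> h (poly_var l)"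
      using c [OF l] by (simp add: hk A.int_scalar_mult)
  qed
  finally show ?thesis .
qed

context partition begin

lemma part_ring_hom_eq:
  assumes A: "cring A" and h: "h \<in> ring_hom R A" and g: "g \<in> ring_hom R A"
    and eq: "\<And>i. i \<in> {1..n} \<Longrightarrow> h (yv i) = g (yv i)" and x: "x \<in> carrier R"
  shows "h x = g x"
proof -
  obtain p where p: "vars_in {1..n} p" "x = cl p" using x by (rule R_E)
  have "(h \<circ> cl) p = (g \<circ> cl) p"
    by (rule polys_upto_hom_eq [OF A ring_hom_trans [OF cl_hom h] ring_hom_trans [OF cl_hom g] _ p(1)])
      (simp add: eq)
  then show ?thesis by (simp add: p)
qed

abbreviation "ks \<equiv> cut_indices lam"

lemma ks_sorted: "sorted_wrt (<) ks"
proof -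
  have "sorted_wrt (<) (filter (\<lambda>k. part lam k = k) [1..<n + 1])"
    by (intro sorted_wrt_filter) simp
  then show ?thesis
    by (auto simp: cut_indices_def sorted_wrt_append)
qed

lemma ks_set: "set ks = {0} \<union> {k \<in> {1..n}. part lam k = k} \<union> {n + 1}"
  by (auto simp: cut_indices_def)

lemma ks_less: "t < u \<Longrightarrow> u < length ks \<Longrightarrow> ks ! t < ks ! u"
  using ks_sorted by (rule sorted_wrt_nth_less)

lemma ks_last: "ks ! (length ks - 1) = n + 1"
  by (simp add: cut_indices_def nth_append)

lemma ks_length: "2 \<le> length ks"
  by (simp add: cut_indices_def)

lemma ks_cut: assumes "t < length ks - 1" shows "is_cut (ks ! t)" "ks ! t \<le> n"
proof -
  have "ks ! t < n + 1" using ks_less [of t "length ks - 1"] ks_last assms by simp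
  moreover have "ks ! t \<in> set ks" using assms by simp
  ultimately show "is_cut (ks ! t)" "ks ! t \<le> n" unfolding ks_set is_cut_def by auto
qed

lemma ks_between: assumes "t < length ks - 1" "ks ! t < l" "l < ks ! (t + 1)" shows "l \<notin> set ks"
proof
  assume "l \<in> set ks"
  then obtain u where u: "u < length ks" "l = ks ! u" by (auto simp: in_set_conv_nth)
  consider "u \<le> t" | "u = t + 1" | "t + 1 < u" by linarith
  then show False
  proof cases
    case 1
    moreover have "t < length ks" using assms(1) by linarith
    ultimately have "ks ! u \<le> ks ! t" using ks_less [of u t] by (cases "u = t") auto
    then show ?thesis using u assms by simp
  next
    case 2
    then show ?thesis using u assms by simp
  next
    case 3
    then show ?thesis using ks_less [OF 3 u(1)] u assms by simp
  qed
qed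

abbreviation "r \<equiv> num_components lam"
abbreviation "C \<equiv> component lam"
abbreviation "ofs \<equiv> offset lam"

lemma component_index:
  assumes "j < r"
  obtains t where "t < length ks - 1" "ofs j = ks ! t"
    "C j = map (\<lambda>i. part lam i - ks ! t) [ks ! t + 1..<ks ! (t + 1)]" "C j \<noteq> []"
proof -
  have "components lam ! j \<in> set (components lam)"
    using assms by (simp add: num_components_def)
  then obtain t where "t < length ks - 1" "components lam ! j =
      (ks ! t, map (\<lambda>i. part lam i - ks ! t) [ks ! t + 1..<ks ! (t + 1)])" "snd (components lam ! j) \<noteq> []"
    unfolding components_def Let_def by auto
  then show thesis by (intro that [of t]) (simp_all add: offset_def component_def)
qed

lemma component_props:
  assumes j: "j < r"
  shows "is_cut (ofs j)" "1 \<le> length (C j)" "ofs j + length (C j) \<le> n"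
    "\<And>i. i \<in> {1..length (C j)} \<Longrightarrow> ofs j + i < part lam (ofs j + i)"
    "\<And>i. i \<in> {1..length (C j)} \<Longrightarrow> part (C j) i = part lam (ofs j + i) - ofs j"
proof -
  obtain t where t: "t < length ks - 1" "ofs j = ks ! t"
    "C j = map (\<lambda>i. part lam i - ks ! t) [ks ! t + 1..<ks ! (t + 1)]" "C j \<noteq> []"
    using component_index [OF j] .
  have len: "length (C j) = ks ! (t + 1) - (ks ! t + 1)" using t(3) by simp
  have le: "ks ! (t + 1) \<le> n + 1"
  proof (cases "t + 1 = length ks - 1")
    case False
    then have "t + 1 < length ks - 1" "length ks - 1 < length ks" using t(1) ks_length by linarith+
    then show ?thesis using ks_less [of "t + 1" "length ks - 1"] ks_last by simp
  qed (simp only: ks_last order_refl)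
  show "is_cut (ofs j)" using ks_cut t by simp
  show l1: "1 \<le> length (C j)" using t(4) by (cases "C j") auto
  then show len': "ofs j + length (C j) \<le> n" using len le t(2) by simp
  show "ofs j + i < part lam (ofs j + i)" if i: "i \<in> {1..length (C j)}" for i
  proof -
    have "1 \<le> i" "i \<le> ks ! (t + 1) - (ks ! t + 1)" using i len by simp_all
    then have "ks ! t < ofs j + i" "ofs j + i < ks ! (t + 1)" using t(2) by linarith+
    then have "ofs j + i \<notin> set ks" using ks_between [OF t(1), of "ofs j + i"] by simp
    moreover have "ofs j + i \<in> {1..n}" using i len' by auto
    ultimately show ?thesis unfolding ks_set using lam_ge [of "ofs j + i"] by auto
  qed
  show "part (C j) i = part lam (ofs j + i) - ofs j" if i: "i \<in> {1..length (C j)}" for i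
  proof -
    have "i - 1 < length [ks ! t + 1..<ks ! (t + 1)]" "ks ! t + 1 + (i - 1) < ks ! (t + 1)" "ks ! t + 1 + (i - 1) = ks ! t + i"
      using i unfolding len by auto
    then show ?thesis unfolding part_def [of "C j"] t(2) by (simp only: t(3) nth_map nth_upt)
  qed
qed

lemma ofs_inj: assumes "j < r" "j' < r" "ofs j = ofs j'" shows "j = j'"
proof -
  let ?F = "\<lambda>t. (ks ! t, map (\<lambda>i. part lam i - ks ! t) [ks ! t + 1..<ks ! (t + 1)])"
  have "distinct ks" using ks_sorted strict_sorted_iff by blast
  then have "distinct (map (\<lambda>t. ks ! t) [0..<length ks - 1])"
    by (auto simp: distinct_map inj_on_def nth_eq_iff_index_eq)
  then have "distinct (map fst (map ?F [0..<length ks - 1]))" by (simp add: comp_def)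
  then have "distinct (map fst (components lam))"
    unfolding components_def Let_def by (rule distinct_map_filter)
  then show ?thesis
    using assms nth_eq_iff_index_eq [of "map fst (components lam)" j j'] by (simp add: num_components_def offset_def)
qed

text \<open>If the offsets differed, the larger one would be an index inside the block of the
  smaller one; but it is a cut, and blocks contain none.\<close>

lemma block_unique:
  assumes "j < r" "i \<in> {1..length (C j)}" "j' < r" "i' \<in> {1..length (C j')}" "ofs j + i = ofs j' + i'"
  shows "j = j' \<and> i = i'"
proof -
  have *: "\<not> ofs a < ofs b" if "a < r" "p \<in> {1..length (C a)}" "b < r" "q \<in> {1..length (C b)}" "ofs a + p = ofs b + q" for a b p q
  proof
    assume lt: "ofs a < ofs b"
    then have "ofs b - ofs a \<in> {1..length (C a)}" using that by auto
    from component_props(4) [OF that(1) this] lt have "ofs b < part lam (ofs b)" by simp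
    then show False using component_props(1) [OF that(3)] lt by (auto simp: is_cut_def)
  qed
  have "ofs j = ofs j'" using *[OF assms] *[OF assms(3,4,1,2)] assms(5) by simp
  then show ?thesis using ofs_inj assms by auto
qed

text \<open>The block starts at the last entry of \<open>ks\<close> below \<open>l\<close>. As
  \<open>l\<close> is not itself an entry, it lies strictly before the next one, so this component
  is nonempty and survives the filter.\<close>

lemma block_exists:
  assumes l: "l \<in> {1..n}" "part lam l \<noteq> l"
  shows "\<exists>j<r. \<exists>i\<in>{1..length (C j)}. l = ofs j + i"
proof -
  define t where "t = Max {t. t < length ks \<and> ks ! t < l}"
  have "0 \<in> {t. t < length ks \<and> ks ! t < l}" using l by (simp add: cut_indices_def)
  then have "t \<in> {t. t < length ks \<and> ks ! t < l}" unfolding t_def by (intro Max_in) auto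
  then have t: "t < length ks" "ks ! t < l" by auto
  have "t \<noteq> length ks - 1" using t l ks_last by auto
  then have t1: "t < length ks - 1" using t by simp
  have "\<not> ks ! (t + 1) < l"
  proof
    assume "ks ! (t + 1) < l"
    then have "t + 1 \<le> t" unfolding t_def using t1 by (intro Max_ge) (auto simp: t_def)
    then show False by simp
  qed
  moreover have "ks ! (t + 1) \<noteq> l"
  proof
    assume "ks ! (t + 1) = l"
    then have "l \<in> set ks" using t1 nth_mem [of "t + 1" ks] by auto
    then show False unfolding ks_set using l by auto
  qed
  ultimately have lt: "l < ks ! (t + 1)" by simp
  let ?F = "\<lambda>t. (ks ! t, map (\<lambda>i. part lam i - ks ! t) [ks ! t + 1..<ks ! (t + 1)])"
  have "?F t \<in> set (components lam)"
    unfolding components_def Let_def using t1 t(2) lt by auto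
  then obtain j where j: "j < r" "components lam ! j = ?F t"
    by (auto simp: in_set_conv_nth num_components_def)
  then have "ofs j = ks ! t" "length (C j) = ks ! (t + 1) - (ks ! t + 1)"
    by (simp_all add: offset_def component_def)
  then have "l - ofs j \<in> {1..length (C j)}" "l = ofs j + (l - ofs j)" using t(2) lt by auto
  then show ?thesis using j(1) by blast
qed

lemma partition_component: assumes j: "j < r" shows "partition (C j)"
proof
  note cp = component_props [OF j]
  show "sorted (C j)"
    unfolding sorted_iff_nth_mono
  proof (intro allI impI)
    fix i i' assume i: "i \<le> i'" "i' < length (C j)"
    have "part (C j) (i + 1) \<le> part (C j) (i' + 1)"
      using cp(5) [of "i + 1"] cp(5) [of "i' + 1"] i cp(3) part_mono [of "ofs j + (i + 1)" "ofs j + (i' + 1)"] by simp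
    then show "C j ! i \<le> C j ! i'" by (simp add: part_def)
  qed
  show "i \<le> part (C j) i" if "i \<in> {1..length (C j)}" for i
    using cp(4,5) [OF that] by simp
qed

lemma component_lt: assumes j: "j < r" and i: "i \<in> {1..length (C j)}" shows "i < part (C j) i"
  using component_props(4,5) [OF j i] by simp

lemma component_dg: assumes j: "j < r" and i: "i \<in> {1..length (C j)}" shows "partition.dg (C j) i = dg (ofs j + i)"
  using component_props(4,5) [OF j i] by (simp add: partition.dg_def [OF partition_component [OF j]] dg_def)

lemma component_L: assumes j: "j < r" shows "partition.L (C j) = {1..length (C j)}"
proof -
  have "2 \<le> partition.dg (C j) i" if "i \<in> {1..length (C j)}" for i
    using component_lt [OF j that] unfolding partition.dg_def [OF partition_component [OF j]] by linarith
  then show ?thesis unfolding partition.L_def [OF partition_component [OF j]] by auto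
qed

section \<open>Blocks of variables and the embeddings of the component rings\<close>

definition "blk j = {ofs j + 1..ofs j + length (C j)}"

lemma blk_iff: "l \<in> blk j \<longleftrightarrow> (\<exists>i\<in>{1..length (C j)}. l = ofs j + i)"
proof
  assume "l \<in> blk j"
  then have "l - ofs j \<in> {1..length (C j)}" "l = ofs j + (l - ofs j)" by (auto simp: blk_def)
  then show "\<exists>i\<in>{1..length (C j)}. l = ofs j + i" by blast
qed (auto simp: blk_def)

lemma blk_disjoint: "j < r \<Longrightarrow> j' < r \<Longrightarrow> l \<in> blk j \<Longrightarrow> l \<in> blk j' \<Longrightarrow> j = j'"
  unfolding blk_iff using block_unique by blast

lemma blk_sub: "j < r \<Longrightarrow> blk j \<subseteq> L"
proof
  fix l assume j: "j < r" and l: "l \<in> blk j"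
  then obtain i where i: "i \<in> {1..length (C j)}" "l = ofs j + i" using blk_iff by blast
  then show "l \<in> L" using component_props(3,4) [OF j] by (fastforce simp: L_def dg_def)
qed

lemma L_blk: "L = (\<Union>j<r. blk j)"
proof
  show "L \<subseteq> (\<Union>j<r. blk j)"
  proof
    fix l assume "l \<in> L"
    then have "l \<in> {1..n}" "part lam l \<noteq> l" by (auto simp: L_def dg_def)
    then show "l \<in> (\<Union>j<r. blk j)" using block_exists [of l] blk_iff by blast
  qed
qed (use blk_sub in blast)

lemma linear_form_blk: "linear_form L c = (\<Sum>j<r. linear_form (blk j) c)"
  unfolding linear_form_def L_blk
proof (rule sum.UNION_disjoint)
  show "\<forall>j\<in>{..<r}. finite (blk j)" by (simp add: blk_def)
  show "\<forall>j\<in>{..<r}. \<forall>j'\<in>{..<r}. j \<noteq> j' \<longrightarrow> blk j \<inter> blk j' = {}" using blk_disjoint by blast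
qed simp

text \<open>Stated for an arbitrary homomorphism that shifts the variables, since it is applied both
  to the embedding constructed below and to the inclusion provided by a decomposition.\<close>

lemma component_linear_form:
  assumes j: "j < r" and \<iota>: "\<iota> \<in> ring_hom (component_ring lam j) R"
    and \<iota>y: "\<And>i. i \<in> {1..length (C j)} \<Longrightarrow> \<iota> (part_class (C j) (poly_var i)) = yv (ofs j + i)"
  shows "\<iota> (part_class (C j) (linear_form {1..length (C j)} (\<lambda>i. c (ofs j + i)))) = cl (linear_form (blk j) c)"
proof -
  have h: "part_class (C j) \<in> ring_hom (polys_upto (length (C j))) (component_ring lam j)"
    using partition.cl_hom [OF partition_component [OF j]] by (simp add: component_ring_def)
  have sub: "blk j \<subseteq> {1..n}" using blk_sub [OF j] L_sub by blast
  have inj: "inj_on (\<lambda>i. ofs j + i) {1..length (C j)}" by simp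
  have img: "blk j = (\<lambda>i. ofs j + i) ` {1..length (C j)}" using blk_iff by blast
  have c: "(\<lambda>l. [(c l)] \<cdot>\<^bsub>R\<^esub> yv l) \<in> (\<lambda>i. ofs j + i) ` {1..length (C j)} \<rightarrow> carrier R"
  proof
    fix l assume "l \<in> (\<lambda>i. ofs j + i) ` {1..length (C j)}"
    then have "yv l \<in> carrier R" using sub img yv_closed by blast
    then show "[(c l)] \<cdot>\<^bsub>R\<^esub> yv l \<in> carrier R" by simp
  qed
  have "\<iota> (part_class (C j) (linear_form {1..length (C j)} (\<lambda>i. c (ofs j + i))))
     = (\<iota> \<circ> part_class (C j)) (linear_form {1..length (C j)} (\<lambda>i. c (ofs j + i)))" by simp
  also have "\<dots> = finsum R (\<lambda>i. [(c (ofs j + i))] \<cdot>\<^bsub>R\<^esub> (\<iota> \<circ> part_class (C j)) (poly_var i)) {1..length (C j)}"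
    by (rule hom_linear_form [OF cring_R ring_hom_trans [OF h \<iota>] subset_refl])
  also have "\<dots> = finsum R (\<lambda>i. [(c (ofs j + i))] \<cdot>\<^bsub>R\<^esub> yv (ofs j + i)) {1..length (C j)}"
    using c \<iota>y by (intro R.finsum_cong' [OF refl]) (auto simp: Pi_iff)
  also have "\<dots> = finsum R (\<lambda>l. [(c l)] \<cdot>\<^bsub>R\<^esub> yv l) (blk j)"
    unfolding img using R.finsum_reindex [OF c inj] by simp
  also have "\<dots> = cl (linear_form (blk j) c)" using cl_linear_form [OF sub] by simp
  finally show ?thesis .
qed

lemma component_homog1:
  assumes j: "j < r" and x: "x \<in> homog (component_ring lam j) 1"
  obtains c where "x = part_class (C j) (linear_form {1..length (C j)} (\<lambda>i. c (ofs j + i)))"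
proof -
  obtain c where "x = part_class (C j) (linear_form (partition.L (C j)) c)"
    using partition.homog1_linear [OF partition_component [OF j]] x unfolding component_ring_def by blast
  then have "x = part_class (C j) (linear_form {1..length (C j)} (\<lambda>i. (\<lambda>l. c (l - ofs j)) (ofs j + i)))"
    by (simp add: component_L [OF j])
  then show thesis by (rule that)
qed

lemma component_std: "j < r \<Longrightarrow> std_graded (component_ring lam j)"
  unfolding component_ring_def by (rule partition.std_graded_R [OF partition_component])

text \<open>By \<open>block_rel\<close> the shifted variables satisfy the relations of the
  component, whose degrees agree by \<open>component_dg\<close>.\<close>

lemma component_embedding:
  assumes j: "j < r"
  shows "\<exists>\<iota>\<in>ring_hom (component_ring lam j) R. \<forall>i\<in>{1..length (C j)}. \<iota> (part_class (C j) (poly_var i)) = yv (ofs j + i)"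
proof -
  note cp = component_props [OF j]
  obtain H where "H \<in> ring_hom (part_ring (C j)) R"
    "\<And>i. i \<in> {1..length (C j)} \<Longrightarrow> H (part_class (C j) (poly_var i)) = yv (ofs j + i)"
  proof (rule partition.part_ring_lift [OF partition_component [OF j] cring_R, of "\<lambda>i. yv (ofs j + i)"])
    show "yv (ofs j + i) \<in> carrier R" if "i \<in> {1..length (C j)}" for i
      using that cp(3) by (intro yv_closed) auto
    show "csym R (\<lambda>i. yv (ofs j + i)) (partition.dg (C j) i) i = \<zero>\<^bsub>R\<^esub>" if "i \<in> {1..length (C j)}" for i
      using block_rel [OF cp(1), of i] cl_hpoly [of "ofs j" i "dg (ofs j + i)"] that cp(3) component_dg [OF j that] by simp
  qed blast
  then show ?thesis unfolding component_ring_def by blast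
qed

abbreviation "B \<equiv> tensor_product {..<r} (component_ring lam)"

lemma prev_cut:
  assumes "l \<in> {1..n}"
  obtains k where "is_cut k" "k < l" "\<And>l'. l' \<in> {k + 1..<l} \<Longrightarrow> l' \<in> {1..n} \<and> part lam l' \<noteq> l'"
proof -
  define k where "k = Max {k. is_cut k \<and> k < l}"
  have "0 \<in> {k. is_cut k \<and> k < l}" using assms by (simp add: is_cut_def)
  then have "k \<in> {k. is_cut k \<and> k < l}" unfolding k_def by (intro Max_in) auto
  moreover have "l' \<in> {1..n} \<and> part lam l' \<noteq> l'" if l': "l' \<in> {k + 1..<l}" for l'
  proof -
    have "\<not> is_cut l'"
    proof
      assume "is_cut l'"
      then have "l' \<le> k" unfolding k_def using l' by (intro Max_ge) auto
      then show False using l' by simp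
    qed
    then show ?thesis using l' assms by (auto simp: is_cut_def)
  qed
  ultimately show thesis by (intro that [of k]) auto
qed

text \<open>A homomorphism from \<open>R\<close> to the tensor product has to be prescribed on all
  variables, including those at cut indices, which belong to no component; there the relation of
  degree 1 dictates the value. The isomorphism is then a check in degree 1 by
  \<open>tensor_decompositionI\<close>.\<close>

theorem component_decomposition:
  obtains \<phi> where "tensor_decomposition R r (component_ring lam) \<phi>" "identifies_variables lam \<phi>"
proof -
  interpret TF: graded_tensor_family "{..<r}" "component_ring lam"
    by (intro graded_tensor_familyI finite_lessThan component_std) simp
  have Bc: "cring B" by (rule TF.cring_TP)
  let ?x = "\<lambda>j i. tensor_embed {..<r} (component_ring lam) j (part_class (C j) (poly_var i))"
  have xc: "?x j i \<in> carrier B" if "j < r" "i \<in> {1..length (C j)}" for j i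
    using partition.yv_closed [OF partition_component [OF that(1)] that(2)] that(1)
    by (intro TF.emb_closed) (simp_all add: component_ring_def)
  \<comment> \<open>The value at a variable that belongs to a component; \<open>block_unique\<close>
    makes the description definite.\<close>
  define w0 where "w0 l = (THE x. \<exists>j<r. \<exists>i\<in>{1..length (C j)}. l = ofs j + i \<and> x = ?x j i)" for l
  have w0: "w0 (ofs j + i) = ?x j i" if "j < r" "i \<in> {1..length (C j)}" for j i
    unfolding w0_def
  proof (rule the_equality)
    show "\<exists>j'<r. \<exists>i'\<in>{1..length (C j')}. ofs j + i = ofs j' + i' \<and> ?x j i = ?x j' i'"
      by (intro exI [of _ j] conjI bexI [of _ i] refl that)
    fix x assume "\<exists>j'<r. \<exists>i'\<in>{1..length (C j')}. ofs j + i = ofs j' + i' \<and> x = ?x j' i'"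
    then obtain j' i' where *: "j' < r" "i' \<in> {1..length (C j')}" "ofs j + i = ofs j' + i'" "x = ?x j' i'"
      by (elim exE bexE conjE)
    then show "x = ?x j i" using block_unique [OF that *(1-3)] by simp
  qed
  have w0c: "w0 l \<in> carrier B" if l: "l \<in> {1..n}" "part lam l \<noteq> l" for l
  proof -
    obtain j i where "j < r" "i \<in> {1..length (C j)}" "l = ofs j + i" using block_exists [OF l] by blast
    then show ?thesis using w0 xc by simp
  qed
  have "\<exists>p. \<forall>l\<in>{1..n}. is_cut (p l) \<and> p l < l \<and> (\<forall>l'\<in>{p l + 1..<l}. l' \<in> {1..n} \<and> part lam l' \<noteq> l')"
  proof (rule bchoice, rule ballI)
    fix l assume "l \<in> {1..n}"
    then obtain k where k: "is_cut k" "k < l" "\<And>l'. l' \<in> {k + 1..<l} \<Longrightarrow> l' \<in> {1..n} \<and> part lam l' \<noteq> l'"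
      using prev_cut by metis
    show "\<exists>k. is_cut k \<and> k < l \<and> (\<forall>l'\<in>{k + 1..<l}. l' \<in> {1..n} \<and> part lam l' \<noteq> l')"
      by (rule exI [of _ k]) (intro conjI ballI k(1,2) conjunct1 [OF k(3)] conjunct2 [OF k(3)])
  qed
  then obtain p where p: "\<And>l. l \<in> {1..n} \<Longrightarrow> is_cut (p l)" "\<And>l. l \<in> {1..n} \<Longrightarrow> p l < l"
    "\<And>l l'. l \<in> {1..n} \<Longrightarrow> l' \<in> {p l + 1..<l} \<Longrightarrow> l' \<in> {1..n} \<and> part lam l' \<noteq> l'" by blast
  \<comment> \<open>At a cut \<open>l\<close> the relation is the sum of the variables 1 to
    \<open>l\<close>. The sum up to the previous cut \<open>p l\<close> vanishes, so the value must
    be minus the sum of the values in between.\<close>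
  define w where "w l = (if part lam l = l then \<ominus>\<^bsub>B\<^esub> finsum B w0 {p l + 1..<l} else w0 l)" for l
  have wc: "w l \<in> carrier B" if l: "l \<in> {1..n}" for l
    unfolding w_def using w0c p(3) [OF l] l by (auto intro!: TF.TP.finsum_closed TF.TP.a_inv_closed)
  \<comment> \<open>Dropping the variables up to a cut uses the relations up to that cut, hence the
    induction on \<open>l\<close>.\<close>
  have rel: "csym B w (dg l) l = \<zero>\<^bsub>B\<^esub>" if "l \<in> {1..n}" for l
    using that
  proof (induction l rule: less_induct)
    case (less l)
    have split: "csym B w m l = csym B (\<lambda>a. w (k + a)) m (l - k)" if k: "is_cut k" "k < l" for k m
    proof -
      have "csym B w m' k = \<zero>\<^bsub>B\<^esub>" if "1 \<le> m'" for m'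
        by (rule csym_cut [OF Bc wc _ k(1) le_refl that]) (use less.IH k less.prems in auto)
      then have "csym B w m (k + (l - k)) = csym B (\<lambda>a. w (k + a)) m (l - k)"
        using wc less.prems k by (intro csym_split [OF Bc]) auto
      then show ?thesis using k by simp
    qed
    show ?case
    proof (cases "part lam l = l")
      case True
      define k where "k = p l"
      have k: "is_cut k" "k < l" using p less.prems by (simp_all add: k_def)
      have kc: "w (k + a) \<in> carrier B" if "a \<in> {1..l - k}" for a
        using wc that less.prems by auto
      have eq: "w l' = w0 l'" if "l' \<in> {k + 1..<l}" for l'
        using p(3) [OF less.prems] that by (simp add: w_def k_def)
      have c0: "w0 l' \<in> carrier B" if "l' \<in> {k + 1..<l}" for l'
        using p(3) [OF less.prems] that w0c by (simp add: k_def)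
      have "dg l = 1" using True by (simp add: dg_def)
      then have "csym B w (dg l) l = finsum B (\<lambda>a. w (k + a)) {1..l - k}"
        using split [OF k, of 1] csym_1 [OF Bc kc] by simp
      also have "\<dots> = finsum B w ((\<lambda>a. k + a) ` {1..l - k})"
        using wc less.prems k by (intro TF.TP.finsum_reindex [symmetric]) auto
      also have "(\<lambda>a. k + a) ` {1..l - k} = insert l {k + 1..<l}"
        using k by (auto simp: image_iff)
      also have "finsum B w (insert l {k + 1..<l}) = w l \<oplus>\<^bsub>B\<^esub> finsum B w {k + 1..<l}"
        using wc less.prems by (intro TF.TP.finsum_insert) auto
      also have "finsum B w {k + 1..<l} = finsum B w0 {k + 1..<l}"
        using eq c0 by (intro TF.TP.finsum_cong' [OF refl]) simp_all
      also have "w l \<oplus>\<^bsub>B\<^esub> \<dots> = \<zero>\<^bsub>B\<^esub>"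
        using True c0 by (simp add: w_def k_def TF.TP.l_neg TF.TP.finsum_closed Pi_iff)
      finally show ?thesis .
    next
      case False
      then obtain j i where j: "j < r" and i: "i \<in> {1..length (C j)}" and l: "l = ofs j + i"
        using block_exists [OF less.prems] by blast
      note cp = component_props [OF j]
      let ?Cj = "component_ring lam j"
      have Cc: "cring ?Cj" using std_graded_cring [OF component_std [OF j]] .
      have xcl: "part_class (C j) (poly_var a) \<in> carrier ?Cj" if "a \<in> {1..i}" for a
        using partition.yv_closed [OF partition_component [OF j], of a] i that by (simp add: component_ring_def)
      have "w (ofs j + a) = ?x j a" if "a \<in> {1..i}" for a
        using cp(4) [of a] w0 [OF j, of a] i that by (simp add: w_def)
      then have "csym B (\<lambda>a. w (ofs j + a)) (dg l) i = csym B (?x j) (dg l) i"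
        by (intro csym_cong) auto
      also have "\<dots> = tensor_embed {..<r} (component_ring lam) j (csym ?Cj (\<lambda>a. part_class (C j) (poly_var a)) (dg l) i)"
        by (rule csym_hom [OF Cc Bc TF.emb_hom xcl, symmetric]) (use j in auto)
      also have "csym ?Cj (\<lambda>a. part_class (C j) (poly_var a)) (dg l) i = \<zero>\<^bsub>?Cj\<^esub>"
        using partition.csym_rel [OF partition_component [OF j] i] component_dg [OF j i] by (simp add: component_ring_def l)
      also have "tensor_embed {..<r} (component_ring lam) j \<zero>\<^bsub>?Cj\<^esub> = \<zero>\<^bsub>B\<^esub>"
        by (rule TF.emb_zero) (use j in simp)
      finally show ?thesis using split [OF cp(1), of "dg l"] i by (simp add: l)
    qed
  qed
  obtain \<gamma> where \<gamma>: "\<gamma> \<in> ring_hom R B" "\<And>i. i \<in> {1..n} \<Longrightarrow> \<gamma> (yv i) = w i"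
    using part_ring_lift [OF Bc, of w] wc rel by blast
  obtain \<iota> where \<iota>: "\<And>j. j < r \<Longrightarrow> \<iota> j \<in> ring_hom (component_ring lam j) R"
    "\<And>j i. j < r \<Longrightarrow> i \<in> {1..length (C j)} \<Longrightarrow> \<iota> j (part_class (C j) (poly_var i)) = yv (ofs j + i)"
    using component_embedding by metis
  have \<gamma>y: "\<gamma> (yv (ofs j + i)) = ?x j i" if "j < r" "i \<in> {1..length (C j)}" for j i
  proof -
    have "ofs j + i \<in> {1..n}" using component_props(3) [OF that(1)] that(2) by auto
    then show ?thesis using \<gamma>(2) w0 [OF that] component_props(4) [OF that] by (simp add: w_def)
  qed
  have "tensor_decomposition R r (component_ring lam) \<gamma>"
  proof (rule tensor_decompositionI [where e = \<iota>])
    show "std_graded R" by (rule std_graded_R)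
    show "std_graded (component_ring lam i)" if "i < r" for i using component_std that .
    show "\<iota> i \<in> ring_hom (component_ring lam i) R" if "i < r" for i using \<iota>(1) that .
    show "\<gamma> \<in> ring_hom R B" by (rule \<gamma>(1))
    show "\<iota> i x \<in> homog R 1" if i: "i < r" and x: "x \<in> homog (component_ring lam i) 1" for i x
    proof -
      obtain c where c: "x = part_class (C i) (linear_form {1..length (C i)} (\<lambda>a. c (ofs i + a)))"
        using component_homog1 [OF i x] .
      have "\<iota> i x = cl (linear_form (blk i) c)"
        unfolding c by (rule component_linear_form [OF i \<iota>(1) [OF i] \<iota>(2) [OF i]])
      moreover have "cl (linear_form (blk i) c) \<in> homog R 1"
        using subset_trans [OF blk_sub [OF i] L_sub] by (intro cl_homog linear_form_vars linear_form_homogeneous)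
      ultimately show ?thesis by simp
    qed
    show "\<gamma> (\<iota> i x) = tensor_embed {..<r} (component_ring lam) i x"
      if i: "i < r" and x: "x \<in> homog (component_ring lam i) 1" for i x
    proof -
      have xc: "x \<in> carrier (part_ring (C i))"
        using partition.homog_R_carrier [OF partition_component [OF i]] x by (simp add: component_ring_def)
      have "(\<gamma> \<circ> \<iota> i) x = tensor_embed {..<r} (component_ring lam) i x"
      proof (rule partition.part_ring_hom_eq [OF partition_component [OF i] Bc _ _ _ xc])
        show "\<gamma> \<circ> \<iota> i \<in> ring_hom (part_ring (C i)) B"
          using ring_hom_trans [OF \<iota>(1) [OF i] \<gamma>(1)] by (simp add: component_ring_def)
        show "tensor_embed {..<r} (component_ring lam) i \<in> ring_hom (part_ring (C i)) B"
          using TF.emb_hom [of i] i by (simp add: component_ring_def)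
        show "(\<gamma> \<circ> \<iota> i) (part_class (C i) (poly_var a)) = tensor_embed {..<r} (component_ring lam) i (part_class (C i) (poly_var a))"
          if "a \<in> {1..length (C i)}" for a
          using \<iota>(2) [OF i that] \<gamma>y [OF i that] by simp
      qed
      then show ?thesis by simp
    qed
    show "\<exists>t. (\<forall>i<r. t i \<in> homog (component_ring lam i) 1) \<and> x = finsum R (\<lambda>i. \<iota> i (t i)) {..<r}"
      if x: "x \<in> homog R 1" for x
    proof -
      obtain c where c: "x = cl (linear_form L c)" using homog1_linear [OF x] .
      have v: "vars_in {1..n} (linear_form (blk j) c)" if "j \<in> {..<r}" for j
        using blk_sub [of j] L_sub that by (intro linear_form_vars) auto
      define t where "t j = part_class (C j) (linear_form {1..length (C j)} (\<lambda>i. c (ofs j + i)))" for j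
      have \<iota>t: "\<iota> j (t j) = cl (linear_form (blk j) c)" if "j < r" for j
        unfolding t_def by (rule component_linear_form [OF that \<iota>(1) [OF that] \<iota>(2) [OF that]])
      have "x = finsum R (\<lambda>j. cl (linear_form (blk j) c)) {..<r}"
        unfolding c linear_form_blk by (rule hom_sum [OF cring_R cl_hom v])
      also have "\<dots> = finsum R (\<lambda>j. \<iota> j (t j)) {..<r}"
        using \<iota>t cl_simps(5) [OF v] by (intro R.finsum_cong' [OF refl]) auto
      finally have "x = finsum R (\<lambda>j. \<iota> j (t j)) {..<r}" .
      moreover have "t j \<in> homog (component_ring lam j) 1" if "j < r" for j
        unfolding t_def component_ring_def
        by (intro partition.cl_homog [OF partition_component [OF that]] linear_form_vars linear_form_homogeneous) simp
      ultimately show ?thesis by blast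
    qed
  qed
  moreover have "identifies_variables lam \<gamma>"
    unfolding identifies_variables_def using \<gamma>y by simp
  ultimately show thesis by (rule that)
qed

end

section \<open>Uniqueness of decompositions\<close>

text \<open>An abstract setting for uniqueness: \<open>C\<close> is the candidate for the finest
  decomposition, and \<open>T\<close> an arbitrary one with the derivations \<open>D\<close> of its
  factors. What is known about partitions enters through \<open>D_block\<close>.\<close>

locale refinement = CD: decomposition R r C \<phi> + TD: decomposition R s T \<psi>
  for R :: "'a graded_ring" and r :: nat and C :: "nat \<Rightarrow> 'c graded_ring" and \<phi>
    and s :: nat and T :: "nat \<Rightarrow> 'b graded_ring" and \<psi> +
  fixes D :: "nat \<Rightarrow> 'a \<Rightarrow> 'a"
  assumes C_nontrivial: "j < r \<Longrightarrow> \<not> \<Z> \<simeq> C j"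
    and D_der: "i < s \<Longrightarrow> derivation R (D i)"
    and D_summand: "i < s \<Longrightarrow> x \<in> homog R 1 \<Longrightarrow> D i x \<in> TD.summand i"
    and D_id: "i < s \<Longrightarrow> x \<in> TD.summand i \<Longrightarrow> D i x = x"
    and D_zero: "i < s \<Longrightarrow> j < s \<Longrightarrow> i \<noteq> j \<Longrightarrow> x \<in> TD.summand i \<Longrightarrow> D j x = \<zero>\<^bsub>R\<^esub>"
    and D_sum: "x \<in> homog R 1 \<Longrightarrow> x = finsum R (\<lambda>i. D i x) {..<s}"
    and D_block: "i < s \<Longrightarrow> j < r \<Longrightarrow>
      (\<forall>x\<in>CD.summand j. D i x = \<zero>\<^bsub>R\<^esub>) \<or> (\<forall>x\<in>CD.summand j. D i x = x)"
begin

text \<open>The factors of \<open>C\<close> that lie inside the factor \<open>T i\<close>, in the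
  sense of \<open>block_subset\<close>.\<close>

definition "blocks i = {j. j < r \<and> (\<forall>x\<in>CD.summand j. D i x = x)}"

lemma blocks_less: "j \<in> blocks i \<Longrightarrow> j < r"
  by (simp add: blocks_def)

lemma blocks_finite: "finite (blocks i)"
  by (rule finite_subset [of _ "{..<r}"]) (auto simp: blocks_def)

lemma D_in: "j \<in> blocks i \<Longrightarrow> x \<in> CD.summand j \<Longrightarrow> D i x = x"
  by (simp add: blocks_def)

lemma D_out: "i < s \<Longrightarrow> j < r \<Longrightarrow> j \<notin> blocks i \<Longrightarrow> x \<in> CD.summand j \<Longrightarrow> D i x = \<zero>\<^bsub>R\<^esub>"
  using D_block [of i j] by (auto simp: blocks_def)

lemma block_subset: assumes "i < s" "j \<in> blocks i" shows "CD.summand j \<subseteq> TD.summand i"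
proof
  fix x assume x: "x \<in> CD.summand j"
  have "D i x \<in> TD.summand i"
    by (rule D_summand [OF assms(1) CD.summand_homog [OF blocks_less [OF assms(2)] x]])
  then show "x \<in> TD.summand i" by (simp only: D_in [OF assms(2) x])
qed

lemma nonzero_element:
  assumes j: "j < r"
  obtains z where "z \<in> homog (C j) 1" "z \<noteq> \<zero>\<^bsub>C j\<^esub>" "CD.eps j z \<noteq> \<zero>\<^bsub>R\<^esub>"
proof -
  have "\<not> homog (C j) 1 \<subseteq> {\<zero>\<^bsub>C j\<^esub>}"
    using std_graded.trivial_if_homog1_trivial [OF CD.T_std [OF j]] C_nontrivial [OF j] by (rule contrapos_nn [rotated])
  then obtain z where z: "z \<in> homog (C j) 1" "z \<noteq> \<zero>\<^bsub>C j\<^esub>" by blast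
  obtain p where p: "p \<in> ring_hom R (C j)" "\<And>x. x \<in> carrier (C j) \<Longrightarrow> p (CD.eps j x) = x"
    using CD.projection [OF j] by blast
  have "p \<zero>\<^bsub>R\<^esub> = \<zero>\<^bsub>C j\<^esub>"
    by (rule add_hom_zero [OF CD.R.is_abelian_group cring_abelian [OF CD.T_cring [OF j]] ring_hom_add_hom [OF p(1)]])
  then have "CD.eps j z \<noteq> \<zero>\<^bsub>R\<^esub>" using p(2) [OF CD.T_carrier [OF j z(1)]] z(2) by auto
  then show thesis by (rule that [OF z])
qed

text \<open>Otherwise a nonzero element of \<open>C j\<close> would lie in two summands of
  \<open>T\<close>, and the derivation of one summand kills the other.\<close>

lemma factor_unique:
  assumes "i < s" "i' < s" "j \<in> blocks i" "j \<in> blocks i'"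
  shows "i = i'"
proof (rule ccontr)
  assume ne: "i \<noteq> i'"
  have j: "j < r" using assms(3) by (rule blocks_less)
  obtain z where z: "z \<in> homog (C j) 1" "CD.eps j z \<noteq> \<zero>\<^bsub>R\<^esub>" using nonzero_element [OF j] .
  have x: "CD.eps j z \<in> CD.summand j" by (rule CD.eps_summand [OF j z(1)])
  have "D i' (CD.eps j z) = \<zero>\<^bsub>R\<^esub>"
    by (rule D_zero [OF assms(1,2) ne subsetD [OF block_subset [OF assms(1,3)] x]])
  then show False using D_in [OF assms(4) x] z(2) by simp
qed

text \<open>The derivations sum to the identity in degree 1, so they cannot all kill a nonzero
  element.\<close>

lemma factor_exists:
  assumes j: "j < r"
  shows "\<exists>i<s. j \<in> blocks i"
proof (rule ccontr)
  assume no: "\<not> (\<exists>i<s. j \<in> blocks i)"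
  obtain z where z: "z \<in> homog (C j) 1" "CD.eps j z \<noteq> \<zero>\<^bsub>R\<^esub>" using nonzero_element [OF j] .
  let ?x = "CD.eps j z"
  have x: "?x \<in> CD.summand j" by (rule CD.eps_summand [OF j z(1)])
  have Dx: "D i ?x = \<zero>\<^bsub>R\<^esub>" if "i < s" for i
    by (rule D_out [OF that j _ x]) (use no that in simp)
  have "?x = finsum R (\<lambda>i. D i ?x) {..<s}" by (rule D_sum [OF CD.summand_homog [OF j x]])
  also have "\<dots> = finsum R (\<lambda>i. \<zero>\<^bsub>R\<^esub>) {..<s}"
    by (rule CD.R.finsum_cong' [OF refl]) (simp_all add: Dx)
  also have "\<dots> = \<zero>\<^bsub>R\<^esub>" by simp
  finally show False using z(2) by simp
qed

text \<open>Applying \<open>D i\<close> to the expansion of \<open>x\<close> along \<open>C\<close>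
  keeps the terms of the blocks of \<open>i\<close> and removes the others, while \<open>x\<close>
  itself is fixed.\<close>

lemma summand_blocks:
  assumes i: "i < s" and x: "x \<in> TD.summand i"
  shows "\<exists>t. (\<forall>j<r. t j \<in> homog (C j) 1) \<and> x = finsum R (\<lambda>j. CD.eps j (t j)) (blocks i)"
proof -
  from CD.homog1_eps [OF TD.summand_homog [OF i x]]
  obtain t where t: "\<forall>j<r. t j \<in> homog (C j) 1" "x = finsum R (\<lambda>j. CD.eps j (t j)) {..<r}" by blast
  have ts: "CD.eps j (t j) \<in> CD.summand j" if "j < r" for j
    by (rule CD.eps_summand [OF that]) (use t(1) that in simp)
  have tc: "CD.eps j (t j) \<in> carrier R" if "j < r" for j
    by (rule CD.R.homog_carrier [OF CD.summand_homog [OF that ts [OF that]]])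
  have Dh: "D i \<in> hom (add_monoid R) (add_monoid R)" using D_der [OF i] by (simp add: derivation_def)
  have Dc: "D i (CD.eps j (t j)) \<in> carrier R" if "j < r" for j
    by (rule add_hom_closed [OF CD.R.is_abelian_group CD.R.is_abelian_group Dh tc [OF that]])
  have "x = D i x" by (rule D_id [OF i x, symmetric])
  also have "\<dots> = finsum R (\<lambda>j. D i (CD.eps j (t j))) {..<r}"
    unfolding t(2) by (rule add_hom_finsum [OF CD.R.is_abelian_group CD.R.is_abelian_group Dh])
      (intro funcsetI, simp add: tc)
  also have "\<dots> = finsum R (\<lambda>j. CD.eps j (t j)) (blocks i)"
  proof (rule CD.R.add.finprod_mono_neutral_cong_left [symmetric])
    show "finite {..<r}" by simp
    show "blocks i \<subseteq> {..<r}" using blocks_less by auto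
    show "D i (CD.eps j (t j)) = \<zero>\<^bsub>R\<^esub>" if "j \<in> {..<r} - blocks i" for j
      using D_out [OF i _ _ ts] that by simp
    show "CD.eps j (t j) = D i (CD.eps j (t j))" if "j \<in> blocks i" for j
      using D_in [OF that ts [OF blocks_less [OF that]]] by simp
    show "(\<lambda>j. D i (CD.eps j (t j))) \<in> {..<r} \<rightarrow> carrier R"
      by (intro funcsetI) (simp add: Dc)
  qed
  finally show ?thesis using t(1) by (intro exI [of _ t] conjI)
qed

lemma blocks_nonempty:
  assumes i: "i < s" and nt: "\<not> \<Z> \<simeq> T i"
  shows "blocks i \<noteq> {}"
proof
  assume e: "blocks i = {}"
  have "TD.summand i \<subseteq> {\<zero>\<^bsub>R\<^esub>}"
  proof
    fix x assume "x \<in> TD.summand i"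
    from summand_blocks [OF i this] obtain t where "x = finsum R (\<lambda>j. CD.eps j (t j)) (blocks i)" by blast
    then show "x \<in> {\<zero>\<^bsub>R\<^esub>}" by (simp add: e)
  qed
  then show False using TD.summand_trivial [OF i] nt by blast
qed

text \<open>The blocks inside a factor \<open>T i\<close> decompose it; they are realised as subrings of \<open>T i\<close>, because
  \<open>tensor_indecomposable\<close> only speaks about factors with the element type of the ring itself.\<close>

lemma factor_decomposition:
  assumes i: "i < s"
  obtains U :: "nat \<Rightarrow> 'b graded_ring" and \<gamma> where "nontrivial_decomposition (T i) (card (blocks i)) U \<gamma>"
proof -
  let ?J = "blocks i" and ?A = "T i"
  let ?m = "card ?J"
  have Ac: "cring ?A" by (rule TD.T_cring [OF i])
  interpret A: std_graded ?A by (rule TD.T_std [OF i])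
  note Jr = blocks_less
  obtain p where p: "p \<in> ring_hom R ?A" "\<And>x. x \<in> carrier ?A \<Longrightarrow> p (TD.eps i x) = x"
    using TD.projection [OF i] by blast
  \<comment> \<open>\<open>C j\<close> is included into \<open>R\<close> and then projected to
    \<open>T i\<close>. In degree 1 nothing is lost, since the summand of \<open>C j\<close> lies in
    that of \<open>T i\<close>.\<close>
  define \<alpha> where "\<alpha> j = p \<circ> CD.eps j" for j
  have \<alpha>h: "\<alpha> j \<in> ring_hom (C j) ?A" if "j \<in> ?J" for j
    unfolding \<alpha>_def by (rule ring_hom_trans [OF CD.eps_hom [OF Jr [OF that]] p(1)])
  have \<alpha>1: "\<alpha> j x \<in> homog ?A 1" "TD.eps i (\<alpha> j x) = CD.eps j x"
    if j: "j \<in> ?J" and x: "x \<in> homog (C j) 1" for j x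
  proof -
    have "CD.eps j x \<in> TD.summand i"
      by (rule subsetD [OF block_subset [OF i j] CD.eps_summand [OF Jr [OF j] x]])
    then obtain y where y: "y \<in> homog ?A 1" "CD.eps j x = TD.eps i y"
      unfolding TD.summand_eps [OF i] by blast
    have "\<alpha> j x = y" using p(2) [OF A.homog_carrier [OF y(1)]] y(2) by (simp add: \<alpha>_def)
    then show "\<alpha> j x \<in> homog ?A 1" "TD.eps i (\<alpha> j x) = CD.eps j x" using y by simp_all
  qed
  \<comment> \<open>Including \<open>T i\<close> into \<open>R\<close> and projecting to
    \<open>C j\<close> gives a left inverse, so the image of \<open>\<alpha> j\<close> is a copy of
    \<open>C j\<close>.\<close>
  have \<alpha>inv: "\<exists>\<beta>. \<beta> \<in> ring_hom ?A (C j) \<and> (\<forall>x\<in>carrier (C j). \<beta> (\<alpha> j x) = x)" if j: "j \<in> ?J" for j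
  proof -
    obtain q where q: "q \<in> ring_hom R (C j)" "\<And>x. x \<in> carrier (C j) \<Longrightarrow> q (CD.eps j x) = x"
      using CD.projection [OF Jr [OF j]] by blast
    have \<beta>h: "q \<circ> TD.eps i \<in> ring_hom ?A (C j)" by (rule ring_hom_trans [OF TD.eps_hom [OF i] q(1)])
    have "((q \<circ> TD.eps i) \<circ> \<alpha> j) x = id x" if x: "x \<in> carrier (C j)" for x
    proof (rule std_graded.hom_eq [OF CD.T_std [OF Jr [OF j]] CD.T_cring [OF Jr [OF j]] _ _ _ x])
      show "(q \<circ> TD.eps i) \<circ> \<alpha> j \<in> ring_hom (C j) (C j)" by (rule ring_hom_trans [OF \<alpha>h [OF j] \<beta>h])
      show "id \<in> ring_hom (C j) (C j)" by (rule id_ring_hom)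
      show "((q \<circ> TD.eps i) \<circ> \<alpha> j) y = id y" if y: "y \<in> homog (C j) 1" for y
        using \<alpha>1(2) [OF j y] q(2) [OF CD.T_carrier [OF Jr [OF j] y]] by simp
    qed
    then show ?thesis using \<beta>h by (intro exI [of _ "q \<circ> TD.eps i"] conjI ballI) simp_all
  qed
  have \<alpha>inj: "inj_on (\<alpha> j) (carrier (C j))" if "j \<in> ?J" for j
    using \<alpha>inv [OF that] by (metis inj_onI)
  obtain g where g: "bij_betw g {..<?m} ?J"
    using ex_bij_betw_nat_finite [OF blocks_finite] unfolding atLeast0LessThan by blast
  have gJ: "g k \<in> ?J" if "k < ?m" for k using bij_betw_apply [OF g] that by simp
  define U where "U k = ?A\<lparr>carrier := \<alpha> (g k) ` carrier (C (g k)), homog := \<lambda>d. \<alpha> (g k) ` homog (C (g k)) d\<rparr>" for k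
  have Uh: "homog (U k) d = \<alpha> (g k) ` homog (C (g k)) d" for k d by (simp add: U_def)
  have Ucar: "carrier (U k) = \<alpha> (g k) ` carrier (C (g k))" for k by (simp add: U_def)
  have Uring: "cring (U k)" if k: "k < ?m" for k
  proof -
    have Cc: "cring (C (g k))" by (rule CD.T_cring [OF Jr [OF gJ [OF k]]])
    have "ring_hom_ring (C (g k)) ?A (\<alpha> (g k))"
      by (intro ring_hom_ring.intro ring_hom_ring_axioms.intro cring.axioms(1) Cc Ac \<alpha>h gJ k)
    from ring_hom_ring.img_is_cring [OF this Ac] show ?thesis
      by (rule cring_cong) (simp_all add: U_def)
  qed
  have \<alpha>U: "\<alpha> (g k) \<in> ring_hom (C (g k)) (U k)" if k: "k < ?m" for k
    using \<alpha>h [OF gJ [OF k]] by (simp add: ring_hom_def U_def Pi_iff)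
  have Ustd: "std_graded (U k)" if k: "k < ?m" for k
  proof (rule std_graded_transport [OF CD.T_std [OF Jr [OF gJ [OF k]]] Uring [OF k]])
    show "\<alpha> (g k) \<in> ring_iso (C (g k)) (U k)"
      using \<alpha>U [OF k] \<alpha>inj [OF gJ [OF k]] by (simp add: ring_iso_def bij_betw_def Ucar)
    show "\<alpha> (g k) ` homog (C (g k)) d = homog (U k) d" for d by (simp add: Uh)
  qed
  interpret UF: graded_tensor_family "{..<?m}" U
    by (intro graded_tensor_familyI finite_lessThan Ustd) simp
  define g' where "g' = the_inv_into {..<?m} g"
  have g': "g' (g k) = k" if "k < ?m" for k
    unfolding g'_def using g that by (intro the_inv_into_f_f) (simp_all add: bij_betw_def)
  \<comment> \<open>The blocks inside \<open>T i\<close> go to their copies in the tensor product of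
    the \<open>U k\<close>; the other factors of \<open>C\<close> are collapsed by an
    augmentation.\<close>
  have "\<exists>q. q \<in> ring_hom (C j) UF.TP \<and> (\<forall>k<?m. j = g k \<longrightarrow> q = UF.emb k \<circ> \<alpha> j)" if j: "j < r" for j
  proof (cases "\<exists>k<?m. j = g k")
    case True
    then obtain k where k: "k < ?m" "j = g k" by blast
    have "UF.emb k \<circ> \<alpha> j \<in> ring_hom (C j) UF.TP"
      unfolding k(2) by (rule ring_hom_trans [OF \<alpha>U [OF k(1)] UF.emb_hom]) (simp add: k(1))
    moreover have "k' = k" if "k' < ?m" "j = g k'" for k'
      using g' [OF that(1)] g' [OF k(1)] that(2) k(2) by simp
    ultimately show ?thesis by (intro exI [of _ "UF.emb k \<circ> \<alpha> j"] conjI) auto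
  next
    case False
    obtain q where "q \<in> ring_hom (C j) UF.TP"
      using std_graded.augmentation [OF CD.T_std [OF j] UF.cring_TP] by blast
    then show ?thesis using False by (intro exI [of _ q] conjI) auto
  qed
  then obtain q where q: "\<And>j. j < r \<Longrightarrow> q j \<in> ring_hom (C j) UF.TP"
    "\<And>j k. j < r \<Longrightarrow> k < ?m \<Longrightarrow> j = g k \<Longrightarrow> q j = UF.emb k \<circ> \<alpha> j" by metis
  obtain \<Gamma> where \<Gamma>: "\<Gamma> \<in> ring_hom R UF.TP" "\<And>j x. j < r \<Longrightarrow> x \<in> carrier (C j) \<Longrightarrow> \<Gamma> (CD.eps j x) = q j x"
  proof (rule CD.lift_homs [OF UF.cring_TP, of q], goal_cases)
    case (1 j) show ?case by (rule q(1) [OF 1(2)])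
  next
    case (2 \<Phi>) show ?case by (rule 2(1)) (fact 2)+
  qed
  have "tensor_decomposition ?A ?m U (\<Gamma> \<circ> TD.eps i)"
  \<comment> \<open>The \<open>U k\<close> are subsets of \<open>T i\<close>, so the inclusions are
    identity maps.\<close>
  proof (rule tensor_decompositionI [where e = "\<lambda>k x. x"])
    show "std_graded ?A" by (rule A.std_graded_axioms)
    show "std_graded (U k)" if "k < ?m" for k by (rule Ustd [OF that])
    show "(\<lambda>x. x) \<in> ring_hom (U k) ?A" if k: "k < ?m" for k
      using ring_hom_closed [OF \<alpha>h [OF gJ [OF k]]] by (auto simp: ring_hom_def U_def)
    show "x \<in> homog ?A 1" if k: "k < ?m" and x: "x \<in> homog (U k) 1" for k x
      using x \<alpha>1(1) [OF gJ [OF k]] unfolding Uh by blast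
    show "\<Gamma> \<circ> TD.eps i \<in> ring_hom ?A UF.TP" by (rule ring_hom_trans [OF TD.eps_hom [OF i] \<Gamma>(1)])
    show "(\<Gamma> \<circ> TD.eps i) x = UF.emb k x" if k: "k < ?m" and x: "x \<in> homog (U k) 1" for k x
    proof -
      obtain y where y: "y \<in> homog (C (g k)) 1" "x = \<alpha> (g k) y" using x unfolding Uh by blast
      have gr: "g k < r" by (rule Jr [OF gJ [OF k]])
      have "(\<Gamma> \<circ> TD.eps i) x = \<Gamma> (CD.eps (g k) y)" using \<alpha>1(2) [OF gJ [OF k] y(1)] y(2) by simp
      also have "\<dots> = q (g k) y" by (rule \<Gamma>(2) [OF gr CD.T_carrier [OF gr y(1)]])
      also have "\<dots> = UF.emb k x" by (simp add: q(2) [OF gr k refl] y(2))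
      finally show ?thesis .
    qed
    show "\<exists>t. (\<forall>k<?m. t k \<in> homog (U k) 1) \<and> y = finsum ?A (\<lambda>k. t k) {..<?m}" if y: "y \<in> homog ?A 1" for y
    proof -
      from summand_blocks [OF i TD.eps_summand [OF i y]]
      obtain t where t: "\<forall>j<r. t j \<in> homog (C j) 1" "TD.eps i y = finsum R (\<lambda>j. CD.eps j (t j)) ?J" by blast
      have tc: "CD.eps j (t j) \<in> carrier R" if "j \<in> ?J" for j
        by (rule CD.eps_closed [OF Jr [OF that] CD.T_carrier [OF Jr [OF that], of _ 1]]) (use t(1) Jr [OF that] in simp)
      have \<alpha>tc: "\<alpha> j (t j) \<in> carrier ?A" if "j \<in> ?J" for j
        using ring_hom_closed [OF p(1) tc [OF that]] by (simp add: \<alpha>_def)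
      have "y = p (TD.eps i y)" by (rule p(2) [OF A.homog_carrier [OF y], symmetric])
      also have "\<dots> = finsum ?A (\<lambda>j. p (CD.eps j (t j))) ?J"
        unfolding t(2) by (rule add_hom_finsum [OF CD.R.is_abelian_group A.is_abelian_group ring_hom_add_hom [OF p(1)]])
          (intro funcsetI tc)
      also have "\<dots> = finsum ?A (\<lambda>j. \<alpha> j (t j)) (g ` {..<?m})"
        using g by (simp add: \<alpha>_def bij_betw_def)
      also have "\<dots> = finsum ?A (\<lambda>k. \<alpha> (g k) (t (g k))) {..<?m}"
        by (rule A.finsum_reindex) (use g \<alpha>tc gJ in \<open>auto simp: bij_betw_def\<close>)
      finally have "y = finsum ?A (\<lambda>k. \<alpha> (g k) (t (g k))) {..<?m}" .
      moreover have "\<alpha> (g k) (t (g k)) \<in> homog (U k) 1" if "k < ?m" for k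
        unfolding Uh by (rule imageI) (use t(1) Jr [OF gJ [OF that]] in simp)
      ultimately show ?thesis by (intro exI [of _ "\<lambda>k. \<alpha> (g k) (t (g k))"] conjI allI impI)
    qed
  qed
  moreover have "\<not> \<Z> \<simeq> U k" if k: "k < ?m" for k
  proof -
    have gr: "g k < r" by (rule Jr [OF gJ [OF k]])
    obtain z where z: "z \<in> homog (C (g k)) 1" "z \<noteq> \<zero>\<^bsub>C (g k)\<^esub>" using nonzero_element [OF gr] .
    have zc: "z \<in> carrier (C (g k))" by (rule CD.T_carrier [OF gr z(1)])
    have zc0: "\<zero>\<^bsub>C (g k)\<^esub> \<in> carrier (C (g k))"
      by (rule CD.TF.T_homog_carrier [OF _ CD.TF.T_homog_zero]) (simp_all add: gr)
    have "\<alpha> (g k) \<zero>\<^bsub>C (g k)\<^esub> = \<zero>\<^bsub>?A\<^esub>"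
      by (rule add_hom_zero [OF cring_abelian [OF CD.T_cring [OF gr]] A.is_abelian_group ring_hom_add_hom [OF \<alpha>h [OF gJ [OF k]]]])
    then have "\<alpha> (g k) z \<noteq> \<zero>\<^bsub>U k\<^esub>"
      using inj_onD [OF \<alpha>inj [OF gJ [OF k]] _ zc zc0] z(2) by (auto simp: U_def)
    moreover have "\<alpha> (g k) z \<in> homog (U k) 1" unfolding Uh using z(1) by (rule imageI)
    ultimately show ?thesis by (intro std_graded.not_int_if_homog1 [OF Ustd [OF k]])
  qed
  ultimately show thesis by (intro that [of U "\<Gamma> \<circ> TD.eps i"]) (simp add: nontrivial_decomposition_def)
qed

text \<open>By \<open>factor_decomposition\<close> an indecomposable factor cannot contain two
  blocks, and being nontrivial it contains one. Factor and block then have the same summand of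
  degree 1, hence the same subalgebra.\<close>

theorem same_decomposition:
  assumes ind: "\<And>i. i < s \<Longrightarrow> tensor_indecomposable (T i)"
  shows "same_up_to_permutation R s T \<psi> r C \<phi>"
proof -
  have "\<exists>j. blocks i = {j}" if i: "i < s" for i
  proof -
    obtain U :: "nat \<Rightarrow> 'b graded_ring" and \<gamma> where "nontrivial_decomposition (T i) (card (blocks i)) U \<gamma>"
      using factor_decomposition [OF i] .
    then have "\<not> 2 \<le> card (blocks i)" using ind [OF i] unfolding tensor_indecomposable_def by blast
    moreover have "card (blocks i) \<noteq> 0"
      using blocks_nonempty [OF i] ind [OF i] blocks_finite by (simp add: tensor_indecomposable_def)
    ultimately have "card (blocks i) = 1" by linarith
    then show ?thesis by (rule card_1_singletonE) blast
  qed
  then obtain \<sigma> where \<sigma>: "\<And>i. i < s \<Longrightarrow> blocks i = {\<sigma> i}" by metis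
  have \<sigma>r: "\<sigma> i < r" if "i < s" for i using blocks_less [of "\<sigma> i" i] \<sigma> [OF that] by simp
  have "bij_betw \<sigma> {..<s} {..<r}"
    unfolding bij_betw_def
  proof (intro conjI inj_onI equalityI subsetI)
    fix i i' assume "i \<in> {..<s}" "i' \<in> {..<s}" "\<sigma> i = \<sigma> i'"
    then show "i = i'" using factor_unique [of i i' "\<sigma> i"] \<sigma> by simp
  next
    fix j assume "j \<in> \<sigma> ` {..<s}"
    then show "j \<in> {..<r}" using \<sigma>r by auto
  next
    fix j assume "j \<in> {..<r}"
    then obtain i where i: "i < s" "j \<in> blocks i" using factor_exists [of j] by auto
    then show "j \<in> \<sigma> ` {..<s}" using \<sigma> [OF i(1)] by (intro image_eqI [of _ _ i]) simp_all
  qed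
  moreover have "TD.summand i = CD.summand (\<sigma> i)" if i: "i < s" for i
  proof
    show "CD.summand (\<sigma> i) \<subseteq> TD.summand i" by (rule block_subset [OF i]) (simp add: \<sigma> [OF i])
    show "TD.summand i \<subseteq> CD.summand (\<sigma> i)"
    proof
      fix x assume "x \<in> TD.summand i"
      from summand_blocks [OF i this] obtain t where t: "\<forall>j<r. t j \<in> homog (C j) 1"
        "x = finsum R (\<lambda>j. CD.eps j (t j)) {\<sigma> i}" unfolding \<sigma> [OF i] by blast
      have ts: "CD.eps (\<sigma> i) (t (\<sigma> i)) \<in> CD.summand (\<sigma> i)"
        by (rule CD.eps_summand [OF \<sigma>r [OF i]]) (use t(1) \<sigma>r [OF i] in simp)
      have "x = CD.eps (\<sigma> i) (t (\<sigma> i))"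
        using CD.R.homog_carrier [OF CD.summand_homog [OF \<sigma>r [OF i] ts]] t(2) by simp
      then show "x \<in> CD.summand (\<sigma> i)" using ts by simp
    qed
  qed
  ultimately show ?thesis
    unfolding same_up_to_permutation_def TD.factor_subalgebra_summand CD.factor_subalgebra_summand
    by (intro exI [of _ \<sigma>] conjI allI impI) simp_all
qed

end

section \<open>Application to the components of a partition\<close>

context partition begin

text \<open>The identification of variables forces the summand into the span of the variables of the
  block, where \<open>derivation_on_block\<close> applies.\<close>

lemma component_summand:
  assumes \<phi>: "tensor_decomposition R r (component_ring lam) \<phi>" "identifies_variables lam \<phi>" and j: "j < r"
    and x: "x \<in> decomposition.summand R r (component_ring lam) \<phi> j"
  shows "\<exists>c. x = cl (linear_form (blk j) c)"
proof -
  interpret CD: decomposition R r "component_ring lam" \<phi>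
    by (intro decomposition.intro std_graded_R decomposition_axioms.intro \<phi>(1))
  have y: "CD.eps j (part_class (C j) (poly_var i)) = yv (ofs j + i)" if i: "i \<in> {1..length (C j)}" for i
  proof -
    have "ofs j + i \<in> {1..n}" using component_props(3) [OF j] i by auto
    then have "yv (ofs j + i) = CD.\<phi>inv (\<phi> (yv (ofs j + i)))" by (intro CD.\<phi>inv(2) [symmetric] yv_closed)
    also have "\<phi> (yv (ofs j + i)) = tensor_embed {..<r} (component_ring lam) j (part_class (C j) (poly_var i))"
      using \<phi>(2) j i unfolding identifies_variables_def by blast
    finally show ?thesis by (simp only: CD.eps_def)
  qed
  obtain z where z: "z \<in> homog (component_ring lam j) 1" "x = CD.eps j z"
    using x unfolding CD.summand_eps [OF j] by blast
  obtain c where c: "z = part_class (C j) (linear_form {1..length (C j)} (\<lambda>a. c (ofs j + a)))"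
    using component_homog1 [OF j z(1)] .
  show ?thesis
  proof (rule exI)
    show "x = cl (linear_form (blk j) c)"
      unfolding z(2) c by (rule component_linear_form [OF j CD.eps_hom [OF j] y])
  qed
qed

lemma derivation_on_component:
  assumes \<phi>: "tensor_decomposition R r (component_ring lam) \<phi>" "identifies_variables lam \<phi>" and j: "j < r"
    and D: "derivation R D" and D1: "\<And>x. x \<in> homog R 1 \<Longrightarrow> D x \<in> homog R 1"
    and D2: "\<And>x. x \<in> homog R 1 \<Longrightarrow> D (D x) = D x"
  shows "(\<forall>x\<in>decomposition.summand R r (component_ring lam) \<phi> j. D x = \<zero>\<^bsub>R\<^esub>) \<or>
    (\<forall>x\<in>decomposition.summand R r (component_ring lam) \<phi> j. D x = x)"
proof -
  have dg2: "2 \<le> dg l" if "l \<in> {ofs j + 1..ofs j + length (C j)}" for l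
    using blk_sub [OF j] that by (auto simp: L_def blk_def)
  have "\<exists>k\<in>{0, 1 :: int}. \<forall>l\<in>{ofs j + 1..ofs j + length (C j)}. D (yv l) = [k] \<cdot>\<^bsub>R\<^esub> yv l"
    by (rule derivation_on_block [OF D D1 D2 component_props(1) [OF j] component_props(3) [OF j] dg2])
  then obtain k :: int where k: "k \<in> {0, 1}" "\<forall>l\<in>blk j. D (yv l) = [k] \<cdot>\<^bsub>R\<^esub> yv l"
    unfolding blk_def by blast
  have sub: "blk j \<subseteq> {1..n}" by (rule subset_trans [OF blk_sub [OF j] L_sub])
  have Dh: "D \<in> hom (add_monoid R) (add_monoid R)" using D by (simp add: derivation_def)
  have Dx: "D x = [k] \<cdot>\<^bsub>R\<^esub> x" "x \<in> carrier R" if x: "x \<in> decomposition.summand R r (component_ring lam) \<phi> j" for x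
  proof -
    obtain c where c: "x = cl (linear_form (blk j) c)" using component_summand [OF \<phi> j x] by blast
    show "D x = [k] \<cdot>\<^bsub>R\<^esub> x"
      unfolding c by (rule add_hom_linear_form [OF Dh sub bspec [OF k(2)]])
    show "x \<in> carrier R"
      unfolding c by (intro cl_simps(5) linear_form_vars sub)
  qed
  from k(1) show ?thesis
  proof (elim insertE emptyE)
    assume "k = 0"
    then show ?thesis using Dx(1) by simp
  next
    assume "k = 1"
    then show ?thesis using Dx by simp
  qed
qed

lemma component_indecomposable:
  assumes j: "j < r" shows "tensor_indecomposable (component_ring lam j)"
  unfolding component_ring_def
  by (rule partition.indecomposable [OF partition_component [OF j] component_props(2) [OF j] component_lt [OF j]])

lemma decomposition_unique:
  fixes T :: "nat \<Rightarrow> 'b graded_ring"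
  assumes \<phi>: "tensor_decomposition R r (component_ring lam) \<phi>" "identifies_variables lam \<phi>"
    and \<psi>: "tensor_decomposition R s T \<psi>" and ind: "\<And>i. i < s \<Longrightarrow> tensor_indecomposable (T i)"
  shows "same_up_to_permutation R s T \<psi> r (component_ring lam) \<phi>"
proof -
  have CD: "decomposition R r (component_ring lam) \<phi>"
    by (intro decomposition.intro std_graded_R decomposition_axioms.intro \<phi>(1))
  have TD: "decomposition R s T \<psi>"
    by (intro decomposition.intro std_graded_R decomposition_axioms.intro \<psi>)
  interpret TD: decomposition R s T \<psi> by (rule TD)
  obtain D where D: "\<And>i. i < s \<Longrightarrow> derivation R (D i)"
    "\<And>i x. i < s \<Longrightarrow> x \<in> homog R 1 \<Longrightarrow> D i x \<in> TD.summand i"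
    "\<And>i x. i < s \<Longrightarrow> x \<in> TD.summand i \<Longrightarrow> D i x = x"
    "\<And>i j x. i < s \<Longrightarrow> j < s \<Longrightarrow> i \<noteq> j \<Longrightarrow> x \<in> TD.summand i \<Longrightarrow> D j x = \<zero>\<^bsub>R\<^esub>"
    "\<And>x. x \<in> homog R 1 \<Longrightarrow> x = finsum R (\<lambda>i. D i x) {..<s}"
  proof (rule TD.factor_derivations, goal_cases)
    case (1 D) show ?case by (rule 1(1)) (fact 1)+
  qed
  have "refinement R r (component_ring lam) \<phi> s T \<psi> D"
  proof (intro refinement.intro refinement_axioms.intro CD TD)
    show "\<not> \<Z> \<simeq> component_ring lam j" if "j < r" for j
      using component_indecomposable [OF that] by (simp add: tensor_indecomposable_def)
    show "(\<forall>x\<in>decomposition.summand R r (component_ring lam) \<phi> j. D i x = \<zero>\<^bsub>R\<^esub>) \<or>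
      (\<forall>x\<in>decomposition.summand R r (component_ring lam) \<phi> j. D i x = x)" if i: "i < s" and j: "j < r" for i j
      by (rule derivation_on_component [OF \<phi> j D(1) [OF i] TD.summand_homog [OF i D(2) [OF i]] D(3) [OF i D(2) [OF i]]])
  qed (fact D)+
  from refinement.same_decomposition [OF this ind] show ?thesis .
qed

end

theorem lemma7p5:
  fixes lam :: "nat list"
  assumes "sorted lam"
    and "\<forall>i\<in>{1..length lam}. i \<le> part lam i"
  shows "\<exists>\<phi>.
    tensor_decomposition (part_ring lam) (num_components lam) (component_ring lam) \<phi> \<and>
    identifies_variables lam \<phi> \<and>
    (\<forall>j<num_components lam. tensor_indecomposable (component_ring lam j)) \<and>
    (\<forall>s (T :: nat \<Rightarrow> 'b graded_ring) \<psi>.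
       tensor_decomposition (part_ring lam) s T \<psi> \<and> (\<forall>i<s. tensor_indecomposable (T i)) \<longrightarrow>
       same_up_to_permutation (part_ring lam) s T \<psi>
         (num_components lam) (component_ring lam) \<phi>)"
proof -
  interpret partition lam
    by (intro partition.intro assms(1)) (use assms(2) in blast)
  obtain \<phi> where \<phi>: "tensor_decomposition R r (component_ring lam) \<phi>" "identifies_variables lam \<phi>"
    using component_decomposition .
  show ?thesis
    by (intro exI [of _ \<phi>] conjI allI impI \<phi> component_indecomposable decomposition_unique [OF \<phi>]) auto
qed

end
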